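(* Let $\alpha\in(0,1)$, let $\Omega\subset\mathbb{R}^n$ be a bounded Lipschitz domain and let $g\in S^{\alpha,1}(\mathbb{R}^n;\mathbb{R}^m)$. For every $u\in BV^\alpha_g(\Omega;\mathbb{R}^m)$ there exists a sequence $(u_j)_j\subset g+C_c^\infty(\Omega;\mathbb{R}^m)$ such that $u_j\to u$ area-strictly in $BV^\alpha_g(\Omega;\mathbb{R}^m)$.
   Context: Here $n,m\in\mathbb{N}$, $\Omega^c=\mathbb{R}^n\setminus\Omega$, and functions in $C_c^\infty(\Omega;\mathbb{R}^m)$ are extended to $\mathbb{R}^n$ by zero. Fractional divergence: for $\phi\in C_c^\infty(\mathbb{R}^n;\mathbb{R}^n)$, $$\mathrm{div}^\alpha\phi(x)=\mu_{n,\alpha}\int_{\mathbb{R}^n}\frac{\phi(y)-\phi(x)}{|y-x|^{n+\alpha}}\cdot\frac{y-x}{|y-x|}\,dy,\qquad \mu_{n,\alpha}=2^\alpha\pi^{-n/2}\frac{\Gamma((n+\alpha+1)/2)}{\Gamma((1-\alpha)/2)}.$$ Spaces: $BV^\alpha(\mathbb{R}^n)$ is the set of $u\in L^1(\mathbb{R}^n)$ for which there is a (necessarily unique) finite vector-valued Radon measure $D^\alpha u\in\mathcal{M}(\mathbb{R}^n;\mathbb{R}^n)$ with $\int_{\mathbb{R}^n}u\,\mathrm{div}^\alpha\phi\,dx=-\int_{\mathbb{R}^n}\phi\cdot dD^\alpha u$ for all $\phi\in C_c^\infty(\mathbb{R}^n;\mathbb{R}^n)$. $BV^\alpha(\mathbb{R}^n;\mathbb{R}^m)$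 is the componentwise vector-valued analogue, with $D^\alpha u\in\mathcal{M}(\mathbb{R}^n;\mathbb{R}^{m\times n})$. Write $D^\alpha u=\nabla^\alpha u\,dx+D^\alpha_s u$ for the Lebesgue decomposition with respect to Lebesgue measure, with $\nabla^\alpha u\in L^1(\mathbb{R}^n;\mathbb{R}^{m\times n})$ and $D^\alpha_s u$ the singular part. Set $S^{\alpha,1}(\mathbb{R}^n;\mathbb{R}^m)=\{u\in BV^\alpha(\mathbb{R}^n;\mathbb{R}^m): D^\alpha_su=0\}$ and $BV^\alpha_g(\Omega;\mathbb{R}^m)=\{u\in BV^\alpha(\mathbb{R}^n;\mathbb{R}^m):u=g\text{ a.e. in }\Omega^c\}$. Area functional: for a finite Radon measure $\mu\in\mathcal{M}(\mathbb{R}^n;\mathbb{R}^N)$ and a Borel set $U\subset\mathbb{R}^n$, $$\langle\mu\rangle(U)=\int_U\sqrt{1+\Big|\frac{d\mu}{dx}\Big|^2}\,dx+|\mu^s|(U),$$ where $\frac{d\mu}{dx}$ is the density of the absolutely continuous part of $\mu$ and $\mu^s$ the singular part, with respect to Lebesgue measure. Area-strict convergence: $(u_j)_j\subset BV^\alpha_g(\Omega;\mathbb{R}^m)$ converges area-strictly to $u\in BV^\alpha_g(\Omega;\mathbb{R}^m)$ if, as $j\to\infty$, $u_j\to u$ in $L^1(\mathbb{R}^n;\mathbb{R}^m)$, $\langle D^\alpha u_j\rangle(\overline{\Omega})\to\langle D^\alpha u\rangle(\overline{\Omega})$, and $\nabla^\alpha u_j\to\nabla^\alpha u$ in $L^1(\Omega^c;\mathbb{R}^{m\times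 n})$. *)

theory Defs
  imports "HOL-Analysis.Analysis"
begin

section \<open>Test functions and Lipschitz domains\<close>

primrec Ck :: "nat \<Rightarrow> (('a::real_normed_vector) \<Rightarrow> ('b::real_normed_vector)) \<Rightarrow> bool" where
  "Ck 0 f \<longleftrightarrow> continuous_on UNIV f"
| "Ck (Suc k) f \<longleftrightarrow>
     (\<forall>x. f differentiable (at x)) \<and> (\<forall>v. Ck k (\<lambda>x. frechet_derivative f (at x) v))"

text \<open>\<open>C\<^sub>c\<^sup>\<infinity>(\<Omega>; 'b)\<close>; the elements are already extended by zero to the whole space.\<close>

definition Cc_infinity :: "('a::euclidean_space) set \<Rightarrow> ('a \<Rightarrow> 'b::real_normed_vector) set" where
  "Cc_infinity \<Omega> = {\<phi>. (\<forall>k. Ck k \<phi>) \<and>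
     compact (closure {x. \<phi> x \<noteq> 0}) \<and> closure {x. \<phi> x \<noteq> 0} \<subseteq> \<Omega>}"

text \<open>Near each boundary point the domain is the strict epigraph of a Lipschitz function in some
  rotated orthonormal coordinate system. The unit vector \<open>\<nu>\<close> is the last coordinate axis, the
  hyperplane orthogonal to \<open>\<nu>\<close> carries the remaining coordinates, and \<open>x - (x \<bullet> \<nu>) \<nu>\<close> is the
  orthogonal projection of \<open>x\<close> onto that hyperplane.\<close>

definition bounded_lipschitz_domain :: "('a::euclidean_space) set \<Rightarrow> bool" where
  "bounded_lipschitz_domain \<Omega> \<longleftrightarrow>
     \<Omega> \<noteq> {} \<and> open \<Omega> \<and> connected \<Omega> \<and> bounded \<Omega> \<and>
     (\<forall>p\<in>frontier \<Omega>. \<exists>r>0. \<exists>\<nu> \<gamma> L. norm \<nu> = 1 \<and>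
        L-lipschitz_on {y. y \<bullet> \<nu> = 0} (\<gamma> :: 'a \<Rightarrow> real) \<and>
        \<Omega> \<inter> ball p r = {x \<in> ball p r. x \<bullet> \<nu> > \<gamma> (x - (x \<bullet> \<nu>) *\<^sub>R \<nu>)})"

section \<open>Finite vector-valued Radon measures\<close>

text \<open>On a Euclidean space every countably additive vector-valued function on the Borel sets has
  finite total variation and is Radon. As for \<^const>\<open>emeasure\<close>, the value outside the
  sigma-algebra is fixed to be zero, so that two measures are equal as soon as they agree on all
  Borel sets.\<close>

definition radon_vmeasure :: "(('a::euclidean_space) set \<Rightarrow> 'b::euclidean_space) \<Rightarrow> bool" where
  "radon_vmeasure \<mu> \<longleftrightarrow>
     (\<forall>A. A \<notin> sets borel \<longrightarrow> \<mu> A = 0) \<and>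
     (\<forall>A::nat \<Rightarrow> 'a set. range A \<subseteq> sets borel \<and> disjoint_family A \<longrightarrow>
        (\<lambda>i. \<mu> (A i)) sums \<mu> (\<Union>i. A i))"

definition total_variation ::
    "(('a::euclidean_space) set \<Rightarrow> 'b::euclidean_space) \<Rightarrow> 'a set \<Rightarrow> ennreal" where
  "total_variation \<mu> A =
     (SUP B\<in>{B::nat \<Rightarrow> 'a set. range B \<subseteq> sets borel \<and> disjoint_family B \<and> (\<Union>i. B i) = A}.
        \<Sum>i. ennreal (norm (\<mu> (B i))))"

text \<open>The positive part of the Jordan decomposition of a signed measure. Here \<^const>\<open>ennreal\<close>
  truncates negative values to zero, which is harmless because the empty set is among the \<open>B\<close>.
  The negative part is the positive part of the opposite measure.\<close>

definition positive_part :: "(('a::euclidean_space) set \<Rightarrow> real) \<Rightarrow> 'a measure" where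
  "positive_part \<mu> =
     measure_of UNIV (sets borel) (\<lambda>A. SUP B\<in>{B \<in> sets borel. B \<subseteq> A}. ennreal (\<mu> B))"

definition signed_integral :: "(('a::euclidean_space) set \<Rightarrow> real) \<Rightarrow> ('a \<Rightarrow> real) \<Rightarrow> real" where
  "signed_integral \<mu> f =
     integral\<^sup>L (positive_part \<mu>) f - integral\<^sup>L (positive_part (\<lambda>A. - \<mu> A)) f"

text \<open>The integral of \<open>\<phi> \<bullet> d\<mu>\<close>.\<close>

definition dot_integral :: "((real^'n) set \<Rightarrow> real^'n) \<Rightarrow> (real^'n \<Rightarrow> real^'n) \<Rightarrow> real" where
  "dot_integral \<mu> \<phi> = (\<Sum>k\<in>UNIV. signed_integral (\<lambda>A. \<mu> A $ k) (\<lambda>x. \<phi> x $ k))"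

definition lebesgue_decomposition ::
    "(('a::euclidean_space) set \<Rightarrow> 'b::euclidean_space) \<Rightarrow> ('a \<Rightarrow> 'b) \<Rightarrow> ('a set \<Rightarrow> 'b) \<Rightarrow> bool" where
  "lebesgue_decomposition \<mu> f \<sigma> \<longleftrightarrow>
     integrable lebesgue f \<and> radon_vmeasure \<sigma> \<and>
     (\<exists>N\<in>null_sets lborel. total_variation \<sigma> (- N) = 0) \<and>
     (\<forall>A\<in>sets borel. \<mu> A = (LINT x:A|lebesgue. f x) + \<sigma> A)"

text \<open>The density is determined only almost everywhere; some representative is chosen.\<close>

definition ac_density :: "(('a::euclidean_space) set \<Rightarrow> 'b::euclidean_space) \<Rightarrow> 'a \<Rightarrow> 'b" where
  "ac_density \<mu> = (SOME f. \<exists>\<sigma>. lebesgue_decomposition \<mu> f \<sigma>)"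

definition singular_part :: "(('a::euclidean_space) set \<Rightarrow> 'b::euclidean_space) \<Rightarrow> 'a set \<Rightarrow> 'b" where
  "singular_part \<mu> = (THE \<sigma>. \<exists>f. lebesgue_decomposition \<mu> f \<sigma>)"

definition area_functional ::
    "(('a::euclidean_space) set \<Rightarrow> 'b::euclidean_space) \<Rightarrow> 'a set \<Rightarrow> ennreal" where
  "area_functional \<mu> U =
     (\<integral>\<^sup>+x\<in>U. ennreal (sqrt (1 + (norm (ac_density \<mu> x))\<^sup>2)) \<partial>lebesgue)
     + total_variation (singular_part \<mu>) U"

section \<open>Fractional divergence and fractional variation\<close>

definition frac_const :: "nat \<Rightarrow> real \<Rightarrow> real" where
  "frac_const n \<alpha> =
     2 powr \<alpha> * pi powr (- (real n / 2)) * Gamma ((real n + \<alpha> + 1) / 2) / Gamma ((1 - \<alpha>) / 2)"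

definition frac_div :: "real \<Rightarrow> (real^'n \<Rightarrow> real^'n) \<Rightarrow> real^'n \<Rightarrow> real" where
  "frac_div \<alpha> \<phi> x = frac_const CARD('n) \<alpha> *
     (\<integral>y. ((\<phi> y - \<phi> x) /\<^sub>R (norm (y - x) powr (real CARD('n) + \<alpha>)))
            \<bullet> ((y - x) /\<^sub>R norm (y - x)) \<partial>lebesgue)"

definition has_frac_variation ::
    "real \<Rightarrow> (real^'n \<Rightarrow> real) \<Rightarrow> ((real^'n) set \<Rightarrow> real^'n) \<Rightarrow> bool" where
  "has_frac_variation \<alpha> u D \<longleftrightarrow> radon_vmeasure D \<and>
     (\<forall>\<phi>\<in>Cc_infinity UNIV. (\<integral>x. u x * frac_div \<alpha> \<phi> x \<partial>lebesgue) = - dot_integral D \<phi>)"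

definition BV_frac_scalar :: "real \<Rightarrow> (real^'n \<Rightarrow> real) set" where
  "BV_frac_scalar \<alpha> = {u. integrable lebesgue u \<and> (\<exists>D. has_frac_variation \<alpha> u D)}"

definition frac_variation_scalar :: "real \<Rightarrow> (real^'n \<Rightarrow> real) \<Rightarrow> (real^'n) set \<Rightarrow> real^'n" where
  "frac_variation_scalar \<alpha> u = (THE D. has_frac_variation \<alpha> u D)"

text \<open>An \<open>m \<times> n\<close> matrix is a vector of rows, so row \<open>i\<close> of the fractional variation belongs to the
  component \<open>u\<^sub>i\<close>; the norm on the matrix type is the Frobenius norm.\<close>

definition BV_frac :: "real \<Rightarrow> (real^'n \<Rightarrow> real^'m) set" where
  "BV_frac \<alpha> = {u. \<forall>i. (\<lambda>x. u x $ i) \<in> BV_frac_scalar \<alpha>}"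

definition frac_variation :: "real \<Rightarrow> (real^'n \<Rightarrow> real^'m) \<Rightarrow> (real^'n) set \<Rightarrow> real^'n^'m" where
  "frac_variation \<alpha> u A = (\<chi> i. frac_variation_scalar \<alpha> (\<lambda>x. u x $ i) A)"

definition frac_gradient :: "real \<Rightarrow> (real^'n \<Rightarrow> real^'m) \<Rightarrow> real^'n \<Rightarrow> real^'n^'m" where
  "frac_gradient \<alpha> u = ac_density (frac_variation \<alpha> u)"

definition S_frac :: "real \<Rightarrow> (real^'n \<Rightarrow> real^'m) set" where
  "S_frac \<alpha> = {u \<in> BV_frac \<alpha>. singular_part (frac_variation \<alpha> u) = (\<lambda>A. 0)}"

definition BV_frac_bdry ::
    "real \<Rightarrow> (real^'n) set \<Rightarrow> (real^'n \<Rightarrow> real^'m) \<Rightarrow> (real^'n \<Rightarrow> real^'m) set" where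
  "BV_frac_bdry \<alpha> \<Omega> g = {u \<in> BV_frac \<alpha>. AE x in lebesgue. x \<notin> \<Omega> \<longrightarrow> u x = g x}"

definition area_strict_convergence ::
    "real \<Rightarrow> (real^'n) set \<Rightarrow> (real^'n \<Rightarrow> real^'m) \<Rightarrow>
     (nat \<Rightarrow> real^'n \<Rightarrow> real^'m) \<Rightarrow> (real^'n \<Rightarrow> real^'m) \<Rightarrow> bool" where
  "area_strict_convergence \<alpha> \<Omega> g w u \<longleftrightarrow>
     (\<forall>j. w j \<in> BV_frac_bdry \<alpha> \<Omega> g) \<and> u \<in> BV_frac_bdry \<alpha> \<Omega> g \<and>
     (\<lambda>j. \<integral>\<^sup>+x. ennreal (norm (w j x - u x)) \<partial>lebesgue) \<longlonglongrightarrow> 0 \<and>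
     (\<lambda>j. area_functional (frac_variation \<alpha> (w j)) (closure \<Omega>))
        \<longlonglongrightarrow> area_functional (frac_variation \<alpha> u) (closure \<Omega>) \<and>
     (\<lambda>j. \<integral>\<^sup>+x\<in>-\<Omega>. ennreal (norm (frac_gradient \<alpha> (w j) x - frac_gradient \<alpha> u x)) \<partial>lebesgue)
        \<longlonglongrightarrow> 0"

end

theory Submission
  imports Defs
begin

text \<open>
  Let \<open>v = u - g\<close>, which vanishes outside \<open>\<Omega>\<close>, and let \<open>f dx + s T\<close> be its fractional variation, where
  the finite measure \<open>T\<close> and the density \<open>s\<close> describe the singular part. The task is to approximate \<open>v\<close>
  by test functions supported in \<open>\<Omega>\<close> without losing area and without moving mass of the singular part
  out of \<open>\<Omega>\<close>.

  Near the boundary a Lipschitz domain can be pushed into itself: for a suitable direction \<open>\<nu>\<close> the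
  translate by \<open>t \<nu>\<close> of its closure stays in the domain together with a neighbourhood of radius \<open>c t\<close>.
  A smooth partition of unity \<open>\<theta>\<^sub>i\<close> (\<open>lipschitz_domain_partition\<close>) reduces to finitely many such
  directions, and the approximations are \<open>\<psi>\<^sub>j = \<Sum>\<^sub>i \<eta>\<^sub>i\<^sub>j * (\<theta>\<^sub>i v)\<close>, where the mollifier \<open>\<eta>\<^sub>i\<^sub>j\<close> is centred at
  \<open>t\<^sub>j \<nu>\<^sub>i\<close> and has radius \<open>c t\<^sub>j\<close>. They are test functions in \<open>\<Omega>\<close>.

  The fractional divergence commutes with convolution (\<open>frac_pairing_conv\<close>), and a Leibniz rule
  holds up to a nonlocal term (\<open>frac_pairing_mult\<close>): the variation of \<open>\<theta> v\<close> is \<open>\<theta>\<close> times that of \<open>v\<close>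
  plus a function that depends on \<open>v\<close> and the increments of \<open>\<theta>\<close> only and is integrable. Hence the
  variation of \<open>\<psi>\<^sub>j\<close> has the density
  \<open>\<Sum>\<^sub>i \<eta>\<^sub>i\<^sub>j * (\<theta>\<^sub>i f + N\<^sub>i) + h\<^sub>j\<close> with \<open>h\<^sub>j = \<Sum>\<^sub>i \<eta>\<^sub>i\<^sub>j * (\<theta>\<^sub>i s T)\<close>. The nonlocal terms \<open>N\<^sub>i\<close> add up to zero because the
  \<open>\<theta>\<^sub>i\<close> add up to one, so the first sum tends to \<open>f\<close> in \<open>L\<^sup>1\<close>. The Leibniz rule also locates the singular
  part (\<open>singular_part_supported\<close>): if \<open>\<zeta>\<close> vanishes on the closure of \<open>\<Omega>\<close>, then \<open>\<zeta> v = 0\<close>, so \<open>\<zeta>\<close> times the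
  variation of \<open>v\<close> is absolutely continuous. Therefore \<open>s T\<close> lives on the closure of \<open>\<Omega>\<close>, and \<open>h\<^sub>j\<close>
  vanishes outside \<open>\<Omega>\<close>. Outside \<open>\<Omega>\<close> the gradients thus converge in \<open>L\<^sup>1\<close>.

  Inside, \<open>h\<^sub>j\<close> converges to \<open>s T\<close> weakly only, but its mass does not exceed that of \<open>s T\<close>. This is enough
  for the area (\<open>area_limit\<close>), since the integrand is the norm of \<open>(1, A)\<close>: the triangle inequality bounds
  the limit from above, and testing with continuous fields that almost realise the total variation
  bounds it from below.

  The definitions speak of arbitrary vector measures, of the unique variation and of chosen densities.
  A vector measure is therefore represented throughout by a density with respect to a finite positive
  measure (\<open>radon_representation\<close>); integrals, total variation and the Lebesgue decomposition are
  computed from it, and test functions are shown to determine the measure.\<close>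

section \<open>Smooth functions and bumps\<close>

lemma Ck_Suc_imp_Ck: "Ck (Suc k) f \<Longrightarrow> Ck k f"
proof (induction k arbitrary: f)
  case 0
  then show ?case
    by (auto simp: continuous_on_eq_continuous_at intro: differentiable_imp_continuous_within)
next
  case (Suc k)
  then show ?case by (metis Ck.simps(2))
qed

lemma Ck_SucI:
  assumes "\<And>x. (f has_derivative f' x) (at x)" "\<And>v. Ck k (\<lambda>x. f' x v)"
  shows "Ck (Suc k) f"
proof -
  have "frechet_derivative f (at x) = f' x" for x
    using frechet_derivative_at[OF assms(1)] by metis
  with assms show ?thesis by (auto simp: differentiable_def)
qed

lemma Ck_const: "Ck k (\<lambda>x. c)"
proof (induction k arbitrary: c)
  case (Suc k)
  show ?case by (rule Ck_SucI[where f' = "\<lambda>x v. 0"]) (auto simp: Suc)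
qed auto

lemma Ck_add: "Ck k f \<Longrightarrow> Ck k g \<Longrightarrow> Ck k (\<lambda>x. f x + g x)"
proof (induction k arbitrary: f g)
  case 0 then show ?case by (auto intro: continuous_intros)
next
  case (Suc k)
  show ?case
  proof (rule Ck_SucI)
    fix x show "((\<lambda>x. f x + g x) has_derivative
        (\<lambda>v. frechet_derivative f (at x) v + frechet_derivative g (at x) v)) (at x)"
      using Suc.prems by (auto intro!: has_derivative_add simp: frechet_derivative_works)
  next
    fix v show "Ck k (\<lambda>x. frechet_derivative f (at x) v + frechet_derivative g (at x) v)"
      using Suc by auto
  qed
qed

text \<open>The product rule keeps the number of factors at two, so the induction on \<open>k\<close> only needs
  sums of products of one factor with a derivative of the other.\<close>

lemma Ck_bilinear:
  assumes b: "bounded_bilinear b"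
  shows "Ck k f \<Longrightarrow> Ck k g \<Longrightarrow> Ck k (\<lambda>x. b (f x) (g x))"
proof (induction k arbitrary: f g)
  case 0 then show ?case
    by (auto intro: bounded_bilinear.continuous_on[OF b])
next
  case (Suc k)
  note [simp] = Ck_Suc_imp_Ck[OF Suc.prems(1)] Ck_Suc_imp_Ck[OF Suc.prems(2)]
  show ?case
  proof (rule Ck_SucI)
    fix x show "((\<lambda>x. b (f x) (g x)) has_derivative
        (\<lambda>v. b (f x) (frechet_derivative g (at x) v) + b (frechet_derivative f (at x) v) (g x))) (at x)"
      using Suc.prems by (intro bounded_bilinear.FDERIV[OF b]) (auto simp: frechet_derivative_works)
  next
    fix v show "Ck k (\<lambda>x. b (f x) (frechet_derivative g (at x) v) + b (frechet_derivative f (at x) v) (g x))"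
      using Suc by (intro Ck_add Suc.IH) auto
  qed
qed

lemmas Ck_scaleR = Ck_bilinear[OF bounded_bilinear_scaleR]
lemmas Ck_inner = Ck_bilinear[OF bounded_bilinear_inner]
lemmas Ck_mult = Ck_bilinear[OF bounded_bilinear_mult]

lemma Ck_sum: "(\<And>i. i \<in> I \<Longrightarrow> Ck k (f i)) \<Longrightarrow> Ck k (\<lambda>x. \<Sum>i\<in>I. f i x)"
  by (induction I rule: infinite_finite_induct) (auto intro: Ck_add Ck_const)

lemma Ck_ident: "Ck k (\<lambda>x. x)"
proof (cases k)
  case (Suc j)
  show ?thesis unfolding Suc
    by (rule Ck_SucI[where f' = "\<lambda>x v. v"]) (auto intro: Ck_const)
qed auto

lemma Ck_affine_arg: "Ck k f \<Longrightarrow> Ck k (\<lambda>x. f (a *\<^sub>R x + b))"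
proof (induction k arbitrary: f)
  case 0 
  then have "continuous_on UNIV f" by simp
  then show ?case by (auto intro!: continuous_intros intro: continuous_on_compose2)
next
  case (Suc k)
  show ?case
  proof (rule Ck_SucI)
    fix x
    have "(f has_derivative frechet_derivative f (at (a *\<^sub>R x + b))) (at (a *\<^sub>R x + b))"
      using Suc.prems by (auto simp: frechet_derivative_works[symmetric])
    then have "((\<lambda>x. f (a *\<^sub>R x + b)) has_derivative 
        (\<lambda>v. frechet_derivative f (at (a *\<^sub>R x + b)) (a *\<^sub>R v))) (at x)"
      by (rule has_derivative_compose[rotated]) (auto intro!: derivative_eq_intros)
    then show "((\<lambda>x. f (a *\<^sub>R x + b)) has_derivative 
        (\<lambda>v. frechet_derivative f (at (a *\<^sub>R x + b)) (a *\<^sub>R v))) (at x)" .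
  next
    fix v show "Ck k (\<lambda>x. frechet_derivative f (at (a *\<^sub>R x + b)) (a *\<^sub>R v))"
      using Suc.IH[of "\<lambda>x. frechet_derivative f (at x) (a *\<^sub>R v)"] Suc.prems by simp
  qed
qed

text \<open>A sequence of functions each of which is the derivative of its predecessor stands for a smooth
  function together with all its derivatives. Differentiating the composition moves one step along
  the sequence and multiplies by a derivative of \<open>q\<close>, which is again smooth.\<close>

lemma Ck_compose_real:
  fixes B :: "nat \<Rightarrow> real \<Rightarrow> real"
  assumes B: "\<And>j t. (B j has_real_derivative B (Suc j) t) (at t)"
    and q: "\<And>k. Ck k q"
  shows "Ck k (\<lambda>x. B j (q x))"
proof (induction k arbitrary: j)
  case 0
  have "continuous_on UNIV (B j)"
    by (meson B DERIV_isCont continuous_at_imp_continuous_on)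
  then show ?case using q[of 0] by (auto intro: continuous_on_compose2)
next
  case (Suc k)
  have qd: "Ck (Suc k) q" using q .
  show ?case
  proof (rule Ck_SucI)
    fix x
    have "(B j has_derivative (\<lambda>t. B (Suc j) (q x) * t)) (at (q x))"
      using B by (simp add: has_field_derivative_def)
    moreover have "(q has_derivative frechet_derivative q (at x)) (at x)"
      using qd by (auto simp: frechet_derivative_works[symmetric])
    ultimately show "((\<lambda>x. B j (q x)) has_derivative
        (\<lambda>v. B (Suc j) (q x) * frechet_derivative q (at x) v)) (at x)"
      by (rule has_derivative_compose[rotated])
  next
    fix v show "Ck k (\<lambda>x. B (Suc j) (q x) * frechet_derivative q (at x) v)"
      using qd by (intro Ck_mult Suc) auto
  qed
qed

lemma poly_exp_inverse_tendsto_0: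
  "((\<lambda>t::real. poly p (1/t) * exp (-(1/t))) \<longlongrightarrow> 0) (at_right 0)"
proof -
  have "((\<lambda>x::real. poly p x / exp x) \<longlongrightarrow> 0) at_top"
  proof -
    have "((\<lambda>x::real. \<Sum>i\<le>degree p. coeff p i * (x ^ i / exp x)) \<longlongrightarrow> (\<Sum>i\<le>degree p. coeff p i * 0)) at_top"
      by (intro tendsto_sum tendsto_mult tendsto_const tendsto_power_div_exp_0)
    then show ?thesis by (simp add: poly_altdef sum_divide_distrib)
  qed
  then have "((\<lambda>t::real. poly p (inverse t) / exp (inverse t)) \<longlongrightarrow> 0) (at_right 0)"
    by (rule filterlim_compose) (rule filterlim_inverse_at_top_right)
  then show ?thesis by (simp add: exp_minus divide_inverse)
qed

text \<open>The functions \<open>p (1/t) exp (-1/t)\<close>, extended by zero to \<open>t \<le> 0\<close>. This class is closed under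
  differentiation, which makes \<open>exp (-1/t)\<close> smooth without a formula for its higher derivatives.\<close>

definition flat :: "real poly \<Rightarrow> real \<Rightarrow> real" where
  "flat p t = (if t \<le> 0 then 0 else poly p (1/t) * exp (-(1/t)))"

definition flat_deriv :: "real poly \<Rightarrow> real poly" where
  "flat_deriv p = [:0,0,1:] * (p - pderiv p)"

text \<open>Only \<open>t = 0\<close> needs an argument: the difference quotient there is \<open>flat (x p) h\<close>, and the
  exponential beats every polynomial.\<close>

lemma flat_has_derivative: "(flat p has_real_derivative flat (flat_deriv p) t) (at t)"
proof -
  consider "t < 0" | "t > 0" | "t = 0" by linarith
  then show ?thesis
  proof cases
    case 1
    have "((\<lambda>t. 0) has_real_derivative 0) (at t)" by simp
    then have "(flat p has_real_derivative 0) (at t)"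
      by (rule has_field_derivative_transform_within_open[where S = "{..<0}"])
        (use 1 in \<open>auto simp: flat_def\<close>)
    then show ?thesis using 1 by (simp add: flat_def)
  next
    case 2
    have "((\<lambda>t. poly p (1/t) * exp (-(1/t))) has_real_derivative 
        poly p (1/t) * (exp (-(1/t)) * (1/t^2)) + (poly (pderiv p) (1/t) * (-(1/t^2))) * exp (-(1/t))) (at t)"
      using 2 by (auto intro!: derivative_eq_intros DERIV_chain2[OF poly_DERIV] simp: power2_eq_square field_simps)
    then have "(flat p has_real_derivative 
        poly p (1/t) * (exp (-(1/t)) * (1/t^2)) + (poly (pderiv p) (1/t) * (-(1/t^2))) * exp (-(1/t))) (at t)"
      by (rule has_field_derivative_transform_within_open[where S = "{0<..}"])
        (use 2 in \<open>auto simp: flat_def\<close>)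
    then show ?thesis using 2
      by (simp add: flat_def flat_deriv_def power2_eq_square field_simps)
  next
    case 3
    have r: "((\<lambda>h. flat p h / h) \<longlongrightarrow> 0) (at_right 0)"
    proof (rule Lim_transform_eventually[OF poly_exp_inverse_tendsto_0[of "[:0,1:] * p"]])
      show "\<forall>\<^sub>F x in at_right 0. poly ([:0, 1:] * p) (1 / x) * exp (- (1 / x)) = flat p x / x"
        by (auto simp: eventually_at_filter flat_def)
    qed
    have l: "((\<lambda>h. flat p h / h) \<longlongrightarrow> 0) (at_left 0)"
      by (rule Lim_transform_eventually[OF tendsto_const])
        (auto simp: eventually_at_filter flat_def)
    have "((\<lambda>h. flat p h / h) \<longlongrightarrow> 0) (at 0)"
      using l r by (simp add: filterlim_split_at)
    then show ?thesis using 3 by (simp add: has_field_derivative_iff flat_def)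
  qed
qed

text \<open>The prototype of a bump: positive exactly on the open unit ball.\<close>

lemma Ck_bump: "Ck k (\<lambda>x::'a::euclidean_space. flat 1 (1 - x \<bullet> x))"
proof -
  have q: "Ck k (\<lambda>x::'a. 1 - x \<bullet> x)" for k
    using Ck_add[OF Ck_const[of k 1] Ck_scaleR[OF Ck_const[of k "-1"] Ck_inner[OF Ck_ident[of k] Ck_ident]]]
    by simp
  have "Ck k (\<lambda>x::'a. flat ((flat_deriv ^^ 0) 1) (1 - x \<bullet> x))"
    by (rule Ck_compose_real[where B = "\<lambda>j. flat ((flat_deriv ^^ j) 1)"])
      (auto simp: q flat_has_derivative)
  then show ?thesis by simp
qed

lemma Cc_infinity_UNIV: "f \<in> Cc_infinity UNIV \<longleftrightarrow> (\<forall>k. Ck k f) \<and> bounded {x. f x \<noteq> 0}"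
  by (auto simp: Cc_infinity_def compact_closure)

lemma Cc_infinityI:
  assumes "\<And>k. Ck k f" "compact K" "K \<subseteq> \<Omega>" "\<And>x. x \<notin> K \<Longrightarrow> f x = 0"
  shows "f \<in> Cc_infinity \<Omega>"
proof -
  have "{x. f x \<noteq> 0} \<subseteq> K" using assms(4) by blast
  then have "closure {x. f x \<noteq> 0} \<subseteq> K" using assms(2) by (simp add: closure_minimal compact_imp_closed)
  moreover have "compact (closure {x. f x \<noteq> 0})"
    using \<open>{x. f x \<noteq> 0} \<subseteq> K\<close> assms(2) bounded_subset compact_closure compact_imp_bounded by blast
  ultimately show ?thesis using assms(1,3) by (auto simp: Cc_infinity_def)
qed

lemma Cc_infinity_imp_UNIV: "f \<in> Cc_infinity \<Omega> \<Longrightarrow> f \<in> Cc_infinity UNIV"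
  by (auto simp: Cc_infinity_def)

lemma Cc_infinity_bounded:
  assumes "f \<in> Cc_infinity UNIV"
  obtains B where "B > 0" "\<And>x. norm (f x) \<le> B"
proof -
  have c: "continuous_on UNIV f" and b: "bounded {x. f x \<noteq> 0}" 
    using assms by (auto simp: Cc_infinity_UNIV dest: spec[of _ 0])
  have "compact (f ` closure {x. f x \<noteq> 0})"
    using b c by (intro compact_continuous_image) (auto simp: compact_closure intro: continuous_on_subset)
  then obtain B where B: "\<And>y. y \<in> f ` closure {x. f x \<noteq> 0} \<Longrightarrow> norm y \<le> B"
    by (meson bounded_iff compact_imp_bounded)
  have "norm (f x) \<le> max B 1" for x
    using B[of "f x"] closure_subset[of "{x. f x \<noteq> 0}"] by (cases "f x = 0") (auto simp: le_max_iff_disj)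
  then show ?thesis using that[of "max B 1"] by auto
qed

lemma Cc_infinity_deriv:
  fixes f :: "'a::euclidean_space \<Rightarrow> 'b::real_normed_vector"
  assumes "f \<in> Cc_infinity UNIV"
  shows "(\<lambda>x. frechet_derivative f (at x) v) \<in> Cc_infinity UNIV"
    and "(f has_derivative frechet_derivative f (at x)) (at x)"
proof -
  have d: "Ck (Suc k) f" for k using assms by (auto simp: Cc_infinity_UNIV)
  then show D: "(f has_derivative frechet_derivative f (at x)) (at x)" for x
    by (metis Ck.simps(2) frechet_derivative_works)
  have "frechet_derivative f (at x) v = 0" if "x \<notin> closure {x. f x \<noteq> 0}" for x
  proof -
    have "((\<lambda>x. 0) has_derivative (\<lambda>v. 0)) (at x)" by simp
    then have "(f has_derivative (\<lambda>v. 0)) (at x)"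
      by (rule has_derivative_transform_within_open[where s = "- closure {x. f x \<noteq> 0}"])
        (use that in \<open>auto intro: closure_subset[THEN subsetD]\<close>)
    then show ?thesis by (metis frechet_derivative_at)
  qed
  then have "{x. frechet_derivative f (at x) v \<noteq> 0} \<subseteq> closure {x. f x \<noteq> 0}" by blast
  then show "(\<lambda>x. frechet_derivative f (at x) v) \<in> Cc_infinity UNIV"
    using assms d[unfolded Ck.simps]
    by (auto simp: Cc_infinity_UNIV intro: bounded_subset[OF bounded_closure])
qed

text \<open>The partial derivatives are again test functions, hence bounded, and they bound the operator
  norm of the derivative.\<close>

lemma Cc_infinity_lipschitz:
  fixes f :: "'a::euclidean_space \<Rightarrow> 'b::real_normed_vector"
  assumes "f \<in> Cc_infinity UNIV"
  obtains L where "L > 0" "\<And>x y. norm (f x - f y) \<le> L * norm (x - y)"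
proof -
  note D = Cc_infinity_deriv[OF assms]
  have "\<exists>B>0. \<forall>x. norm (frechet_derivative f (at x) b) \<le> B" for b
    using Cc_infinity_bounded[OF D(1)] by metis
  then obtain B where B: "\<And>b. B b > 0" "\<And>b x. norm (frechet_derivative f (at x) b) \<le> B b" by metis
  let ?L = "\<Sum>b\<in>Basis. B b"
  have o: "onorm (frechet_derivative f (at x)) \<le> ?L" for x
  proof (rule onorm_le)
    fix v :: 'a
    have bl: "linear (frechet_derivative f (at x))"
      using D(2)[of x] has_derivative_linear by blast
    have "frechet_derivative f (at x) v = frechet_derivative f (at x) (\<Sum>b\<in>Basis. (v \<bullet> b) *\<^sub>R b)"
      by (simp add: euclidean_representation)
    also have "\<dots> = (\<Sum>b\<in>Basis. (v \<bullet> b) *\<^sub>R frechet_derivative f (at x) b)"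
      by (simp add: linear_sum[OF bl] linear_cmul[OF bl])
    also have "norm \<dots> \<le> (\<Sum>b\<in>Basis. norm v * B b)"
      by (rule sum_norm_le) (auto intro!: mult_mono B Basis_le_norm less_imp_le[OF B(1)])
    finally show "norm (frechet_derivative f (at x) v) \<le> ?L * norm v"
      by (simp add: sum_distrib_left mult.commute)
  qed
  have "norm (f x - f y) \<le> ?L * norm (x - y)" for x y
    by (rule differentiable_bound[where S = UNIV and f' = "\<lambda>x. frechet_derivative f (at x)"])
      (auto simp: o D(2) has_derivative_at_withinI)
  moreover have "?L > 0" by (intro sum_pos) (auto simp: B)
  ultimately show ?thesis using that by blast
qed

section \<open>Convolution and mollifiers\<close>

lemma integrable_scaleR_bounded:
  fixes f :: "'a \<Rightarrow> 'b::{second_countable_topology, banach}"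
  assumes "integrable M f" "g \<in> borel_measurable M" "\<And>x. \<bar>g x\<bar> \<le> B"
  shows "integrable M (\<lambda>x. g x *\<^sub>R f x)"
proof (rule Bochner_Integration.integrable_bound)
  show "integrable M (\<lambda>x. B *\<^sub>R f x)" using assms(1) by simp
  show "(\<lambda>x. g x *\<^sub>R f x) \<in> borel_measurable M" using assms by auto
  show "AE x in M. norm (g x *\<^sub>R f x) \<le> norm (B *\<^sub>R f x)"
    using order_trans[OF assms(3) abs_ge_self] by (auto intro!: mult_right_mono)
qed

lemma integrable_inner_bounded:
  fixes f :: "'a \<Rightarrow> 'b::euclidean_space"
  assumes "integrable M f" "g \<in> borel_measurable M" "\<And>x. norm (g x) \<le> B"
  shows "integrable M (\<lambda>x. g x \<bullet> f x)"
proof (rule Bochner_Integration.integrable_bound)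
  show "integrable M (\<lambda>x. B *\<^sub>R f x)" using assms(1) by simp
  show "(\<lambda>x. g x \<bullet> f x) \<in> borel_measurable M" using assms by auto
  have "\<bar>g x \<bullet> f x\<bar> \<le> \<bar>B\<bar> * norm (f x)" for x
    using Cauchy_Schwarz_ineq2[of "g x" "f x"] mult_right_mono[OF assms(3)[of x] norm_ge_zero[of "f x"]]
      abs_ge_self[of B] mult_right_mono[OF abs_ge_self[of B] norm_ge_zero[of "f x"]] by linarith
  then show "AE x in M. norm (g x \<bullet> f x) \<le> norm (B *\<^sub>R f x)" by auto
qed

lemma borel_measurable_continuous_UNIV:
  assumes "sets Q = sets borel" "continuous_on UNIV f"
  shows "f \<in> borel_measurable Q"
  using borel_measurable_continuous_onI[OF assms(2)] assms(1) measurable_cong_sets by blast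

lemma Cc_continuous: "f \<in> Cc_infinity \<Omega> \<Longrightarrow> continuous_on UNIV f"
  by (auto simp: Cc_infinity_def dest: spec[of _ 0])

text \<open>Convolution against a measure \<open>Q\<close> with density \<open>s\<close>. The two instances that matter are Lebesgue
  measure, where it is the usual convolution of functions, and the finite measure that carries the
  singular part of a fractional variation.\<close>

definition conv :: "'a measure \<Rightarrow> ('a::euclidean_space \<Rightarrow> real) \<Rightarrow> ('a \<Rightarrow> 'b::euclidean_space) \<Rightarrow> 'a \<Rightarrow> 'b" where
  "conv Q \<eta> s x = (\<integral>y. \<eta> (x - y) *\<^sub>R s y \<partial>Q)"

lemma conv_integrand:
  fixes s :: "'a::euclidean_space \<Rightarrow> 'b::euclidean_space"
  assumes [simp, measurable_cong]: "sets Q = sets borel" and "\<eta> \<in> borel_measurable borel" "\<And>x. \<bar>\<eta> x\<bar> \<le> B"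
    and "integrable Q s"
  shows "integrable Q (\<lambda>y. \<eta> (x - y) *\<^sub>R s y)"
  using assms by (intro integrable_scaleR_bounded[where B = B]) auto

text \<open>The remainder of the first order expansion of \<open>\<eta>\<close>, divided by the length of the increment, is
  bounded by twice a Lipschitz constant of \<open>\<eta>\<close> and tends to zero pointwise, so dominated convergence
  applies however rough \<open>s\<close> is.\<close>

lemma conv_has_derivative:
  fixes s :: "'a::euclidean_space \<Rightarrow> 'b::euclidean_space"
  assumes Q[simp, measurable_cong]: "sets Q = sets borel" and \<eta>: "\<eta> \<in> Cc_infinity UNIV" and s: "integrable Q s"
  shows "(conv Q \<eta> s has_derivative (\<lambda>v. conv Q (\<lambda>z. frechet_derivative \<eta> (at z) v) s x)) (at x)"
proof -
  note D = Cc_infinity_deriv[OF \<eta>]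
  obtain L where L: "L > 0" "\<And>x y. norm (\<eta> x - \<eta> y) \<le> L * norm (x - y)"
    using Cc_infinity_lipschitz[OF \<eta>] by blast
  have lin: "linear (frechet_derivative \<eta> (at z))" for z
    using D(2) has_derivative_linear by blast
  have int: "integrable Q (\<lambda>y. \<eta> (x - y) *\<^sub>R s y)" for x
  proof -
    obtain B where "\<And>z. norm (\<eta> z) \<le> B" using Cc_infinity_bounded[OF \<eta>] by blast
    then show ?thesis
      using conv_integrand[OF Q _ _ s, of \<eta> B x] Cc_continuous[OF \<eta>] borel_measurable_continuous_onI by auto
  qed
  have dint: "integrable Q (\<lambda>y. frechet_derivative \<eta> (at (x - y)) v *\<^sub>R s y)" for x v
  proof -
    obtain B where "\<And>z. norm (frechet_derivative \<eta> (at z) v) \<le> B" using Cc_infinity_bounded[OF D(1)[of v]] by metis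
    then show ?thesis
      using conv_integrand[OF Q _ _ s, of "\<lambda>z. frechet_derivative \<eta> (at z) v" B x] 
        Cc_continuous[OF D(1)] borel_measurable_continuous_onI by auto
  qed
  \<comment> \<open>the remainder of the first order expansion\<close>
  define R where "R h y = (\<eta> (x + h - y) - \<eta> (x - y) - frechet_derivative \<eta> (at (x - y)) h) *\<^sub>R s y" for h y
  have Rint: "integrable Q (R h)" for h
    unfolding R_def scaleR_left_diff_distrib by (intro Bochner_Integration.integrable_diff int dint)
  have nb: "\<bar>frechet_derivative \<eta> (at z) h\<bar> \<le> L * norm h" for z h
  proof (rule tendsto_upperbound)
    have d: "((\<lambda>t. \<eta> (z + t *\<^sub>R h)) has_derivative (\<lambda>t. frechet_derivative \<eta> (at z) (t *\<^sub>R h))) (at 0)"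
      by (rule has_derivative_compose[where g = \<eta>, of "\<lambda>t. z + t *\<^sub>R h"]) (auto intro!: derivative_eq_intros D(2))
    then have "((\<lambda>t. \<eta> (z + t *\<^sub>R h)) has_real_derivative frechet_derivative \<eta> (at z) h) (at 0)"
      unfolding has_field_derivative_def by (simp add: linear_cmul[OF lin] mult_commute_abs)
    then have "((\<lambda>t. (\<eta> (z + t *\<^sub>R h) - \<eta> z) / t) \<longlongrightarrow> frechet_derivative \<eta> (at z) h) (at 0)"
      by (simp add: has_field_derivative_iff)
    then show "((\<lambda>t. \<bar>(\<eta> (z + t *\<^sub>R h) - \<eta> z) / t\<bar>) \<longlongrightarrow> \<bar>frechet_derivative \<eta> (at z) h\<bar>) (at 0)"
      by (rule tendsto_rabs)
    have "\<bar>(\<eta> (z + t *\<^sub>R h) - \<eta> z) / t\<bar> \<le> L * norm h" if "t \<noteq> 0" for t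
      using L(2)[of "z + t *\<^sub>R h" z] that by (simp add: divide_le_eq mult_ac)
    then show "\<forall>\<^sub>F t in at 0. \<bar>(\<eta> (z + t *\<^sub>R h) - \<eta> z) / t\<bar> \<le> L * norm h"
      by (simp add: eventually_at_filter)
  qed auto
  have lim: "((\<lambda>h. (\<integral>y. norm (R h y) / norm h \<partial>Q)) \<longlongrightarrow> 0) (at 0)"
    unfolding tendsto_at_iff_sequentially comp_def
  proof (intro allI impI)
    fix X :: "nat \<Rightarrow> 'a" assume X0: "\<forall>i. X i \<in> UNIV - {0}" and X: "X \<longlonglongrightarrow> 0"
    have "(\<lambda>i. (\<integral>y. norm (R (X i) y) / norm (X i) \<partial>Q)) \<longlonglongrightarrow> (\<integral>y. 0 \<partial>Q)"
    proof (rule integral_dominated_convergence)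
      show "integrable Q (\<lambda>y. 2 * L * norm (s y))" using s by auto
      show "(\<lambda>y. norm (R (X i) y) / norm (X i)) \<in> borel_measurable Q" for i
        using Rint by (intro borel_measurable_divide borel_measurable_norm) auto
      show "AE y in Q. norm (norm (R (X i) y) / norm (X i)) \<le> 2 * L * norm (s y)" for i
      proof (rule AE_I2)
        fix y
        have "\<bar>\<eta> (x + X i - y) - \<eta> (x - y) - frechet_derivative \<eta> (at (x - y)) (X i)\<bar> \<le> 2 * L * norm (X i)"
          using L(2)[of "x + X i - y" "x - y"] nb[of "x - y" "X i"] by simp
        then have "norm (R (X i) y) \<le> 2 * L * norm (X i) * norm (s y)"
          unfolding R_def by (simp add: mult_right_mono)
        then show "norm (norm (R (X i) y) / norm (X i)) \<le> 2 * L * norm (s y)"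
          using X0 by (simp add: divide_simps mult_ac)
      qed
      show "AE y in Q. (\<lambda>i. norm (R (X i) y) / norm (X i)) \<longlonglongrightarrow> 0"
      proof (rule AE_I2)
        fix y
        have "((\<lambda>h. norm (\<eta> (x - y + h) - \<eta> (x - y) - frechet_derivative \<eta> (at (x - y)) h) / norm h) \<longlongrightarrow> 0) (at 0)"
          using D(2)[of "x - y"] by (auto simp: has_derivative_at)
        then have "(\<lambda>i. norm (\<eta> (x - y + X i) - \<eta> (x - y) - frechet_derivative \<eta> (at (x - y)) (X i)) / norm (X i)) \<longlonglongrightarrow> 0"
          using X0 X unfolding tendsto_at_iff_sequentially comp_def by blast
        then have "(\<lambda>i. norm (\<eta> (x - y + X i) - \<eta> (x - y) - frechet_derivative \<eta> (at (x - y)) (X i)) / norm (X i) * norm (s y)) \<longlonglongrightarrow> 0 * norm (s y)"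
          by (intro tendsto_mult tendsto_const)
        then show "(\<lambda>i. norm (R (X i) y) / norm (X i)) \<longlonglongrightarrow> 0"
          by (simp add: R_def diff_add_eq)
      qed
    qed simp
    then show "(\<lambda>i. (\<integral>y. norm (R (X i) y) / norm (X i) \<partial>Q)) \<longlonglongrightarrow> 0" by simp
  qed
  have eq: "(\<integral>y. R h y \<partial>Q) = conv Q \<eta> s (x + h) - conv Q \<eta> s x - conv Q (\<lambda>z. frechet_derivative \<eta> (at z) h) s x" for h
    unfolding R_def conv_def scaleR_left_diff_distrib
    by (simp add: Bochner_Integration.integral_diff int dint)
  have bl: "bounded_linear (\<lambda>v. conv Q (\<lambda>z. frechet_derivative \<eta> (at z) v) s x)"
  proof -
    have "linear (\<lambda>v. conv Q (\<lambda>z. frechet_derivative \<eta> (at z) v) s x)"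
      by (rule linearI) (simp_all add: conv_def linear_add[OF lin] linear_cmul[OF lin] scaleR_left_distrib dint
          flip: scaleR_scaleR)
    then show ?thesis using linear_conv_bounded_linear by blast
  qed
  have "((\<lambda>h. norm (conv Q \<eta> s (x + h) - conv Q \<eta> s x - conv Q (\<lambda>z. frechet_derivative \<eta> (at z) h) s x) / norm h) \<longlongrightarrow> 0) (at 0)"
  proof (rule Lim_null_comparison[OF _ lim])
    show "\<forall>\<^sub>F h in at 0. norm (norm (conv Q \<eta> s (x + h) - conv Q \<eta> s x - conv Q (\<lambda>z. frechet_derivative \<eta> (at z) h) s x) / norm h)
      \<le> (\<integral>y. norm (R h y) / norm h \<partial>Q)"
      using integral_norm_bound[of Q "R h" for h]
      by (auto intro!: always_eventually divide_right_mono simp flip: eq)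
  qed
  with bl show ?thesis by (simp add: has_derivative_at)
qed

lemma conv_Ck:
  fixes s :: "'a::euclidean_space \<Rightarrow> 'b::euclidean_space"
  assumes Q: "sets Q = sets borel" and s: "integrable Q s"
  shows "\<eta> \<in> Cc_infinity UNIV \<Longrightarrow> Ck k (conv Q \<eta> s)"
proof (induction k arbitrary: \<eta>)
  case 0
  then show ?case using has_derivative_continuous[OF conv_has_derivative[OF Q _ s]]
    by (simp add: continuous_on_eq_continuous_at)
next
  case (Suc k)
  show ?case
    by (rule Ck_SucI[OF conv_has_derivative[OF Q Suc.prems s]]) (intro Suc.IH Cc_infinity_deriv Suc.prems)
qed

lemma conv_Cc_infinity:
  fixes s :: "'a::euclidean_space \<Rightarrow> 'b::euclidean_space"
  assumes Q: "sets Q = sets borel" and s: "integrable Q s" and \<eta>: "\<eta> \<in> Cc_infinity UNIV"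
    and "compact K" "K \<subseteq> \<Omega>" "\<And>x y. \<eta> (x - y) \<noteq> 0 \<Longrightarrow> s y \<noteq> 0 \<Longrightarrow> x \<in> K"
  shows "conv Q \<eta> s \<in> Cc_infinity \<Omega>"
proof (rule Cc_infinityI[OF conv_Ck[OF Q s \<eta>] assms(4,5)])
  fix x assume "x \<notin> K"
  then have "(\<lambda>y. \<eta> (x - y) *\<^sub>R s y) = (\<lambda>y. 0)" using assms(6) by force
  then show "conv Q \<eta> s x = 0" by (simp add: conv_def)
qed

lemma
  fixes f :: "'a::euclidean_space \<Rightarrow> 'b::euclidean_space"
  assumes c: "c \<noteq> 0"
  shows lborel_integral_affine:
      "f \<in> borel_measurable borel \<Longrightarrow> (\<integral>x. f (t + c *\<^sub>R x) \<partial>lborel) = (1 / \<bar>c\<bar> ^ DIM('a)) *\<^sub>R (\<integral>x. f x \<partial>lborel)"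
    and lborel_integrable_affine: "integrable lborel f \<Longrightarrow> integrable lborel (\<lambda>x. f (t + c *\<^sub>R x))"
proof -
  have e: "integral\<^sup>L lborel f = \<bar>c\<bar> ^ DIM('a) *\<^sub>R (\<integral>x. f (t + c *\<^sub>R x) \<partial>lborel)"
    if [measurable]: "f \<in> borel_measurable borel"
    by (subst lborel_affine[OF c, of t]) (simp add: integral_density integral_distr)
  then show "f \<in> borel_measurable borel \<Longrightarrow> (\<integral>x. f (t + c *\<^sub>R x) \<partial>lborel) = (1 / \<bar>c\<bar> ^ DIM('a)) *\<^sub>R (\<integral>x. f x \<partial>lborel)"
    using c by simp
  assume f: "integrable lborel f"
  then have [measurable]: "f \<in> borel_measurable borel" by auto
  have "integrable (density (distr lborel borel (\<lambda>x. t + c *\<^sub>R x)) (\<lambda>_. ennreal (\<bar>c\<bar> ^ DIM('a)))) f"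
    using f by (subst (asm) lborel_affine[OF c, of t]) (simp add: ennreal_power)
  then have "integrable lborel (\<lambda>x. \<bar>c\<bar> ^ DIM('a) *\<^sub>R f (t + c *\<^sub>R x))"
    by (simp add: integrable_density integrable_distr_eq)
  then have "integrable lborel (\<lambda>x. (1 / \<bar>c\<bar> ^ DIM('a)) *\<^sub>R (\<bar>c\<bar> ^ DIM('a) *\<^sub>R f (t + c *\<^sub>R x)))"
    by (rule integrable_scaleR_right)
  then show "integrable lborel (\<lambda>x. f (t + c *\<^sub>R x))" using c by simp
qed

lemma conv_commute:
  fixes s :: "'a::euclidean_space \<Rightarrow> 'b::euclidean_space"
  assumes [measurable]: "\<eta> \<in> borel_measurable borel" "s \<in> borel_measurable borel"
  shows "conv lborel \<eta> s x = (\<integral>w. \<eta> w *\<^sub>R s (x - w) \<partial>lborel)"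
proof -
  have "(\<lambda>w. \<eta> w *\<^sub>R s (x - w)) \<in> borel_measurable borel" by measurable
  from lborel_integral_affine[OF _ this, of "-1" x] show ?thesis by (simp add: conv_def)
qed

lemma conv_pair_integrable:
  fixes s :: "'a::euclidean_space \<Rightarrow> 'b::euclidean_space"
  assumes "sigma_finite_measure Q" and Q[simp, measurable_cong]: "sets Q = sets borel"
    and \<eta>: "integrable lborel \<eta>" and s: "integrable Q s"
  shows "integrable (Q \<Otimes>\<^sub>M lborel) (\<lambda>(y, x). \<eta> (x - y) *\<^sub>R s y)"
proof -
  interpret Q: sigma_finite_measure Q by fact
  interpret P: pair_sigma_finite Q lborel ..
  have [measurable]: "\<eta> \<in> borel_measurable borel" "s \<in> borel_measurable Q"
    using \<eta> s by auto
  show ?thesis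
  proof (rule P.Fubini_integrable)
    show "(\<lambda>(y, x). \<eta> (x - y) *\<^sub>R s y) \<in> borel_measurable (Q \<Otimes>\<^sub>M lborel)"
      by measurable
    have "(\<integral>x. \<bar>\<eta> (x - y)\<bar> \<partial>lborel) = (\<integral>x. \<bar>\<eta> x\<bar> \<partial>lborel)" for y
      using lborel_integral_affine[of 1 "\<lambda>x. \<bar>\<eta> x\<bar>" "-y"] by simp
    then show "integrable Q (\<lambda>y. \<integral>x. norm (case (y, x) of (y, x) \<Rightarrow> \<eta> (x - y) *\<^sub>R s y) \<partial>lborel)"
      using s by simp
    have "integrable lborel (\<lambda>x. \<eta> (x - y))" for y
      using lborel_integrable_affine[of 1 \<eta> "-y"] \<eta> by simp
    then show "AE y in Q. integrable lborel (\<lambda>x. case (y, x) of (y, x) \<Rightarrow> \<eta> (x - y) *\<^sub>R s y)"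
      by auto
  qed
qed

lemma
  fixes s :: "'a::euclidean_space \<Rightarrow> 'b::euclidean_space"
  assumes sf: "sigma_finite_measure Q" and Q[simp, measurable_cong]: "sets Q = sets borel"
    and \<eta>: "integrable lborel \<eta>" and s: "integrable Q s"
  shows conv_integrable: "integrable lborel (conv Q \<eta> s)"
    and conv_norm_le: "(\<integral>x. norm (conv Q \<eta> s x) \<partial>lborel) \<le> (\<integral>x. \<bar>\<eta> x\<bar> \<partial>lborel) * (\<integral>y. norm (s y) \<partial>Q)"
proof -
  interpret Q: sigma_finite_measure Q by fact
  interpret P: pair_sigma_finite Q lborel ..
  have [measurable]: "\<eta> \<in> borel_measurable borel" "s \<in> borel_measurable Q"
    using \<eta> s by auto
  note I = conv_pair_integrable[OF sf Q \<eta> s]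
  show i: "integrable lborel (conv Q \<eta> s)"
    unfolding conv_def[abs_def] by (rule P.integrable_snd[OF I])
  have I': "integrable (Q \<Otimes>\<^sub>M lborel) (\<lambda>(y, x). \<bar>\<eta> (x - y)\<bar> * norm (s y))"
    using integrable_norm[OF I] by (simp add: case_prod_unfold)
  have "(\<integral>x. norm (conv Q \<eta> s x) \<partial>lborel) \<le> (\<integral>x. (\<integral>y. \<bar>\<eta> (x - y)\<bar> * norm (s y) \<partial>Q) \<partial>lborel)"
    unfolding conv_def
    by (rule integral_mono[OF integrable_norm[OF i[unfolded conv_def[abs_def]]] P.integrable_snd[OF I']])
      (use integral_norm_bound[of Q "\<lambda>y. \<eta> (x - y) *\<^sub>R s y" for x] in simp)
  also have "\<dots> = (\<integral>y. (\<integral>x. \<bar>\<eta> (x - y)\<bar> * norm (s y) \<partial>lborel) \<partial>Q)"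
    by (rule P.Fubini_integral[OF I'])
  also have "\<dots> = (\<integral>y. (\<integral>x. \<bar>\<eta> x\<bar> \<partial>lborel) * norm (s y) \<partial>Q)"
  proof -
    have "(\<integral>x. \<bar>\<eta> (x - y)\<bar> \<partial>lborel) = (\<integral>x. \<bar>\<eta> x\<bar> \<partial>lborel)" for y
      using lborel_integral_affine[of 1 "\<lambda>x. \<bar>\<eta> x\<bar>" "-y"] by simp
    then show ?thesis by simp
  qed
  finally show "(\<integral>x. norm (conv Q \<eta> s x) \<partial>lborel) \<le> (\<integral>x. \<bar>\<eta> x\<bar> \<partial>lborel) * (\<integral>y. norm (s y) \<partial>Q)"
    by simp
qed

text \<open>Convolution with \<open>\<eta>\<close> is moved to the other side of the pairing as convolution with the reflected
  kernel. For \<open>Q\<close> carrying a measure this says that mollifying a test field amounts to mollifying the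
  measure.\<close>

lemma conv_adjoint:
  fixes s \<phi> :: "'a::euclidean_space \<Rightarrow> 'b::euclidean_space"
  assumes sf: "sigma_finite_measure Q" and Q[simp, measurable_cong]: "sets Q = sets borel"
    and \<eta>: "integrable lborel \<eta>" "\<And>x. \<bar>\<eta> x\<bar> \<le> B" and s: "integrable Q s"
    and \<phi>[measurable]: "\<phi> \<in> borel_measurable borel" and C: "\<And>x. norm (\<phi> x) \<le> C"
  shows "(\<integral>x. \<phi> x \<bullet> conv Q \<eta> s x \<partial>lborel) = (\<integral>y. conv lborel (\<lambda>z. \<eta> (- z)) \<phi> y \<bullet> s y \<partial>Q)"
proof -
  interpret Q: sigma_finite_measure Q by fact
  interpret P: pair_sigma_finite Q lborel ..
  have [measurable]: "\<eta> \<in> borel_measurable borel" "s \<in> borel_measurable Q"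
    using \<eta> s by auto
  have I: "integrable (Q \<Otimes>\<^sub>M lborel) (\<lambda>(y, x). \<phi> x \<bullet> (\<eta> (x - y) *\<^sub>R s y))"
    using integrable_inner_bounded[OF conv_pair_integrable[OF sf Q \<eta>(1) s], of "\<lambda>(y,x). \<phi> x" C] C
    by (simp add: case_prod_unfold)
  have "(\<integral>x. \<phi> x \<bullet> conv Q \<eta> s x \<partial>lborel) = (\<integral>x. (\<integral>y. \<phi> x \<bullet> (\<eta> (x - y) *\<^sub>R s y) \<partial>Q) \<partial>lborel)"
    unfolding conv_def
    by (intro Bochner_Integration.integral_cong refl integral_inner_right[symmetric] conv_integrand[OF Q _ \<eta>(2) s]) simp
  also have "\<dots> = (\<integral>y. (\<integral>x. \<phi> x \<bullet> (\<eta> (x - y) *\<^sub>R s y) \<partial>lborel) \<partial>Q)"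
    by (rule P.Fubini_integral[OF I])
  also have "\<dots> = (\<integral>y. (\<integral>x. (\<eta> (x - y) *\<^sub>R \<phi> x) \<bullet> s y \<partial>lborel) \<partial>Q)"
    by simp
  also have "\<dots> = (\<integral>y. conv lborel (\<lambda>z. \<eta> (- z)) \<phi> y \<bullet> s y \<partial>Q)"
  proof -
    have "integrable lborel (\<lambda>x. \<eta> (x - y))" for y
      using lborel_integrable_affine[of 1 \<eta> "-y"] \<eta> by simp
    then have "integrable lborel (\<lambda>x. \<eta> (x - y) *\<^sub>R \<phi> x)" for y
    proof (rule Bochner_Integration.integrable_bound[OF integrable_mult_right[where c = C]])
      have "\<bar>\<eta> (x - y)\<bar> * norm (\<phi> x) \<le> \<bar>\<eta> (x - y)\<bar> * \<bar>C\<bar>" for x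
        using C[of x] by (intro mult_left_mono) auto
      then show "AE x in lborel. norm (\<eta> (x - y) *\<^sub>R \<phi> x) \<le> norm (C * \<eta> (x - y))"
        by (auto simp: abs_mult mult.commute)
    qed auto
    then have "(\<integral>x. (\<eta> (x - y) *\<^sub>R \<phi> x) \<bullet> s y \<partial>lborel) = conv lborel (\<lambda>z. \<eta> (- z)) \<phi> y \<bullet> s y" for y
      unfolding conv_def minus_diff_eq by (rule integral_inner_left)
    then show ?thesis by simp
  qed
  finally show ?thesis .
qed

lemma Cc_integrable:
  fixes f :: "'a::euclidean_space \<Rightarrow> 'b::euclidean_space"
  assumes "f \<in> Cc_infinity UNIV"
  shows "integrable lborel f"
proof -
  have c: "compact (closure {x. f x \<noteq> 0})" using assms by (auto simp: Cc_infinity_def)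
  have "integrable lborel (\<lambda>x. indicator (closure {x. f x \<noteq> 0}) x *\<^sub>R f x)"
    using borel_integrable_compact[OF c, of f] Cc_continuous[OF assms] continuous_on_subset by auto
  moreover have "(\<lambda>x. indicator (closure {x. f x \<noteq> 0}) x *\<^sub>R f x) = f"
    using closure_subset[of "{x. f x \<noteq> 0}"] by (auto simp: indicator_def fun_eq_iff)
  ultimately show ?thesis by simp
qed

text \<open>The centre \<open>a\<close> is not assumed to be the origin: a mollifier centred at \<open>a\<close> translates by \<open>a\<close> and
  smooths at scale \<open>r\<close> in a single convolution.\<close>

definition mollifier :: "('a::euclidean_space \<Rightarrow> real) \<Rightarrow> 'a \<Rightarrow> real \<Rightarrow> bool" where
  "mollifier \<eta> a r \<longleftrightarrow> \<eta> \<in> Cc_infinity UNIV \<and> (\<forall>z. 0 \<le> \<eta> z) \<and> (\<forall>z. \<eta> z \<noteq> 0 \<longrightarrow> norm (z - a) < r) \<and>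
     (\<integral>z. \<eta> z \<partial>lborel) = 1"

lemma mollifier_exists:
  assumes r: "r > 0"
  shows "\<exists>\<eta>. mollifier \<eta> (a::'a::euclidean_space) r"
proof -
  define b where "b x = flat 1 (1 - x \<bullet> x)" for x :: 'a
  have bz: "b x \<noteq> 0 \<Longrightarrow> norm x < 1" for x
    by (auto simp: b_def flat_def norm_eq_sqrt_inner split: if_splits)
  have bp: "0 \<le> b x" "norm x < 1 \<Longrightarrow> 0 < b x" for x
    by (auto simp: b_def flat_def norm_eq_sqrt_inner real_less_lsqrt not_less)
  have bC: "b \<in> Cc_infinity UNIV"
  proof -
    have "{x. b x \<noteq> 0} \<subseteq> ball 0 1" using bz by (auto simp: dist_norm)
    then have "bounded {x. b x \<noteq> 0}" using bounded_subset bounded_ball by blast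
    then show ?thesis unfolding Cc_infinity_UNIV using Ck_bump unfolding b_def by blast
  qed
  define c where "c z = b ((1/r) *\<^sub>R z + (- a /\<^sub>R r))" for z
  have cb: "c z = b ((z - a) /\<^sub>R r)" for z by (simp add: c_def algebra_simps divide_inverse)
  have nr: "norm ((z - a) /\<^sub>R r) < 1 \<longleftrightarrow> norm (z - a) < r" for z
    using r by (simp add: divide_simps)
  have cz: "c z \<noteq> 0 \<Longrightarrow> norm (z - a) < r" for z
    using bz[of "(z - a) /\<^sub>R r"] unfolding cb nr .
  have cC: "c \<in> Cc_infinity UNIV"
  proof -
    have "Ck k c" for k
      using Ck_affine_arg[of k b "1/r" "- a /\<^sub>R r"] bC unfolding c_def[abs_def] Cc_infinity_UNIV by blast
    moreover have "{x. c x \<noteq> 0} \<subseteq> cball a r"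
      using cz by (auto simp: dist_norm norm_minus_commute less_imp_le)
    ultimately show ?thesis unfolding Cc_infinity_UNIV using bounded_subset bounded_cball by blast
  qed
  have ci: "integrable lborel c" by (rule Cc_integrable[OF cC])
  have cn: "0 \<le> c z" for z using bp by (simp add: cb)
  have "(\<integral>z. c z \<partial>lborel) \<noteq> 0"
  proof
    assume "(\<integral>z. c z \<partial>lborel) = 0"
    then have "AE z in lborel. c z = 0" using ci cn by (simp add: integral_nonneg_eq_0_iff_AE)
    then have "AE z in lborel. z \<notin> ball a r"
    proof eventually_elim
      fix z assume "c z = 0"
      then have "\<not> norm (z - a) < r" using bp(2)[of "(z - a) /\<^sub>R r"] unfolding cb nr by auto
      then show "z \<notin> ball a r" by (simp add: dist_norm norm_minus_commute)
    qed
    then have "ball a r \<in> null_sets lborel"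
      by (subst (asm) AE_iff_null_sets[symmetric]) auto
    then show False using r unit_ball_vol_pos[of "real DIM('a)"] by (simp add: null_sets_def emeasure_ball)
  qed
  then have I: "0 < (\<integral>z. c z \<partial>lborel)" using cn by (simp add: order_less_le)
  have "mollifier (\<lambda>z. (1 / (\<integral>z. c z \<partial>lborel)) * c z) a r"
    unfolding mollifier_def
  proof (intro conjI allI impI)
    have "Ck k (\<lambda>z. (1 / (\<integral>z. c z \<partial>lborel)) * c z)" for k
      by (intro Ck_mult Ck_const) (use cC in \<open>auto simp: Cc_infinity_UNIV\<close>)
    then show "(\<lambda>z. (1 / (\<integral>z. c z \<partial>lborel)) * c z) \<in> Cc_infinity UNIV"
      using cC I by (simp add: Cc_infinity_UNIV)
  qed (use cn cz I in auto)
  then show ?thesis by blast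
qed

section \<open>Representing vector measures by densities\<close>

lemma radon_empty:
  assumes "radon_vmeasure \<mu>" shows "\<mu> {} = 0"
proof -
  have "(\<lambda>i::nat. \<mu> {}) sums \<mu> (\<Union>i::nat. {})"
    using assms unfolding radon_vmeasure_def 
    by (elim conjE allE[where x = "\<lambda>i::nat. {}"]) (auto simp: disjoint_family_on_def)
  then have "summable (\<lambda>i::nat. \<mu> {})" by (rule sums_summable)
  then show ?thesis by (simp add: summable_const_iff)
qed

lemma radon_sums:
  fixes A :: "nat \<Rightarrow> 'a::euclidean_space set"
  assumes "radon_vmeasure \<mu>" "\<And>i. A i \<in> sets borel" "disjoint_family A"
  shows "(\<lambda>i. \<mu> (A i)) sums \<mu> (\<Union>i. A i)"
  using assms unfolding radon_vmeasure_def by blast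

lemma radon_Un:
  assumes \<mu>: "radon_vmeasure \<mu>" and "A \<in> sets borel" "B \<in> sets borel" "A \<inter> B = {}"
  shows "\<mu> (A \<union> B) = \<mu> A + \<mu> B"
proof -
  have "(\<lambda>i. \<mu> (binaryset A B i)) sums \<mu> (\<Union>i. binaryset A B i)"
    using assms by (intro radon_sums[OF \<mu>]) (auto simp: binaryset_def disjoint_family_on_def)
  moreover have "(\<lambda>i. \<mu> (binaryset A B i)) sums (\<mu> A + \<mu> B)"
    by (rule binaryset_sums) (rule radon_empty[OF \<mu>])
  ultimately show ?thesis using sums_unique2 by (fastforce simp: UN_binaryset_eq)
qed

lemma radon_Diff:
  assumes \<mu>: "radon_vmeasure \<mu>" and "A \<in> sets borel" "B \<in> sets borel" "B \<subseteq> A"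
  shows "\<mu> (A - B) = \<mu> A - \<mu> B"
proof -
  have "B \<union> (A - B) = A" using assms by blast
  then show ?thesis using radon_Un[OF \<mu>, of B "A - B"] assms by auto
qed

lemma radon_bounded_linear:
  assumes "radon_vmeasure \<mu>" "bounded_linear h"
  shows "radon_vmeasure (\<lambda>A. h (\<mu> A))"
proof -
  interpret h: bounded_linear h by fact
  show ?thesis using assms(1) h.sums unfolding radon_vmeasure_def by (simp add: h.zero)
qed

lemma radon_eqI:
  assumes \<mu>: "radon_vmeasure \<mu>" and \<nu>: "radon_vmeasure \<nu>" and "\<And>A. A \<in> sets borel \<Longrightarrow> \<mu> A = \<nu> A"
  shows "\<mu> = \<nu>"
proof (rule ext)
  fix A show "\<mu> A = \<nu> A"
    using assms by (cases "A \<in> sets borel") (auto simp: radon_vmeasure_def)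
qed

text \<open>Open sets are stable under intersection and generate the Borel sets, and the sets on which two
  countably additive functions agree are closed under complements and disjoint unions.\<close>

lemma radon_eq_on_open:
  assumes \<mu>: "radon_vmeasure \<mu>" and \<nu>: "radon_vmeasure \<nu>" and o: "\<And>U. open U \<Longrightarrow> \<mu> U = \<nu> U"
  shows "\<mu> = \<nu>"
proof (rule radon_eqI[OF \<mu> \<nu>])
  fix A :: "'a set" assume "A \<in> sets borel"
  then have A: "A \<in> sigma_sets UNIV {S. open S}" by (simp add: borel_def)
  have st: "Int_stable {S::'a set. open S}" by (auto intro!: Int_stableI)
  have pw: "{S::'a set. open S} \<subseteq> Pow UNIV" by simp
  from st pw A show "\<mu> A = \<nu> A"
  proof (induction rule: sigma_sets_induct_disjoint)
    case (compl B)
    then have "B \<in> sets borel" by (simp add: borel_def)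
    then show ?case using radon_Diff[OF \<mu>, of UNIV B] radon_Diff[OF \<nu>, of UNIV B] compl o[of UNIV] by simp
  next
    case (union B)
    have "B i \<in> sets borel" for i using union(2) by (auto simp: borel_def)
    then have "(\<lambda>i. \<mu> (B i)) sums \<mu> (\<Union>i. B i)" "(\<lambda>i. \<nu> (B i)) sums \<nu> (\<Union>i. B i)"
      using radon_sums[OF \<mu>, of B] radon_sums[OF \<nu>, of B] union(1) by blast+
    then show ?case using union(3) sums_unique2 by simp
  qed (auto simp: o radon_empty[OF \<mu>] radon_empty[OF \<nu>])
qed

text \<open>Call a set bad if the measure is unbounded on its subsets. If the whole space were bad, it could
  be cut into two parts of measure at least one in absolute value, one of them bad again. Iterating
  produces disjoint sets whose measures do not tend to zero, against countable additivity.\<close>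

lemma radon_real_bounded:
  fixes \<mu> :: "'a::euclidean_space set \<Rightarrow> real"
  assumes \<mu>: "radon_vmeasure \<mu>"
  obtains C where "\<And>A. A \<in> sets borel \<Longrightarrow> \<bar>\<mu> A\<bar> \<le> C"
proof -
  define bad where "bad A \<longleftrightarrow> (\<forall>C. \<exists>B\<in>sets borel. B \<subseteq> A \<and> \<bar>\<mu> B\<bar> > C)" for A
  have split: "bad B \<or> bad (A - B)" if A: "bad A" "A \<in> sets borel" "B \<in> sets borel" for A B
  proof (rule ccontr)
    assume "\<not> ?thesis"
    then obtain C1 C2 where C: "\<And>E. E \<in> sets borel \<Longrightarrow> E \<subseteq> B \<Longrightarrow> \<bar>\<mu> E\<bar> \<le> C1"
        "\<And>E. E \<in> sets borel \<Longrightarrow> E \<subseteq> A - B \<Longrightarrow> \<bar>\<mu> E\<bar> \<le> C2"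
      unfolding bad_def by (meson not_le)
    obtain E where E: "E \<in> sets borel" "E \<subseteq> A" "\<bar>\<mu> E\<bar> > C1 + C2" using A unfolding bad_def by blast
    have "\<mu> E = \<mu> (E \<inter> B) + \<mu> (E - B)"
    proof -
      have "(E \<inter> B) \<union> (E - B) = E" "(E \<inter> B) \<inter> (E - B) = {}" by blast+
      then show ?thesis using radon_Un[OF \<mu>, of "E \<inter> B" "E - B"] E A by simp
    qed
    moreover have "\<bar>\<mu> (E \<inter> B)\<bar> \<le> C1" "\<bar>\<mu> (E - B)\<bar> \<le> C2"
      using C(1)[of "E \<inter> B"] C(2)[of "E - B"] E A by auto
    ultimately show False using E(3) by linarith
  qed
  \<comment> \<open>with \<open>|\<mu> B| > |\<mu> A| + 1\<close> both \<open>B\<close> and \<open>A - B\<close> have measure at least one in absolute value\<close>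
  have step: "\<exists>A'. (A' \<in> sets borel \<and> bad A') \<and> (A' \<subseteq> A \<and> 1 \<le> \<bar>\<mu> (A - A')\<bar>)" if A: "A \<in> sets borel \<and> bad A" for A
  proof -
    obtain B where B: "B \<in> sets borel" "B \<subseteq> A" "\<bar>\<mu> B\<bar> > \<bar>\<mu> A\<bar> + 1" using A unfolding bad_def by blast
    have d: "\<mu> (A - B) = \<mu> A - \<mu> B" using radon_Diff[OF \<mu>, of A B] A B by auto
    have dd: "A - (A - B) = B" using B by blast
    show ?thesis
    proof (cases "bad B")
      case True then show ?thesis using B A d by (intro exI[of _ B]) auto
    next
      case False
      then have "bad (A - B)" using split A B by blast
      then show ?thesis using B A d dd by (intro exI[of _ "A - B"]) auto
    qed
  qed
  have "\<not> bad UNIV"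
  proof
    assume bU: "bad UNIV"
    have "\<exists>A. \<forall>n. (A n \<in> sets borel \<and> bad (A n)) \<and> (A (Suc n) \<subseteq> A n \<and> 1 \<le> \<bar>\<mu> (A n - A (Suc n))\<bar>)"
    proof (rule dependent_nat_choice[of "\<lambda>_ A. A \<in> sets borel \<and> bad A" "\<lambda>_ A A'. A' \<subseteq> A \<and> 1 \<le> \<bar>\<mu> (A - A')\<bar>"])
      show "\<exists>A. A \<in> sets borel \<and> bad A" using bU sets.top[of borel] by (metis space_borel)
    qed (rule step)
    then obtain A where A: "\<And>n. A n \<in> sets borel \<and> bad (A n)" "\<And>n. A (Suc n) \<subseteq> A n \<and> 1 \<le> \<bar>\<mu> (A n - A (Suc n))\<bar>"
      by blast
    have dec: "A m \<subseteq> A n" if "n \<le> m" for n m using that by (induction rule: dec_induct) (use A(2) in auto)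
    have "disjoint_family (\<lambda>n. A n - A (Suc n))"
      unfolding disjoint_family_on_def
    proof (intro ballI impI)
      fix m n :: nat assume "m \<noteq> n"
      then show "(A m - A (Suc m)) \<inter> (A n - A (Suc n)) = {}"
        using dec[of "Suc m" n] dec[of "Suc n" m] by (cases "m < n") auto
    qed
    then have "(\<lambda>n. \<mu> (A n - A (Suc n))) sums \<mu> (\<Union>n. A n - A (Suc n))"
      using A by (intro radon_sums[OF \<mu>]) auto
    then have "(\<lambda>n. \<mu> (A n - A (Suc n))) \<longlonglongrightarrow> 0" using sums_summable summable_LIMSEQ_zero by blast
    then have "\<forall>\<^sub>F n in sequentially. \<bar>\<mu> (A n - A (Suc n))\<bar> < 1"
      by (auto dest!: tendstoD[where e = 1] simp: dist_real_def)
    then obtain n where "\<bar>\<mu> (A n - A (Suc n))\<bar> < 1" unfolding eventually_sequentially by blast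
    then show False using A(2)[of n] by linarith
  qed
  then obtain C where "\<forall>B\<in>sets borel. \<not> \<bar>\<mu> B\<bar> > C" unfolding bad_def by auto
  then show ?thesis using that[of C] by (simp add: not_less)
qed

lemma ennreal_sums_le_suminf:
  assumes "f sums (l::real)"
  shows "ennreal l \<le> (\<Sum>i. ennreal (f i))"
proof (rule tendsto_upperbound[OF tendsto_ennrealI])
  show "(\<lambda>n. \<Sum>i<n. f i) \<longlonglongrightarrow> l" using assms by (simp add: sums_def)
  have "ennreal (\<Sum>i<n. f i) \<le> (\<Sum>i. ennreal (f i))" for n
  proof -
    have "ennreal (\<Sum>i<n. f i) \<le> ennreal (\<Sum>i<n. max 0 (f i))"
      by (intro ennreal_leI sum_mono) auto
    also have "\<dots> = (\<Sum>i<n. ennreal (max 0 (f i)))" by (rule sum_ennreal[symmetric]) auto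
    also have "\<dots> = (\<Sum>i<n. ennreal (f i))" by (rule sum.cong) (auto simp: max_def ennreal_neg)
    also have "\<dots> \<le> (\<Sum>i. ennreal (f i))" by (rule sum_le_suminf) auto
    finally show ?thesis .
  qed
  then show "\<forall>\<^sub>F n in sequentially. ennreal (\<Sum>i<n. f i) \<le> (\<Sum>i. ennreal (f i))" by simp
qed auto

lemma sets_positive_part[simp, measurable_cong]: "sets (positive_part \<mu>) = sets borel"
  by (simp add: positive_part_def borel_def sigma_sets_sigma_sets_eq[of "sigma_sets UNIV _" UNIV])
    (metis sets.sigma_sets_eq space_borel borel_def sets_measure_of top_greatest Pow_UNIV)

text \<open>The supremum over subsets is countably additive: subadditivity comes from cutting a subset of the
  union along the parts, superadditivity from uniting subsets of the parts.\<close>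

lemma emeasure_positive_part:
  fixes \<mu> :: "'a::euclidean_space set \<Rightarrow> real"
  assumes \<mu>: "radon_vmeasure \<mu>" and A: "A \<in> sets borel"
  shows "emeasure (positive_part \<mu>) A = (SUP B\<in>{B \<in> sets borel. B \<subseteq> A}. ennreal (\<mu> B))"
proof -
  define F where "F A = (SUP B\<in>{B \<in> sets borel. B \<subseteq> A}. ennreal (\<mu> B))" for A :: "'a set"
  have ub: "ennreal (\<mu> B) \<le> F A" if "B \<in> sets borel" "B \<subseteq> A" for A B
    unfolding F_def using that by (intro SUP_upper) auto
  have mono: "F A \<le> F B" if "A \<subseteq> B" for A B
    unfolding F_def using that by (intro SUP_subset_mono) auto
  have add2: "F A + F B \<le> F (A \<union> B)" if d: "A \<inter> B = {}" for A B
  proof -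
    have 1: "ennreal (\<mu> X) + ennreal (\<mu> Y) \<le> F (A \<union> B)" 
      if X: "X \<in> sets borel" "X \<subseteq> A" and Y: "Y \<in> sets borel" "Y \<subseteq> B" for X Y
    proof -
      consider "\<mu> X \<le> 0" | "\<mu> Y \<le> 0" | "\<mu> X \<ge> 0" "\<mu> Y \<ge> 0" by linarith
      then show ?thesis
      proof cases
        case 1 then show ?thesis using ub[of Y "A \<union> B"] Y by (simp add: ennreal_neg le_supI2)
      next
        case 2 then show ?thesis using ub[of X "A \<union> B"] X by (simp add: ennreal_neg le_supI1)
      next
        case 3
        moreover have "X \<inter> Y = {}" using X Y d by blast
        ultimately have "ennreal (\<mu> X) + ennreal (\<mu> Y) = ennreal (\<mu> (X \<union> Y))"
          using radon_Un[OF \<mu>, of X Y] X Y by simp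
        then show ?thesis using ub[of "X \<union> Y" "A \<union> B"] X Y by auto
      qed
    qed
    have "F A + ennreal (\<mu> Y) \<le> F (A \<union> B)" if Y: "Y \<in> sets borel" "Y \<subseteq> B" for Y
    proof -
      have "(SUP X\<in>{X \<in> sets borel. X \<subseteq> A}. ennreal (\<mu> X) + ennreal (\<mu> Y)) \<le> F (A \<union> B)"
        using 1 Y by (intro SUP_least) blast
      moreover have "{} \<in> {X \<in> sets borel. X \<subseteq> A}" by simp
      then have "{X \<in> sets borel. X \<subseteq> A} \<noteq> {}" by blast
      then have "F A + ennreal (\<mu> Y) = (SUP X\<in>{X \<in> sets borel. X \<subseteq> A}. ennreal (\<mu> X) + ennreal (\<mu> Y))"
        unfolding F_def[of A] by (rule ennreal_SUP_add_left[symmetric])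
      ultimately show ?thesis by (simp only:)
    qed
    then have "(SUP Y\<in>{Y \<in> sets borel. Y \<subseteq> B}. F A + ennreal (\<mu> Y)) \<le> F (A \<union> B)"
      by (intro SUP_least) blast
    moreover have "{} \<in> {Y \<in> sets borel. Y \<subseteq> B}" by simp
    then have "{Y \<in> sets borel. Y \<subseteq> B} \<noteq> {}" by blast
    then have "F A + F B = (SUP Y\<in>{Y \<in> sets borel. Y \<subseteq> B}. F A + ennreal (\<mu> Y))"
      unfolding F_def[of B] by (rule ennreal_SUP_add_right)
    ultimately show ?thesis by (simp only:)
  qed
  have sigma: "sigma_sets UNIV (sets borel) = sets (borel :: 'a measure)"
    by (metis sets.sigma_sets_eq space_borel)
  have "countably_additive (sets borel) F"
  proof (rule countably_additiveI)
    fix A :: "nat \<Rightarrow> 'a set" assume A: "range A \<subseteq> sets borel" "disjoint_family A"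
    have fin: "(\<Sum>i<n. F (A i)) \<le> F (\<Union>i<n. A i)" for n
    proof (induction n)
      case (Suc n)
      have "(\<Sum>i<Suc n. F (A i)) \<le> F (\<Union>i<n. A i) + F (A n)" using Suc by (simp add: add_mono)
      also have "\<dots> \<le> F ((\<Union>i<n. A i) \<union> A n)"
      proof (rule add2)
        have "A i \<inter> A n = {}" if "i < n" for i using A(2) that by (auto simp: disjoint_family_on_def)
        then show "(\<Union>i<n. A i) \<inter> A n = {}" by blast
      qed
      also have "(\<Union>i<n. A i) \<union> A n = (\<Union>i<Suc n. A i)" by (auto simp: lessThan_Suc)
      finally show ?case .
    qed auto
    show "(\<Sum>i. F (A i)) = F (\<Union>i. A i)"
    proof (rule antisym)
      show "(\<Sum>i. F (A i)) \<le> F (\<Union>i. A i)"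
      proof (rule suminf_le_const[OF summableI])
        fix n
        have "F (\<Union>i<n. A i) \<le> F (\<Union>i. A i)" by (rule mono) blast
        with fin[of n] show "(\<Sum>i<n. F (A i)) \<le> F (\<Union>i. A i)" by (rule order_trans)
      qed
      show "F (\<Union>i. A i) \<le> (\<Sum>i. F (A i))"
        unfolding F_def[of "\<Union>i. A i"]
      proof (rule SUP_least)
        fix B assume B: "B \<in> {B \<in> sets borel. B \<subseteq> (\<Union>i. A i)}"
        have "(\<lambda>i. \<mu> (B \<inter> A i)) sums \<mu> (\<Union>i. B \<inter> A i)"
          using A B by (intro radon_sums[OF \<mu>]) (auto simp: disjoint_family_on_def)
        moreover have "(\<Union>i. B \<inter> A i) = B" using B by auto
        ultimately have "ennreal (\<mu> B) \<le> (\<Sum>i. ennreal (\<mu> (B \<inter> A i)))" using ennreal_sums_le_suminf by metis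
        also have "\<dots> \<le> (\<Sum>i. F (A i))" using A B by (intro suminf_le ub summableI) auto
        finally show "ennreal (\<mu> B) \<le> (\<Sum>i. F (A i))" .
      qed
    qed
  qed
  moreover have "positive (sets borel) F"
  proof -
    have "{B. B \<in> sets borel \<and> B = {}} = {{}::'a set}" by auto
    then show ?thesis by (auto simp: positive_def F_def radon_empty[OF \<mu>])
  qed
  ultimately have "emeasure (positive_part \<mu>) A = F A"
    using A sets.sigma_algebra_axioms[of borel]
    by (intro emeasure_measure_of[where \<Omega> = UNIV and A = "sets borel"])
       (auto simp: positive_part_def F_def[abs_def] sigma)
  then show ?thesis by (simp add: F_def)
qed

lemma positive_part_finite:
  fixes \<mu> :: "'a::euclidean_space set \<Rightarrow> real"
  assumes \<mu>: "radon_vmeasure \<mu>"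
  shows "finite_measure (positive_part \<mu>)"
proof
  have sp: "space (positive_part \<mu>) = UNIV"
    using sets_eq_imp_space_eq[OF sets_positive_part[of \<mu>]] by simp
  obtain C where C: "\<And>A. A \<in> sets borel \<Longrightarrow> \<bar>\<mu> A\<bar> \<le> C" using radon_real_bounded[OF \<mu>] by blast
  have "emeasure (positive_part \<mu>) UNIV \<le> ennreal C"
    by (subst emeasure_positive_part[OF \<mu>]) (simp, rule SUP_least, use C in \<open>fastforce intro!: ennreal_leI\<close>)
  then show "emeasure (positive_part \<mu>) (space (positive_part \<mu>)) \<noteq> \<infinity>"
    unfolding sp using ennreal_less_top[of C] le_less_trans by (auto simp: top_unique)
qed

text \<open>Passing from \<open>B\<close> to \<open>A - B\<close> turns the supremum of \<open>\<mu>\<close> over subsets of \<open>A\<close> into \<open>\<mu> A\<close> plus the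
  supremum of \<open>- \<mu>\<close>.\<close>

lemma positive_part_diff:
  fixes \<mu> :: "'a::euclidean_space set \<Rightarrow> real"
  assumes \<mu>: "radon_vmeasure \<mu>" and A: "A \<in> sets borel"
  shows "\<mu> A = measure (positive_part \<mu>) A - measure (positive_part (\<lambda>A. - \<mu> A)) A"
proof -
  have neg: "radon_vmeasure (\<lambda>A. - \<mu> A)" 
    by (rule radon_bounded_linear[OF \<mu>]) (rule bounded_linear_minus[OF bounded_linear_ident])
  have ub: "\<nu> B \<le> measure (positive_part \<nu>) A"
    if \<nu>: "radon_vmeasure \<nu>" and B: "B \<in> sets borel" "B \<subseteq> A" for B and \<nu> :: "'a set \<Rightarrow> real"
  proof -
    interpret finite_measure "positive_part \<nu>" by (rule positive_part_finite[OF \<nu>])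
    have "ennreal (\<nu> B) \<le> emeasure (positive_part \<nu>) A"
      unfolding emeasure_positive_part[OF \<nu> A] using B by (intro SUP_upper) auto
    then show ?thesis by (simp add: emeasure_eq_measure)
  qed
  have least: "measure (positive_part \<nu>) A \<le> c" 
    if \<nu>: "radon_vmeasure \<nu>" and c: "\<And>B. B \<in> sets borel \<Longrightarrow> B \<subseteq> A \<Longrightarrow> \<nu> B \<le> c" for c and \<nu> :: "'a set \<Rightarrow> real"
  proof -
    interpret finite_measure "positive_part \<nu>" by (rule positive_part_finite[OF \<nu>])
    have "0 \<le> c" using c[of "{}"] radon_empty[OF \<nu>] by simp
    have "emeasure (positive_part \<nu>) A \<le> ennreal c"
      unfolding emeasure_positive_part[OF \<nu> A] using c by (intro SUP_least) (auto intro: ennreal_leI)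
    then show ?thesis using \<open>0 \<le> c\<close> by (simp add: emeasure_eq_measure)
  qed
  have "measure (positive_part \<mu>) A \<le> \<mu> A + measure (positive_part (\<lambda>A. - \<mu> A)) A"
  proof (rule least[OF \<mu>])
    fix B assume B: "B \<in> sets borel" "B \<subseteq> A"
    then show "\<mu> B \<le> \<mu> A + measure (positive_part (\<lambda>A. - \<mu> A)) A"
      using ub[OF neg, of "A - B"] radon_Diff[OF \<mu> A B(1)] A by auto
  qed
  moreover have "measure (positive_part (\<lambda>A. - \<mu> A)) A \<le> measure (positive_part \<mu>) A - \<mu> A"
  proof (rule least[OF neg])
    fix B assume B: "B \<in> sets borel" "B \<subseteq> A"
    then show "- \<mu> B \<le> measure (positive_part \<mu>) A - \<mu> A"
      using ub[OF \<mu>, of "A - B"] radon_Diff[OF \<mu> A B(1)] A by auto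
  qed
  ultimately show ?thesis by linarith
qed

lemma sum_measure_exists:
  assumes "finite I" and N: "\<And>i. i \<in> I \<Longrightarrow> finite_measure (N i)" 
    "\<And>i. i \<in> I \<Longrightarrow> sets (N i) = sets (borel :: 'a::topological_space measure)"
  shows "\<exists>T. finite_measure T \<and> sets T = sets borel \<and> (\<forall>A\<in>sets borel. emeasure T A = (\<Sum>i\<in>I. emeasure (N i) A))"
proof -
  define T where "T = measure_of UNIV (sets borel) (\<lambda>A. \<Sum>i\<in>I. emeasure (N i) A)"
  have sT: "sets T = sets borel" by (simp add: T_def) (metis sets.sigma_sets_eq space_borel)
  have sigma: "sigma_sets UNIV (sets borel) = sets (borel :: 'a measure)"
    by (metis sets.sigma_sets_eq space_borel)
  have "countably_additive (sets borel) (\<lambda>A. \<Sum>i\<in>I. emeasure (N i) A)"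
    by (rule countably_additiveI) (use N in \<open>simp add: suminf_sum suminf_emeasure\<close>)
  then have eT: "emeasure T A = (\<Sum>i\<in>I. emeasure (N i) A)" if "A \<in> sets borel" for A
    using that sigma
    by (intro emeasure_measure_of[where \<Omega> = UNIV and A = "sets borel"])
      (auto simp: T_def positive_def)
  have "finite_measure T"
  proof
    have "emeasure (N i) UNIV \<noteq> \<infinity>" if "i \<in> I" for i
      using finite_measure.emeasure_finite[OF N(1)[OF that]] by auto
    moreover have "space T = UNIV" using sT sets_eq_imp_space_eq by fastforce
    ultimately show "emeasure T (space T) \<noteq> \<infinity>" using eT \<open>finite I\<close> by (simp add: top_unique)
  qed
  then show ?thesis using sT eT by blast
qed

lemma finite_measure_density:
  assumes T: "finite_measure T" and N: "finite_measure N" and s: "sets N = sets T"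
    and le: "\<And>A. A \<in> sets T \<Longrightarrow> emeasure N A \<le> emeasure T A"
  obtains d where "integrable T d" "\<And>x. 0 \<le> d x" "\<And>A. A \<in> sets T \<Longrightarrow> measure N A = (LINT x:A|T. d x)"
proof -
  interpret T: finite_measure T by fact
  interpret N: finite_measure N by fact
  have ac: "absolutely_continuous T N"
    unfolding absolutely_continuous_def null_sets_def using le s by force
  obtain D where D[measurable]: "D \<in> borel_measurable T" "AE x in T. RN_deriv T N x = ennreal (D x)" "\<And>x. 0 \<le> D x"
    using T.real_RN_deriv[OF N ac s] by metis
  have "N = density T (RN_deriv T N)" using T.density_RN_deriv[OF ac s] by simp
  also have "\<dots> = density T (\<lambda>x. ennreal (D x))" using D by (intro density_cong) auto
  finally have ND: "N = density T (\<lambda>x. ennreal (D x))" .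
  have nn: "(\<integral>\<^sup>+x\<in>A. ennreal (D x) \<partial>T) = emeasure N A" if "A \<in> sets T" for A
    using that by (subst ND) (simp add: emeasure_density)
  have I: "integrable T D"
  proof (rule integrableI_bounded)
    have "(\<integral>\<^sup>+x. ennreal (norm (D x)) \<partial>T) = (\<integral>\<^sup>+x\<in>space T. ennreal (D x) \<partial>T)"
      using D(3) by (intro nn_integral_cong) auto
    then show "(\<integral>\<^sup>+x. ennreal (norm (D x)) \<partial>T) < \<infinity>" unfolding nn[OF sets.top] using N.emeasure_finite by (simp add: less_top[symmetric])
  qed simp
  have "measure N A = (LINT x:A|T. D x)" if A: "A \<in> sets T" for A
  proof -
    have "ennreal (LINT x:A|T. D x) = (\<integral>\<^sup>+x. ennreal (indicator A x * D x) \<partial>T)"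
      unfolding set_lebesgue_integral_def using I D(3) A
      by (subst nn_integral_eq_integral) (auto intro!: integrable_real_mult_indicator simp: mult.commute)
    also have "\<dots> = emeasure N A"
      unfolding nn[OF A, symmetric] using D(3) by (intro nn_integral_cong) (auto simp: indicator_def)
    finally have "ennreal (LINT x:A|T. D x) = ennreal (measure N A)" by (simp add: N.emeasure_eq_measure)
    moreover have "0 \<le> (LINT x:A|T. D x)"
      unfolding set_lebesgue_integral_def using D(3) by (intro integral_nonneg_AE) auto
    ultimately show ?thesis by simp
  qed
  with I D(3) that show ?thesis by blast
qed

text \<open>Every vector measure has a density with respect to a finite positive one: take the sum of the
  positive and negative parts of all components, which dominates each of them, and apply the
  Radon-Nikodym theorem. All later work with vector measures goes through such a density.\<close>

theorem radon_representation:
  fixes \<mu> :: "'a::euclidean_space set \<Rightarrow> 'b::euclidean_space"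
  assumes \<mu>: "radon_vmeasure \<mu>"
  obtains T s where "finite_measure T" "sets T = sets borel" "integrable T s"
    "\<And>A. A \<in> sets borel \<Longrightarrow> \<mu> A = (LINT x:A|T. s x)"
proof -
  define \<nu> where "\<nu> = (\<lambda>p A. (snd p :: real) * (\<mu> A \<bullet> (fst p :: 'b)))"
  have \<nu>: "radon_vmeasure (\<nu> p)" for p
    unfolding \<nu>_def by (rule radon_bounded_linear[OF \<mu>])
      (intro bounded_linear_const_mult bounded_linear_inner_left)
  define I where "I = (Basis :: 'b set) \<times> {1, -1::real}"
  define N where "N p = positive_part (\<nu> p)" for p
  have N: "finite_measure (N p)" "sets (N p) = sets borel" for p
    using positive_part_finite[OF \<nu>] by (auto simp: N_def)
  have "finite I" by (simp add: I_def)
  obtain T where T: "finite_measure T" and sT: "sets T = sets borel"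
    and eT: "\<And>A. A \<in> sets borel \<Longrightarrow> emeasure T A = (\<Sum>i\<in>I. emeasure (N i) A)"
    using sum_measure_exists[OF \<open>finite I\<close>, of N] N by blast
  have "\<exists>d. integrable T d \<and> (\<forall>A\<in>sets borel. measure (N p) A = (LINT x:A|T. d x))" if "p \<in> I" for p
  proof -
    have "emeasure (N p) A \<le> emeasure T A" if "A \<in> sets T" for A
    proof -
      have "emeasure (N p) A \<le> (\<Sum>i\<in>I. emeasure (N i) A)"
        using \<open>p \<in> I\<close> \<open>finite I\<close> by (intro member_le_sum) auto
      also have "\<dots> = emeasure T A" using that eT unfolding sT by metis
      finally show ?thesis .
    qed
    then show ?thesis using finite_measure_density[OF T N(1), of p] N(2) sT by metis
  qed
  then obtain d where d: "\<And>p. p \<in> I \<Longrightarrow> integrable T (d p)" 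
    "\<And>p A. p \<in> I \<Longrightarrow> A \<in> sets borel \<Longrightarrow> measure (N p) A = (LINT x:A|T. d p x)" by metis
  define s where "s x = (\<Sum>b\<in>Basis. (d (b, 1) x - d (b, -1) x) *\<^sub>R b)" for x
  have sI: "integrable T s" unfolding s_def
    by (intro Bochner_Integration.integrable_sum integrable_scaleR_left Bochner_Integration.integrable_diff d)
      (simp_all add: I_def)
  have "\<mu> A = (LINT x:A|T. s x)" if A: "A \<in> sets borel" for A
  proof (rule euclidean_eqI)
    fix b :: 'b assume b: "b \<in> Basis"
    have i: "set_integrable T A (d p)" if "p \<in> I" for p
      using d(1)[OF that] A sT unfolding set_integrable_def by (intro integrable_mult_indicator) auto
    have "\<mu> A \<bullet> b = \<nu> (b, 1) A" by (simp add: \<nu>_def)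
    also have "\<dots> = measure (N (b, 1)) A - measure (N (b, -1)) A"
      using positive_part_diff[OF \<nu> A, of "(b, 1)"] by (simp add: N_def \<nu>_def)
    also have "\<dots> = (LINT x:A|T. d (b, 1) x - d (b, -1) x)"
      using d(2)[of _ A] A b i by (simp add: I_def set_integral_diff(2))
    also have "\<dots> = (LINT x:A|T. s x \<bullet> b)"
      using b by (simp add: s_def inner_sum_left inner_Basis if_distrib sum.delta cong: if_cong)
    also have "\<dots> = (LINT x:A|T. s x) \<bullet> b"
    proof -
      have "integrable T (\<lambda>x. indicator A x *\<^sub>R s x)" using A sT by (intro integrable_mult_indicator sI) auto
      then show ?thesis unfolding set_lebesgue_integral_def by (subst integral_inner_left[symmetric]) auto
    qed
    finally show "\<mu> A \<bullet> b = (LINT x:A|T. s x) \<bullet> b" .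
  qed
  then show ?thesis using that T sT sI by blast
qed

section \<open>Integrals and total variation of a vector measure\<close>

lemma set_integrable_borel:
  fixes f :: "'a::topological_space \<Rightarrow> 'b::{banach, second_countable_topology}"
  assumes "integrable M f" "sets M = sets borel" "A \<in> sets borel"
  shows "set_integrable M A f"
  unfolding set_integrable_def using assms by (intro integrable_mult_indicator) auto

lemma radon_density:
  fixes s :: "'a::euclidean_space \<Rightarrow> 'b::euclidean_space"
  assumes M: "sets M = sets borel" and s: "integrable M s"
  shows "radon_vmeasure (\<lambda>A. if A \<in> sets borel then (LINT x:A|M. s x) else 0)"
  unfolding radon_vmeasure_def
proof (intro conjI allI impI)
  fix A :: "nat \<Rightarrow> 'a set" assume A: "range A \<subseteq> sets borel \<and> disjoint_family A"
  have U: "(\<Union>i. A i) \<in> sets borel" using A by (intro sets.countable_UN) auto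
  have "(\<lambda>i. LINT x:A i|M. s x) sums (LINT x:(\<Union>i. A i)|M. s x)"
    unfolding sums_def
  proof -
    have "(\<lambda>n. \<integral>x. (\<Sum>i<n. indicator (A i) x *\<^sub>R s x) \<partial>M) \<longlonglongrightarrow> (\<integral>x. indicator (\<Union>i. A i) x *\<^sub>R s x \<partial>M)"
    proof (rule integral_dominated_convergence[where w = "\<lambda>x. norm (s x)"])
      have i: "(\<Sum>i<n. indicator (A i) x *\<^sub>R s x) = indicator (\<Union>i<n. A i) x *\<^sub>R s x" for n x
      proof -
        have "disjoint_family_on A {..<n}" using A by (auto simp: disjoint_family_on_def)
        then show ?thesis by (simp add: indicator_UN_disjoint scaleR_sum_left)
      qed
      show "(\<lambda>x. indicator (\<Union>i. A i) x *\<^sub>R s x) \<in> borel_measurable M"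
        using s U M by (intro borel_measurable_scaleR borel_measurable_indicator) auto
      show "(\<lambda>x. \<Sum>i<n. indicator (A i) x *\<^sub>R s x) \<in> borel_measurable M" for n
        using s A M by (intro borel_measurable_sum borel_measurable_scaleR borel_measurable_indicator) auto
      show "AE x in M. (\<lambda>n. \<Sum>i<n. indicator (A i) x *\<^sub>R s x) \<longlonglongrightarrow> indicator (\<Union>i. A i) x *\<^sub>R s x"
        unfolding i by (intro AE_I2 tendsto_scaleR tendsto_const LIMSEQ_indicator_UN)
      show "AE x in M. norm (\<Sum>i<n. indicator (A i) x *\<^sub>R s x) \<le> norm (s x)" for n
        unfolding i by (intro AE_I2) (simp add: indicator_def)
    qed (use s in auto)
    moreover have "(\<integral>x. (\<Sum>i<n. indicator (A i) x *\<^sub>R s x) \<partial>M) = (\<Sum>i<n. LINT x:A i|M. s x)" for n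
      unfolding set_lebesgue_integral_def
      using set_integrable_borel[OF s M] A
      by (intro Bochner_Integration.integral_sum) (auto simp: set_integrable_def)
    ultimately show "(\<lambda>n. \<Sum>i<n. LINT x:A i|M. s x) \<longlonglongrightarrow> (LINT x:(\<Union>i. A i)|M. s x)"
      by (simp add: set_lebesgue_integral_def)
  qed
  then show "(\<lambda>i. if A i \<in> sets borel then (LINT x:A i|M. s x) else 0) sums
      (if (\<Union>i. A i) \<in> sets borel then (LINT x:(\<Union>i. A i)|M. s x) else 0)"
    using A U by (simp add: image_subset_iff)
qed simp

lemma radon_add: "radon_vmeasure \<mu> \<Longrightarrow> radon_vmeasure \<nu> \<Longrightarrow> radon_vmeasure (\<lambda>A. \<mu> A + \<nu> A)"
  unfolding radon_vmeasure_def by (auto intro!: sums_add)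

lemma radon_zero: "radon_vmeasure (\<lambda>A. 0)"
  unfolding radon_vmeasure_def by auto

text \<open>The supremum that defines the positive part is attained at the part of the set where the density
  is nonnegative.\<close>

lemma positive_part_density:
  fixes r :: "'a::euclidean_space \<Rightarrow> real"
  assumes M: "sets M = sets borel" and r: "integrable M r"
    and \<mu>: "\<And>A. A \<in> sets borel \<Longrightarrow> \<mu> A = (LINT x:A|M. r x)"
  shows "positive_part \<mu> = density M (\<lambda>x. ennreal (max 0 (r x)))"
proof -
  let ?N = "density M (\<lambda>x. ennreal (max 0 (r x)))"
  have [measurable]: "r \<in> borel_measurable M" using r by auto
  note [measurable_cong] = M
  have sp: "space M = UNIV" using sets_eq_imp_space_eq[OF M] by simp
  have le: "ennreal (LINT x:B|M. r x) \<le> emeasure ?N A" if "B \<in> sets borel" "B \<subseteq> A" "A \<in> sets borel" for A B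
  proof -
    have BA: "B \<in> sets M" "A \<in> sets M" using that M by auto
    have mr: "integrable M (\<lambda>x. max 0 (r x))" by (rule integrable_max[OF integrable_zero r])
    have I: "integrable M (\<lambda>x. indicator B x * r x)" "integrable M (\<lambda>x. indicator A x * max 0 (r x))"
      using integrable_mult_indicator[OF BA(1) r] integrable_mult_indicator[OF BA(2) mr] by simp_all
    have "ennreal (LINT x:B|M. r x) \<le> ennreal (\<integral>x. indicator A x * max 0 (r x) \<partial>M)"
      unfolding set_lebesgue_integral_def real_scaleR_def using that(2)
      by (intro ennreal_leI integral_mono I) (auto simp: indicator_def)
    also have "\<dots> = (\<integral>\<^sup>+x. ennreal (indicator A x * max 0 (r x)) \<partial>M)"
      by (intro nn_integral_eq_integral[symmetric] I AE_I2) simp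
    also have "\<dots> = emeasure ?N A"
      using that M by (subst emeasure_density) (auto simp: indicator_def intro!: nn_integral_cong)
    finally show ?thesis .
  qed
  have eq: "(SUP B\<in>{B \<in> sets borel. B \<subseteq> A}. ennreal (\<mu> B)) = emeasure ?N A" if A: "A \<in> sets borel" for A
  proof (rule antisym)
    show "(SUP B\<in>{B \<in> sets borel. B \<subseteq> A}. ennreal (\<mu> B)) \<le> emeasure ?N A"
      using le[OF _ _ A] \<mu> by (intro SUP_least) auto
    let ?B = "A \<inter> {x. r x \<ge> 0}"
    have "{x \<in> space M. r x \<ge> 0} \<in> sets M" by measurable
    then have B: "?B \<in> sets borel" using A M sp by auto
    have "emeasure ?N A = (\<integral>\<^sup>+x. ennreal (indicator ?B x * r x) \<partial>M)"
      using A M by (subst emeasure_density) (auto simp: indicator_def max_def intro!: nn_integral_cong)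
    also have "\<dots> = ennreal (\<integral>x. indicator ?B x * r x \<partial>M)"
      using integrable_mult_indicator[of ?B M r] r B M
      by (intro nn_integral_eq_integral) (auto simp: indicator_def)
    also have "\<dots> = ennreal (\<mu> ?B)" using \<mu>[OF B] by (simp add: set_lebesgue_integral_def)
    also have "\<dots> \<le> (SUP B\<in>{B \<in> sets borel. B \<subseteq> A}. ennreal (\<mu> B))" using B by (intro SUP_upper) auto
    finally show "emeasure ?N A \<le> (SUP B\<in>{B \<in> sets borel. B \<subseteq> A}. ennreal (\<mu> B))" .
  qed
  have "positive_part \<mu> = measure_of UNIV (sets borel) (emeasure ?N)"
    unfolding positive_part_def
    by (rule measure_of_eq) (use eq in \<open>auto simp: sets.sigma_sets_eq[of borel, simplified]\<close>)
  also have "\<dots> = ?N" using measure_of_of_measure[of ?N] M sp by simp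
  finally show ?thesis .
qed

text \<open>This evaluates the integral against a signed measure by an ordinary integral, whatever dominating
  measure its density refers to.\<close>

lemma signed_integral_density:
  fixes r :: "'a::euclidean_space \<Rightarrow> real"
  assumes M: "sets M = sets borel" and r: "integrable M r"
    and \<mu>: "\<And>A. A \<in> sets borel \<Longrightarrow> \<mu> A = (LINT x:A|M. r x)"
    and f: "f \<in> borel_measurable borel" "\<And>x. \<bar>f x\<bar> \<le> C"
  shows "signed_integral \<mu> f = (\<integral>x. f x * r x \<partial>M)"
proof -
  note [measurable_cong] = M and [measurable] = f(1)
  have [measurable]: "r \<in> borel_measurable M" using r by auto
  have "- \<mu> A = (LINT x:A|M. - r x)" if "A \<in> sets borel" for A
    using \<mu>[OF that] by (simp add: set_lebesgue_integral_def)
  then have neg: "positive_part (\<lambda>A. - \<mu> A) = density M (\<lambda>x. ennreal (max 0 (- r x)))"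
    using r by (intro positive_part_density[OF M]) auto
  have i: "integrable M (\<lambda>x. f x * max 0 (r x))" "integrable M (\<lambda>x. f x * max 0 (- r x))"
  proof -
    have [measurable]: "f \<in> borel_measurable M" using f(1) M measurable_cong_sets by blast
    show "integrable M (\<lambda>x. f x * max 0 (r x))" "integrable M (\<lambda>x. f x * max 0 (- r x))"
      using integrable_scaleR_bounded[of M "\<lambda>x. max 0 (r x)" f C]
        integrable_scaleR_bounded[of M "\<lambda>x. max 0 (- r x)" f C] f(2) r by auto
  qed
  have "signed_integral \<mu> f = (\<integral>x. max 0 (r x) * f x \<partial>M) - (\<integral>x. max 0 (- r x) * f x \<partial>M)"
    unfolding signed_integral_def neg positive_part_density[of M r \<mu>, OF M r \<mu>, simplified]
    by (simp add: integral_density)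
  also have "\<dots> = (\<integral>x. f x * max 0 (r x) - f x * max 0 (- r x) \<partial>M)"
    using i by (simp add: mult.commute)
  also have "\<dots> = (\<integral>x. f x * r x \<partial>M)"
    by (intro Bochner_Integration.integral_cong) (auto simp: max_def)
  finally show ?thesis .
qed

lemma radon_Pair:
  assumes \<mu>: "radon_vmeasure \<mu>" and \<nu>: "radon_vmeasure \<nu>"
  shows "radon_vmeasure (\<lambda>A. (\<mu> A, \<nu> A))"
proof -
  have "radon_vmeasure (\<lambda>A. (\<mu> A, 0) + (0, \<nu> A))"
  proof (rule radon_add)
    show "radon_vmeasure (\<lambda>A. (\<mu> A, 0))"
      by (rule radon_bounded_linear[OF \<mu>]) (intro bounded_linear_Pair bounded_linear_ident bounded_linear_zero)
    show "radon_vmeasure (\<lambda>A. (0, \<nu> A))"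
      by (rule radon_bounded_linear[OF \<nu>]) (intro bounded_linear_Pair bounded_linear_ident bounded_linear_zero)
  qed
  then show ?thesis by simp
qed

lemma set_integral_bounded_linear:
  fixes s :: "'a::euclidean_space \<Rightarrow> 'b::euclidean_space" and h :: "'b \<Rightarrow> 'c::euclidean_space"
  assumes h: "bounded_linear h" and M: "sets M = sets borel" and s: "integrable M s" and A: "A \<in> sets borel"
  shows "h (LINT x:A|M. s x) = (LINT x:A|M. h (s x))"
proof -
  interpret h: bounded_linear h by fact
  have I: "integrable M (\<lambda>x. indicator A x *\<^sub>R s x)"
    using set_integrable_borel[OF s M A] by (simp add: set_integrable_def)
  show ?thesis
    using integral_bounded_linear[OF h I] by (simp add: set_lebesgue_integral_def h.scaleR)
qed

text \<open>Representing the pair as one vector measure gives both measures densities with respect to the same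
  \<open>T\<close>, so that they can be added and compared pointwise.\<close>

lemma radon_common_representation:
  fixes \<mu> :: "'a::euclidean_space set \<Rightarrow> 'b::euclidean_space" and \<nu> :: "'a set \<Rightarrow> 'c::euclidean_space"
  assumes \<mu>: "radon_vmeasure \<mu>" and \<nu>: "radon_vmeasure \<nu>"
  obtains T a b where "finite_measure T" "sets T = sets borel" "integrable T a" "integrable T b"
    "\<And>A. A \<in> sets borel \<Longrightarrow> \<mu> A = (LINT x:A|T. a x)" "\<And>A. A \<in> sets borel \<Longrightarrow> \<nu> A = (LINT x:A|T. b x)"
proof -
  obtain T s where T: "finite_measure T" "sets T = sets borel" and s: "integrable T s"
    and rep: "\<And>A. A \<in> sets borel \<Longrightarrow> (\<mu> A, \<nu> A) = (LINT x:A|T. s x)"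
    using radon_representation[OF radon_Pair[OF \<mu> \<nu>]] by metis
  have i: "integrable T (\<lambda>x. fst (s x))" "integrable T (\<lambda>x. snd (s x))"
    by (rule integrable_bounded_linear[OF bounded_linear_fst s], rule integrable_bounded_linear[OF bounded_linear_snd s])
  have "\<mu> A = (LINT x:A|T. fst (s x))" "\<nu> A = (LINT x:A|T. snd (s x))" if A: "A \<in> sets borel" for A
  proof -
    have "\<mu> A = fst (LINT x:A|T. s x)" "\<nu> A = snd (LINT x:A|T. s x)" by (simp_all flip: rep[OF A])
    then show "\<mu> A = (LINT x:A|T. fst (s x))" "\<nu> A = (LINT x:A|T. snd (s x))"
      using set_integral_bounded_linear[OF bounded_linear_fst T(2) s A] set_integral_bounded_linear[OF bounded_linear_snd T(2) s A]
      by simp_all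
  qed
  then show ?thesis by (rule that[OF T i])
qed

lemma signed_integral_add:
  fixes \<mu> \<nu> :: "'a::euclidean_space set \<Rightarrow> real"
  assumes \<mu>: "radon_vmeasure \<mu>" and \<nu>: "radon_vmeasure \<nu>"
    and f: "f \<in> borel_measurable borel" "\<And>x. \<bar>f x\<bar> \<le> C"
  shows "signed_integral (\<lambda>A. \<mu> A + \<nu> A) f = signed_integral \<mu> f + signed_integral \<nu> f"
proof -
  obtain T p q where T: "finite_measure T" "sets T = sets borel" and i: "integrable T p" "integrable T q"
    and m: "\<And>A. A \<in> sets borel \<Longrightarrow> \<mu> A = (LINT x:A|T. p x)" "\<And>A. A \<in> sets borel \<Longrightarrow> \<nu> A = (LINT x:A|T. q x)"
    using radon_common_representation[OF \<mu> \<nu>] by metis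
  have a: "\<mu> A + \<nu> A = (LINT x:A|T. p x + q x)" if A: "A \<in> sets borel" for A
    using m[OF A] set_integrable_borel[OF i(1) T(2) A] set_integrable_borel[OF i(2) T(2) A] by simp
  have ib: "integrable T (\<lambda>x. f x * g x)" if "integrable T g" for g :: "'a \<Rightarrow> real"
  proof -
    have "f \<in> borel_measurable T" using f(1) T(2) measurable_cong_sets by blast
    then show ?thesis using integrable_scaleR_bounded[OF that _ f(2)] by simp
  qed
  show ?thesis
    using signed_integral_density[OF T(2) i(1) m(1) f] signed_integral_density[OF T(2) i(2) m(2) f]
      signed_integral_density[OF T(2) Bochner_Integration.integrable_add[OF i] a f] ib[OF i(1)] ib[OF i(2)]
    by (simp add: distrib_left)
qed

text \<open>For the lower bound the set is partitioned according to the value of \<open>s\<close>: on a part where \<open>s\<close> stays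
  within \<open>d\<close> of a constant, the norm of the integral of \<open>s\<close> differs from the integral of the norm by at
  most \<open>2 d\<close> times the mass of the part.\<close>

lemma total_variation_density:
  fixes s :: "'a::euclidean_space \<Rightarrow> 'b::euclidean_space"
  assumes T: "finite_measure T" and sT: "sets T = sets borel" and s: "integrable T s"
    and \<mu>: "\<And>A. A \<in> sets borel \<Longrightarrow> \<mu> A = (LINT x:A|T. s x)" and A: "A \<in> sets borel"
  shows "total_variation \<mu> A = (\<integral>\<^sup>+x\<in>A. ennreal (norm (s x)) \<partial>T)"
proof -
  interpret T: finite_measure T by fact
  note [measurable_cong] = sT
  have [measurable]: "s \<in> borel_measurable T" using s by auto
  have sp: "space T = UNIV" using sets_eq_imp_space_eq[OF sT] by simp
  define V where "V = density T (\<lambda>x. ennreal (norm (s x)))"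
  have V: "emeasure V B = (\<integral>\<^sup>+x\<in>B. ennreal (norm (s x)) \<partial>T)" if "B \<in> sets borel" for B
    using that sT by (simp add: V_def emeasure_density)
  have sV: "sets V = sets borel" by (simp add: V_def sT)
  have le1: "ennreal (norm (\<mu> B)) \<le> emeasure V B" if B: "B \<in> sets borel" for B
  proof -
    have i: "integrable T (\<lambda>x. indicator B x *\<^sub>R s x)"
      using set_integrable_borel[OF s sT B] by (simp add: set_integrable_def)
    have "ennreal (norm (\<mu> B)) \<le> (\<integral>\<^sup>+x. ennreal (norm (indicator B x *\<^sub>R s x)) \<partial>T)"
      unfolding \<mu>[OF B] set_lebesgue_integral_def by (rule integral_norm_bound_ennreal[OF i])
    also have "\<dots> = emeasure V B"
      unfolding V[OF B] by (intro nn_integral_cong) (simp add: indicator_def)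
    finally show ?thesis .
  qed
  have "total_variation \<mu> A \<le> emeasure V A"
    unfolding total_variation_def
  proof (rule SUP_least)
    fix B :: "nat \<Rightarrow> 'a set" assume B: "B \<in> {B. range B \<subseteq> sets borel \<and> disjoint_family B \<and> (\<Union>i. B i) = A}"
    have "(\<Sum>i. ennreal (norm (\<mu> (B i)))) \<le> (\<Sum>i. emeasure V (B i))"
      using B by (intro suminf_le le1 summableI) auto
    also have "\<dots> = emeasure V A" using B sV by (subst suminf_emeasure) auto
    finally show "(\<Sum>i. ennreal (norm (\<mu> (B i)))) \<le> emeasure V A" .
  qed
  moreover have "emeasure V A \<le> total_variation \<mu> A"
  proof (rule ennreal_le_epsilon)
    fix e :: real assume e: "0 < e"
    define m where "m = measure T UNIV"
    have m: "0 \<le> m" by (simp add: m_def)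
    define d where "d = e / (2 * (m + 1))"
    have d: "d > 0" using e m by (simp add: d_def)
    have dm: "2 * d * m \<le> e" using e m by (simp add: d_def divide_simps)
    \<comment> \<open>the parts are the preimages of balls of radius \<open>d\<close> around a countable dense set\<close>
    obtain D :: "'b set" where D: "countable D" "\<And>X. open X \<Longrightarrow> X \<noteq> {} \<Longrightarrow> \<exists>d\<in>D. d \<in> X"
      using countable_dense_setE by blast
    have Dne: "D \<noteq> {}" using D(2)[of UNIV] by auto
    define c where "c = from_nat_into D"
    have cov: "\<exists>i. norm (y - c i) < d" for y
    proof -
      obtain z where "z \<in> D" "z \<in> ball y d" using D(2)[of "ball y d"] d by auto
      then show ?thesis using from_nat_into_surj[OF D(1), of z] by (auto simp: c_def dist_norm)
    qed
    define Q where "Q i = {x. norm (s x - c i) < d}" for i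
    have Q: "Q i \<in> sets borel" for i
    proof -
      have "{x \<in> space T. norm (s x - c i) < d} \<in> sets T" by measurable
      then show ?thesis by (simp add: Q_def sp sT)
    qed
    define B where "B i = A \<inter> disjointed Q i" for i
    have Bs: "B i \<in> sets borel" for i
      using A Q sets.range_disjointed_sets[of Q borel] by (auto simp: B_def image_subset_iff)
    have Bd: "disjoint_family B" using disjoint_family_disjointed[of Q] by (auto simp: B_def disjoint_family_on_def)
    have BU: "(\<Union>i. B i) = A"
    proof -
      have "(\<Union>i. Q i) = UNIV" using cov by (auto simp: Q_def)
      then show ?thesis unfolding B_def Int_UN_distrib[symmetric] UN_disjointed_eq by simp
    qed
    have est: "emeasure V (B i) \<le> ennreal (norm (\<mu> (B i))) + ennreal (2 * d) * emeasure T (B i)" for i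
    proof -
      have near: "norm (s x - c i) \<le> d" if "x \<in> B i" for x
        using that disjointed_subset[of Q i] by (auto simp: B_def Q_def less_imp_le)
      have iB: "integrable T (\<lambda>x. indicator (B i) x *\<^sub>R s x)"
        using set_integrable_borel[OF s sT Bs] by (simp add: set_integrable_def)
      have ind: "integrable T (indicator (B i) :: 'a \<Rightarrow> real)"
        using Bs[of i] sT by (intro integrable_real_indicator) (auto simp: T.emeasure_eq_measure)
      have ii: "integrable T (\<lambda>x. indicator (B i) x *\<^sub>R z)" for z :: 'b
        by (intro integrable_scaleR_left ind)
      have mi: "(\<integral>x. indicator (B i) x \<partial>T) = measure T (B i)" using Bs[of i] sT by (simp add: sp)
      have mB: "(\<integral>x. indicator (B i) x *\<^sub>R z \<partial>T) = measure T (B i) *\<^sub>R z" for z :: 'b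
        by (subst integral_scaleR_left[OF ind]) (simp add: sp)
      have "norm (measure T (B i) *\<^sub>R c i - \<mu> (B i)) = norm (\<integral>x. indicator (B i) x *\<^sub>R c i - indicator (B i) x *\<^sub>R s x \<partial>T)"
        unfolding \<mu>[OF Bs] set_lebesgue_integral_def mB[symmetric] using iB ii by simp
      also have "\<dots> \<le> (\<integral>x. norm (indicator (B i) x *\<^sub>R c i - indicator (B i) x *\<^sub>R s x) \<partial>T)"
        by (rule integral_norm_bound)
      also have "\<dots> \<le> (\<integral>x. indicator (B i) x *\<^sub>R d \<partial>T)"
      proof (rule integral_mono)
        show "integrable T (\<lambda>x. norm (indicator (B i) x *\<^sub>R c i - indicator (B i) x *\<^sub>R s x))" using iB ii by auto
        show "integrable T (\<lambda>x. indicator (B i) x *\<^sub>R d)" by (intro integrable_scaleR_left ind)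
        show "norm (indicator (B i) x *\<^sub>R c i - indicator (B i) x *\<^sub>R s x) \<le> indicator (B i) x *\<^sub>R d" for x
          using near[of x] by (simp add: indicator_def norm_minus_commute)
      qed
      also have "\<dots> = measure T (B i) * d" by (subst integral_scaleR_left[OF ind]) (simp add: sp)
      finally have 1: "measure T (B i) * norm (c i) \<le> norm (\<mu> (B i)) + measure T (B i) * d"
        using norm_triangle_ineq2[of "measure T (B i) *\<^sub>R c i" "\<mu> (B i)"] by simp
      have "emeasure V (B i) \<le> (\<integral>\<^sup>+x. ennreal (norm (c i) + d) * indicator (B i) x \<partial>T)"
        unfolding V[OF Bs]
      proof (intro nn_integral_mono)
        fix x
        show "ennreal (norm (s x)) * indicator (B i) x \<le> ennreal (norm (c i) + d) * indicator (B i) x"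
          using near[of x] norm_triangle_ineq2[of "s x" "c i"] by (auto simp: indicator_def intro!: ennreal_leI)
      qed
      also have "\<dots> = ennreal (norm (c i) + d) * ennreal (measure T (B i))"
        using Bs[of i] sT by (simp add: nn_integral_cmult_indicator T.emeasure_eq_measure)
      also have "\<dots> = ennreal (measure T (B i) * norm (c i) + measure T (B i) * d)"
        using d by (simp add: ennreal_mult[symmetric] algebra_simps)
      also have "\<dots> \<le> ennreal (norm (\<mu> (B i)) + 2 * d * measure T (B i))"
        using 1 by (intro ennreal_leI) (simp add: algebra_simps)
      also have "\<dots> = ennreal (norm (\<mu> (B i))) + ennreal (2 * d) * emeasure T (B i)"
        using d by (simp add: T.emeasure_eq_measure ennreal_mult)
      finally show ?thesis .
    qed
    have "emeasure V A = (\<Sum>i. emeasure V (B i))"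
      using suminf_emeasure[of B V] Bs Bd sV BU by (simp add: image_subset_iff)
    also have "\<dots> \<le> (\<Sum>i. ennreal (norm (\<mu> (B i))) + ennreal (2 * d) * emeasure T (B i))"
      by (intro suminf_le est summableI)
    also have "\<dots> = (\<Sum>i. ennreal (norm (\<mu> (B i)))) + ennreal (2 * d) * (\<Sum>i. emeasure T (B i))"
      by (simp add: suminf_add[symmetric] ennreal_suminf_cmult)
    also have "(\<Sum>i. emeasure T (B i)) = emeasure T A"
      using suminf_emeasure[of B T] Bs Bd sT BU by (simp add: image_subset_iff)
    also have "(\<Sum>i. ennreal (norm (\<mu> (B i)))) \<le> total_variation \<mu> A"
      unfolding total_variation_def using Bs Bd BU by (intro SUP_upper) auto
    also have "ennreal (2 * d) * emeasure T A \<le> ennreal e"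
    proof -
      have "measure T A \<le> m" unfolding m_def using T.bounded_measure[of A] sp by simp
      then have "2 * d * measure T A \<le> e" using dm d mult_left_mono[of "measure T A" m "2 * d"] by linarith
      then show ?thesis using d by (simp add: T.emeasure_eq_measure ennreal_mult[symmetric] ennreal_leI)
    qed
    finally show "emeasure V A \<le> total_variation \<mu> A + ennreal e" by (simp add: add_mono)
  qed
  ultimately show ?thesis using V[OF A] by simp
qed

section \<open>The Lebesgue decomposition\<close>

text \<open>A Lebesgue null set of maximal \<open>T\<close>-measure has this property: a null set of positive \<open>T\<close>-measure
  outside it could be added to it. The maximum exists because a countable union of null sets is null.\<close>

lemma null_part_exists:
  fixes T :: "'a::euclidean_space measure"
  assumes T: "finite_measure T" and sT: "sets T = sets borel"
  obtains N where "N \<in> null_sets lborel" "N \<in> sets borel"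
    "\<And>A. A \<in> null_sets lborel \<Longrightarrow> emeasure T (A - N) = 0"
proof -
  interpret T: finite_measure T by fact
  let ?Z = "null_sets lborel :: 'a set set"
  have Zb: "A \<in> sets T" if "A \<in> ?Z" for A using that sT by (auto simp: null_sets_def)
  have "?Z \<noteq> {}" by blast
  then obtain f where f: "range f \<subseteq> emeasure T ` ?Z" "(SUP A\<in>?Z. emeasure T A) = (SUP i::nat. f i)"
    using ennreal_Sup_countable_SUP[of "emeasure T ` ?Z"] by auto
  then have "\<forall>i. \<exists>A\<in>?Z. f i = emeasure T A" by (meson image_iff range_subsetD)
  then obtain A where A: "\<And>i. A i \<in> ?Z" "\<And>i. f i = emeasure T (A i)" by metis
  define N where "N = (\<Union>i. A i)"
  have N: "N \<in> ?Z" unfolding N_def using A by (intro null_sets_UN) auto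
  have "f i \<le> emeasure T N" for i
    unfolding A(2) using Zb[OF N] by (intro emeasure_mono) (auto simp: N_def)
  then have sup: "(SUP A\<in>?Z. emeasure T A) \<le> emeasure T N" unfolding f(2) by (intro SUP_least)
  have "emeasure T (B - N) = 0" if B: "B \<in> ?Z" for B
  proof -
    have "N \<union> B \<in> ?Z" using N B by (rule null_sets.Un)
    then have "emeasure T (N \<union> B) \<le> emeasure T N" using sup by (meson SUP_upper order_trans)
    moreover have "emeasure T (N \<union> B) = emeasure T N + emeasure T (B - N)"
    proof -
      have "N \<union> (B - N) = N \<union> B" by blast
      then show ?thesis using plus_emeasure[of N T "B - N"] Zb[OF N] Zb[OF B] by auto
    qed
    ultimately show ?thesis by (simp add: T.emeasure_eq_measure ennreal_plus[symmetric] measure_nonneg del: ennreal_plus)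
      (metis add_le_same_cancel1 antisym ennreal_0 measure_nonneg)
  qed
  then show ?thesis using that[of N] N sT Zb[OF N] by auto
qed

text \<open>The Lebesgue decomposition in terms of densities. Removing a maximal null set leaves an absolutely
  continuous measure, to which the Radon-Nikodym theorem applies. The singular part is represented by
  a density that vanishes identically off the null set \<open>N\<close>.\<close>

lemma radon_structure:
  fixes \<mu> :: "'a::euclidean_space set \<Rightarrow> 'b::euclidean_space"
  assumes \<mu>: "radon_vmeasure \<mu>"
  obtains T s f N where "finite_measure T" "sets T = sets borel" "integrable T s"
    "integrable lborel f" "N \<in> null_sets lborel" "N \<in> sets borel" "\<And>x. x \<notin> N \<Longrightarrow> s x = 0"
    "\<And>A. A \<in> sets borel \<Longrightarrow> \<mu> A = (LINT x:A|lborel. f x) + (LINT x:A|T. s x)"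
proof -
  obtain T r where T: "finite_measure T" and sT: "sets T = sets borel" and r: "integrable T r"
    and \<mu>r: "\<And>A. A \<in> sets borel \<Longrightarrow> \<mu> A = (LINT x:A|T. r x)"
    using radon_representation[OF \<mu>] by metis
  interpret T: finite_measure T by fact
  note [measurable_cong] = sT
  have rm[measurable]: "r \<in> borel_measurable T" using r by auto
  have sp: "space T = UNIV" using sets_eq_imp_space_eq[OF sT] by simp
  obtain N where N: "N \<in> null_sets lborel" "N \<in> sets borel"
    and nN: "\<And>A. A \<in> null_sets lborel \<Longrightarrow> emeasure T (A - N) = 0"
    using null_part_exists[OF T sT] by metis
  have Nm[measurable]: "N \<in> sets T" using N sT by simp
  have cN[measurable]: "- N \<in> sets T" using N sT by (simp add: borel_comp)
  define T1 where "T1 = density T (indicator (- N))"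
  have sT1: "sets T1 = sets lborel" by (simp add: T1_def sT)
  have eT1: "emeasure T1 A = emeasure T (A - N)" if "A \<in> sets borel" for A
    using that sT Nm by (simp add: T1_def emeasure_density Diff_eq Int_commute indicator_inter_arith[symmetric] mult.commute)
  interpret T1: finite_measure T1
    by standard (simp add: eT1 sp T1_def[THEN arg_cong[where f = space]] T.emeasure_eq_measure)
  have ac: "absolutely_continuous lborel T1"
    unfolding absolutely_continuous_def
  proof
    fix A :: "'a set" assume A: "A \<in> null_sets lborel"
    then have "A \<in> sets borel" by (auto simp: null_sets_def)
    then show "A \<in> null_sets T1" using eT1 nN[OF A] sT1 by (auto simp: null_sets_def)
  qed
  obtain h' where h': "h' \<in> borel_measurable lborel" "density lborel h' = T1"
    using sigma_finite_measure.Radon_Nikodym[OF lborel.sigma_finite_measure_axioms ac sT1] by blast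
  have "(\<integral>\<^sup>+x. h' x \<partial>lborel) = emeasure T1 UNIV"
    unfolding h'(2)[symmetric] using h'(1) by (subst emeasure_density) auto
  also have "\<dots> < \<infinity>" using T1.emeasure_finite by (simp add: less_top[symmetric])
  finally have "AE x in lborel. h' x \<noteq> \<infinity>"
    by (intro nn_integral_noteq_infinite h') auto
  then have h1: "AE x in lborel. h' x = ennreal (enn2real (h' x))" by eventually_elim (simp add: less_top)
  define h where "h x = enn2real (h' x)" for x
  have h[measurable]: "h \<in> borel_measurable lborel" unfolding h_def[abs_def] using h'(1) by measurable
  have h0: "0 \<le> h x" for x by (simp add: h_def)
  have T1h: "T1 = density lborel (\<lambda>x. ennreal (h x))"
    unfolding h'(2)[symmetric] using h'(1) h1 h by (intro density_cong) (auto simp: h_def[abs_def])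
  have r1: "integrable T (\<lambda>x. indicator (- N) x *\<^sub>R r x)"
    using cN r by (intro integrable_mult_indicator) auto
  have rb: "r \<in> borel_measurable borel" using rm measurable_cong_sets[OF sT refl] by blast
  have T1r: "T1 = density T (\<lambda>x. ennreal (indicator (- N) x))"
    unfolding T1_def by (simp add: ennreal_indicator)
  have rT1: "integrable T1 r"
    unfolding T1r by (subst integrable_density) (use r1 in auto)
  then have f: "integrable lborel (\<lambda>x. h x *\<^sub>R r x)"
    unfolding T1h by (subst (asm) integrable_density) (use h0 rb in auto)
  have s: "integrable T (\<lambda>x. indicator N x *\<^sub>R r x)"
    using Nm r by (intro integrable_mult_indicator) auto
  show ?thesis
  proof (rule that[OF T sT s f N])
    fix A :: "'a set" assume A: "A \<in> sets borel"
    have AT: "A \<in> sets T" using A sT by simp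
    have Ar: "(\<lambda>x. indicator A x *\<^sub>R r x) \<in> borel_measurable borel"
      using A rb by (intro borel_measurable_scaleR borel_measurable_indicator) auto
    have ArT: "(\<lambda>x. indicator A x *\<^sub>R r x) \<in> borel_measurable T"
      using Ar measurable_cong_sets[OF sT refl] by blast
    have "(LINT x:A|lborel. h x *\<^sub>R r x) = (\<integral>x. h x *\<^sub>R (indicator A x *\<^sub>R r x) \<partial>lborel)"
      by (simp add: set_lebesgue_integral_def mult.commute)
    also have "\<dots> = (\<integral>x. indicator A x *\<^sub>R r x \<partial>T1)"
      unfolding T1h by (rule integral_density[symmetric]) (use Ar h0 in auto)
    also have "\<dots> = (\<integral>x. indicator (- N) x *\<^sub>R (indicator A x *\<^sub>R r x) \<partial>T)"
      unfolding T1r by (rule integral_density) (use ArT cN in auto)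
    finally have 1: "(LINT x:A|lborel. h x *\<^sub>R r x) = (\<integral>x. indicator (- N) x *\<^sub>R (indicator A x *\<^sub>R r x) \<partial>T)" .
    have i: "integrable T (\<lambda>x. indicator A x *\<^sub>R r x)"
      using AT r by (intro integrable_mult_indicator)
    have "\<mu> A = (\<integral>x. indicator (- N) x *\<^sub>R (indicator A x *\<^sub>R r x) + indicator N x *\<^sub>R (indicator A x *\<^sub>R r x) \<partial>T)"
      unfolding \<mu>r[OF A] set_lebesgue_integral_def
      by (intro Bochner_Integration.integral_cong) (auto simp: indicator_def)
    also have "\<dots> = (\<integral>x. indicator (- N) x *\<^sub>R (indicator A x *\<^sub>R r x) \<partial>T) + (\<integral>x. indicator N x *\<^sub>R (indicator A x *\<^sub>R r x) \<partial>T)"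
      using Nm by (intro Bochner_Integration.integral_add integrable_mult_indicator i) auto
    also have "(\<integral>x. indicator N x *\<^sub>R (indicator A x *\<^sub>R r x) \<partial>T) = (LINT x:A|T. indicator N x *\<^sub>R r x)"
      by (simp add: set_lebesgue_integral_def mult.commute)
    finally show "\<mu> A = (LINT x:A|lborel. h x *\<^sub>R r x) + (LINT x:A|T. indicator N x *\<^sub>R r x)"
      unfolding 1 .
  qed simp
qed

lemma set_integral_lebesgue_lborel:
  fixes f :: "'a::euclidean_space \<Rightarrow> 'b::euclidean_space"
  assumes "f \<in> borel_measurable borel" "A \<in> sets borel"
  shows "(LINT x:A|lebesgue. f x) = (LINT x:A|lborel. f x)"
  unfolding set_lebesgue_integral_def
  by (rule integral_completion) (use assms in \<open>auto intro!: borel_measurable_scaleR borel_measurable_indicator\<close>)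

lemma total_variation_zero_imp:
  fixes \<sigma> :: "'a::euclidean_space set \<Rightarrow> 'b::euclidean_space"
  assumes \<sigma>: "radon_vmeasure \<sigma>" and tv: "total_variation \<sigma> C = 0" and B: "B \<in> sets borel" "B \<subseteq> C" "C \<in> sets borel"
  shows "\<sigma> B = 0"
proof -
  have "(\<Sum>i. ennreal (norm (\<sigma> (binaryset B (C - B) i)))) \<le> total_variation \<sigma> C"
    unfolding total_variation_def
    using B by (intro SUP_upper) (auto simp: binaryset_def disjoint_family_on_def UN_binaryset_eq split: if_splits)
  then have "(\<Sum>i. ennreal (norm (\<sigma> (binaryset B (C - B) i)))) = 0" using tv by simp
  then have "ennreal (norm (\<sigma> (binaryset B (C - B) 0))) = 0"
    by (subst (asm) suminf_eq_zero_iff) (auto intro: summableI)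
  then show ?thesis by (simp add: binaryset_def)
qed

lemma lebesgue_decomposition_density:
  fixes \<mu> :: "'a::euclidean_space set \<Rightarrow> 'b::euclidean_space"
  assumes T: "finite_measure T" and sT: "sets T = sets borel" and s: "integrable T s"
    and f: "integrable lborel f" and N: "N \<in> null_sets lborel" "N \<in> sets borel" "\<And>x. x \<notin> N \<Longrightarrow> s x = 0"
    and \<mu>: "\<And>A. A \<in> sets borel \<Longrightarrow> \<mu> A = (LINT x:A|lborel. f x) + (LINT x:A|T. s x)"
  shows "lebesgue_decomposition \<mu> f (\<lambda>A. if A \<in> sets borel then (LINT x:A|T. s x) else 0)"
    (is "lebesgue_decomposition \<mu> f ?\<sigma>")
  unfolding lebesgue_decomposition_def
proof (intro conjI ballI)
  have fm: "f \<in> borel_measurable borel" using f by auto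
  show "integrable lebesgue f" using f fm by (subst integrable_completion) auto
  show "radon_vmeasure ?\<sigma>" by (rule radon_density[OF sT s])
  have "total_variation ?\<sigma> (- N) = (\<integral>\<^sup>+x\<in>-N. ennreal (norm (s x)) \<partial>T)"
    by (rule total_variation_density[OF T sT s]) (use N in auto)
  also have "\<dots> = (\<integral>\<^sup>+x. 0 \<partial>T)" using N(3) by (intro nn_integral_cong) (auto simp: indicator_def)
  finally have "total_variation ?\<sigma> (- N) = 0" by simp
  with N(1) show "\<exists>N\<in>null_sets lborel. total_variation ?\<sigma> (- N) = 0" by blast
  show "\<mu> A = (LINT x:A|lebesgue. f x) + ?\<sigma> A" if "A \<in> sets borel" for A
    using \<mu>[OF that] that set_integral_lebesgue_lborel[OF fm that] by simp
qed

lemma sigma_finite_lebesgue: "sigma_finite_measure (lebesgue :: 'a::euclidean_space measure)"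
proof
  have "(\<Union>n::nat. ball (0::'a) (real n)) = UNIV"
    using reals_Archimedean2 by (auto simp: dist_norm)
  moreover have "emeasure lebesgue (ball (0::'a) (real n)) \<noteq> \<infinity>" for n
    using emeasure_lborel_ball_finite[of "0::'a" "real n"] by (simp add: less_top)
  ultimately show "\<exists>A. countable A \<and> A \<subseteq> sets lebesgue \<and> \<Union> A = space lebesgue \<and> (\<forall>a\<in>A. emeasure (lebesgue :: 'a measure) a \<noteq> \<infinity>)"
    by (intro exI[of _ "range (\<lambda>n::nat. ball (0::'a) (real n))"]) auto
qed

text \<open>Both singular parts are carried by a common null set. Off this set the densities have equal
  integrals, and on it both absolutely continuous parts vanish.\<close>

lemma lebesgue_decomposition_unique:
  fixes \<mu> :: "'a::euclidean_space set \<Rightarrow> 'b::euclidean_space"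
  assumes 1: "lebesgue_decomposition \<mu> f \<sigma>" and 2: "lebesgue_decomposition \<mu> g \<tau>"
  shows "\<sigma> = \<tau>" "AE x in lebesgue. f x = g x"
proof -
  obtain N1 where N1: "N1 \<in> null_sets lborel" "total_variation \<sigma> (- N1) = 0"
    using 1 unfolding lebesgue_decomposition_def by blast
  obtain N2 where N2: "N2 \<in> null_sets lborel" "total_variation \<tau> (- N2) = 0"
    using 2 unfolding lebesgue_decomposition_def by blast
  have i: "integrable lebesgue f" "integrable lebesgue g" and r: "radon_vmeasure \<sigma>" "radon_vmeasure \<tau>"
    and \<mu>: "\<And>A. A \<in> sets borel \<Longrightarrow> \<mu> A = (LINT x:A|lebesgue. f x) + \<sigma> A"
      "\<And>A. A \<in> sets borel \<Longrightarrow> \<mu> A = (LINT x:A|lebesgue. g x) + \<tau> A"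
    using 1 2 unfolding lebesgue_decomposition_def by auto
  define N where "N = N1 \<union> N2"
  have N: "N \<in> null_sets lborel" using N1 N2 by (auto simp: N_def)
  have Nb: "N1 \<in> sets borel" "N2 \<in> sets borel" "N \<in> sets borel" using N1 N2 N by (auto simp: null_sets_def)
  have NL: "AE x in lebesgue. x \<notin> N" using N null_sets_completionI AE_not_in by blast
  have z: "\<sigma> B = 0" "\<tau> B = 0" if "B \<in> sets borel" "B \<subseteq> - N" for B
    using total_variation_zero_imp[OF r(1) N1(2)] total_variation_zero_imp[OF r(2) N2(2)] that Nb
    by (auto simp: N_def)
  have bl: "B \<in> sets lebesgue" if "B \<in> sets borel" for B :: "'a set" using that by (simp add: sets_completionI_sets)
  have off: "(LINT x:A|lebesgue. k x) = (LINT x:A - N|lebesgue. k x)" if A: "A \<in> sets borel" and k: "integrable lebesgue k" for A and k :: "'a \<Rightarrow> 'b"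
    unfolding set_lebesgue_integral_def
  proof (rule integral_cong_AE)
    show "(\<lambda>x. indicator A x *\<^sub>R k x) \<in> borel_measurable lebesgue" "(\<lambda>x. indicator (A - N) x *\<^sub>R k x) \<in> borel_measurable lebesgue"
      using A k Nb by (auto intro!: borel_measurable_scaleR borel_measurable_indicator bl)
    show "AE x in lebesgue. indicator A x *\<^sub>R k x = indicator (A - N) x *\<^sub>R k x"
      using NL by eventually_elim (simp add: indicator_def)
  qed
  have eqA: "(LINT x:A|lebesgue. f x) = (LINT x:A|lebesgue. g x)" if A: "A \<in> sets borel" for A
  proof -
    have AN: "A - N \<in> sets borel" using A Nb by auto
    then have "(LINT x:A - N|lebesgue. f x) = (LINT x:A - N|lebesgue. g x)"
      using \<mu>[OF AN] z[OF AN] by (simp add: Diff_eq)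
    then show ?thesis using off[OF A i(1)] off[OF A i(2)] by simp
  qed
  show "\<sigma> = \<tau>"
  proof (rule radon_eqI[OF r])
    fix A :: "'a set" assume "A \<in> sets borel" then show "\<sigma> A = \<tau> A" using \<mu> eqA by force
  qed
  have "AE x in lebesgue. f x = g x"
  proof (rule sigma_finite_measure.density_unique_banach[OF sigma_finite_lebesgue i])
    fix A :: "'a set" assume A: "A \<in> sets lebesgue"
    obtain B where B: "B \<in> sets borel" "AE x in lebesgue. x \<in> A \<longleftrightarrow> x \<in> B"
    proof -
      obtain S N N' where SN: "A = S \<union> N" "S \<in> sets lborel" "N \<subseteq> N'" "N' \<in> null_sets lborel"
        using A by (rule sets_completionE) auto
      have "AE x in lebesgue. x \<notin> N'" using SN(4) null_sets_completionI AE_not_in by blast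
      then have "AE x in lebesgue. x \<in> A \<longleftrightarrow> x \<in> S" by eventually_elim (use SN in auto)
      then show ?thesis using that SN(2) by auto
    qed
    have "(LINT x:A|lebesgue. k x) = (LINT x:B|lebesgue. k x)" if k: "integrable lebesgue k" for k :: "'a \<Rightarrow> 'b"
      unfolding set_lebesgue_integral_def
    proof (rule integral_cong_AE)
      show "(\<lambda>x. indicator A x *\<^sub>R k x) \<in> borel_measurable lebesgue" "(\<lambda>x. indicator B x *\<^sub>R k x) \<in> borel_measurable lebesgue"
        using A k B by (auto intro!: borel_measurable_scaleR borel_measurable_indicator bl)
      show "AE x in lebesgue. indicator A x *\<^sub>R k x = indicator B x *\<^sub>R k x"
        using B(2) by eventually_elim (simp add: indicator_def)
    qed
    then show "(LINT x:A|lebesgue. f x) = (LINT x:A|lebesgue. g x)" using eqA[OF B(1)] i by simp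
  qed
  then show "AE x in lebesgue. f x = g x" .
qed

lemma
  assumes "lebesgue_decomposition \<mu> f \<sigma>"
  shows singular_part_eq: "singular_part \<mu> = \<sigma>"
    and ac_density_eq: "AE x in lebesgue. ac_density \<mu> x = f x"
proof -
  show "singular_part \<mu> = \<sigma>"
    unfolding singular_part_def using assms lebesgue_decomposition_unique(1) by (intro the_equality) blast+
  have "\<exists>\<sigma>. lebesgue_decomposition \<mu> (ac_density \<mu>) \<sigma>"
    unfolding ac_density_def by (rule someI[of "\<lambda>f. \<exists>\<sigma>. lebesgue_decomposition \<mu> f \<sigma>" f]) (use assms in blast)
  then show "AE x in lebesgue. ac_density \<mu> x = f x"
    using lebesgue_decomposition_unique(2)[OF _ assms] by blast
qed

section \<open>Test functions determine measures\<close>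

lemma mollifierD:
  assumes "mollifier \<eta> a r"
  shows "\<eta> \<in> Cc_infinity UNIV" "\<And>z. 0 \<le> \<eta> z" "\<And>z. \<eta> z \<noteq> 0 \<Longrightarrow> norm (z - a) < r" "(\<integral>z. \<eta> z \<partial>lborel) = 1"
    "integrable lborel \<eta>" "\<eta> \<in> borel_measurable borel" "\<exists>B. \<forall>z. \<bar>\<eta> z\<bar> \<le> B"
proof -
  show C: "\<eta> \<in> Cc_infinity UNIV" using assms by (simp add: mollifier_def)
  show "integrable lborel \<eta>" by (rule Cc_integrable[OF C])
  then show "\<eta> \<in> borel_measurable borel" by auto
  obtain B where "\<And>z. norm (\<eta> z) \<le> B" using Cc_infinity_bounded[OF C] by metis
  then show "\<exists>B. \<forall>z. \<bar>\<eta> z\<bar> \<le> B" by auto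
qed (use assms in \<open>auto simp: mollifier_def\<close>)

lemma mollifier_reflect:
  assumes "mollifier \<eta> (a::'a::euclidean_space) r"
  shows "mollifier (\<lambda>z. \<eta> (- z)) (- a) r"
  unfolding mollifier_def
proof (intro conjI allI impI)
  note m = mollifierD[OF assms]
  have "Ck k (\<lambda>z. \<eta> ((-1) *\<^sub>R z + 0))" for k
    by (rule Ck_affine_arg) (use m(1) in \<open>auto simp: Cc_infinity_UNIV\<close>)
  moreover have "{z. \<eta> (- z) \<noteq> 0} = uminus ` {z. \<eta> z \<noteq> 0}"
    by (auto simp: image_iff) (metis minus_minus)
  ultimately show "(\<lambda>z. \<eta> (- z)) \<in> Cc_infinity UNIV"
    using m(1) by (simp add: Cc_infinity_UNIV)
  show "norm (z - - a) < r" if "\<eta> (- z) \<noteq> 0" for z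
  proof -
    have "- z - a = - (z - - a)" by simp
    then show ?thesis using m(3)[OF that] by (metis norm_minus_cancel)
  qed
  show "(\<integral>z. \<eta> (- z) \<partial>lborel) = 1"
    using lborel_integral_affine[of "-1" \<eta> 0] m(4,6) by simp
qed (use mollifierD[OF assms] in auto)

text \<open>A weighted mean of values of \<open>g\<close> near \<open>x - a\<close>: the error is at most the oscillation of \<open>g\<close> on the
  support of the weight.\<close>

lemma conv_pointwise_bound:
  fixes g :: "'a::euclidean_space \<Rightarrow> 'b::euclidean_space"
  assumes m: "mollifier \<eta> a r" and g[measurable]: "g \<in> borel_measurable borel"
    and d: "\<And>w. norm (w - a) < r \<Longrightarrow> norm (g (x - w) - g x) \<le> \<epsilon>" and e: "0 \<le> \<epsilon>"
  shows "norm (conv lborel \<eta> g x - g x) \<le> \<epsilon>"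
proof -
  note m = mollifierD[OF m]
  note [measurable] = m(6)
  have bnd: "norm (\<eta> w *\<^sub>R (g (x - w) - g x)) \<le> \<eta> w * \<epsilon>" for w
    using d[of w] m(2,3)[of w] by (cases "\<eta> w = 0") (auto intro!: mult_left_mono)
  have i0: "integrable lborel (\<lambda>w. \<eta> w *\<^sub>R (g (x - w) - g x))"
  proof (rule Bochner_Integration.integrable_bound)
    show "integrable lborel (\<lambda>w. \<eta> w * \<epsilon>)" using m(5) by simp
    show "AE w in lborel. norm (\<eta> w *\<^sub>R (g (x - w) - g x)) \<le> norm (\<eta> w * \<epsilon>)"
      using bnd m(2) e by (intro AE_I2) (simp add: abs_mult)
  qed measurable
  have i1: "integrable lborel (\<lambda>w. \<eta> w *\<^sub>R g x)" using m(5) by (intro integrable_scaleR_left)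
  have "conv lborel \<eta> g x = (\<integral>w. \<eta> w *\<^sub>R (g (x - w) - g x) + \<eta> w *\<^sub>R g x \<partial>lborel)"
    by (subst conv_commute[OF m(6) g]) (simp add: algebra_simps)
  also have "\<dots> = (\<integral>w. \<eta> w *\<^sub>R (g (x - w) - g x) \<partial>lborel) + (\<integral>w. \<eta> w *\<^sub>R g x \<partial>lborel)"
    by (rule Bochner_Integration.integral_add[OF i0 i1])
  also have "(\<integral>w. \<eta> w *\<^sub>R g x \<partial>lborel) = g x"
    using m(4,5) by (subst integral_scaleR_left) auto
  finally have "norm (conv lborel \<eta> g x - g x) = norm (\<integral>w. \<eta> w *\<^sub>R (g (x - w) - g x) \<partial>lborel)" by simp
  also have "\<dots> \<le> (\<integral>w. norm (\<eta> w *\<^sub>R (g (x - w) - g x)) \<partial>lborel)" by (rule integral_norm_bound)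
  also have "\<dots> \<le> (\<integral>w. \<eta> w * \<epsilon> \<partial>lborel)"
    by (rule integral_mono[OF integrable_norm[OF i0] _ bnd]) (use m(5) in simp)
  also have "\<dots> = \<epsilon>" using m(4) by simp
  finally show ?thesis .
qed

lemma conv_mollifier_norm_le:
  fixes g :: "'a::euclidean_space \<Rightarrow> 'b::euclidean_space"
  assumes m: "mollifier \<eta> a r" and g[measurable]: "g \<in> borel_measurable borel"
    and C: "\<And>x. norm (g x) \<le> C"
  shows "norm (conv lborel \<eta> g x) \<le> C"
proof -
  note m = mollifierD[OF m]
  note [measurable] = m(6)
  have C0: "0 \<le> C" using norm_ge_zero[of "g 0"] C[of 0] by linarith
  have "norm (conv lborel \<eta> g x) \<le> (\<integral>y. norm (\<eta> (x - y) *\<^sub>R g y) \<partial>lborel)"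
    unfolding conv_def by (rule integral_norm_bound)
  also have "\<dots> \<le> (\<integral>y. \<eta> (x - y) * C \<partial>lborel)"
  proof (rule Bochner_Integration.integral_mono')
    show "integrable lborel (\<lambda>y. \<eta> (x - y) * C)"
      using lborel_integrable_affine[of "-1" \<eta> x] m(5) by simp
  qed (use m(2) C C0 in \<open>auto intro!: mult_left_mono\<close>)
  also have "\<dots> = C" using lborel_integral_affine[of "-1" \<eta> x] m(4,6) by simp
  finally show ?thesis .
qed

text \<open>A mollified indicator is a smooth cut-off function. These bounds locate the regions where it is
  zero and where it is one.\<close>

lemma conv_indicator:
  fixes A :: "'a::euclidean_space set"
  assumes m: "mollifier \<eta> 0 r" and A: "A \<in> sets borel"
  shows "(0::real) \<le> conv lborel \<eta> (indicator A) x" "conv lborel \<eta> (indicator A) x \<le> (1::real)"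
    "conv lborel \<eta> (indicator A) x \<noteq> (0::real) \<Longrightarrow> \<exists>y\<in>A. norm (x - y) < r"
    "(\<And>y. norm (x - y) < r \<Longrightarrow> y \<in> A) \<Longrightarrow> conv lborel \<eta> (indicator A) x = (1::real)"
proof -
  note md = mollifierD[OF m]
  show "0 \<le> conv lborel \<eta> (indicator A :: 'a \<Rightarrow> real) x"
    unfolding conv_def using md(2) by (intro integral_nonneg_AE) auto
  show "conv lborel \<eta> (indicator A :: 'a \<Rightarrow> real) x \<le> 1"
    using conv_mollifier_norm_le[OF m, of "indicator A :: 'a \<Rightarrow> real" 1 x] A
    by (auto simp: indicator_def abs_le_iff)
  show "\<exists>y\<in>A. norm (x - y) < r" if "conv lborel \<eta> (indicator A) x \<noteq> (0::real)"
  proof (rule ccontr)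
    assume "\<not> ?thesis"
    then have "\<eta> (x - y) *\<^sub>R (indicator A y :: real) = 0" for y
      using md(3)[of "x - y"] by (cases "y \<in> A") (auto simp: indicator_def)
    then have "conv lborel \<eta> (indicator A) x = (0::real)" unfolding conv_def by (simp only: integral_zero)
    then show False using that by simp
  qed
  assume s: "\<And>y. norm (x - y) < r \<Longrightarrow> y \<in> A"
  have e: "\<eta> (x - y) *\<^sub>R (indicator A y :: real) = \<eta> (x - y)" for y
    using s[of y] md(3)[of "x - y"] by (cases "\<eta> (x - y) = 0") auto
  show "conv lborel \<eta> (indicator A) x = (1::real)"
    unfolding conv_def e using lborel_integral_affine[of "-1" \<eta> x] md(4,6) by simp
qed

lemma compact_neighbourhood_radius:
  fixes K :: "'a::euclidean_space set"
  assumes "compact K" "open U" "K \<subseteq> U"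
  obtains r where "r > 0" "\<And>x y. x \<in> K \<Longrightarrow> norm (x - y) \<le> r \<Longrightarrow> y \<in> U"
proof -
  obtain r where "r > 0" "(\<Union>x\<in>K. cball x r) \<subseteq> U"
    using compact_subset_open_imp_cball_epsilon_subset[OF assms] by metis
  then show ?thesis using that[of r] by (force simp: dist_norm)
qed

text \<open>Exhaust \<open>U\<close> by compact sets, each in the interior of the next, and mollify the indicator of the
  middle one of three consecutive sets. The result is one on the smallest and is supported in the
  largest of the three.\<close>

lemma smooth_approx_open:
  fixes U :: "'a::euclidean_space set"
  assumes U: "open U"
  obtains \<zeta> :: "nat \<Rightarrow> 'a \<Rightarrow> real" where "\<And>n. \<zeta> n \<in> Cc_infinity U" "\<And>n x. 0 \<le> \<zeta> n x" "\<And>n x. \<zeta> n x \<le> 1"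
    "\<And>x. (\<lambda>n. \<zeta> n x) \<longlonglongrightarrow> indicator U x"
proof -
  obtain C where C: "\<And>n. compact (C n)" "\<And>n. C n \<subseteq> U" "\<And>n. C n \<subseteq> interior (C (Suc n))" "\<Union>(range C) = U"
    and ev: "\<And>K. compact K \<Longrightarrow> K \<subseteq> U \<Longrightarrow> \<exists>N. \<forall>n\<ge>N. K \<subseteq> C n"
    by (rule open_Union_compact_subsets[OF U]) (rule that)
  have "\<exists>\<zeta>::'a \<Rightarrow> real. \<zeta> \<in> Cc_infinity U \<and> (\<forall>x. 0 \<le> \<zeta> x \<and> \<zeta> x \<le> 1) \<and> (\<forall>x\<in>C n. \<zeta> x = 1)" for n
  proof -
    obtain r1 where r1: "r1 > 0" "\<And>x y. x \<in> C n \<Longrightarrow> norm (x - y) \<le> r1 \<Longrightarrow> y \<in> interior (C (Suc n))"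
      using compact_neighbourhood_radius[OF C(1) open_interior C(3)] by metis
    obtain r2 where r2: "r2 > 0" "\<And>x y. x \<in> C (Suc n) \<Longrightarrow> norm (x - y) \<le> r2 \<Longrightarrow> y \<in> interior (C (Suc (Suc n)))"
      using compact_neighbourhood_radius[OF C(1) open_interior C(3)] by metis
    obtain \<eta> where m: "mollifier \<eta> (0::'a) (min r1 r2)" using mollifier_exists[of "min r1 r2" "0::'a"] r1 r2 by auto
    have Cb: "C (Suc n) \<in> sets borel" using C(1) by (intro borel_compact)
    define \<zeta> where "\<zeta> = conv lborel \<eta> (indicator (C (Suc n)) :: 'a \<Rightarrow> real)"
    note ci = conv_indicator[OF m Cb]
    have "integrable lborel (indicator (C (Suc n)) :: 'a \<Rightarrow> real)"
      using C(1) emeasure_compact_finite by (intro integrable_real_indicator) (auto simp: Cb)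
    then have "\<zeta> \<in> Cc_infinity U"
      unfolding \<zeta>_def
    proof (rule conv_Cc_infinity[OF sets_lborel _ mollifierD(1)[OF m] C(1) C(2)])
      fix x y assume "\<eta> (x - y) \<noteq> 0" "indicator (C (Suc n)) y \<noteq> (0::real)"
      then have "norm (x - y) < min r1 r2" "y \<in> C (Suc n)"
        using mollifierD(3)[OF m, of "x - y"] by (simp_all add: indicator_eq_0_iff)
      then have "norm (y - x) \<le> r2" "y \<in> C (Suc n)" by (simp_all add: norm_minus_commute)
      then have "x \<in> interior (C (Suc (Suc n)))" using r2(2)[of y x] by blast
      then show "x \<in> C (Suc (Suc n))" using interior_subset by blast
    qed
    moreover have "\<zeta> x = 1" if "x \<in> C n" for x
      unfolding \<zeta>_def
    proof (rule ci(4))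
      fix y assume "norm (x - y) < min r1 r2"
      then have "y \<in> interior (C (Suc n))" using r1(2)[OF that, of y] by simp
      then show "y \<in> C (Suc n)" using interior_subset by blast
    qed
    moreover have "0 \<le> \<zeta> x" "\<zeta> x \<le> 1" for x unfolding \<zeta>_def by (rule ci(1), rule ci(2))
    ultimately show ?thesis by (intro exI[of _ \<zeta>]) blast
  qed
  then obtain \<zeta> :: "nat \<Rightarrow> 'a \<Rightarrow> real" where \<zeta>: "\<And>n. \<zeta> n \<in> Cc_infinity U" "\<And>n x. 0 \<le> \<zeta> n x" "\<And>n x. \<zeta> n x \<le> 1"
    "\<And>n x. x \<in> C n \<Longrightarrow> \<zeta> n x = 1" by metis
  have "(\<lambda>n. \<zeta> n x) \<longlonglongrightarrow> indicator U x" for x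
  proof (cases "x \<in> U")
    case True
    then obtain N where N: "\<forall>n\<ge>N. {x} \<subseteq> C n" using ev[of "{x}"] by auto
    have "\<forall>\<^sub>F n in sequentially. \<zeta> n x = 1"
      using eventually_ge_at_top[of N] by eventually_elim (use \<zeta>(4) N in blast)
    then have "(\<lambda>n. \<zeta> n x) \<longlonglongrightarrow> 1" by (rule tendsto_eventually)
    then show ?thesis using True by simp
  next
    case False
    have "\<zeta> n x = 0" for n
    proof (rule ccontr)
      assume "\<zeta> n x \<noteq> 0"
      then have "x \<in> {x. \<zeta> n x \<noteq> 0}" by simp
      then have "x \<in> closure {x. \<zeta> n x \<noteq> 0}" by (rule closure_subset[THEN subsetD])
      moreover have "closure {x. \<zeta> n x \<noteq> 0} \<subseteq> U" using \<zeta>(1)[of n] unfolding Cc_infinity_def by blast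
      ultimately show False using False by blast
    qed
    then show ?thesis using False by simp
  qed
  then show ?thesis by (rule that[OF \<zeta>(1-3)])
qed

text \<open>Test functions converge boundedly to the indicator of any open set, so the two integrals cancel on
  open sets, and therefore on all Borel sets.\<close>

lemma test_functions_determine:
  fixes a b :: "'a::euclidean_space \<Rightarrow> real"
  assumes T: "sets T = sets borel" and a: "integrable lborel a" and b: "integrable T b"
    and z: "\<And>\<zeta>. \<zeta> \<in> Cc_infinity UNIV \<Longrightarrow> (\<integral>x. \<zeta> x * a x \<partial>lborel) + (\<integral>x. \<zeta> x * b x \<partial>T) = 0"
    and A: "A \<in> sets borel"
  shows "(LINT x:A|lborel. a x) + (LINT x:A|T. b x) = 0"
proof -
  define \<mu> where "\<mu> A = (if A \<in> sets borel then (LINT x:A|lborel. a x) else 0) + (if A \<in> sets borel then (LINT x:A|T. b x) else 0)" for A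
  have \<mu>: "radon_vmeasure \<mu>"
    unfolding \<mu>_def by (intro radon_add radon_density T a b) simp
  have "\<mu> = (\<lambda>A. 0)"
  proof (rule radon_eq_on_open[OF \<mu> radon_zero])
    fix U :: "'a set" assume U: "open U"
    obtain \<zeta> :: "nat \<Rightarrow> 'a \<Rightarrow> real" where \<zeta>: "\<And>n. \<zeta> n \<in> Cc_infinity U" "\<And>n x. 0 \<le> \<zeta> n x" "\<And>n x. \<zeta> n x \<le> 1"
      "\<And>x. (\<lambda>n. \<zeta> n x) \<longlonglongrightarrow> indicator U x" using smooth_approx_open[OF U] by metis
    have lim: "(\<lambda>n. \<integral>x. \<zeta> n x * c x \<partial>M) \<longlonglongrightarrow> (LINT x:U|M. c x)"
      if M: "sets M = sets borel" and c: "integrable M c" for M and c :: "'a \<Rightarrow> real"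
      unfolding set_lebesgue_integral_def
    proof (rule integral_dominated_convergence[where w = "\<lambda>x. norm (c x)"])
      show "(\<lambda>x. indicator U x *\<^sub>R c x) \<in> borel_measurable M"
        using U M c by (intro borel_measurable_scaleR borel_measurable_indicator) auto
      show "(\<lambda>x. \<zeta> n x * c x) \<in> borel_measurable M" for n
        using borel_measurable_continuous_UNIV[OF M Cc_continuous[OF \<zeta>(1)]] c by (intro borel_measurable_times) auto
      show "AE x in M. (\<lambda>n. \<zeta> n x * c x) \<longlonglongrightarrow> indicator U x *\<^sub>R c x"
        unfolding real_scaleR_def by (intro AE_I2 tendsto_mult \<zeta>(4) tendsto_const)
      show "AE x in M. norm (\<zeta> n x * c x) \<le> norm (c x)" for n
        using \<zeta>(2,3) by (intro AE_I2) (simp add: abs_mult mult_left_le_one_le)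
    qed (use c in auto)
    have "(\<lambda>n. (\<integral>x. \<zeta> n x * a x \<partial>lborel) + (\<integral>x. \<zeta> n x * b x \<partial>T)) \<longlonglongrightarrow> (LINT x:U|lborel. a x) + (LINT x:U|T. b x)"
      by (intro tendsto_add lim sets_lborel a T b)
    moreover have "(\<integral>x. \<zeta> n x * a x \<partial>lborel) + (\<integral>x. \<zeta> n x * b x \<partial>T) = 0" for n
      by (rule z) (rule Cc_infinity_imp_UNIV[OF \<zeta>(1)])
    ultimately have "(LINT x:U|lborel. a x) + (LINT x:U|T. b x) = 0"
      by (simp add: LIMSEQ_const_iff)
    then show "\<mu> U = 0" using U by (simp add: \<mu>_def)
  qed
  then have "\<mu> A = 0" by simp
  then show ?thesis using A by (simp add: \<mu>_def)
qed

section \<open>Density of continuous functions and convergence of mollifications\<close>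

text \<open>By inner and outer regularity an indicator is approximated by a Urysohn function between a compact
  and an open set. Sums and dominated limits preserve the property.\<close>

lemma continuous_dense_L1:
  fixes f :: "'a::euclidean_space \<Rightarrow> 'b::euclidean_space"
  assumes P: "finite_measure P" and sP: "sets P = sets borel" and f: "integrable P f" and e: "e > 0"
  shows "\<exists>t. continuous_on UNIV t \<and> integrable P t \<and> (\<integral>x. norm (f x - t x) \<partial>P) < e"
  using f e
proof (induction arbitrary: e rule: integrable_induct)
  interpret finite_measure P by fact
  case (base A c)
  have A: "A \<in> sets borel" using base sP by simp
  have Pfin: "emeasure P (space P) \<noteq> \<infinity>" by simp
  define d where "d = e / (2 * (norm c + 1))"
  have d: "d > 0" using base by (simp add: d_def add_nonneg_pos)
  have dc: "2 * d * norm c < e"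
    using base(3) by (simp add: d_def divide_simps add_nonneg_pos)
  obtain K where K: "K \<subseteq> A" "compact K" "measure P A - d < measure P K"
  proof (cases "measure P A < d")
    case True
    then show ?thesis by (intro that[of "{}"]) auto
  next
    case False
    have "ennreal (measure P A - d) < emeasure P A"
      using False d by (simp add: emeasure_eq_measure ennreal_less_iff)
    also have "emeasure P A = (SUP K \<in> {K. K \<subseteq> A \<and> compact K}. emeasure P K)"
      by (rule inner_regular[OF sP Pfin A])
    finally obtain K where "K \<subseteq> A" "compact K" "ennreal (measure P A - d) < emeasure P K"
      unfolding less_SUP_iff by blast
    then show ?thesis using False by (intro that[of K]) (auto simp: emeasure_eq_measure ennreal_less_iff)
  qed
  obtain U where U: "A \<subseteq> U" "open U" "measure P U < measure P A + d"
  proof -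
    have "(INF U \<in> {U. A \<subseteq> U \<and> open U}. emeasure P U) = emeasure P A"
      by (rule outer_regular[OF sP Pfin A, symmetric])
    also have "\<dots> < ennreal (measure P A + d)"
      using d by (simp add: emeasure_eq_measure ennreal_less_iff)
    finally obtain U where "A \<subseteq> U" "open U" "emeasure P U < ennreal (measure P A + d)"
      unfolding INF_less_iff by blast
    then show ?thesis by (intro that[of U]) (auto simp: emeasure_eq_measure ennreal_less_iff)
  qed
  obtain g :: "'a \<Rightarrow> real" where g: "continuous_on UNIV g" "\<And>x. g x \<in> closed_segment 0 1"
      "\<And>x. x \<in> - U \<Longrightarrow> g x = 0" "\<And>x. x \<in> K \<Longrightarrow> g x = 1"
    using Urysohn_local[of UNIV "- U" K 0 1] U K compact_imp_closed[of K]
    by (auto simp: closed_Compl)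
  have g01: "0 \<le> g x" "g x \<le> 1" for x using g(2)[of x] by (auto simp: closed_segment_eq_real_ivl)
  have gm: "g \<in> borel_measurable P" by (rule borel_measurable_continuous_UNIV[OF sP g(1)])
  have KU: "K \<in> sets P" "U \<in> sets P" using U K sP by (auto intro: borel_compact)
  have gi: "integrable P (\<lambda>x. g x *\<^sub>R c)"
  proof -
    have "integrable P g" by (rule integrable_const_bound[where B = 1]) (use g01 gm in auto)
    then show ?thesis by (intro integrable_scaleR_left)
  qed
  have "(\<integral>x. norm (indicator A x *\<^sub>R c - g x *\<^sub>R c) \<partial>P) \<le> (\<integral>x. indicator (U - K) x * norm c \<partial>P)"
  proof (rule Bochner_Integration.integral_mono')
    show "integrable P (\<lambda>x. indicator (U - K) x * norm c)" using KU by (intro integrable_mult_left) (auto simp: emeasure_eq_measure intro!: integrable_real_indicator)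
    show "norm (indicator A x *\<^sub>R c - g x *\<^sub>R c) \<le> indicator (U - K) x * norm c" for x
    proof -
      have "\<bar>indicator A x - g x\<bar> \<le> (indicator (U - K) x :: real)"
        using g01[of x] g(3,4)[of x] U(1) K(1) by (auto simp: indicator_def)
      then show ?thesis unfolding scaleR_diff_left[symmetric] norm_scaleR by (intro mult_right_mono) auto
    qed
  qed auto
  also have "\<dots> = measure P (U - K) * norm c"
    using KU by (simp add: sets.Int_space_eq2)
  also have "measure P (U - K) \<le> 2 * d"
    using K U KU finite_measure_Diff[of U K] by auto
  finally have "(\<integral>x. norm (indicator A x *\<^sub>R c - g x *\<^sub>R c) \<partial>P) < e"
    using dc by (auto simp: mult_right_mono order.strict_trans1)
  then show ?case using gi g(1) by (intro exI[of _ "\<lambda>x. g x *\<^sub>R c"]) (auto intro!: continuous_intros)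
next
  case (add f g)
  obtain t u where t: "continuous_on UNIV t" "integrable P t" "(\<integral>x. norm (f x - t x) \<partial>P) < e / 2"
    and u: "continuous_on UNIV u" "integrable P u" "(\<integral>x. norm (g x - u x) \<partial>P) < e / 2"
    using add(3)[of "e / 2"] add(4)[of "e / 2"] add(5) by auto
  have i: "integrable P (\<lambda>x. norm (f x - t x))" "integrable P (\<lambda>x. norm (g x - u x))"
    using add(1,2) t(2) u(2) by auto
  have "(\<integral>x. norm (f x + g x - (t x + u x)) \<partial>P) \<le> (\<integral>x. norm (f x - t x) + norm (g x - u x) \<partial>P)"
    by (rule Bochner_Integration.integral_mono')
      (use i norm_diff_triangle_ineq[of "f x" "g x" "t x" "u x" for x] in auto)
  also have "\<dots> < e" using i t(3) u(3) by simp
  finally show ?case using t u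
    by (intro exI[of _ "\<lambda>x. t x + u x"]) (auto intro!: continuous_intros)
next
  case (lim f s)
  have sp: "space P = UNIV" using sets_eq_imp_space_eq[OF sP] by simp
  have "(\<lambda>i. \<integral>x. norm (f x - s i x) \<partial>P) \<longlonglongrightarrow> (\<integral>x. 0 \<partial>P)"
  proof (rule integral_dominated_convergence[where w = "\<lambda>x. 3 * norm (f x)"])
    show "AE x in P. (\<lambda>i. norm (f x - s i x)) \<longlonglongrightarrow> 0"
    proof (rule AE_I2)
      fix x assume "x \<in> space P"
      then have "(\<lambda>i. f x - s i x) \<longlonglongrightarrow> f x - f x" by (intro tendsto_diff tendsto_const lim)
      then show "(\<lambda>i. norm (f x - s i x)) \<longlonglongrightarrow> 0" by (simp add: tendsto_norm_zero)
    qed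
    show "AE x in P. norm (norm (f x - s i x)) \<le> 3 * norm (f x)" for i
    proof (rule AE_I2)
      fix x assume "x \<in> space P"
      then show "norm (norm (f x - s i x)) \<le> 3 * norm (f x)"
        using lim(3)[of x i] norm_triangle_ineq4[of "f x" "s i x"] by simp
    qed
  qed (use lim in auto)
  then have "\<forall>\<^sub>F i in sequentially. (\<integral>x. norm (f x - s i x) \<partial>P) < e / 2"
    using lim.prems by (intro order_tendstoD(2)[where a = "e/2"]) auto
  then obtain i where i: "(\<integral>x. norm (f x - s i x) \<partial>P) < e / 2"
    using eventually_happens'[OF sequentially_bot] by blast
  obtain t where t: "continuous_on UNIV t" "integrable P t" "(\<integral>x. norm (s i x - t x) \<partial>P) < e / 2"
    using lim(5)[of "e / 2" i] lim.prems by auto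
  have ii: "integrable P (\<lambda>x. norm (f x - s i x))" "integrable P (\<lambda>x. norm (s i x - t x))"
    using lim(1,4) t(2) by auto
  have "(\<integral>x. norm (f x - t x) \<partial>P) \<le> (\<integral>x. norm (f x - s i x) + norm (s i x - t x) \<partial>P)"
    by (rule Bochner_Integration.integral_mono')
      (use ii norm_diff_triangle_ineq[of "f x" "s i x" "s i x" "t x" for x] in auto)
  also have "\<dots> < e" using ii i t(3) by simp
  finally show ?case using t by blast
qed

text \<open>Truncation to a ball reduces the claim to a finite measure. A cut-off with values between zero and
  one does not increase the error, because the truncated function vanishes where the cut-off is not
  equal to one.\<close>

lemma continuous_compact_support_dense_L1:
  fixes f :: "'a::euclidean_space \<Rightarrow> 'b::euclidean_space"
  assumes f: "integrable lborel f" and e: "e > 0"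
  obtains t R where "continuous_on UNIV t" "\<And>x. R \<le> norm x \<Longrightarrow> t x = 0" "integrable lborel t"
    "(\<integral>x. norm (f x - t x) \<partial>lborel) < e" "R > 0"
proof -
  have fm[measurable]: "f \<in> borel_measurable borel" using f by auto
  have "(\<lambda>n. \<integral>x. norm (f x - indicator (ball 0 (real n)) x *\<^sub>R f x) \<partial>lborel) \<longlonglongrightarrow> (\<integral>x. 0 \<partial>(lborel::'a measure))"
  proof (rule integral_dominated_convergence[where w = "\<lambda>x. norm (f x)"])
    show "AE x in lborel. (\<lambda>n. norm (f x - indicator (ball 0 (real n)) x *\<^sub>R f x)) \<longlonglongrightarrow> 0"
    proof (rule AE_I2)
      fix x :: 'a
      obtain N :: nat where N: "norm x < real N" using reals_Archimedean2 by blast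
      have "\<forall>\<^sub>F n in sequentially. norm (f x - indicator (ball 0 (real n)) x *\<^sub>R f x) = 0"
        using eventually_ge_at_top[of N] by eventually_elim (use N in \<open>simp add: dist_norm\<close>)
      then show "(\<lambda>n. norm (f x - indicator (ball 0 (real n)) x *\<^sub>R f x)) \<longlonglongrightarrow> 0" by (rule tendsto_eventually)
    qed
    show "(\<lambda>x. norm (f x - indicator (ball 0 (real n)) x *\<^sub>R f x)) \<in> borel_measurable lborel" for n
      by (intro borel_measurable_integrable integrable_norm Bochner_Integration.integrable_diff integrable_mult_indicator f) simp
    show "AE x in lborel. norm (norm (f x - indicator (ball 0 (real n)) x *\<^sub>R f x)) \<le> norm (f x)" for n
      by (intro AE_I2) (simp add: indicator_def)
  qed (use f in auto)
  then have "\<forall>\<^sub>F n in sequentially. (\<integral>x. norm (f x - indicator (ball 0 (real n)) x *\<^sub>R f x) \<partial>lborel) < e / 2"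
    using e by (intro order_tendstoD(2)[where a = "e/2"]) auto
  then obtain n where n: "(\<integral>x. norm (f x - indicator (ball 0 (real n)) x *\<^sub>R f x) \<partial>lborel) < e / 2"
    using eventually_happens'[OF sequentially_bot] by blast
  define fn where "fn x = indicator (ball 0 (real n)) x *\<^sub>R f x" for x
  have fni: "integrable lborel fn" unfolding fn_def[abs_def] using f by (intro integrable_mult_indicator) auto
  then have fnm[measurable]: "fn \<in> borel_measurable borel" by auto
  define B where "B = cball (0::'a) (real n + 1)"
  have Bm[measurable]: "B \<in> sets borel" by (simp add: B_def)
  define P where "P = density lborel (\<lambda>x. ennreal (indicator B x))"
  have sP: "sets P = sets borel" by (simp add: P_def)
  have "finite_measure P"
  proof
    have "emeasure P (space P) = emeasure lborel B"
      using Bm by (simp add: P_def emeasure_density ennreal_indicator)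
    also have "\<dots> < \<infinity>" unfolding B_def by (rule emeasure_lborel_cball_finite)
    finally show "emeasure P (space P) \<noteq> \<infinity>" by simp
  qed
  moreover have "integrable P fn"
    unfolding P_def by (subst integrable_density) (use fni Bm in \<open>auto intro!: integrable_mult_indicator\<close>)
  ultimately obtain t where t: "continuous_on UNIV t" "integrable P t" "(\<integral>x. norm (fn x - t x) \<partial>P) < e / 2"
    using continuous_dense_L1[of P fn "e/2"] sP e by auto
  have tm[measurable]: "t \<in> borel_measurable borel" by (rule borel_measurable_continuous_onI[OF t(1)])
  define \<theta> where "\<theta> x = max 0 (min 1 (real n + 1 - norm x))" for x :: 'a
  have \<theta>: "0 \<le> \<theta> x" "\<theta> x \<le> 1" "norm x < real n \<Longrightarrow> \<theta> x = 1" "real n + 1 \<le> norm x \<Longrightarrow> \<theta> x = 0" for x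
    by (auto simp: \<theta>_def)
  have c\<theta>: "continuous_on UNIV \<theta>" unfolding \<theta>_def by (intro continuous_intros)
  define t' where "t' x = \<theta> x *\<^sub>R t x" for x
  have ct': "continuous_on UNIV t'" unfolding t'_def using c\<theta> t(1) by (intro continuous_intros)
  have t'0: "t' x = 0" if "real n + 1 \<le> norm x" for x using \<theta>(4)[OF that] by (simp add: t'_def)
  have it: "integrable lborel (\<lambda>x. indicator B x *\<^sub>R norm (fn x - t x))"
    using integrable_norm[OF Bochner_Integration.integrable_diff[OF \<open>integrable P fn\<close> t(2)]]
    unfolding P_def by (subst (asm) integrable_density) auto
  have et: "(\<integral>x. indicator B x *\<^sub>R norm (fn x - t x) \<partial>lborel) = (\<integral>x. norm (fn x - t x) \<partial>P)"
    unfolding P_def by (subst integral_density) auto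
  have bnd: "norm (fn x - t' x) \<le> indicator B x *\<^sub>R norm (fn x - t x)" for x
  proof -
    consider "norm x < real n" | "real n \<le> norm x" "norm x \<le> real n + 1" | "norm x > real n + 1" by linarith
    then show ?thesis
    proof cases
      case 1 then show ?thesis using \<theta>(3)[OF 1] by (simp add: t'_def B_def dist_norm)
    next
      case 2
      then have "fn x = 0" by (simp add: fn_def dist_norm)
      then show ?thesis using 2 \<theta>(1,2)[of x] by (simp add: t'_def B_def dist_norm mult_left_le_one_le)
    next
      case 3
      then have "fn x = 0" by (simp add: fn_def dist_norm)
      then show ?thesis using t'0[of x] 3 by simp
    qed
  qed
  have t'm[measurable]: "t' \<in> borel_measurable borel" by (rule borel_measurable_continuous_onI[OF ct'])
  have ft': "integrable lborel (\<lambda>x. fn x - t' x)"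
    by (rule Bochner_Integration.integrable_bound[OF it]) (use bnd in \<open>auto intro!: order_trans[OF bnd]\<close>)
  have it': "integrable lborel t'" using Bochner_Integration.integrable_diff[OF fni ft'] by simp
  have "(\<integral>x. norm (f x - t' x) \<partial>lborel) \<le> (\<integral>x. norm (f x - fn x) + norm (fn x - t' x) \<partial>lborel)"
    by (rule Bochner_Integration.integral_mono')
      (use f fni ft' norm_diff_triangle_ineq[of "f x" "fn x" "fn x" "t' x" for x] in auto)
  also have "\<dots> = (\<integral>x. norm (f x - fn x) \<partial>lborel) + (\<integral>x. norm (fn x - t' x) \<partial>lborel)"
    using f fni ft' by (intro Bochner_Integration.integral_add) auto
  also have "(\<integral>x. norm (fn x - t' x) \<partial>lborel) \<le> (\<integral>x. indicator B x *\<^sub>R norm (fn x - t x) \<partial>lborel)"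
    by (rule integral_mono[OF integrable_norm[OF ft'] it bnd])
  also have "\<dots> < e / 2" unfolding et by (rule t(3))
  finally have "(\<integral>x. norm (f x - t' x) \<partial>lborel) < e" using n by (simp add: fn_def)
  then show ?thesis using that[of t' "real n + 1"] ct' t'0 it' by simp
qed

text \<open>For a continuous function with compact support the convergence is uniform with supports in a fixed
  ball. The general case follows because convolution with a mollifier does not increase the
  \<open>L\<^sup>1\<close> norm.\<close>

lemma conv_L1_limit:
  fixes f :: "'a::euclidean_space \<Rightarrow> 'b::euclidean_space"
  assumes f: "integrable lborel f" and m: "\<And>j. mollifier (\<eta> j) (a j) (r j)"
    and a: "a \<longlonglongrightarrow> 0" and r: "r \<longlonglongrightarrow> 0"
  shows "(\<lambda>j. \<integral>x. norm (conv lborel (\<eta> j) f x - f x) \<partial>lborel) \<longlonglongrightarrow> 0"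
proof (rule tendstoI)
  fix e :: real assume e: "e > 0"
  obtain t R where t: "continuous_on UNIV t" "\<And>x. R \<le> norm x \<Longrightarrow> t x = 0" "integrable lborel t"
    "(\<integral>x. norm (f x - t x) \<partial>lborel) < e / 3" "R > 0"
    using continuous_compact_support_dense_L1[OF f, of "e / 3"] e by auto
  have tm[measurable]: "t \<in> borel_measurable borel" using t(3) by auto
  define V where "V = measure lborel (cball (0::'a) (R + 1))"
  define \<epsilon> where "\<epsilon> = e / (3 * (V + 1))"
  have V: "V \<ge> 0" by (simp add: V_def)
  have \<epsilon>: "\<epsilon> > 0" "\<epsilon> * V < e / 3" using e V by (auto simp: \<epsilon>_def divide_simps)
  have "uniformly_continuous_on (cball 0 (R + 2)) t"
    using t(1) by (intro compact_uniformly_continuous) (auto intro: continuous_on_subset)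
  then obtain d where d: "d > 0" "\<And>x y. x \<in> cball 0 (R + 2) \<Longrightarrow> y \<in> cball 0 (R + 2) \<Longrightarrow> dist y x < d \<Longrightarrow> dist (t y) (t x) < \<epsilon>"
    using \<epsilon>(1) unfolding uniformly_continuous_on_def by metis
  have "(\<lambda>j. norm (a j) + r j) \<longlonglongrightarrow> norm (0::'a) + 0" by (intro tendsto_add tendsto_norm a r)
  then have "\<forall>\<^sub>F j in sequentially. norm (a j) + r j < min d 1"
    using d(1) by (intro order_tendstoD(2)) auto
  then show "\<forall>\<^sub>F j in sequentially. dist (\<integral>x. norm (conv lborel (\<eta> j) f x - f x) \<partial>lborel) 0 < e"
  proof eventually_elim
    fix j assume j: "norm (a j) + r j < min d 1"
    note mj = mollifierD[OF m[of j]]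
    obtain B where B: "\<And>z. \<bar>\<eta> j z\<bar> \<le> B" using mj(7) by blast
    have w: "norm w < min d 1" if "norm (w - a j) < r j" for w
      using that j norm_triangle_ineq2[of w "a j"] by linarith
    have tb: "norm (conv lborel (\<eta> j) t x - t x) \<le> indicator (cball 0 (R + 1)) x * \<epsilon>" for x
    proof (cases "norm x \<le> R + 1")
      case True
      have "norm (conv lborel (\<eta> j) t x - t x) \<le> \<epsilon>"
      proof (rule conv_pointwise_bound[OF m tm])
        fix w assume "norm (w - a j) < r j"
        then have w: "norm w < d" "norm w < 1" using w[of w] by auto
        have "norm (x - w) \<le> R + 2" using norm_triangle_ineq4[of x w] True w by linarith
        then show "norm (t (x - w) - t x) \<le> \<epsilon>"
          using d(2)[of x "x - w"] True w norm_minus_commute[of w x] by (simp add: dist_norm)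
      qed (use \<epsilon> in simp)
      then show ?thesis using True by (simp add: dist_norm)
    next
      case False
      have "norm (conv lborel (\<eta> j) t x - t x) \<le> 0"
      proof (rule conv_pointwise_bound[OF m tm])
        fix w assume "norm (w - a j) < r j"
        then have w: "norm w < 1" using w[of w] by auto
        have "R \<le> norm (x - w)" using norm_triangle_ineq2[of x w] False w by linarith
        then show "norm (t (x - w) - t x) \<le> 0" using t(2) False by simp
      qed simp
      then show ?thesis using False by (simp add: dist_norm)
    qed
    have i1: "integrable lborel (conv lborel (\<eta> j) g)" if "integrable lborel g" for g :: "'a \<Rightarrow> 'b"
      by (rule conv_integrable[OF lborel.sigma_finite_measure_axioms sets_lborel mj(5) that])
    have ft: "integrable lborel (\<lambda>x. f x - t x)" using f t(3) by simp
    have "(\<integral>x. norm (conv lborel (\<eta> j) (\<lambda>x. f x - t x) x) \<partial>lborel) \<le> (\<integral>x. \<bar>\<eta> j x\<bar> \<partial>lborel) * (\<integral>x. norm (f x - t x) \<partial>lborel)"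
      by (rule conv_norm_le[OF lborel.sigma_finite_measure_axioms sets_lborel mj(5) ft])
    then have b1: "(\<integral>x. norm (conv lborel (\<eta> j) (\<lambda>x. f x - t x) x) \<partial>lborel) < e / 3"
      using t(4) mj(2,4) by simp
    have i2: "integrable lborel (\<lambda>x. conv lborel (\<eta> j) t x - t x)" using i1[OF t(3)] t(3) by simp
    have ind: "integrable lborel (\<lambda>x. indicator (cball 0 (R + 1)) (x::'a) * \<epsilon>)"
      by (intro integrable_mult_left integrable_real_indicator) (use emeasure_lborel_cball_finite[of "0::'a" "R + 1"] in auto)
    have "(\<integral>x. norm (conv lborel (\<eta> j) t x - t x) \<partial>lborel) \<le> (\<integral>x. indicator (cball 0 (R + 1)) (x::'a) * \<epsilon> \<partial>lborel)"
      by (rule integral_mono[OF integrable_norm[OF i2] ind tb])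
    also have "\<dots> = V * \<epsilon>" by (simp add: V_def)
    finally have b2: "(\<integral>x. norm (conv lborel (\<eta> j) t x - t x) \<partial>lborel) < e / 3" using \<epsilon>(2) by (simp add: mult.commute)
    have lin: "conv lborel (\<eta> j) f x = conv lborel (\<eta> j) (\<lambda>x. f x - t x) x + conv lborel (\<eta> j) t x" for x
    proof -
      have "conv lborel (\<eta> j) (\<lambda>x. f x - t x) x = (\<integral>y. \<eta> j (x - y) *\<^sub>R f y - \<eta> j (x - y) *\<^sub>R t y \<partial>lborel)"
        unfolding conv_def by (simp only: scaleR_diff_right)
      also have "\<dots> = conv lborel (\<eta> j) f x - conv lborel (\<eta> j) t x"
        unfolding conv_def
        by (rule Bochner_Integration.integral_diff[OF conv_integrand[OF sets_lborel mj(6) B f] conv_integrand[OF sets_lborel mj(6) B t(3)]])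
      finally show ?thesis by simp
    qed
    have "(\<integral>x. norm (conv lborel (\<eta> j) f x - f x) \<partial>lborel) \<le>
      (\<integral>x. norm (conv lborel (\<eta> j) (\<lambda>x. f x - t x) x) + norm (conv lborel (\<eta> j) t x - t x) + norm (f x - t x) \<partial>lborel)"
    proof (rule Bochner_Integration.integral_mono')
      show "integrable lborel (\<lambda>x. norm (conv lborel (\<eta> j) (\<lambda>x. f x - t x) x) + norm (conv lborel (\<eta> j) t x - t x) + norm (f x - t x))"
        by (intro Bochner_Integration.integrable_add integrable_norm i1 i2 ft)
      show "norm (conv lborel (\<eta> j) f x - f x) \<le> norm (conv lborel (\<eta> j) (\<lambda>x. f x - t x) x) + norm (conv lborel (\<eta> j) t x - t x) + norm (f x - t x)" for x
      proof -
        have "conv lborel (\<eta> j) f x - f x = conv lborel (\<eta> j) (\<lambda>x. f x - t x) x + (conv lborel (\<eta> j) t x - t x) - (f x - t x)"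
          by (simp add: lin)
        then show ?thesis by (smt (verit) norm_triangle_ineq norm_triangle_ineq4)
      qed
    qed simp
    also have "\<dots> = (\<integral>x. norm (conv lborel (\<eta> j) (\<lambda>x. f x - t x) x) \<partial>lborel) + (\<integral>x. norm (conv lborel (\<eta> j) t x - t x) \<partial>lborel) + (\<integral>x. norm (f x - t x) \<partial>lborel)"
      using integrable_norm[OF i1[OF ft]] integrable_norm[OF i2] integrable_norm[OF ft] by simp
    also have "\<dots> < e" using b1 b2 t(4) by simp
    finally show "dist (\<integral>x. norm (conv lborel (\<eta> j) f x - f x) \<partial>lborel) 0 < e" by (simp add: dist_real_def)
  qed
qed

text \<open>The mollification is moved to the test field, which converges boundedly and pointwise. Strong
  convergence cannot be expected here since \<open>T\<close> may be singular.\<close>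

lemma conv_weak_limit:
  fixes s \<Phi> :: "'a::euclidean_space \<Rightarrow> 'b::euclidean_space"
  assumes T: "sigma_finite_measure T" "sets T = sets borel" and s: "integrable T s"
    and \<Phi>: "continuous_on UNIV \<Phi>" "\<And>x. norm (\<Phi> x) \<le> C"
    and m: "\<And>j. mollifier (\<eta> j) (a j) (r j)" and a: "a \<longlonglongrightarrow> 0" and r: "r \<longlonglongrightarrow> 0"
  shows "(\<lambda>j. \<integral>x. \<Phi> x \<bullet> conv T (\<eta> j) s x \<partial>lborel) \<longlonglongrightarrow> (\<integral>x. \<Phi> x \<bullet> s x \<partial>T)"
proof -
  have \<Phi>m[measurable]: "\<Phi> \<in> borel_measurable borel" by (rule borel_measurable_continuous_onI[OF \<Phi>(1)])
  note mr = mollifier_reflect[OF m]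
  have adj: "(\<integral>x. \<Phi> x \<bullet> conv T (\<eta> j) s x \<partial>lborel) = (\<integral>y. conv lborel (\<lambda>z. \<eta> j (- z)) \<Phi> y \<bullet> s y \<partial>T)" for j
  proof -
    obtain B where B: "\<And>z. \<bar>\<eta> j z\<bar> \<le> B" using mollifierD(7)[OF m] by blast
    show ?thesis by (rule conv_adjoint[OF T mollifierD(5)[OF m] B s \<Phi>m \<Phi>(2)])
  qed
  have lim: "(\<lambda>j. conv lborel (\<lambda>z. \<eta> j (- z)) \<Phi> y) \<longlonglongrightarrow> \<Phi> y" for y
  proof (rule tendstoI)
    fix e :: real assume e: "e > 0"
    have "isCont \<Phi> y" using \<Phi>(1) by (simp add: continuous_on_eq_continuous_at)
    then obtain d where d: "d > 0" "\<And>x. dist x y < d \<Longrightarrow> dist (\<Phi> x) (\<Phi> y) < e / 2"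
      using e unfolding continuous_at_eps_delta by (metis half_gt_zero)
    have "(\<lambda>j. norm (a j) + r j) \<longlonglongrightarrow> norm (0::'a) + 0" by (intro tendsto_add tendsto_norm a r)
    then have "\<forall>\<^sub>F j in sequentially. norm (a j) + r j < d" using d(1) by (intro order_tendstoD(2)) auto
    then show "\<forall>\<^sub>F j in sequentially. dist (conv lborel (\<lambda>z. \<eta> j (- z)) \<Phi> y) (\<Phi> y) < e"
    proof eventually_elim
      fix j assume j: "norm (a j) + r j < d"
      have "norm (conv lborel (\<lambda>z. \<eta> j (- z)) \<Phi> y - \<Phi> y) \<le> e / 2"
      proof (rule conv_pointwise_bound[OF mr \<Phi>m])
        fix w assume "norm (w - - a j) < r j"
        then have "norm w < d" using j norm_triangle_ineq2[of w "- a j"] by simp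
        then show "norm (\<Phi> (y - w) - \<Phi> y) \<le> e / 2" using d(2)[of "y - w"] by (simp add: dist_norm)
      qed (use e in simp)
      then show "dist (conv lborel (\<lambda>z. \<eta> j (- z)) \<Phi> y) (\<Phi> y) < e" using e by (simp add: dist_norm)
    qed
  qed
  have cm: "conv lborel (\<lambda>z. \<eta> j (- z)) \<Phi> \<in> borel_measurable T" for j
  proof -
    note [measurable] = mollifierD(6)[OF mr[of j]]
    have "conv lborel (\<lambda>z. \<eta> j (- z)) \<Phi> \<in> borel_measurable borel"
      unfolding conv_def[abs_def] by measurable
    then show ?thesis using T(2) measurable_cong_sets by blast
  qed
  have "(\<lambda>j. \<integral>y. conv lborel (\<lambda>z. \<eta> j (- z)) \<Phi> y \<bullet> s y \<partial>T) \<longlonglongrightarrow> (\<integral>y. \<Phi> y \<bullet> s y \<partial>T)"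
  proof (rule integral_dominated_convergence[where w = "\<lambda>y. C * norm (s y)"])
    show "(\<lambda>y. \<Phi> y \<bullet> s y) \<in> borel_measurable T"
      using borel_measurable_continuous_UNIV[OF T(2) \<Phi>(1)] s by (intro borel_measurable_inner) auto
    show "(\<lambda>y. conv lborel (\<lambda>z. \<eta> j (- z)) \<Phi> y \<bullet> s y) \<in> borel_measurable T" for j
      using cm s by (intro borel_measurable_inner) auto
    show "AE y in T. (\<lambda>j. conv lborel (\<lambda>z. \<eta> j (- z)) \<Phi> y \<bullet> s y) \<longlonglongrightarrow> \<Phi> y \<bullet> s y"
      by (intro AE_I2 tendsto_inner lim tendsto_const)
    show "AE y in T. norm (conv lborel (\<lambda>z. \<eta> j (- z)) \<Phi> y \<bullet> s y) \<le> C * norm (s y)" for j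
    proof (rule AE_I2)
      fix y
      have "norm (conv lborel (\<lambda>z. \<eta> j (- z)) \<Phi> y \<bullet> s y) \<le> norm (conv lborel (\<lambda>z. \<eta> j (- z)) \<Phi> y) * norm (s y)"
        using Cauchy_Schwarz_ineq2 by simp
      also have "\<dots> \<le> C * norm (s y)"
        using conv_mollifier_norm_le[OF mr \<Phi>m \<Phi>(2)] by (intro mult_right_mono) auto
      finally show "norm (conv lborel (\<lambda>z. \<eta> j (- z)) \<Phi> y \<bullet> s y) \<le> C * norm (s y)" .
    qed
  qed (use s in auto)
  then show ?thesis by (simp add: adj)
qed

section \<open>The fractional divergence under convolution and multiplication\<close>

text \<open>The vector kernel \<open>z / |z|\<close> divided by \<open>|z|\<close> to the power \<open>n + \<alpha>\<close> that occurs in the fractional divergence.\<close>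

definition riesz_kernel :: "real \<Rightarrow> real^'n \<Rightarrow> real^'n" where
  "riesz_kernel \<alpha> z = (1 / (norm z powr (real CARD('n) + \<alpha>) * norm z)) *\<^sub>R z"

text \<open>The size of the kernel against the increment of a bounded Lipschitz function: the increment gains
  one power of \<open>|z|\<close> at the origin, where the kernel alone is not integrable.\<close>

definition kernel_majorant :: "real \<Rightarrow> real^'n \<Rightarrow> real" where
  "kernel_majorant \<alpha> z = min (norm z) 1 * norm z powr (- (real CARD('n) + \<alpha>))"

lemma borel_measurable_riesz_kernel[measurable]: "riesz_kernel \<alpha> \<in> borel_measurable borel"
  unfolding riesz_kernel_def[abs_def] by measurable

lemma borel_measurable_kernel_majorant[measurable]: "kernel_majorant \<alpha> \<in> borel_measurable borel"
  unfolding kernel_majorant_def[abs_def] by measurable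

lemma kernel_majorant_nonneg: "0 \<le> kernel_majorant \<alpha> z"
  by (simp add: kernel_majorant_def)

lemma norm_riesz_kernel: "norm (riesz_kernel \<alpha> z) \<le> norm z powr (- (real CARD('n) + \<alpha>))" for z :: "real^'n"
proof (cases "z = 0")
  case False
  then have "norm (riesz_kernel \<alpha> z) = 1 / norm z powr (real CARD('n) + \<alpha>)" by (simp add: riesz_kernel_def)
  then show ?thesis unfolding powr_minus_divide by simp
qed (simp add: riesz_kernel_def)

text \<open>On the dyadic shell with radii \<open>2\<^sup>j\<close> and \<open>2\<^sup>j\<^sup>+\<^sup>1\<close> the majorant is bounded by a constant, and the product
  of this constant with the volume of the ball decays geometrically, with ratio \<open>2 powr (- \<alpha>)\<close> towards
  infinity and \<open>2 powr (\<alpha> - 1)\<close> towards the origin. Both bounds on \<open>\<alpha>\<close> enter here.\<close>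

lemma kernel_majorant_integrable:
  assumes \<alpha>: "0 < \<alpha>" "\<alpha> < 1"
  shows "integrable lborel (kernel_majorant \<alpha> :: real^'n \<Rightarrow> real)"
proof -
  define n where "n = real CARD('n)"
  have n1: "n \<ge> 1" unfolding n_def using zero_less_card_finite[where 'a='n] by linarith
  define a where "a k = 2 powr (- (real k) * (n + \<alpha>))" for k :: nat
  define b where "b k = 2 powr ((real k + 1) * (n + \<alpha> - 1))" for k :: nat
  define A where "A k = ball (0::real^'n) (2 powr (real k + 1))" for k :: nat
  define B where "B k = ball (0::real^'n) (2 powr (- real k))" for k :: nat
  define C where "C = unit_ball_vol n"
  have C: "C \<ge> 0" by (simp add: C_def n_def)
  have [measurable]: "A k \<in> sets borel" "B k \<in> sets borel" for k by (simp_all add: A_def B_def)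
  have vol: "emeasure lborel (ball (0::real^'n) (2 powr t)) = ennreal (C * 2 powr (t * n))" for t
    by (simp add: emeasure_ball C_def n_def powr_realpow[symmetric] powr_powr)
  have pt: "kernel_majorant \<alpha> z \<le> (\<Sum>k. ennreal (a k) * indicator (A k) z + ennreal (b k) * indicator (B k) z)" for z :: "real^'n"
  proof (cases "z = 0")
    case True then show ?thesis by (simp add: kernel_majorant_def)
  next
    case False
    \<comment> \<open>the shell that contains \<open>z\<close>\<close>
    define j where "j = \<lfloor>log 2 (norm z)\<rfloor>"
    have j: "2 powr j \<le> norm z" "norm z < 2 powr (j + 1)"
      using floor_log_eq_powr_iff[of "norm z" 2 j] False by (auto simp: j_def)
    have trm: "g k \<le> (\<Sum>k. g k)" for g :: "nat \<Rightarrow> ennreal" and k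
      using sum_le_suminf[of g "{k}"] by (simp add: summableI)
    show ?thesis
    proof (cases "j \<ge> 0")
      case True
      define k where "k = nat j"
      have kj: "real k = j" using True by (simp add: k_def)
      have "kernel_majorant \<alpha> z \<le> norm z powr (- (n + \<alpha>))"
        unfolding kernel_majorant_def n_def by (intro mult_left_le_one_le) auto
      also have "\<dots> \<le> (2 powr j) powr (- (n + \<alpha>))"
        using j(1) n1 \<alpha> by (intro powr_mono2') auto
      also have "\<dots> = a k" by (simp add: a_def powr_powr kj algebra_simps)
      finally have "ennreal (kernel_majorant \<alpha> z) \<le> ennreal (a k) * indicator (A k) z + ennreal (b k) * indicator (B k) z"
        using j(2) kj by (simp add: A_def dist_norm ennreal_leI add_increasing2)
      then show ?thesis using trm[of "\<lambda>k. ennreal (a k) * indicator (A k) z + ennreal (b k) * indicator (B k) z" k] by (rule order_trans)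
    next
      case False
      define k where "k = nat (- j - 1)"
      have kj: "real k = - j - 1" using False by (simp add: k_def)
      have "kernel_majorant \<alpha> z \<le> norm z powr 1 * norm z powr (- (n + \<alpha>))"
        unfolding kernel_majorant_def n_def using \<open>z \<noteq> 0\<close> by (intro mult_right_mono) auto
      also have "\<dots> = norm z powr (- (n + \<alpha> - 1))" by (simp only: powr_add[symmetric]) (simp add: algebra_simps)
      also have "\<dots> \<le> (2 powr j) powr (- (n + \<alpha> - 1))"
        using j(1) n1 \<alpha> by (intro powr_mono2') auto
      also have "\<dots> = b k" by (simp add: b_def powr_powr kj algebra_simps)
      finally have kb: "kernel_majorant \<alpha> z \<le> b k" .
      have "ennreal (kernel_majorant \<alpha> z) \<le> ennreal (a k) * indicator (A k) z + ennreal (b k) * indicator (B k) z"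
      proof -
        have "z \<in> B k" using j(2) kj by (simp add: B_def dist_norm add.commute)
        then show ?thesis using kb by (simp add: ennreal_leI add_increasing)
      qed
      then show ?thesis using trm[of "\<lambda>k. ennreal (a k) * indicator (A k) z + ennreal (b k) * indicator (B k) z" k] by (rule order_trans)
    qed
  qed
  have "(\<integral>\<^sup>+z. ennreal (norm (kernel_majorant \<alpha> (z::real^'n))) \<partial>lborel)
      \<le> (\<integral>\<^sup>+z. (\<Sum>k. ennreal (a k) * indicator (A k) z + ennreal (b k) * indicator (B k) z) \<partial>lborel)"
    using pt by (intro nn_integral_mono) (simp only: real_norm_def abs_of_nonneg[OF kernel_majorant_nonneg])
  also have "\<dots> = (\<Sum>k. \<integral>\<^sup>+z. ennreal (a k) * indicator (A k) z + ennreal (b k) * indicator (B k) z \<partial>lborel)"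
    by (intro nn_integral_suminf) measurable
  also have "\<dots> = (\<Sum>k. ennreal (a k) * emeasure lborel (A k) + ennreal (b k) * emeasure lborel (B k))"
    by (intro suminf_cong) (simp add: nn_integral_add nn_integral_cmult_indicator)
  also have "\<dots> = (\<Sum>k. ennreal (C * 2 powr n * (2 powr (- \<alpha>)) ^ k + C * 2 powr (n + \<alpha> - 1) * (2 powr (\<alpha> - 1)) ^ k))"
  proof (intro suminf_cong)
    fix k :: nat
    have 1: "a k * (C * 2 powr ((real k + 1) * n)) = C * 2 powr n * (2 powr (- \<alpha>)) ^ k"
      by (simp add: a_def powr_realpow[symmetric] powr_powr powr_add[symmetric] algebra_simps)
    have 2: "b k * (C * 2 powr (- real k * n)) = C * 2 powr (n + \<alpha> - 1) * (2 powr (\<alpha> - 1)) ^ k"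
      by (simp add: b_def powr_realpow[symmetric] powr_powr powr_add[symmetric] algebra_simps)
    have ab: "0 \<le> a k" "0 \<le> b k" by (simp_all add: a_def b_def)
    have "ennreal (a k) * emeasure lborel (A k) + ennreal (b k) * emeasure lborel (B k)
        = ennreal (a k * (C * 2 powr ((real k + 1) * n))) + ennreal (b k * (C * 2 powr (- real k * n)))"
      unfolding A_def B_def vol using ab C by (simp add: ennreal_mult)
    also have "\<dots> = ennreal (a k * (C * 2 powr ((real k + 1) * n)) + b k * (C * 2 powr (- real k * n)))"
      using ab C by (intro ennreal_plus[symmetric]) auto
    finally show "ennreal (a k) * emeasure lborel (A k) + ennreal (b k) * emeasure lborel (B k)
        = ennreal (C * 2 powr n * (2 powr (- \<alpha>)) ^ k + C * 2 powr (n + \<alpha> - 1) * (2 powr (\<alpha> - 1)) ^ k)"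
      unfolding 1 2 .
  qed
  also have "\<dots> < \<infinity>"
  proof -
    have "2 powr (- \<alpha>) < 2 powr (0::real)" "2 powr (\<alpha> - 1) < 2 powr (0::real)"
      using \<alpha> by (intro powr_less_mono; simp)+
    then have "summable (\<lambda>k. C * 2 powr n * (2 powr (- \<alpha>)) ^ k + C * 2 powr (n + \<alpha> - 1) * (2 powr (\<alpha> - 1)) ^ k)"
      by (intro summable_add summable_mult summable_geometric) auto
    then show ?thesis using C by (subst suminf_ennreal2) auto
  qed
  finally show ?thesis by (intro integrableI_bounded) (auto simp: borel_measurable_kernel_majorant)
qed

lemma kernel_difference_bound:
  fixes F :: "real^'n \<Rightarrow> 'b::real_normed_vector"
  assumes L: "\<And>x y. norm (F x - F y) \<le> L * norm (x - y)" and B: "\<And>x. norm (F x) \<le> B"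
  shows "norm (F (x + z) - F x) * norm (riesz_kernel \<alpha> z) \<le> (L + 2 * B) * kernel_majorant \<alpha> z"
proof -
  have L0: "0 \<le> L * norm (x - y)" for x y :: "real^'n" using L[of x y] norm_ge_zero order_trans by blast
  have L1: "0 \<le> L" using L0[of "axis undefined 1" 0] by (simp add: zero_le_mult_iff)
  have B0: "0 \<le> B" using B[of 0] norm_ge_zero order_trans by blast
  have 1: "norm (F (x + z) - F x) \<le> L * norm z" using L[of "x + z" x] by simp
  have 2: "norm (F (x + z) - F x) \<le> 2 * B" using norm_triangle_ineq4[of "F (x + z)" "F x"] B[of "x + z"] B[of x] by linarith
  have "norm (F (x + z) - F x) \<le> (L + 2 * B) * min (norm z) 1"
  proof (cases "norm z \<le> 1")
    case True
    have "L * norm z \<le> (L + 2 * B) * norm z" using B0 by (intro mult_right_mono) auto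
    then show ?thesis using 1 True by simp
  next
    case False then show ?thesis using 2 L1 by simp
  qed
  then have "norm (F (x + z) - F x) * norm (riesz_kernel \<alpha> z)
      \<le> ((L + 2 * B) * min (norm z) 1) * norm z powr (- (real CARD('n) + \<alpha>))"
    using L1 B0 by (intro mult_mono norm_riesz_kernel) auto
  then show ?thesis by (simp add: kernel_majorant_def mult.assoc)
qed

lemma frac_div_eq:
  fixes \<phi> :: "real^'n \<Rightarrow> real^'n"
  assumes "continuous_on UNIV \<phi>"
  shows "frac_div \<alpha> \<phi> x = frac_const CARD('n) \<alpha> * (\<integral>z. (\<phi> (x + z) - \<phi> x) \<bullet> riesz_kernel \<alpha> z \<partial>lborel)"
proof -
  have [measurable]: "\<phi> \<in> borel_measurable borel" by (rule borel_measurable_continuous_onI[OF assms])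
  have e: "((\<phi> y - \<phi> x) /\<^sub>R (norm (y - x) powr (real CARD('n) + \<alpha>))) \<bullet> ((y - x) /\<^sub>R norm (y - x))
     = (\<phi> y - \<phi> x) \<bullet> riesz_kernel \<alpha> (y - x)" for y
    by (simp add: riesz_kernel_def divide_inverse mult_ac)
  have m: "(\<lambda>y. (\<phi> y - \<phi> x) \<bullet> riesz_kernel \<alpha> (y - x)) \<in> borel_measurable borel" by measurable
  have "(\<integral>y. (\<phi> y - \<phi> x) \<bullet> riesz_kernel \<alpha> (y - x) \<partial>lebesgue) = (\<integral>y. (\<phi> y - \<phi> x) \<bullet> riesz_kernel \<alpha> (y - x) \<partial>lborel)"
    by (rule integral_completion) (use m in simp)
  also have "\<dots> = (\<integral>z. (\<phi> (x + z) - \<phi> x) \<bullet> riesz_kernel \<alpha> z \<partial>lborel)"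
    using lborel_integral_affine[OF _ m, of 1 x] by simp
  finally show ?thesis unfolding frac_div_def e by simp
qed

lemma kernel_product_integrable:
  fixes \<alpha> :: real and \<phi> :: "real^'n \<Rightarrow> real^'n"
  assumes \<alpha>: "0 < \<alpha>" "\<alpha> < 1" and \<phi>: "\<phi> \<in> borel_measurable borel"
    and L: "\<And>x y. norm (\<phi> x - \<phi> y) \<le> L * norm (x - y)" and B: "\<And>x. norm (\<phi> x) \<le> B"
  shows "integrable lborel (\<lambda>z. (\<phi> (x + z) - \<phi> x) \<bullet> riesz_kernel \<alpha> z)"
    and "norm (\<integral>z. (\<phi> (x + z) - \<phi> x) \<bullet> riesz_kernel \<alpha> z \<partial>lborel) \<le> (L + 2 * B) * (\<integral>z. kernel_majorant \<alpha> (z::real^'n) \<partial>lborel)"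
proof -
  note [measurable] = \<phi>
  have i: "integrable lborel (\<lambda>z::real^'n. (L + 2 * B) * kernel_majorant \<alpha> z)"
    using kernel_majorant_integrable[OF \<alpha>] by (intro integrable_mult_right)
  have b: "norm ((\<phi> (x + z) - \<phi> x) \<bullet> riesz_kernel \<alpha> z) \<le> (L + 2 * B) * kernel_majorant \<alpha> z" for z
    unfolding real_norm_def
    by (rule order_trans[OF Cauchy_Schwarz_ineq2 kernel_difference_bound[OF L B]])
  show I: "integrable lborel (\<lambda>z. (\<phi> (x + z) - \<phi> x) \<bullet> riesz_kernel \<alpha> z)"
    by (rule Bochner_Integration.integrable_bound[OF i]) (measurable, use b in \<open>auto intro!: order_trans[OF b[unfolded real_norm_def]]\<close>)
  have "norm (\<integral>z. (\<phi> (x + z) - \<phi> x) \<bullet> riesz_kernel \<alpha> z \<partial>lborel) \<le> (\<integral>z. norm ((\<phi> (x + z) - \<phi> x) \<bullet> riesz_kernel \<alpha> z) \<partial>lborel)"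
    by (rule integral_norm_bound)
  also have "\<dots> \<le> (\<integral>z. (L + 2 * B) * kernel_majorant \<alpha> (z::real^'n) \<partial>lborel)"
    by (rule integral_mono[OF integrable_norm[OF I] i b])
  finally show "norm (\<integral>z. (\<phi> (x + z) - \<phi> x) \<bullet> riesz_kernel \<alpha> z \<partial>lborel) \<le> (L + 2 * B) * (\<integral>z. kernel_majorant \<alpha> (z::real^'n) \<partial>lborel)"
    by simp
qed

lemma Cc_infinity_bounds:
  fixes f :: "'a::euclidean_space \<Rightarrow> 'b::euclidean_space"
  assumes "f \<in> Cc_infinity UNIV"
  obtains L B where "L > 0" "B > 0" "\<And>x y. norm (f x - f y) \<le> L * norm (x - y)" "\<And>x. norm (f x) \<le> B"
    "f \<in> borel_measurable borel" "continuous_on UNIV f"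
proof -
  obtain L where L: "L > 0" "\<And>x y. norm (f x - f y) \<le> L * norm (x - y)" by (rule Cc_infinity_lipschitz[OF assms]) (rule that)
  obtain B where B: "B > 0" "\<And>x. norm (f x) \<le> B" by (rule Cc_infinity_bounded[OF assms]) (rule that)
  have c: "continuous_on UNIV f" by (rule Cc_continuous[OF assms])
  show ?thesis by (rule that[OF L(1) B(1) L(2) B(2) borel_measurable_continuous_onI[OF c] c])
qed

lemma frac_div_bounded:
  fixes \<phi> :: "real^'n \<Rightarrow> real^'n"
  assumes \<alpha>: "0 < \<alpha>" "\<alpha> < 1" and \<phi>: "\<phi> \<in> Cc_infinity UNIV"
  shows "\<exists>C. \<forall>x. \<bar>frac_div \<alpha> \<phi> x\<bar> \<le> C" and "frac_div \<alpha> \<phi> \<in> borel_measurable borel"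
proof -
  obtain L B where b: "L > 0" "B > 0" "\<And>x y. norm (\<phi> x - \<phi> y) \<le> L * norm (x - y)" "\<And>x. norm (\<phi> x) \<le> B"
    and m[measurable]: "\<phi> \<in> borel_measurable borel" and c: "continuous_on UNIV \<phi>" by (rule Cc_infinity_bounds[OF \<phi>]) (rule that)
  show "\<exists>C. \<forall>x. \<bar>frac_div \<alpha> \<phi> x\<bar> \<le> C"
  proof (intro exI allI)
    fix x
    show "\<bar>frac_div \<alpha> \<phi> x\<bar> \<le> \<bar>frac_const CARD('n) \<alpha>\<bar> * ((L + 2 * B) * (\<integral>z. kernel_majorant \<alpha> (z::real^'n) \<partial>lborel))"
      unfolding frac_div_eq[OF c] abs_mult
      using kernel_product_integrable(2)[OF \<alpha> m b(3,4), of x] by (intro mult_left_mono) auto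
  qed
  show "frac_div \<alpha> \<phi> \<in> borel_measurable borel"
    unfolding frac_div_eq[OF c, abs_def] by measurable
qed

lemma integrable_pair_product:
  fixes f g :: "'a::euclidean_space \<Rightarrow> real"
  assumes f: "integrable lborel f" and g: "integrable lborel g"
  shows "integrable (lborel \<Otimes>\<^sub>M lborel) (\<lambda>(x, y). f x * g y)"
proof (rule lborel_pair.Fubini_integrable)
  have [measurable]: "f \<in> borel_measurable borel" "g \<in> borel_measurable borel" using f g by auto
  show "(\<lambda>(x, y). f x * g y) \<in> borel_measurable (lborel \<Otimes>\<^sub>M lborel)" by measurable
  show "integrable lborel (\<lambda>x. \<integral>y. norm (case (x, y) of (x, y) \<Rightarrow> f x * g y) \<partial>lborel)"
    using f by (simp add: abs_mult)
  show "AE x in lborel. integrable lborel (\<lambda>y. case (x, y) of (x, y) \<Rightarrow> f x * g y)"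
    using g by simp
qed

lemma conv_Cc_Cc:
  fixes \<phi> :: "'a::euclidean_space \<Rightarrow> 'b::euclidean_space"
  assumes \<eta>: "\<eta> \<in> Cc_infinity UNIV" and \<phi>: "\<phi> \<in> Cc_infinity UNIV"
  shows "conv lborel \<eta> \<phi> \<in> Cc_infinity UNIV"
proof -
  obtain R1 where R1: "\<And>z. \<eta> z \<noteq> 0 \<Longrightarrow> norm z \<le> R1"
    using \<eta> unfolding Cc_infinity_UNIV bounded_iff by blast
  obtain R2 where R2: "\<And>z. \<phi> z \<noteq> 0 \<Longrightarrow> norm z \<le> R2"
    using \<phi> unfolding Cc_infinity_UNIV bounded_iff by blast
  show ?thesis
  proof (rule conv_Cc_infinity[OF sets_lborel Cc_integrable[OF \<phi>] \<eta> compact_cball[of 0 "R1 + R2"]])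
    fix x y assume "\<eta> (x - y) \<noteq> 0" "\<phi> y \<noteq> 0"
    then have "norm (x - y) \<le> R1" "norm y \<le> R2" using R1 R2 by auto
    then show "x \<in> cball 0 (R1 + R2)" using norm_triangle_sub[of x y] by (simp add: dist_norm)
  qed simp
qed

text \<open>The fractional divergence is an integral over translations, so it commutes with convolution. The
  majorant justifies exchanging the two integrals.\<close>

lemma frac_div_conv:
  fixes \<phi> :: "real^'n \<Rightarrow> real^'n"
  assumes \<alpha>: "0 < \<alpha>" "\<alpha> < 1" and \<phi>: "\<phi> \<in> Cc_infinity UNIV" and \<eta>: "\<eta> \<in> Cc_infinity UNIV"
  shows "frac_div \<alpha> (conv lborel \<eta> \<phi>) x = conv lborel \<eta> (frac_div \<alpha> \<phi>) x"
proof -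
  obtain L B where b: "L > 0" "B > 0" "\<And>x y. norm (\<phi> x - \<phi> y) \<le> L * norm (x - y)" "\<And>x. norm (\<phi> x) \<le> B"
    and m[measurable]: "\<phi> \<in> borel_measurable borel" and c: "continuous_on UNIV \<phi>" by (rule Cc_infinity_bounds[OF \<phi>]) (rule that)
  have \<eta>i: "integrable lborel \<eta>" by (rule Cc_integrable[OF \<eta>])
  then have \<eta>m[measurable]: "\<eta> \<in> borel_measurable borel" by auto
  have ic: "integrable lborel (\<lambda>w. \<eta> w *\<^sub>R \<phi> (y - w))" for y
  proof (rule Bochner_Integration.integrable_bound)
    show "integrable lborel (\<lambda>w. B * \<eta> w)" using \<eta>i by simp
    show "AE w in lborel. norm (\<eta> w *\<^sub>R \<phi> (y - w)) \<le> norm (B * \<eta> w)"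
    proof (intro AE_I2)
      fix w
      have "\<bar>\<eta> w\<bar> * norm (\<phi> (y - w)) \<le> \<bar>\<eta> w\<bar> * B" by (intro mult_left_mono b) simp
      then show "norm (\<eta> w *\<^sub>R \<phi> (y - w)) \<le> norm (B * \<eta> w)"
        using b(2) by (simp add: abs_mult mult.commute)
    qed
  qed measurable
  define H where "H w z = \<eta> w * ((\<phi> (x - w + z) - \<phi> (x - w)) \<bullet> riesz_kernel \<alpha> z)" for w z
  have HI: "integrable (lborel \<Otimes>\<^sub>M lborel) (\<lambda>(w, z). H w z)"
  proof (rule Bochner_Integration.integrable_bound)
    show "integrable (lborel \<Otimes>\<^sub>M lborel) (\<lambda>(w, z::real^'n). \<eta> w * ((L + 2 * B) * kernel_majorant \<alpha> z))"
      by (rule integrable_pair_product[OF \<eta>i]) (intro integrable_mult_right kernel_majorant_integrable[OF \<alpha>])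
    show "(\<lambda>(w, z). H w z) \<in> borel_measurable (lborel \<Otimes>\<^sub>M lborel)" unfolding H_def by measurable
    have "norm (H w z) \<le> norm (\<eta> w * ((L + 2 * B) * kernel_majorant \<alpha> z))" for w z
    proof -
      have "\<bar>(\<phi> (x - w + z) - \<phi> (x - w)) \<bullet> riesz_kernel \<alpha> z\<bar> \<le> (L + 2 * B) * kernel_majorant \<alpha> z"
        by (rule order_trans[OF Cauchy_Schwarz_ineq2 kernel_difference_bound[OF b(3,4)]])
      then have "\<bar>(\<phi> (x - w + z) - \<phi> (x - w)) \<bullet> riesz_kernel \<alpha> z\<bar> \<le> \<bar>(L + 2 * B) * kernel_majorant \<alpha> z\<bar>" by linarith
      then show ?thesis by (simp only: H_def abs_mult real_norm_def) (intro mult_left_mono, auto simp: abs_mult)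
    qed
    then show "AE p in lborel \<Otimes>\<^sub>M lborel. norm (case p of (w, z) \<Rightarrow> H w z) \<le> norm (case p of (w, z) \<Rightarrow> \<eta> w * ((L + 2 * B) * kernel_majorant \<alpha> z))"
      by (intro AE_I2) (simp split: prod.split)
  qed
  have inner: "(conv lborel \<eta> \<phi> (x + z) - conv lborel \<eta> \<phi> x) \<bullet> riesz_kernel \<alpha> z = (\<integral>w. H w z \<partial>lborel)" for z
  proof -
    have "conv lborel \<eta> \<phi> (x + z) - conv lborel \<eta> \<phi> x = (\<integral>w. \<eta> w *\<^sub>R \<phi> (x + z - w) - \<eta> w *\<^sub>R \<phi> (x - w) \<partial>lborel)"
      unfolding conv_commute[OF \<eta>m m] by (rule Bochner_Integration.integral_diff[symmetric]) (rule ic)+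
    moreover have "integrable lborel (\<lambda>w. \<eta> w *\<^sub>R \<phi> (x + z - w) - \<eta> w *\<^sub>R \<phi> (x - w))"
      by (intro Bochner_Integration.integrable_diff ic)
    ultimately have "(conv lborel \<eta> \<phi> (x + z) - conv lborel \<eta> \<phi> x) \<bullet> riesz_kernel \<alpha> z
       = (\<integral>w. (\<eta> w *\<^sub>R \<phi> (x + z - w) - \<eta> w *\<^sub>R \<phi> (x - w)) \<bullet> riesz_kernel \<alpha> z \<partial>lborel)"
      by (simp only: integral_inner_left[symmetric])
    also have "\<dots> = (\<integral>w. H w z \<partial>lborel)"
      unfolding H_def by (simp only: scaleR_diff_right[symmetric] inner_scaleR_left add_diff_eq diff_add_eq)
    finally show ?thesis .
  qed
  have "frac_div \<alpha> (conv lborel \<eta> \<phi>) x = frac_const CARD('n) \<alpha> * (\<integral>z. (\<integral>w. H w z \<partial>lborel) \<partial>lborel)"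
    unfolding frac_div_eq[OF Cc_continuous[OF conv_Cc_Cc[OF \<eta> \<phi>]]] inner ..
  also have "(\<integral>z. (\<integral>w. H w z \<partial>lborel) \<partial>lborel) = (\<integral>w. (\<integral>z. H w z \<partial>lborel) \<partial>lborel)"
    by (rule lborel_pair.Fubini_integral[OF HI])
  also have "frac_const CARD('n) \<alpha> * \<dots> = (\<integral>w. \<eta> w *\<^sub>R frac_div \<alpha> \<phi> (x - w) \<partial>lborel)"
    unfolding H_def frac_div_eq[OF c] by (simp add: mult.left_commute[of _ "frac_const CARD('n) \<alpha>"])
  also have "\<dots> = conv lborel \<eta> (frac_div \<alpha> \<phi>) x"
    by (rule conv_commute[OF \<eta>m frac_div_bounded(2)[OF \<alpha> \<phi>], symmetric])
  finally show ?thesis .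
qed

text \<open>Says that the fractional derivative of \<open>u\<close> acts on test fields as the functional \<open>\<Lambda>\<close>. Leaving \<open>\<Lambda>\<close>
  arbitrary makes it possible to transform \<open>u\<close> first and to identify the measure behind \<open>\<Lambda>\<close> afterwards.
  Here \<open>u\<close> is a Borel representative, so that Fubini's theorem applies.\<close>

definition frac_pairing :: "real \<Rightarrow> (real^'n \<Rightarrow> real) \<Rightarrow> ((real^'n \<Rightarrow> real^'n) \<Rightarrow> real) \<Rightarrow> bool" where
  "frac_pairing \<alpha> u \<Lambda> \<longleftrightarrow> integrable lborel u \<and>
     (\<forall>\<phi>\<in>Cc_infinity UNIV. (\<integral>x. u x * frac_div \<alpha> \<phi> x \<partial>lborel) = - \<Lambda> \<phi>)"

lemma frac_pairing_integrable:
  fixes \<phi> :: "real^'n \<Rightarrow> real^'n"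
  assumes \<alpha>: "0 < \<alpha>" "\<alpha> < 1" and \<phi>: "\<phi> \<in> Cc_infinity UNIV" and u: "integrable lborel u"
  shows "integrable lborel (\<lambda>x. u x * frac_div \<alpha> \<phi> x)"
proof -
  obtain C where C: "\<And>x. \<bar>frac_div \<alpha> \<phi> x\<bar> \<le> C" using frac_div_bounded(1)[OF \<alpha> \<phi>] by blast
  show ?thesis using integrable_scaleR_bounded[OF u _ C] frac_div_bounded(2)[OF \<alpha> \<phi>] by (simp add: mult.commute)
qed

lemma frac_pairing_add:
  fixes u v :: "real^'n \<Rightarrow> real"
  assumes \<alpha>: "0 < \<alpha>" "\<alpha> < 1" and "frac_pairing \<alpha> u \<Lambda>" "frac_pairing \<alpha> v \<Lambda>'"
  shows "frac_pairing \<alpha> (\<lambda>x. u x + v x) (\<lambda>\<phi>. \<Lambda> \<phi> + \<Lambda>' \<phi>)"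
  unfolding frac_pairing_def
proof (intro conjI ballI)
  have i: "integrable lborel u" "integrable lborel v" using assms(3,4) by (simp_all add: frac_pairing_def)
  then show "integrable lborel (\<lambda>x. u x + v x)" by simp
  fix \<phi> :: "real^'n \<Rightarrow> real^'n" assume \<phi>: "\<phi> \<in> Cc_infinity UNIV"
  have "(\<integral>x. (u x + v x) * frac_div \<alpha> \<phi> x \<partial>lborel) = (\<integral>x. u x * frac_div \<alpha> \<phi> x \<partial>lborel) + (\<integral>x. v x * frac_div \<alpha> \<phi> x \<partial>lborel)"
    unfolding distrib_right
    by (rule Bochner_Integration.integral_add[OF frac_pairing_integrable[OF \<alpha> \<phi> i(1)] frac_pairing_integrable[OF \<alpha> \<phi> i(2)]])
  then show "(\<integral>x. (u x + v x) * frac_div \<alpha> \<phi> x \<partial>lborel) = - (\<Lambda> \<phi> + \<Lambda>' \<phi>)"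
    using assms(3,4) \<phi> by (simp add: frac_pairing_def)
qed

text \<open>Mollifying \<open>u\<close> amounts to mollifying the test field with the reflected kernel, because the
  fractional divergence commutes with convolution.\<close>

lemma frac_pairing_conv:
  fixes u :: "real^'n \<Rightarrow> real"
  assumes \<alpha>: "0 < \<alpha>" "\<alpha> < 1" and u: "frac_pairing \<alpha> u \<Lambda>" and m: "mollifier \<eta> a r"
  shows "frac_pairing \<alpha> (conv lborel \<eta> u) (\<lambda>\<phi>. \<Lambda> (conv lborel (\<lambda>z. \<eta> (- z)) \<phi>))"
  unfolding frac_pairing_def
proof (intro conjI ballI)
  have ui: "integrable lborel u" using u by (simp add: frac_pairing_def)
  have \<eta>i: "integrable lborel \<eta>" by (rule Cc_integrable) (use m in \<open>simp add: mollifier_def\<close>)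
  show "integrable lborel (conv lborel \<eta> u)"
    by (rule conv_integrable[OF lborel.sigma_finite_measure_axioms sets_lborel \<eta>i ui])
  fix \<phi> :: "real^'n \<Rightarrow> real^'n" assume \<phi>: "\<phi> \<in> Cc_infinity UNIV"
  note mr = mollifier_reflect[OF m]
  have \<eta>r: "(\<lambda>z. \<eta> (- z)) \<in> Cc_infinity UNIV" using mr by (simp add: mollifier_def)
  obtain B where B: "\<And>z. \<bar>\<eta> z\<bar> \<le> B" using mollifierD(7)[OF m] by blast
  obtain C where C: "\<And>x. \<bar>frac_div \<alpha> \<phi> x\<bar> \<le> C" using frac_div_bounded(1)[OF \<alpha> \<phi>] by blast
  have "(\<integral>x. conv lborel \<eta> u x * frac_div \<alpha> \<phi> x \<partial>lborel) = (\<integral>x. frac_div \<alpha> \<phi> x \<bullet> conv lborel \<eta> u x \<partial>lborel)"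
    by (simp add: mult.commute)
  also have "\<dots> = (\<integral>y. conv lborel (\<lambda>z. \<eta> (- z)) (frac_div \<alpha> \<phi>) y \<bullet> u y \<partial>lborel)"
    by (rule conv_adjoint[OF lborel.sigma_finite_measure_axioms sets_lborel \<eta>i B ui frac_div_bounded(2)[OF \<alpha> \<phi>]])
      (use C in simp)
  also have "\<dots> = (\<integral>y. u y * frac_div \<alpha> (conv lborel (\<lambda>z. \<eta> (- z)) \<phi>) y \<partial>lborel)"
    unfolding frac_div_conv[OF \<alpha> \<phi> \<eta>r] by (simp add: mult.commute)
  also have "\<dots> = - \<Lambda> (conv lborel (\<lambda>z. \<eta> (- z)) \<phi>)"
    using u conv_Cc_Cc[OF \<eta>r \<phi>] by (simp add: frac_pairing_def)
  finally show "(\<integral>x. conv lborel \<eta> u x * frac_div \<alpha> \<phi> x \<partial>lborel) = - \<Lambda> (conv lborel (\<lambda>z. \<eta> (- z)) \<phi>)" .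
qed

text \<open>The commutator of the fractional gradient with multiplication by \<open>\<beta>\<close>. For a bounded Lipschitz
  \<open>\<beta>\<close> it is an integrable function even if \<open>u\<close> has no derivative at all.\<close>

definition nonlocal_gradient :: "real \<Rightarrow> (real^'n \<Rightarrow> real) \<Rightarrow> (real^'n \<Rightarrow> real) \<Rightarrow> real^'n \<Rightarrow> real^'n" where
  "nonlocal_gradient \<alpha> \<beta> u y = frac_const CARD('n) \<alpha> *\<^sub>R
     (\<integral>x. (u x * (\<beta> y - \<beta> x)) *\<^sub>R riesz_kernel \<alpha> (y - x) \<partial>lborel)"

text \<open>The integrand is dominated by the convolution of \<open>|u|\<close> with the integrable majorant of the kernel.\<close>

lemma nonlocal_pair_integrable:
  fixes u \<beta> :: "real^'n \<Rightarrow> real"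
  assumes \<alpha>: "0 < \<alpha>" "\<alpha> < 1" and u: "integrable lborel u"
    and L: "\<And>x y. norm (\<beta> x - \<beta> y) \<le> L * norm (x - y)" and B: "\<And>x. norm (\<beta> x) \<le> B"
    and \<beta>[measurable]: "\<beta> \<in> borel_measurable borel"
  shows "integrable (lborel \<Otimes>\<^sub>M lborel) (\<lambda>(x, y). (u x * (\<beta> y - \<beta> x)) *\<^sub>R riesz_kernel \<alpha> (y - x))"
proof (rule Bochner_Integration.integrable_bound)
  have [measurable]: "u \<in> borel_measurable borel" using u by auto
  have "integrable lborel (\<lambda>z::real^'n. (L + 2 * B) * kernel_majorant \<alpha> z)"
    by (intro integrable_mult_right kernel_majorant_integrable[OF \<alpha>])
  from conv_pair_integrable[OF lborel.sigma_finite_measure_axioms sets_lborel this u]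
  show "integrable (lborel \<Otimes>\<^sub>M lborel) (\<lambda>(x, y). ((L + 2 * B) * kernel_majorant \<alpha> (y - x)) *\<^sub>R u x)" .
  show "(\<lambda>(x, y). (u x * (\<beta> y - \<beta> x)) *\<^sub>R riesz_kernel \<alpha> (y - x)) \<in> borel_measurable (lborel \<Otimes>\<^sub>M lborel)"
    by measurable
  have "norm ((u x * (\<beta> y - \<beta> x)) *\<^sub>R riesz_kernel \<alpha> (y - x)) \<le> norm (((L + 2 * B) * kernel_majorant \<alpha> (y - x)) *\<^sub>R u x)" for x y
  proof -
    have "norm (\<beta> (x + (y - x)) - \<beta> x) * norm (riesz_kernel \<alpha> (y - x)) \<le> (L + 2 * B) * kernel_majorant \<alpha> (y - x)"
      by (rule kernel_difference_bound[OF L B])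
    then have "\<bar>\<beta> y - \<beta> x\<bar> * norm (riesz_kernel \<alpha> (y - x)) \<le> \<bar>(L + 2 * B) * kernel_majorant \<alpha> (y - x)\<bar>" by simp
    then have "\<bar>u x\<bar> * (\<bar>\<beta> y - \<beta> x\<bar> * norm (riesz_kernel \<alpha> (y - x))) \<le> \<bar>u x\<bar> * \<bar>(L + 2 * B) * kernel_majorant \<alpha> (y - x)\<bar>"
      by (rule mult_left_mono) simp
    then show ?thesis by (simp add: abs_mult mult_ac)
  qed
  then show "AE p in lborel \<Otimes>\<^sub>M lborel. norm (case p of (x, y) \<Rightarrow> (u x * (\<beta> y - \<beta> x)) *\<^sub>R riesz_kernel \<alpha> (y - x))
      \<le> norm (case p of (x, y) \<Rightarrow> ((L + 2 * B) * kernel_majorant \<alpha> (y - x)) *\<^sub>R u x)"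
    by (intro AE_I2) (simp split: prod.split)
qed

lemma nonlocal_gradient_integrable:
  fixes u \<beta> :: "real^'n \<Rightarrow> real"
  assumes "0 < \<alpha>" "\<alpha> < 1" "integrable lborel u"
    "\<And>x y. norm (\<beta> x - \<beta> y) \<le> L * norm (x - y)" "\<And>x. norm (\<beta> x) \<le> B" "\<beta> \<in> borel_measurable borel"
  shows "integrable lborel (nonlocal_gradient \<alpha> \<beta> u)"
  unfolding nonlocal_gradient_def[abs_def]
  by (intro integrable_scaleR_right lborel_pair.integrable_snd nonlocal_pair_integrable[OF assms])

text \<open>The Leibniz rule. From \<open>\<beta> (x + z) \<phi> (x + z) - \<beta> x \<phi> x\<close> one separates \<open>\<beta> x (\<phi> (x + z) - \<phi> x)\<close>; the
  rest contains the increment of \<open>\<beta>\<close> and no derivative of \<open>\<phi>\<close>, and Fubini's theorem turns it into a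
  pairing of \<open>\<phi>\<close> with the nonlocal gradient.\<close>

lemma frac_pairing_mult:
  fixes u \<beta> :: "real^'n \<Rightarrow> real"
  assumes \<alpha>: "0 < \<alpha>" "\<alpha> < 1" and u: "frac_pairing \<alpha> u \<Lambda>" and \<beta>: "\<And>k. Ck k \<beta>"
    and L: "\<And>x y. norm (\<beta> x - \<beta> y) \<le> L * norm (x - y)" and B: "\<And>x. norm (\<beta> x) \<le> B"
  shows "frac_pairing \<alpha> (\<lambda>x. \<beta> x * u x)
    (\<lambda>\<phi>. \<Lambda> (\<lambda>x. \<beta> x *\<^sub>R \<phi> x) + (\<integral>x. \<phi> x \<bullet> nonlocal_gradient \<alpha> \<beta> u x \<partial>lborel))"
  unfolding frac_pairing_def
proof (intro conjI ballI)
  have ui: "integrable lborel u" using u by (simp add: frac_pairing_def)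
  have [measurable]: "u \<in> borel_measurable borel" using ui by auto
  have \<beta>c: "continuous_on UNIV \<beta>" using \<beta>[of 0] by simp
  have \<beta>m[measurable]: "\<beta> \<in> borel_measurable borel" by (rule borel_measurable_continuous_onI[OF \<beta>c])
  show "integrable lborel (\<lambda>x. \<beta> x * u x)"
    using integrable_scaleR_bounded[OF ui, of \<beta> B] B by simp
  fix \<phi> :: "real^'n \<Rightarrow> real^'n" assume \<phi>: "\<phi> \<in> Cc_infinity UNIV"
  obtain L' B' where b: "L' > 0" "B' > 0" "\<And>x y. norm (\<phi> x - \<phi> y) \<le> L' * norm (x - y)" "\<And>x. norm (\<phi> x) \<le> B'"
    and \<phi>m[measurable]: "\<phi> \<in> borel_measurable borel" and \<phi>c: "continuous_on UNIV \<phi>" by (rule Cc_infinity_bounds[OF \<phi>]) (rule that)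
  define \<psi> where "\<psi> x = \<beta> x *\<^sub>R \<phi> x" for x
  have \<psi>: "\<psi> \<in> Cc_infinity UNIV"
  proof -
    have "Ck k \<psi>" for k unfolding \<psi>_def[abs_def]
      by (rule Ck_scaleR[OF \<beta>]) (use \<phi> in \<open>simp add: Cc_infinity_UNIV\<close>)
    moreover have "{x. \<psi> x \<noteq> 0} \<subseteq> {x. \<phi> x \<noteq> 0}" by (auto simp: \<psi>_def)
    ultimately show ?thesis using \<phi> bounded_subset unfolding Cc_infinity_UNIV by blast
  qed
  obtain L'' B'' where b'': "L'' > 0" "B'' > 0" "\<And>x y. norm (\<psi> x - \<psi> y) \<le> L'' * norm (x - y)" "\<And>x. norm (\<psi> x) \<le> B''"
    and \<psi>m[measurable]: "\<psi> \<in> borel_measurable borel" and \<psi>c: "continuous_on UNIV \<psi>" by (rule Cc_infinity_bounds[OF \<psi>]) (rule that)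
  define c where "c = frac_const CARD('n) \<alpha>"
  \<comment> \<open>the commutator, tested against \<open>\<phi>\<close>\<close>
  define E where "E x = (\<integral>z. (\<beta> (x + z) - \<beta> x) * (\<phi> (x + z) \<bullet> riesz_kernel \<alpha> z) \<partial>lborel)" for x
  have split: "\<beta> x * frac_div \<alpha> \<phi> x = frac_div \<alpha> \<psi> x - c * E x" for x
  proof -
    have i1: "integrable lborel (\<lambda>z. (\<psi> (x + z) - \<psi> x) \<bullet> riesz_kernel \<alpha> z)"
      by (rule kernel_product_integrable(1)[OF \<alpha> \<psi>m b''(3,4)])
    have i2: "integrable lborel (\<lambda>z. \<beta> x * ((\<phi> (x + z) - \<phi> x) \<bullet> riesz_kernel \<alpha> z))"
      by (intro integrable_mult_right kernel_product_integrable(1)[OF \<alpha> \<phi>m b(3,4)])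
    have "\<beta> x * (\<integral>z. (\<phi> (x + z) - \<phi> x) \<bullet> riesz_kernel \<alpha> z \<partial>lborel)
      = (\<integral>z. \<beta> x * ((\<phi> (x + z) - \<phi> x) \<bullet> riesz_kernel \<alpha> z) \<partial>lborel)" by simp
    moreover have "E x = (\<integral>z. (\<psi> (x + z) - \<psi> x) \<bullet> riesz_kernel \<alpha> z - \<beta> x * ((\<phi> (x + z) - \<phi> x) \<bullet> riesz_kernel \<alpha> z) \<partial>lborel)"
      unfolding E_def by (intro Bochner_Integration.integral_cong refl) (simp add: \<psi>_def inner_diff_left algebra_simps)
    ultimately have "E x = (\<integral>z. (\<psi> (x + z) - \<psi> x) \<bullet> riesz_kernel \<alpha> z \<partial>lborel) - \<beta> x * (\<integral>z. (\<phi> (x + z) - \<phi> x) \<bullet> riesz_kernel \<alpha> z \<partial>lborel)"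
      using Bochner_Integration.integral_diff[OF i1 i2] by simp
    moreover have "e = p - b * q \<Longrightarrow> b * (c * q) = c * p - c * e" for e p b q :: real
      by (simp add: right_diff_distrib mult.left_commute)
    ultimately show ?thesis unfolding frac_div_eq[OF \<phi>c] frac_div_eq[OF \<psi>c] c_def[symmetric] by blast
  qed
  define G where "G x y = (u x * (\<beta> y - \<beta> x)) *\<^sub>R riesz_kernel \<alpha> (y - x)" for x y
  have GI: "integrable (lborel \<Otimes>\<^sub>M lborel) (\<lambda>(x, y). G x y)"
    unfolding G_def by (rule nonlocal_pair_integrable[OF \<alpha> ui L B \<beta>m])
  have PI: "integrable (lborel \<Otimes>\<^sub>M lborel) (\<lambda>(x, y). \<phi> y \<bullet> G x y)"
    using integrable_inner_bounded[OF GI, of "\<lambda>(x,y). \<phi> y" B'] b(4) by (simp add: case_prod_unfold)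
  have E: "u x * E x = (\<integral>y. \<phi> y \<bullet> G x y \<partial>lborel)" for x
  proof -
    have m: "(\<lambda>y. (\<beta> y - \<beta> x) * (\<phi> y \<bullet> riesz_kernel \<alpha> (y - x))) \<in> borel_measurable borel" by measurable
    have "E x = (\<integral>y. (\<beta> y - \<beta> x) * (\<phi> y \<bullet> riesz_kernel \<alpha> (y - x)) \<partial>lborel)"
      using lborel_integral_affine[OF _ m, of 1 x] by (simp add: E_def)
    then have "u x * E x = (\<integral>y. u x * ((\<beta> y - \<beta> x) * (\<phi> y \<bullet> riesz_kernel \<alpha> (y - x))) \<partial>lborel)" by simp
    also have "\<dots> = (\<integral>y. \<phi> y \<bullet> G x y \<partial>lborel)" by (simp add: G_def mult.assoc)
    finally show ?thesis .
  qed
  have uE: "integrable lborel (\<lambda>x. u x * E x)"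
    unfolding E by (rule lborel_pair.integrable_fst[OF PI])
  have nl: "c *\<^sub>R (\<integral>x. G x y \<partial>lborel) = nonlocal_gradient \<alpha> \<beta> u y" for y
    by (simp add: nonlocal_gradient_def G_def c_def)
  have "(\<integral>x. u x * E x \<partial>lborel) = (\<integral>y. (\<integral>x. \<phi> y \<bullet> G x y \<partial>lborel) \<partial>lborel)"
    unfolding E by (rule lborel_pair.Fubini_integral[OF PI, symmetric])
  also have "\<dots> = (\<integral>y. \<phi> y \<bullet> (\<integral>x. G x y \<partial>lborel) \<partial>lborel)"
  proof (rule integral_cong_AE)
    show "(\<lambda>y. \<integral>x. \<phi> y \<bullet> G x y \<partial>lborel) \<in> borel_measurable lborel"
      using lborel_pair.integrable_snd[OF PI] by auto
    show "(\<lambda>y. \<phi> y \<bullet> (\<integral>x. G x y \<partial>lborel)) \<in> borel_measurable lborel"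
      using borel_measurable_integrable[OF lborel_pair.integrable_snd[OF GI]] \<phi>m by (intro borel_measurable_inner) auto
    show "AE y in lborel. (\<integral>x. \<phi> y \<bullet> G x y \<partial>lborel) = \<phi> y \<bullet> (\<integral>x. G x y \<partial>lborel)"
      using lborel_pair.AE_integrable_snd[OF GI] by eventually_elim simp
  qed
  finally have FE: "c * (\<integral>x. u x * E x \<partial>lborel) = (\<integral>y. \<phi> y \<bullet> nonlocal_gradient \<alpha> \<beta> u y \<partial>lborel)"
    by (simp add: nl[symmetric])
  have "(\<integral>x. \<beta> x * u x * frac_div \<alpha> \<phi> x \<partial>lborel) = (\<integral>x. u x * frac_div \<alpha> \<psi> x - c * (u x * E x) \<partial>lborel)"
  proof (intro Bochner_Integration.integral_cong refl)
    fix x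
    have "\<beta> x * u x * frac_div \<alpha> \<phi> x = u x * (\<beta> x * frac_div \<alpha> \<phi> x)" by simp
    then show "\<beta> x * u x * frac_div \<alpha> \<phi> x = u x * frac_div \<alpha> \<psi> x - c * (u x * E x)"
      unfolding split by (simp add: algebra_simps)
  qed
  also have "\<dots> = (\<integral>x. u x * frac_div \<alpha> \<psi> x \<partial>lborel) - c * (\<integral>x. u x * E x \<partial>lborel)"
    using frac_pairing_integrable[OF \<alpha> \<psi> ui] uE by simp
  also have "(\<integral>x. u x * frac_div \<alpha> \<psi> x \<partial>lborel) = - \<Lambda> \<psi>"
    using u \<psi> by (simp add: frac_pairing_def)
  finally show "(\<integral>x. \<beta> x * u x * frac_div \<alpha> \<phi> x \<partial>lborel) =
      - (\<Lambda> (\<lambda>x. \<beta> x *\<^sub>R \<phi> x) + (\<integral>x. \<phi> x \<bullet> nonlocal_gradient \<alpha> \<beta> u x \<partial>lborel))"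
    unfolding FE by (simp add: \<psi>_def[abs_def])
qed

section \<open>Lipschitz domains can be pushed inwards\<close>

text \<open>The height \<open>e x\<close> of a point over the graph is Lipschitz with constant \<open>1 + L\<close>, nonnegative on the
  closure of the domain, and grows exactly by \<open>t\<close> when moving by \<open>t\<close> in direction \<open>\<nu>\<close>. A further
  displacement by at most \<open>t / (2 (1 + L))\<close> cannot use up this gain.\<close>

lemma lipschitz_domain_inward:
  fixes \<Omega> :: "'a::euclidean_space set"
  assumes \<Omega>: "bounded_lipschitz_domain \<Omega>" and p: "p \<in> frontier \<Omega>"
  obtains r \<nu> c where "r > 0" "norm \<nu> = 1" "0 < c" "c \<le> (1::real)"
    "\<And>x t w. x \<in> closure \<Omega> \<Longrightarrow> norm (x - p) < r / 2 \<Longrightarrow> 0 < t \<Longrightarrow> t < r / 4 \<Longrightarrow> norm w \<le> c * t \<Longrightarrow> x + t *\<^sub>R \<nu> + w \<in> \<Omega>"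
proof -
  obtain r \<nu> \<gamma> L where r: "r > 0" and \<nu>: "norm \<nu> = 1" and L: "L-lipschitz_on {y. y \<bullet> \<nu> = 0} (\<gamma> :: 'a \<Rightarrow> real)"
    and eq: "\<Omega> \<inter> ball p r = {x \<in> ball p r. x \<bullet> \<nu> > \<gamma> (x - (x \<bullet> \<nu>) *\<^sub>R \<nu>)}"
    using \<Omega> p unfolding bounded_lipschitz_domain_def by blast
  have L0: "0 \<le> L" using L by (rule lipschitz_on_nonneg)
  have \<nu>\<nu>: "\<nu> \<bullet> \<nu> = 1" using \<nu> by (simp add: norm_eq_1)
  define P where "P x = x - (x \<bullet> \<nu>) *\<^sub>R \<nu>" for x
  have P0: "P x \<bullet> \<nu> = 0" for x by (simp add: P_def inner_diff_left \<nu>\<nu>)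
  have Pd: "P x - P y = P (x - y)" for x y by (simp add: P_def inner_diff_left algebra_simps)
  have Pn: "norm (P x) \<le> norm x" for x
  proof -
    have "P x \<bullet> P x = x \<bullet> x - (x \<bullet> \<nu>)\<^sup>2"
      by (simp add: P_def inner_diff_left inner_diff_right \<nu>\<nu> inner_commute power2_eq_square algebra_simps)
    then have "P x \<bullet> P x \<le> x \<bullet> x" by simp
    then show ?thesis by (simp add: norm_eq_sqrt_inner)
  qed
  \<comment> \<open>the height over the graph\<close>
  define e where "e x = x \<bullet> \<nu> - \<gamma> (P x)" for x
  have eL: "\<bar>e x - e y\<bar> \<le> (1 + L) * norm (x - y)" for x y
  proof -
    have "\<bar>\<gamma> (P x) - \<gamma> (P y)\<bar> \<le> L * norm (P x - P y)"
      using lipschitz_onD[OF L, of "P x" "P y"] P0 by (simp add: dist_norm)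
    also have "\<dots> \<le> L * norm (x - y)" unfolding Pd using L0 Pn by (intro mult_left_mono) auto
    finally have 1: "\<bar>\<gamma> (P x) - \<gamma> (P y)\<bar> \<le> L * norm (x - y)" .
    have "\<bar>(x - y) \<bullet> \<nu>\<bar> \<le> norm (x - y)" using Cauchy_Schwarz_ineq2[of "x - y" \<nu>] \<nu> by simp
    then have "\<bar>x \<bullet> \<nu> - y \<bullet> \<nu>\<bar> \<le> norm (x - y)" by (simp add: inner_diff_left)
    with 1 show ?thesis unfolding e_def by (simp add: distrib_right)
  qed
  have mem: "x \<in> \<Omega> \<longleftrightarrow> e x > 0" if "norm (x - p) < r" for x
  proof -
    have b: "x \<in> ball p r" using that by (simp add: dist_norm norm_minus_commute)
    then have "x \<in> \<Omega> \<longleftrightarrow> x \<in> \<Omega> \<inter> ball p r" by simp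
    also have "\<dots> \<longleftrightarrow> e x > 0" unfolding eq using b by (simp add: e_def P_def)
    finally show ?thesis .
  qed
  have cl: "e x \<ge> 0" if x: "x \<in> closure \<Omega>" "norm (x - p) < r" for x
  proof (rule ccontr)
    assume "\<not> e x \<ge> 0"
    then have neg: "e x < 0" by simp
    define d where "d = min (- e x / (1 + L)) (r - norm (x - p))"
    have d: "d > 0" using neg L0 x(2) by (simp add: d_def divide_neg_pos)
    obtain y where y: "y \<in> \<Omega>" "dist y x < d" using x(1) d unfolding closure_approachable by blast
    have "norm (y - p) < r"
      using y(2) norm_triangle_ineq[of "y - x" "x - p"] by (simp add: d_def dist_norm)
    then have "e y > 0" using mem y(1) by blast
    have "norm (y - x) < - e x / (1 + L)" using y(2) by (simp add: d_def dist_norm)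
    then have "(1 + L) * norm (y - x) < - e x" 
      using L0 pos_less_divide_eq[of "1 + L" "norm (y - x)" "- e x"] by (simp add: mult.commute)
    then show False using eL[of y x] \<open>e y > 0\<close> by linarith
  qed
  have eshift: "e (x + t *\<^sub>R \<nu>) = e x + t" for x t
    by (simp add: e_def P_def inner_add_left \<nu>\<nu> algebra_simps)
  define c where "c = 1 / (2 * (1 + L))"
  have c: "0 < c" "c \<le> 1" "(1 + L) * c = 1 / 2" using L0 by (simp_all add: c_def divide_simps)
  show ?thesis
  proof (rule that[OF r \<nu> c(1,2)])
    fix x w :: 'a and t :: real
    assume x: "x \<in> closure \<Omega>" "norm (x - p) < r / 2" and t: "0 < t" "t < r / 4" and w: "norm w \<le> c * t"
    have ct: "c * t \<le> t" using c t by simp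
    have "norm (x + t *\<^sub>R \<nu> + w - p) \<le> norm (x - p) + norm (t *\<^sub>R \<nu>) + norm w"
      using norm_triangle_ineq[of "x - p + t *\<^sub>R \<nu>" w] norm_triangle_ineq[of "x - p" "t *\<^sub>R \<nu>"] by (simp add: algebra_simps)
    also have "\<dots> < r"
    proof -
      have "norm (t *\<^sub>R \<nu>) = t" using t \<nu> by simp
      then show ?thesis using x(2) t w ct by linarith
    qed
    finally have nr: "norm (x + t *\<^sub>R \<nu> + w - p) < r" .
    have "(1 + L) * norm w \<le> (1 + L) * (c * t)" using w L0 by (intro mult_left_mono) auto
    also have "\<dots> = t / 2" using c(3) by (simp add: mult.assoc[symmetric])
    finally have "\<bar>e (x + t *\<^sub>R \<nu> + w) - e (x + t *\<^sub>R \<nu>)\<bar> \<le> t / 2"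
      using eL[of "x + t *\<^sub>R \<nu> + w" "x + t *\<^sub>R \<nu>"] by simp
    moreover have "e (x + t *\<^sub>R \<nu>) \<ge> t" using cl[OF x(1)] x(2) r eshift by simp
    ultimately have "e (x + t *\<^sub>R \<nu> + w) > 0" using t(1) by linarith
    then show "x + t *\<^sub>R \<nu> + w \<in> \<Omega>" using mem[OF nr] by simp
  qed
qed

text \<open>A segment that leaves the domain meets the boundary.\<close>

lemma interior_point_ball:
  fixes \<Omega> :: "'a::euclidean_space set"
  assumes x: "x \<in> closure \<Omega>" and far: "\<And>f. f \<in> frontier \<Omega> \<Longrightarrow> d \<le> norm (f - x)" and w: "norm w < d"
  shows "x + w \<in> \<Omega>"
proof (rule ccontr)
  assume n: "x + w \<notin> \<Omega>"
  have d: "d > 0" using w norm_ge_zero[of w] by linarith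
  have "x \<notin> frontier \<Omega>" using far[of x] d by auto
  then have "x \<in> \<Omega>" using x closure_Un_frontier by blast
  then have "closed_segment x (x + w) \<inter> frontier \<Omega> \<noteq> {}"
    using n by (intro connected_Int_frontier) auto
  then obtain f where f: "f \<in> closed_segment x (x + w)" "f \<in> frontier \<Omega>" by blast
  then have "norm (f - x) \<le> norm w" using segment_bound1[OF f(1)] by simp
  then show False using far[OF f(2)] w by simp
qed

text \<open>Finitely many boundary charts cover the boundary. The balls are made disjoint and their indicators
  are mollified, which gives functions that are smooth, nonnegative and add up to the mollified
  indicator of the union. The remaining function, of index \<open>N\<close>, is
  supported away from the boundary and needs no translation. The sets \<open>S i\<close> are closed neighbourhoods
  of the supports, so that the points pushed inwards form a compact set.\<close>

lemma lipschitz_domain_partition: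
  fixes \<Omega> :: "'a::euclidean_space set"
  assumes \<Omega>: "bounded_lipschitz_domain \<Omega>"
  obtains N :: nat and \<theta> :: "nat \<Rightarrow> 'a \<Rightarrow> real" and S \<nu> t0 c L where
    "0 < t0" "0 < c" "\<And>i k. Ck k (\<theta> i)" "\<And>i x. 0 \<le> \<theta> i x" "\<And>i x. \<theta> i x \<le> 1"
    "\<And>i x y. norm (\<theta> i x - \<theta> i y) \<le> L i * norm (x - y)"
    "\<And>i. closed (S i)" "\<And>i x. \<theta> i x \<noteq> 0 \<Longrightarrow> x \<in> S i" "\<And>i. norm (\<nu> i) \<le> 1"
    "\<And>i x t w. i \<le> N \<Longrightarrow> x \<in> closure \<Omega> \<Longrightarrow> x \<in> S i \<Longrightarrow> 0 < t \<Longrightarrow> t < t0 \<Longrightarrow> norm w \<le> c * t \<Longrightarrow> x + t *\<^sub>R \<nu> i + w \<in> \<Omega>"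
    "\<And>x. (\<Sum>i\<le>N. \<theta> i x) = 1"
proof -
  let ?F = "frontier \<Omega>"
  have cF: "compact ?F" using \<Omega> unfolding bounded_lipschitz_domain_def by (intro compact_frontier_bounded) blast
  define good where "good p r \<nu> c \<longleftrightarrow> r > 0 \<and> norm \<nu> = 1 \<and> 0 < c \<and> c \<le> (1::real) \<and>
    (\<forall>x t w. x \<in> closure \<Omega> \<longrightarrow> norm (x - p) < r / 2 \<longrightarrow> 0 < t \<longrightarrow> t < r / 4 \<longrightarrow> norm w \<le> c * t \<longrightarrow> x + t *\<^sub>R \<nu> + w \<in> \<Omega>)"
    for p r \<nu> c
  have "\<exists>r \<nu> c. good p r \<nu> c" if p: "p \<in> ?F" for p
    unfolding good_def by (rule lipschitz_domain_inward[OF \<Omega> p]) blast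
  then obtain r \<nu> c where good: "\<And>p. p \<in> ?F \<Longrightarrow> good p (r p) (\<nu> p) (c p)" by metis
  have loc: "r p > 0" "norm (\<nu> p) = 1" "0 < c p" "c p \<le> 1"
    "\<And>x t w. x \<in> closure \<Omega> \<Longrightarrow> norm (x - p) < r p / 2 \<Longrightarrow> 0 < t \<Longrightarrow> t < r p / 4 \<Longrightarrow> norm w \<le> c p * t \<Longrightarrow> x + t *\<^sub>R \<nu> p + w \<in> \<Omega>"
    if p: "p \<in> ?F" for p
    using good[OF p] unfolding good_def by blast+
  have cov: "?F \<subseteq> (\<Union>p\<in>?F. ball p (r p / 4))" using loc(1) by force
  obtain P where P: "P \<subseteq> ?F" "finite P" "?F \<subseteq> (\<Union>p\<in>P. ball p (r p / 4))"
    by (rule compactE_image[OF cF _ cov]) auto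
  obtain N :: nat and h where h: "P = h ` {i. i < N}"
    using finite_imp_nat_seg_image_inj_on[OF P(2)] by blast
  have hF: "h i \<in> ?F" if "i < N" for i using P(1) h that by blast
  define U where "U = (\<Union>i<N. ball (h i) (r (h i) / 4))"
  have U: "open U" by (auto simp: U_def)
  have FU: "?F \<subseteq> U" using P(3) unfolding U_def h by auto
  obtain d2 where d2: "d2 > 0" "\<And>x y. x \<in> ?F \<Longrightarrow> norm (x - y) \<le> d2 \<Longrightarrow> y \<in> U"
    by (rule compact_neighbourhood_radius[OF cF U FU]) (rule that)
  \<comment> \<open>half the room is reserved for the mollification radius \<open>\<delta>\<close>\<close>
  define d where "d = d2 / 2"
  have d: "d > 0" using d2(1) by (simp add: d_def)
  define R where "R = insert (8 * d) ((\<lambda>i. r (h i)) ` {..<N})"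
  have R: "finite R" "R \<noteq> {}" by (simp_all add: R_def)
  \<comment> \<open>an eighth of the chart radius keeps the support, of radius at most \<open>r/4 + \<delta>\<close>, inside the half ball\<close>
  define \<delta> where "\<delta> = Min R / 8"
  have \<delta>: "\<delta> > 0" "\<delta> \<le> d" "\<And>i. i < N \<Longrightarrow> \<delta> \<le> r (h i) / 8"
  proof -
    have "Min R > 0" using R d loc(1) hF by (auto simp: Min_gr_iff R_def)
    then show "\<delta> > 0" by (simp add: \<delta>_def)
    have "Min R \<le> 8 * d" using R by (intro Min_le) (auto simp: R_def)
    then show "\<delta> \<le> d" by (simp add: \<delta>_def)
    show "\<delta> \<le> r (h i) / 8" if "i < N" for i
    proof -
      have "Min R \<le> r (h i)" using R that by (intro Min_le) (auto simp: R_def)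
      then show ?thesis by (simp add: \<delta>_def)
    qed
  qed
  obtain \<eta> where m: "mollifier \<eta> (0::'a) \<delta>" using mollifier_exists[OF \<delta>(1)] by blast
  define B where "B i = (if i < N then ball (h i) (r (h i) / 4) else {})" for i
  define A where "A i = disjointed B i" for i
  have Bb: "B i \<in> sets borel" for i by (simp add: B_def)
  have Ab: "A i \<in> sets borel" for i
    using sets.range_disjointed_sets[of B borel] Bb unfolding A_def by blast
  have AB: "A i \<subseteq> B i" for i unfolding A_def by (rule disjointed_subset)
  have Ad: "disjoint_family A" unfolding A_def by (rule disjoint_family_disjointed)
  have AU: "(\<Union>i<N. A i) = U"
  proof -
    have "(\<Union>i. A i) = (\<Union>i. B i)" unfolding A_def by (rule UN_disjointed_eq)
    moreover have "(\<Union>i. B i) = U" by (auto simp: B_def U_def split: if_splits)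
    moreover have "A i = {}" if "\<not> i < N" for i using AB[of i] that by (simp add: B_def)
    then have "(\<Union>i. A i) = (\<Union>i<N. A i)" by blast
    ultimately show ?thesis by simp
  qed
  have Ai: "integrable lborel (indicator (A i) :: 'a \<Rightarrow> real)" for i
  proof (rule integrable_real_indicator)
    show "A i \<in> sets lborel" using Ab by simp
    have "A i \<subseteq> ball (h i) (r (h i) / 4)" using AB[of i] by (auto simp: B_def split: if_splits)
    then have "emeasure lborel (A i) \<le> emeasure lborel (ball (h i) (r (h i) / 4))" by (intro emeasure_mono) auto
    then show "emeasure lborel (A i) < \<infinity>" using emeasure_lborel_ball_finite[of "h i" "r (h i) / 4"] by (rule le_less_trans)
  qed
  define q where "q i = conv lborel \<eta> (indicator (A i) :: 'a \<Rightarrow> real)" for i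
  have q01: "0 \<le> q i x" "q i x \<le> 1" for i x unfolding q_def by (rule conv_indicator[OF m Ab])+
  have qS: "x \<in> cball (h i) (3 * r (h i) / 8)" if qx: "q i x \<noteq> 0" for i x
  proof -
    obtain y where y: "y \<in> A i" "norm (x - y) < \<delta>"
      using conv_indicator(3)[OF m Ab qx[unfolded q_def]] by blast
    then have iN: "i < N" and yb: "norm (y - h i) < r (h i) / 4"
      using AB[of i] by (auto simp: B_def dist_norm norm_minus_commute split: if_splits)
    have "norm (x - h i) \<le> norm (x - y) + norm (y - h i)" using norm_triangle_ineq[of "x - y" "y - h i"] by simp
    then show ?thesis using y(2) yb \<delta>(3)[OF iN] by (simp add: dist_norm norm_minus_commute)
  qed
  have qC: "q i \<in> Cc_infinity UNIV" for i
  proof (rule Cc_infinityI)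
    show "Ck k (q i)" for k unfolding q_def using mollifierD(1)[OF m] by (intro conv_Ck Ai) auto
    show "compact (cball (h i) (3 * r (h i) / 8))" by simp
    show "q i x = 0" if "x \<notin> cball (h i) (3 * r (h i) / 8)" for x using qS that by blast
  qed simp
  have qsum: "(\<Sum>i<N. q i x) = conv lborel \<eta> (indicator U) x" for x
  proof -
    obtain C where C: "\<And>z. \<bar>\<eta> z\<bar> \<le> C" using mollifierD(7)[OF m] by blast
    have "conv lborel \<eta> (indicator U) x = (\<integral>y. (\<Sum>i<N. \<eta> (x - y) *\<^sub>R (indicator (A i) y :: real)) \<partial>lborel)"
    proof -
      have "disjoint_family_on A {..<N}" using Ad by (auto simp: disjoint_family_on_def)
      then have "indicator U y = (\<Sum>i<N. indicator (A i) y :: real)" for y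
        unfolding AU[symmetric] by (intro indicator_UN_disjoint) auto
      then show ?thesis by (simp add: conv_def sum_distrib_left)
    qed
    also have "\<dots> = (\<Sum>i<N. q i x)"
      unfolding q_def conv_def
      by (intro Bochner_Integration.integral_sum conv_integrand[OF sets_lborel mollifierD(6)[OF m] C Ai])
    finally show ?thesis by simp
  qed
  have "\<exists>L. \<forall>x y. norm (q i x - q i y) \<le> L * norm (x - y)" for i
    by (rule Cc_infinity_lipschitz[OF qC[of i]]) blast
  then obtain L where L: "\<And>i x y. norm (q i x - q i y) \<le> L i * norm (x - y)" by metis
  define \<theta> where "\<theta> i = (if i < N then q i else (\<lambda>x. 1 - (\<Sum>j<N. q j x)))" for i
  define S where "S i = (if i < N then cball (h i) (3 * r (h i) / 8) else {x. \<forall>f\<in>?F. d \<le> norm (f - x)})" for i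
  define M where "M = insert 1 ((\<lambda>i. c (h i)) ` {..<N})"
  have M: "finite M" "M \<noteq> {}" by (simp_all add: M_def)
  define t0 where "t0 = min d (Min R / 4)"
  show ?thesis
  proof (rule that[of t0 "Min M" \<theta> "\<lambda>i. if i < N then L i else (\<Sum>j<N. L j)" S "\<lambda>i. if i < N then \<nu> (h i) else 0" N])
    show "0 < t0" using \<delta>(1) d by (simp add: t0_def \<delta>_def)
    show "0 < Min M" using M loc(3) hF by (auto simp: Min_gr_iff M_def)
    have s: "0 \<le> (\<Sum>j<N. q j x)" "(\<Sum>j<N. q j x) \<le> 1" for x
      unfolding qsum using U by (intro conv_indicator[OF m]; simp)+
    show "0 \<le> \<theta> i x" "\<theta> i x \<le> 1" for i x using q01 s by (auto simp: \<theta>_def)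
    show "Ck k (\<theta> i)" for i k
    proof (cases "i < N")
      case True then show ?thesis using qC[of i] by (simp add: \<theta>_def Cc_infinity_UNIV)
    next
      case False
      have "Ck k (\<lambda>x. 1 + (-1) * (\<Sum>j<N. q j x))"
        by (intro Ck_add Ck_mult Ck_const Ck_sum) (use qC in \<open>simp add: Cc_infinity_UNIV\<close>)
      then show ?thesis using False by (simp add: \<theta>_def)
    qed
    show "norm (\<theta> i x - \<theta> i y) \<le> (if i < N then L i else (\<Sum>j<N. L j)) * norm (x - y)" for i x y
    proof (cases "i < N")
      case False
      have "norm (\<theta> i x - \<theta> i y) = norm (\<Sum>j<N. q j x - q j y)"
        using False by (simp add: \<theta>_def sum_subtractf abs_minus_commute)
      also have "\<dots> \<le> (\<Sum>j<N. L j * norm (x - y))" by (intro sum_norm_le L)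
      finally show ?thesis using False by (simp add: sum_distrib_right)
    qed (use L in \<open>simp add: \<theta>_def\<close>)
    show "closed (S i)" for i
    proof (cases "i < N")
      case False
      have "S i = (\<Inter>f\<in>?F. {x. d \<le> norm (f - x)})" using False by (auto simp: S_def)
      moreover have "closed {x. d \<le> norm (f - x)}" for f :: 'a
        by (intro closed_Collect_le continuous_intros)
      ultimately show ?thesis by (simp add: closed_INT)
    qed (simp add: S_def)
    show "x \<in> S i" if "\<theta> i x \<noteq> 0" for i x
    proof (cases "i < N")
      case True then show ?thesis using that qS by (simp add: \<theta>_def S_def)
    next
      case False
      then have "conv lborel \<eta> (indicator U) x \<noteq> (1::real)" using that qsum by (simp add: \<theta>_def)
      then obtain y where y: "norm (x - y) < \<delta>" "y \<notin> U"
        using conv_indicator(4)[OF m borel_open[OF U]] by blast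
      have "d \<le> norm (f - x)" if f: "f \<in> ?F" for f
      proof (rule ccontr)
        assume "\<not> d \<le> norm (f - x)"
        then have "norm (f - y) \<le> d2" using norm_triangle_ineq[of "f - x" "x - y"] y(1) \<delta>(2) by (simp add: d_def)
        then show False using d2(2)[OF f] y(2) by blast
      qed
      then show ?thesis using False by (simp add: S_def)
    qed
    show "norm (if i < N then \<nu> (h i) else 0) \<le> 1" for i using loc(2) hF by simp
    show "(\<Sum>i\<le>N. \<theta> i x) = 1" for x
      by (simp add: lessThan_Suc_atMost[symmetric] \<theta>_def)
    fix i :: nat and x w :: 'a and t :: real
    assume iN: "i \<le> N" and x: "x \<in> closure \<Omega>" "x \<in> S i" and t: "0 < t" "t < t0" and w: "norm w \<le> Min M * t"
    show "x + t *\<^sub>R (if i < N then \<nu> (h i) else 0) + w \<in> \<Omega>"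
    proof (cases "i < N")
      case True
      have "Min R \<le> r (h i)" using R True by (intro Min_le) (auto simp: R_def)
      then have tr: "t < r (h i) / 4" using t(2) by (simp add: t0_def)
      have "Min M \<le> c (h i)" using M True by (intro Min_le) (auto simp: M_def)
      then have "Min M * t \<le> c (h i) * t" using t(1) by (intro mult_right_mono) auto
      then have wc: "norm w \<le> c (h i) * t" using w by linarith
      have "norm (x - h i) \<le> 3 * r (h i) / 8" using x(2) True by (simp add: S_def dist_norm norm_minus_commute)
      also have "\<dots> < r (h i) / 2" using loc(1)[OF hF[OF True]] by simp
      finally show ?thesis using loc(5)[OF hF[OF True] x(1) _ t(1) tr wc] True by simp
    next
      case False
      have "Min M \<le> 1" using M by (intro Min_le) (auto simp: M_def)
      then have "Min M * t \<le> 1 * t" using t(1) by (intro mult_right_mono) auto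
      then have "norm w < d" using w t(2) by (simp add: t0_def)
      moreover have "d \<le> norm (f - x)" if "f \<in> ?F" for f using x(2) False that by (simp add: S_def)
      ultimately have "x + w \<in> \<Omega>" using interior_point_ball[OF x(1)] by blast
      then show ?thesis using False by simp
    qed
  qed
qed

section \<open>The area functional along an approximation\<close>

lemma sqrt_one_plus_norm: "sqrt (1 + (norm v)\<^sup>2) = norm (1::real, v)"
  by (simp add: norm_Pair)

lemma integral_mono_measure_bounded:
  fixes k :: "'a \<Rightarrow> real"
  assumes M: "finite_measure M" and P: "finite_measure P" and s: "sets M = sets P"
    and le: "\<And>A. A \<in> sets P \<Longrightarrow> emeasure M A \<le> emeasure P A"
    and k: "k \<in> borel_measurable P" "\<And>x. 0 \<le> k x" "\<And>x. k x \<le> C"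
  shows "(\<integral>x. k x \<partial>M) \<le> (\<integral>x. k x \<partial>P)"
proof -
  interpret M: finite_measure M by fact
  interpret P: finite_measure P by fact
  have kM: "k \<in> borel_measurable M" using k(1) s measurable_cong_sets by blast
  have iM: "integrable M k" by (rule M.integrable_const_bound[where B = C]) (use k kM in auto)
  have iP: "integrable P k" by (rule P.integrable_const_bound[where B = C]) (use k in auto)
  have "M \<le> P" using le s by (simp add: le_measure)
  then have "(\<integral>\<^sup>+x. ennreal (k x) \<partial>M) \<le> (\<integral>\<^sup>+x. ennreal (k x) \<partial>P)"
    by (rule nn_integral_mono_measure[OF s])
  then have "ennreal (\<integral>x. k x \<partial>M) \<le> ennreal (\<integral>x. k x \<partial>P)"
    using nn_integral_eq_integral[OF iM] nn_integral_eq_integral[OF iP] k(2) by simp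
  moreover have "0 \<le> (\<integral>x. k x \<partial>P)" using k(2) by simp
  ultimately show ?thesis by simp
qed

lemma norm_indicator_scaleR: "norm (indicator X x *\<^sub>R v) = indicator X x * norm v"
  by (simp add: indicator_def)

lemma integrable_indicator_one_Pair:
  fixes f :: "'a::euclidean_space \<Rightarrow> 'b::euclidean_space"
  assumes X[measurable]: "X \<in> sets borel" and fin: "emeasure lborel X < \<infinity>" and f: "integrable lborel f"
  shows "integrable lborel (\<lambda>x. indicator X x *\<^sub>R (1::real, f x))"
    and "integrable lborel (\<lambda>x. indicator X x * norm (1::real, f x))"
proof -
  have [measurable]: "f \<in> borel_measurable borel" using f by auto
  show i: "integrable lborel (\<lambda>x. indicator X x *\<^sub>R (1::real, f x))"
  proof (rule Bochner_Integration.integrable_bound)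
    show "integrable lborel (\<lambda>x. indicator X x + norm (f x))"
      using X fin by (intro Bochner_Integration.integrable_add integrable_norm f integrable_real_indicator) auto
    show "AE x in lborel. norm (indicator X x *\<^sub>R (1::real, f x)) \<le> norm (indicator X x + norm (f x))"
    proof (rule AE_I2)
      fix x
      have "norm (1::real, f x) \<le> 1 + norm (f x)" using norm_Pair_le[of "1::real" "f x"] by simp
      then show "norm (indicator X x *\<^sub>R (1::real, f x)) \<le> norm (indicator X x + norm (f x))" by (simp add: indicator_def)
    qed
  qed measurable
  from integrable_norm[OF i] show "integrable lborel (\<lambda>x. indicator X x * norm (1::real, f x))"
    by (simp only: norm_indicator_scaleR)
qed

text \<open>The area integrand is the norm of \<open>(1, F)\<close>, so the area of \<open>F dx + S T\<close> is the total variation of the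
  vector measure \<open>(dx, F dx + S T)\<close> and is a supremum over fields \<open>\<Psi>\<close> of norm at most one. The
  optimal field is the direction of the measure: \<open>(1, F)\<close> normalised off the null set \<open>N\<close>, and \<open>(0, S)\<close>
  normalised on it. It is approximated by a continuous field in the \<open>L\<^sup>1\<close> norm of the total variation
  and projected back to the unit ball.\<close>

lemma area_dual_approximation:
  fixes F S :: "'a::euclidean_space \<Rightarrow> 'b::euclidean_space"
  assumes T: "finite_measure T" "sets T = sets borel" and F: "integrable lborel F" and S: "integrable T S"
    and N: "N \<in> null_sets lborel" "N \<in> sets borel" "\<And>x. x \<notin> N \<Longrightarrow> S x = 0"
    and X: "X \<in> sets borel" "emeasure lborel X < \<infinity>" and e: "e > 0"
  obtains \<Psi> :: "'a \<Rightarrow> real \<times> 'b" where "continuous_on UNIV \<Psi>" "\<And>x. norm (\<Psi> x) \<le> 1"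
    "(\<integral>x. indicator X x * norm (1::real, F x) \<partial>lborel) + (\<integral>x. norm (S x) \<partial>T) - e
      \<le> (\<integral>x. indicator X x * (\<Psi> x \<bullet> (1, F x)) \<partial>lborel) + (\<integral>x. \<Psi> x \<bullet> (0, S x) \<partial>T)"
proof -
  have Fm[measurable]: "F \<in> borel_measurable borel" using F by auto
  have SmT: "S \<in> borel_measurable T" using S by auto
  then have Sm[measurable]: "S \<in> borel_measurable borel" using T(2) measurable_cong_sets by blast
  note [measurable] = N(2) X(1)
  define w0 where "w0 x = indicator X x * norm (1::real, F x)" for x
  have w0m[measurable]: "w0 \<in> borel_measurable borel" unfolding w0_def[abs_def] by measurable
  have w00: "0 \<le> w0 x" for x by (simp add: w0_def)
  have w0i: "integrable lborel w0"
    unfolding w0_def[abs_def] by (rule integrable_indicator_one_Pair(2)[OF X F])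
  have fin: "finite_measure (density M (\<lambda>x. ennreal (w x)))" if "integrable M w" "\<And>x. 0 \<le> w x" for M and w :: "'a \<Rightarrow> real"
  proof
    have "emeasure (density M (\<lambda>x. ennreal (w x))) (space M) = (\<integral>\<^sup>+x. ennreal (w x) \<partial>M)"
      using that by (subst emeasure_density) (auto intro!: nn_integral_cong)
    also have "\<dots> = ennreal (\<integral>x. w x \<partial>M)" by (rule nn_integral_eq_integral) (use that in auto)
    finally show "emeasure (density M (\<lambda>x. ennreal (w x))) (space (density M (\<lambda>x. ennreal (w x)))) \<noteq> \<infinity>" by simp
  qed
  \<comment> \<open>the two weights make up the total variation on \<open>X\<close>\<close>
  define D where "D i = (if i = (0::nat) then density lborel (\<lambda>x. ennreal (w0 x)) else density T (\<lambda>x. ennreal (norm (S x))))" for i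
  have D: "finite_measure (D i)" "sets (D i) = sets borel" for i
    using fin[OF w0i w00] fin[OF integrable_norm[OF S]] T(2) by (auto simp: D_def)
  obtain P where P: "finite_measure P" "sets P = sets borel" and eP: "\<And>A. A \<in> sets borel \<Longrightarrow> emeasure P A = (\<Sum>i\<in>{0,1}. emeasure (D i) A)"
    using sum_measure_exists[of "{0,1}" D] D by auto
  have leP: "emeasure (D i) A \<le> emeasure P A" if "i \<in> {0,1}" "A \<in> sets P" for i A
    using that eP[of A] P(2) by auto
  \<comment> \<open>the direction of the vector measure\<close>
  define opt where "opt x = (if x \<in> N then (0::real, sgn (S x)) else (1 / norm (1::real, F x)) *\<^sub>R (1, F x))" for x
  have om[measurable]: "opt \<in> borel_measurable borel"
  proof -
    have "(\<lambda>x. sgn (S x)) \<in> borel_measurable borel" unfolding sgn_div_norm by measurable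
    then show ?thesis unfolding opt_def[abs_def] by measurable
  qed
  have one: "norm (1::real, F x) \<ge> 1" for x using norm_fst_le[of "1::real" "F x"] by simp
  have o1: "norm (opt x) \<le> 1" for x
  proof (cases "x \<in> N")
    case True then show ?thesis by (simp add: opt_def norm_Pair norm_sgn)
  next
    case False
    then have "norm (opt x) = \<bar>1 / norm (1::real, F x)\<bar> * norm (1::real, F x)" by (simp only: opt_def if_False norm_scaleR)
    also have "\<dots> = 1" using one[of x] by (subst abs_of_nonneg) (auto simp del: norm_Pair)
    finally show ?thesis by simp
  qed
  interpret P: finite_measure P by fact
  have "opt \<in> borel_measurable P" using om P(2) measurable_cong_sets by blast
  then have "integrable P opt" by (intro P.integrable_const_bound[where B = 1] AE_I2 o1)
  then obtain t where t: "continuous_on UNIV t" "integrable P t" "(\<integral>x. norm (opt x - t x) \<partial>P) < e / 2"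
    using continuous_dense_L1[OF P, of opt "e / 2"] e by auto
  \<comment> \<open>the projection to the unit ball is a contraction that fixes the optimal field\<close>
  define \<Psi> where "\<Psi> x = closest_point (cball 0 1) (t x)" for x
  have c1: "convex (cball (0::real \<times> 'b) 1)" "closed (cball (0::real \<times> 'b) 1)" "cball (0::real \<times> 'b) 1 \<noteq> {}" by auto
  have \<Psi>c: "continuous_on UNIV \<Psi>"
    unfolding \<Psi>_def by (rule continuous_on_compose2[OF continuous_on_closest_point[OF c1, of UNIV] t(1)]) simp
  have \<Psi>1: "norm (\<Psi> x) \<le> 1" for x
    using closest_point_in_set[OF c1(2,3), of "t x"] by (simp add: \<Psi>_def dist_norm)
  have \<Psi>m[measurable]: "\<Psi> \<in> borel_measurable borel" by (rule borel_measurable_continuous_onI[OF \<Psi>c])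
  define k where "k x = norm (opt x - \<Psi> x)" for x
  have km[measurable]: "k \<in> borel_measurable borel" unfolding k_def[abs_def] by measurable
  have k2: "0 \<le> k x" "k x \<le> 2" for x
    using norm_triangle_ineq4[of "opt x" "\<Psi> x"] o1[of x] \<Psi>1[of x] by (auto simp: k_def)
  have kt: "k x \<le> norm (opt x - t x)" for x
  proof -
    have "opt x \<in> cball 0 1" using o1 by (simp add: dist_norm)
    then have "opt x = closest_point (cball 0 1) (opt x)" by (simp add: closest_point_self)
    then show ?thesis
      using closest_point_lipschitz[OF c1, of "opt x" "t x"] by (simp add: k_def \<Psi>_def dist_norm)
  qed
  have kmP: "k \<in> borel_measurable P" using km P(2) measurable_cong_sets by blast
  have "(\<integral>x. k x \<partial>P) \<le> (\<integral>x. norm (opt x - t x) \<partial>P)"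
    using \<open>integrable P opt\<close> t(2) kt k2(1) by (intro Bochner_Integration.integral_mono') auto
  then have kP: "(\<integral>x. k x \<partial>P) < e / 2" using t(3) by linarith
  have kD: "(\<integral>x. k x \<partial>D i) < e / 2" if "i \<in> {0,1}" for i
  proof -
    have "(\<integral>x. k x \<partial>D i) \<le> (\<integral>x. k x \<partial>P)"
      by (rule integral_mono_measure_bounded[OF D(1) P(1) _ leP[OF that] kmP k2]) (simp_all add: D(2) P(2))
    then show ?thesis using kP by linarith
  qed
  have kmT: "k \<in> borel_measurable T" using km T(2) measurable_cong_sets by blast
  have k0: "(\<integral>x. w0 x * k x \<partial>lborel) < e / 2"
    using kD[of 0] w00 by (simp add: D_def integral_density)
  have k1: "(\<integral>x. norm (S x) * k x \<partial>T) < e / 2"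
    using kD[of 1] SmT kmT by (simp add: D_def integral_density)
  have w0ki: "integrable lborel (\<lambda>x. w0 x * k x)"
    using integrable_scaleR_bounded[OF w0i, of k 2] k2 by (simp add: mult.commute)
  have Ski: "integrable T (\<lambda>x. norm (S x) * k x)"
    using integrable_scaleR_bounded[OF integrable_norm[OF S], of k 2] kmT k2 by (simp add: mult.commute)
  note V = integrable_indicator_one_Pair(1)[OF X F]
  have iX: "integrable lborel (\<lambda>x. indicator X x * (\<Psi> x \<bullet> (1, F x)))"
    using integrable_inner_bounded[OF V _ \<Psi>1] \<Psi>m unfolding inner_scaleR_right by simp
  have VT: "integrable T (\<lambda>x. (0::real, S x))"
    by (rule integrable_bounded_linear[OF _ S]) (intro bounded_linear_Pair bounded_linear_zero bounded_linear_ident)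
  have \<Psi>T: "\<Psi> \<in> borel_measurable T" by (rule borel_measurable_continuous_UNIV[OF T(2) \<Psi>c])
  have iT: "integrable T (\<lambda>x. \<Psi> x \<bullet> (0, S x))" by (rule integrable_inner_bounded[OF VT \<Psi>T \<Psi>1])
  have nN: "AE x in lborel. x \<notin> N" by (rule AE_not_in[OF N(1)])
  have "(\<integral>x. w0 x \<partial>lborel) \<le> (\<integral>x. indicator X x * (\<Psi> x \<bullet> (1, F x)) + w0 x * k x \<partial>lborel)"
  proof (rule integral_mono_AE[OF w0i])
    show "integrable lborel (\<lambda>x. indicator X x * (\<Psi> x \<bullet> (1, F x)) + w0 x * k x)" using iX w0ki by simp
    show "AE x in lborel. w0 x \<le> indicator X x * (\<Psi> x \<bullet> (1, F x)) + w0 x * k x"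
      using nN
    proof eventually_elim
      fix x assume x: "x \<notin> N"
      have "opt x \<bullet> (1, F x) = norm (1::real, F x)"
      proof -
        have "opt x \<bullet> (1, F x) = (1 / norm (1::real, F x)) * ((1::real, F x) \<bullet> (1, F x))"
          using x by (simp only: opt_def if_False inner_scaleR_left)
        also have "\<dots> = (1 / norm (1::real, F x)) * (norm (1::real, F x))\<^sup>2"
          by (simp only: power2_norm_eq_inner)
        finally show ?thesis using one[of x] by (simp add: power2_eq_square del: norm_Pair)
      qed
      moreover have "(opt x - \<Psi> x) \<bullet> (1, F x) \<le> k x * norm (1::real, F x)"
        unfolding k_def by (rule norm_cauchy_schwarz)
      ultimately have "norm (1::real, F x) \<le> \<Psi> x \<bullet> (1, F x) + norm (1::real, F x) * k x"
        by (simp add: inner_diff_left mult.commute del: inner_Pair)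
      then show "w0 x \<le> indicator X x * (\<Psi> x \<bullet> (1, F x)) + w0 x * k x" by (simp add: w0_def indicator_def)
    qed
  qed
  also have "\<dots> = (\<integral>x. indicator X x * (\<Psi> x \<bullet> (1, F x)) \<partial>lborel) + (\<integral>x. w0 x * k x \<partial>lborel)"
    by (rule Bochner_Integration.integral_add[OF iX w0ki])
  finally have 1: "(\<integral>x. w0 x \<partial>lborel) \<le> (\<integral>x. indicator X x * (\<Psi> x \<bullet> (1, F x)) \<partial>lborel) + e / 2" using k0 by linarith
  have "(\<integral>x. norm (S x) \<partial>T) \<le> (\<integral>x. \<Psi> x \<bullet> (0, S x) + norm (S x) * k x \<partial>T)"
  proof (rule integral_mono[OF integrable_norm[OF S]])
    show "integrable T (\<lambda>x. \<Psi> x \<bullet> (0, S x) + norm (S x) * k x)" using iT Ski by simp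
    fix x
    show "norm (S x) \<le> \<Psi> x \<bullet> (0, S x) + norm (S x) * k x"
    proof (cases "x \<in> N")
      case True
      have "opt x \<bullet> (0, S x) = norm (S x)"
        using True
        by (cases "S x = 0") (simp_all add: opt_def sgn_div_norm power2_norm_eq_inner[symmetric] power2_eq_square)
      moreover have "(opt x - \<Psi> x) \<bullet> (0, S x) \<le> k x * norm (0::real, S x)"
        unfolding k_def by (rule norm_cauchy_schwarz)
      ultimately show ?thesis by (simp add: inner_diff_left mult.commute norm_Pair del: inner_Pair)
    next
      case False
      then have "S x = 0" by (rule N(3))
      then show ?thesis by (simp add: inner_prod_def)
    qed
  qed
  also have "\<dots> = (\<integral>x. \<Psi> x \<bullet> (0, S x) \<partial>T) + (\<integral>x. norm (S x) * k x \<partial>T)"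
    by (rule Bochner_Integration.integral_add[OF iT Ski])
  finally have 2: "(\<integral>x. norm (S x) \<partial>T) \<le> (\<integral>x. \<Psi> x \<bullet> (0, S x) \<partial>T) + e / 2" using k1 by linarith
  show ?thesis
    by (rule that[OF \<Psi>c \<Psi>1]) (use 1 2 in \<open>simp add: w0_def\<close>)
qed

text \<open>The upper bound is the triangle inequality \<open>|(1, a + h)| \<le> |(1, F)| + |a - F| + |h|\<close>. The lower
  bound tests with an almost optimal continuous field: against \<open>a\<close> it passes to the limit by
  \<open>L\<^sup>1\<close> convergence, against \<open>h\<close> by weak convergence. So no mass is gained or lost although \<open>h\<close> may
  concentrate.\<close>

lemma area_limit:
  fixes F S :: "'a::euclidean_space \<Rightarrow> 'b::euclidean_space" and a h :: "nat \<Rightarrow> 'a \<Rightarrow> 'b"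
  assumes T: "finite_measure T" "sets T = sets borel" and F: "integrable lborel F" and S: "integrable T S"
    and N: "N \<in> null_sets lborel" "N \<in> sets borel" "\<And>x. x \<notin> N \<Longrightarrow> S x = 0"
    and X: "X \<in> sets borel" "emeasure lborel X < \<infinity>"
    and a: "\<And>j. integrable lborel (a j)" "(\<lambda>j. \<integral>x. norm (a j x - F x) \<partial>lborel) \<longlonglongrightarrow> 0"
    and h: "\<And>j. integrable lborel (h j)" "\<And>j x. x \<notin> X \<Longrightarrow> h j x = 0"
      "\<And>j. (\<integral>x. norm (h j x) \<partial>lborel) \<le> (\<integral>x. norm (S x) \<partial>T)"
    and weak: "\<And>\<Phi> C. continuous_on UNIV \<Phi> \<Longrightarrow> (\<And>x. norm (\<Phi> x) \<le> C) \<Longrightarrow>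
      (\<lambda>j. \<integral>x. \<Phi> x \<bullet> h j x \<partial>lborel) \<longlonglongrightarrow> (\<integral>x. \<Phi> x \<bullet> S x \<partial>T)"
  shows "(\<lambda>j. \<integral>x. indicator X x * norm (1::real, a j x + h j x) \<partial>lborel)
    \<longlonglongrightarrow> (\<integral>x. indicator X x * norm (1::real, F x) \<partial>lborel) + (\<integral>x. norm (S x) \<partial>T)"
    (is "?A \<longlonglongrightarrow> ?R")
proof -
  note [measurable] = X(1)
  note vi = integrable_indicator_one_Pair(1)[OF X]
  note ni = integrable_indicator_one_Pair(2)[OF X]
  have ahi: "integrable lborel (\<lambda>x. a j x + h j x)" for j using a(1) h(1) by simp
  have aF: "integrable lborel (\<lambda>x. norm (a j x - F x))" for j using a(1) F by simp
  have upper: "?A j \<le> ?R + (\<integral>x. norm (a j x - F x) \<partial>lborel)" for j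
  proof -
    have "?A j \<le> (\<integral>x. indicator X x * norm (1::real, F x) + norm (a j x - F x) + norm (h j x) \<partial>lborel)"
    proof (rule integral_mono[OF ni[OF ahi]])
      show "integrable lborel (\<lambda>x. indicator X x * norm (1::real, F x) + norm (a j x - F x) + norm (h j x))"
        using ni[OF F] aF h(1) by simp
      fix x
      have "(1::real, a j x + h j x) = (1, F x) + (0, a j x - F x) + (0, h j x)" by simp
      then have "norm (1::real, a j x + h j x) \<le> norm (1::real, F x) + norm (0::real, a j x - F x) + norm (0::real, h j x)"
        by (metis norm_triangle_le norm_triangle_ineq add_right_mono)
      then show "indicator X x * norm (1::real, a j x + h j x) \<le> indicator X x * norm (1::real, F x) + norm (a j x - F x) + norm (h j x)"
        by (simp add: indicator_def norm_Pair)
    qed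
    also have "\<dots> = (\<integral>x. indicator X x * norm (1::real, F x) \<partial>lborel) + (\<integral>x. norm (a j x - F x) \<partial>lborel) + (\<integral>x. norm (h j x) \<partial>lborel)"
      using ni[OF F] aF[of j] integrable_norm[OF h(1)[of j]] by simp
    finally show ?thesis using h(3)[of j] by simp
  qed
  have lower: "\<forall>\<^sub>F j in sequentially. ?R - e < ?A j" if e: "e > 0" for e
  proof -
    have e2: "e / 2 > 0" using e by simp
    obtain \<Psi> :: "'a \<Rightarrow> real \<times> 'b" where \<Psi>: "continuous_on UNIV \<Psi>" "\<And>x. norm (\<Psi> x) \<le> 1"
      "?R - e / 2 \<le> (\<integral>x. indicator X x * (\<Psi> x \<bullet> (1, F x)) \<partial>lborel) + (\<integral>x. \<Psi> x \<bullet> (0, S x) \<partial>T)"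
    proof (rule area_dual_approximation[OF T F S N(1,2) _ X e2])
      show "S x = 0" if "x \<notin> N" for x by (rule N(3)[OF that])
    qed (rule that)
    have \<Psi>m[measurable]: "\<Psi> \<in> borel_measurable borel" by (rule borel_measurable_continuous_onI[OF \<Psi>(1)])
    have s2: "continuous_on UNIV (\<lambda>x. snd (\<Psi> x))" by (intro continuous_on_snd \<Psi>(1))
    have s2b: "norm (snd (\<Psi> x)) \<le> 1" for x
      using norm_snd_le[of "snd (\<Psi> x)" "fst (\<Psi> x)"] \<Psi>(2)[of x] by simp
    have s2m[measurable]: "(\<lambda>x. snd (\<Psi> x)) \<in> borel_measurable borel" by (rule borel_measurable_continuous_onI[OF s2])
    have pi: "integrable lborel (\<lambda>x. indicator X x * (\<Psi> x \<bullet> (1, f x)))" if f: "integrable lborel f" for f :: "'a \<Rightarrow> 'b"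
      using integrable_inner_bounded[OF vi[OF f] _ \<Psi>(2)] \<Psi>m unfolding inner_scaleR_right by simp
    have hi: "integrable lborel (\<lambda>x. snd (\<Psi> x) \<bullet> h j x)" for j
      by (rule integrable_inner_bounded[OF h(1) _ s2b]) simp
    have low: "(\<integral>x. indicator X x * (\<Psi> x \<bullet> (1, F x)) \<partial>lborel) - (\<integral>x. norm (a j x - F x) \<partial>lborel)
        + (\<integral>x. snd (\<Psi> x) \<bullet> h j x \<partial>lborel) \<le> ?A j" for j
    proof -
      have "(\<integral>x. indicator X x * (\<Psi> x \<bullet> (1, F x)) - norm (a j x - F x) + snd (\<Psi> x) \<bullet> h j x \<partial>lborel) \<le> ?A j"
      proof (rule integral_mono[OF _ ni[OF ahi]])
        show "integrable lborel (\<lambda>x. indicator X x * (\<Psi> x \<bullet> (1, F x)) - norm (a j x - F x) + snd (\<Psi> x) \<bullet> h j x)"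
          using pi[OF F] aF hi by simp
        fix x
        show "indicator X x * (\<Psi> x \<bullet> (1, F x)) - norm (a j x - F x) + snd (\<Psi> x) \<bullet> h j x \<le> indicator X x * norm (1::real, a j x + h j x)"
        proof (cases "x \<in> X")
          case True
          have "\<Psi> x \<bullet> (1, a j x + h j x) \<le> norm (\<Psi> x) * norm (1::real, a j x + h j x)" by (rule norm_cauchy_schwarz)
          also have "\<dots> \<le> norm (1::real, a j x + h j x)" using \<Psi>(2)[of x] by (intro mult_left_le_one_le) auto
          finally have 1: "\<Psi> x \<bullet> (1, a j x + h j x) \<le> norm (1::real, a j x + h j x)" .
          have "snd (\<Psi> x) \<bullet> (F x - a j x) \<le> norm (snd (\<Psi> x)) * norm (F x - a j x)" by (rule norm_cauchy_schwarz)
          also have "\<dots> \<le> norm (F x - a j x)" using s2b[of x] by (intro mult_left_le_one_le) auto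
          finally have 2: "snd (\<Psi> x) \<bullet> F x - snd (\<Psi> x) \<bullet> a j x \<le> norm (a j x - F x)" by (simp add: inner_diff_right norm_minus_commute)
          show ?thesis using 1 2 True by (simp add: inner_prod_def inner_add_right)
        next
          case False
          then show ?thesis using h(2)[of x j] by simp
        qed
      qed
      then show ?thesis using pi[OF F] aF[of j] hi[of j] by simp
    qed
    have "(\<lambda>j. (\<integral>x. indicator X x * (\<Psi> x \<bullet> (1, F x)) \<partial>lborel) - (\<integral>x. norm (a j x - F x) \<partial>lborel)
        + (\<integral>x. snd (\<Psi> x) \<bullet> h j x \<partial>lborel)) \<longlonglongrightarrow>
        (\<integral>x. indicator X x * (\<Psi> x \<bullet> (1, F x)) \<partial>lborel) - 0 + (\<integral>x. snd (\<Psi> x) \<bullet> S x \<partial>T)"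
      by (intro tendsto_add tendsto_diff tendsto_const a(2) weak[OF s2 s2b])
    moreover have "?R - e < (\<integral>x. indicator X x * (\<Psi> x \<bullet> (1, F x)) \<partial>lborel) - 0 + (\<integral>x. snd (\<Psi> x) \<bullet> S x \<partial>T)"
      using \<Psi>(3) e by (simp add: inner_prod_def)
    ultimately have "\<forall>\<^sub>F j in sequentially. ?R - e < (\<integral>x. indicator X x * (\<Psi> x \<bullet> (1, F x)) \<partial>lborel) - (\<integral>x. norm (a j x - F x) \<partial>lborel)
        + (\<integral>x. snd (\<Psi> x) \<bullet> h j x \<partial>lborel)"
      by (rule order_tendstoD(1))
    then show ?thesis
    proof eventually_elim
      fix j assume "?R - e < (\<integral>x. indicator X x * (\<Psi> x \<bullet> (1, F x)) \<partial>lborel) - (\<integral>x. norm (a j x - F x) \<partial>lborel)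
        + (\<integral>x. snd (\<Psi> x) \<bullet> h j x \<partial>lborel)"
      then show "?R - e < ?A j" using low[of j] by linarith
    qed
  qed
  show ?thesis
  proof (rule order_tendstoI)
    fix y assume "y < ?R"
    then show "\<forall>\<^sub>F j in sequentially. y < ?A j" using lower[of "?R - y"] by simp
  next
    fix y assume y: "?R < y"
    have "\<forall>\<^sub>F j in sequentially. (\<integral>x. norm (a j x - F x) \<partial>lborel) < y - ?R"
      using y by (intro order_tendstoD(2)[OF a(2)]) simp
    then show "\<forall>\<^sub>F j in sequentially. ?A j < y"
    proof eventually_elim
      fix j assume "(\<integral>x. norm (a j x - F x) \<partial>lborel) < y - ?R"
      then show "?A j < y" using upper[of j] by linarith
    qed
  qed
qed

section \<open>Uniqueness of the fractional variation\<close>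

lemma borel_measurable_component:
  fixes f :: "'a \<Rightarrow> real^'n"
  assumes "f \<in> borel_measurable M"
  shows "(\<lambda>x. f x $ k) \<in> borel_measurable M"
  by (rule borel_measurable_continuous_on[OF _ assms]) (rule linear_continuous_on[OF bounded_linear_vec_nth])

text \<open>This identifies the abstract pairing with a vector measure once the measure is given by densities.\<close>

lemma dot_integral_density:
  fixes f s :: "real^'n \<Rightarrow> real^'n"
  assumes T: "sets T = sets borel" and f: "integrable lborel f" and s: "integrable T s"
    and D: "radon_vmeasure D" "\<And>A. A \<in> sets borel \<Longrightarrow> D A = (LINT x:A|lborel. f x) + (LINT x:A|T. s x)"
    and \<phi>: "\<phi> \<in> borel_measurable borel" "\<And>x. norm (\<phi> x) \<le> C"
  shows "dot_integral D \<phi> = (\<integral>x. \<phi> x \<bullet> f x \<partial>lborel) + (\<integral>x. \<phi> x \<bullet> s x \<partial>T)"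
proof -
  have comp: "signed_integral (\<lambda>A. D A $ k) (\<lambda>x. \<phi> x $ k) = (\<integral>x. \<phi> x $ k * f x $ k \<partial>lborel) + (\<integral>x. \<phi> x $ k * s x $ k \<partial>T)" for k
  proof -
    have bl: "bounded_linear (\<lambda>v::real^'n. v $ k)" by (rule bounded_linear_vec_nth)
    have fk: "integrable lborel (\<lambda>x. f x $ k)" by (rule integrable_bounded_linear[OF bl f])
    have sk: "integrable T (\<lambda>x. s x $ k)" by (rule integrable_bounded_linear[OF bl s])
    define \<mu> where "\<mu> A = (if A \<in> sets borel then (LINT x:A|lborel. f x $ k) else 0)" for A
    define \<nu> where "\<nu> A = (if A \<in> sets borel then (LINT x:A|T. s x $ k) else 0)" for A
    have \<mu>: "radon_vmeasure \<mu>" unfolding \<mu>_def[abs_def] by (rule radon_density[OF sets_lborel fk])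
    have \<nu>: "radon_vmeasure \<nu>" unfolding \<nu>_def[abs_def] by (rule radon_density[OF T sk])
    have "(\<lambda>A. D A $ k) = (\<lambda>A. \<mu> A + \<nu> A)"
    proof (rule radon_eqI[OF radon_bounded_linear[OF D(1) bl] radon_add[OF \<mu> \<nu>]])
      fix A :: "(real^'n) set" assume A: "A \<in> sets borel"
      show "D A $ k = \<mu> A + \<nu> A"
        using set_integral_bounded_linear[OF bl sets_lborel f A] set_integral_bounded_linear[OF bl T s A] A
        by (simp add: D(2) \<mu>_def \<nu>_def)
    qed
    moreover have m: "(\<lambda>x. \<phi> x $ k) \<in> borel_measurable borel" by (rule borel_measurable_component[OF \<phi>(1)])
    have b: "\<bar>\<phi> x $ k\<bar> \<le> C" for x using component_le_norm_cart[of "\<phi> x" k] \<phi>(2)[of x] by linarith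
    have "signed_integral \<mu> (\<lambda>x. \<phi> x $ k) = (\<integral>x. \<phi> x $ k * f x $ k \<partial>lborel)"
      by (rule signed_integral_density[OF sets_lborel fk _ m b]) (simp add: \<mu>_def)
    moreover have "signed_integral \<nu> (\<lambda>x. \<phi> x $ k) = (\<integral>x. \<phi> x $ k * s x $ k \<partial>T)"
      by (rule signed_integral_density[OF T sk _ m b]) (simp add: \<nu>_def)
    ultimately show ?thesis using signed_integral_add[OF \<mu> \<nu> m b] by simp
  qed
  have int: "(\<Sum>k\<in>UNIV. \<integral>x. \<phi> x $ k * g x $ k \<partial>M) = (\<integral>x. \<phi> x \<bullet> g x \<partial>M)"
    if M: "sets M = sets borel" and g: "integrable M g" for M and g :: "real^'n \<Rightarrow> real^'n"
  proof -
    have "integrable M (\<lambda>x. \<phi> x $ k * g x $ k)" for k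
    proof -
      have "(\<lambda>x. \<phi> x $ k) \<in> borel_measurable borel" by (rule borel_measurable_component[OF \<phi>(1)])
      then have m: "(\<lambda>x. \<phi> x $ k) \<in> borel_measurable M" using M measurable_cong_sets by blast
      have b: "\<bar>\<phi> x $ k\<bar> \<le> C" for x using component_le_norm_cart[of "\<phi> x" k] \<phi>(2)[of x] by linarith
      show ?thesis
        using integrable_scaleR_bounded[OF integrable_bounded_linear[OF bounded_linear_vec_nth g] m b] by simp
    qed
    then show ?thesis by (simp add: inner_vec_def)
  qed
  show ?thesis unfolding dot_integral_def comp sum.distrib int[OF sets_lborel f] int[OF T s] ..
qed

lemma test_fields_determine:
  fixes a b :: "real^'n \<Rightarrow> real^'n"
  assumes T: "sets T = sets borel" and a: "integrable lborel a" and b: "integrable T b"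
    and z: "\<And>\<phi>::real^'n \<Rightarrow> real^'n. \<phi> \<in> Cc_infinity UNIV \<Longrightarrow> (\<integral>x. \<phi> x \<bullet> a x \<partial>lborel) + (\<integral>x. \<phi> x \<bullet> b x \<partial>T) = 0"
    and A: "A \<in> sets borel"
  shows "(LINT x:A|lborel. a x) + (LINT x:A|T. b x) = 0"
proof -
  have "((LINT x:A|lborel. a x) + (LINT x:A|T. b x)) $ k = 0" for k
  proof -
    have bl: "bounded_linear (\<lambda>v::real^'n. v $ k)" by (rule bounded_linear_vec_nth)
    have "(LINT x:A|lborel. a x $ k) + (LINT x:A|T. b x $ k) = 0"
    proof (rule test_functions_determine[OF T integrable_bounded_linear[OF bl a] integrable_bounded_linear[OF bl b] _ A])
      fix \<zeta> :: "real^'n \<Rightarrow> real" assume \<zeta>: "\<zeta> \<in> Cc_infinity UNIV"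
      have "(\<lambda>x. \<zeta> x *\<^sub>R (axis k 1 :: real^'n)) \<in> Cc_infinity UNIV"
        using \<zeta> Ck_scaleR[OF _ Ck_const] unfolding Cc_infinity_UNIV by (auto elim!: bounded_subset)
      from z[OF this] show "(\<integral>x. \<zeta> x * a x $ k \<partial>lborel) + (\<integral>x. \<zeta> x * b x $ k \<partial>T) = 0"
        by (simp add: inner_axis' inner_axis)
    qed
    then show ?thesis
      using set_integral_bounded_linear[OF bl sets_lborel a A] set_integral_bounded_linear[OF bl T b A] by simp
  qed
  then show ?thesis by (simp add: vec_eq_iff)
qed

text \<open>Written with a common dominating measure, the difference of two variations pairs to zero with all
  test fields.\<close>

lemma has_frac_variation_unique:
  fixes u :: "real^'n \<Rightarrow> real"
  assumes 1: "has_frac_variation \<alpha> u D" and 2: "has_frac_variation \<alpha> u E"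
  shows "D = E"
proof -
  have D: "radon_vmeasure D" and E: "radon_vmeasure E" using 1 2 by (simp_all add: has_frac_variation_def)
  obtain T a b where T: "finite_measure T" "sets T = sets borel" and i: "integrable T a" "integrable T b"
    and DE: "\<And>A. A \<in> sets borel \<Longrightarrow> D A = (LINT x:A|T. a x)" "\<And>A. A \<in> sets borel \<Longrightarrow> E A = (LINT x:A|T. b x)"
    using radon_common_representation[OF D E] by metis
  have z: "integrable lborel (\<lambda>x::real^'n. 0 :: real^'n)" by simp
  show ?thesis
  proof (rule radon_eqI[OF D E])
    fix A :: "(real^'n) set" assume A: "A \<in> sets borel"
    have "(LINT x:A|lborel. (0::real^'n)) + (LINT x:A|T. a x - b x) = 0"
    proof (rule test_fields_determine[OF T(2) z _ _ A])
      show "integrable T (\<lambda>x. a x - b x)" using i by simp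
      fix \<phi> :: "real^'n \<Rightarrow> real^'n" assume \<phi>: "\<phi> \<in> Cc_infinity UNIV"
      obtain C where C: "\<And>x. norm (\<phi> x) \<le> C" using Cc_infinity_bounded[OF \<phi>] by metis
      have m: "\<phi> \<in> borel_measurable borel" by (rule borel_measurable_continuous_onI[OF Cc_continuous[OF \<phi>]])
      have mT: "\<phi> \<in> borel_measurable T" using m T(2) measurable_cong_sets by blast
      have "dot_integral D \<phi> = (\<integral>x. \<phi> x \<bullet> (0::real^'n) \<partial>lborel) + (\<integral>x. \<phi> x \<bullet> a x \<partial>T)"
        by (rule dot_integral_density[OF T(2) z i(1) D _ m C]) (simp add: DE set_lebesgue_integral_def)
      moreover have "dot_integral E \<phi> = (\<integral>x. \<phi> x \<bullet> (0::real^'n) \<partial>lborel) + (\<integral>x. \<phi> x \<bullet> b x \<partial>T)"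
        by (rule dot_integral_density[OF T(2) z i(2) E _ m C]) (simp add: DE set_lebesgue_integral_def)
      moreover have "dot_integral D \<phi> = dot_integral E \<phi>"
        using 1 2 \<phi> unfolding has_frac_variation_def by (metis minus_equation_iff)
      ultimately show "(\<integral>x. \<phi> x \<bullet> (0::real^'n) \<partial>lborel) + (\<integral>x. \<phi> x \<bullet> (a x - b x) \<partial>T) = 0"
        using integrable_inner_bounded[OF i(1) mT C] integrable_inner_bounded[OF i(2) mT C]
        by (simp add: inner_diff_right)
    qed
    then have "(LINT x:A|T. a x) = (LINT x:A|T. b x)"
      using set_integrable_borel[OF i(1) T(2) A] set_integrable_borel[OF i(2) T(2) A]
      by (simp add: set_lebesgue_integral_def[of lborel])
    then show "D A = E A" using DE[OF A] by simp
  qed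
qed

lemma frac_variation_scalar_eq: "has_frac_variation \<alpha> u D \<Longrightarrow> frac_variation_scalar \<alpha> u = D"
  unfolding frac_variation_scalar_def using has_frac_variation_unique by (intro the_equality) blast+

lemma lebesgue_integral_cong_borel:
  fixes f f' :: "'a::euclidean_space \<Rightarrow> real"
  assumes f: "f \<in> borel_measurable lebesgue" and f': "f' \<in> borel_measurable borel" and ae: "AE x in lebesgue. f x = f' x"
  shows "(\<integral>x. f x \<partial>lebesgue) = (\<integral>x. f' x \<partial>lborel)" "integrable lebesgue f \<longleftrightarrow> integrable lborel f'"
proof -
  have f'l: "f' \<in> borel_measurable lebesgue" using f' by (intro measurable_completion) simp
  have "(\<integral>x. f x \<partial>lebesgue) = (\<integral>x. f' x \<partial>lebesgue)" by (rule integral_cong_AE[OF f f'l ae])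
  also have "\<dots> = (\<integral>x. f' x \<partial>lborel)" by (rule integral_completion) (use f' in simp)
  finally show "(\<integral>x. f x \<partial>lebesgue) = (\<integral>x. f' x \<partial>lborel)" .
  have "integrable lebesgue f \<longleftrightarrow> integrable lebesgue f'" by (rule integrable_cong_AE[OF f f'l ae])
  also have "\<dots> \<longleftrightarrow> integrable lborel f'" by (rule integrable_completion) (use f' in simp)
  finally show "integrable lebesgue f \<longleftrightarrow> integrable lborel f'" .
qed

text \<open>The definition speaks of Lebesgue measurable functions; this passes to a Borel representative.\<close>

lemma has_frac_variation_pairing:
  fixes u u' :: "real^'n \<Rightarrow> real"
  assumes \<alpha>: "0 < \<alpha>" "\<alpha> < 1" and u: "integrable lebesgue u" and u': "u' \<in> borel_measurable borel"
    and ae: "AE x in lebesgue. u x = u' x" and D: "radon_vmeasure D"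
  shows "has_frac_variation \<alpha> u D \<longleftrightarrow> frac_pairing \<alpha> u' (dot_integral D)"
proof -
  have um: "u \<in> borel_measurable lebesgue" using u by auto
  have iu: "integrable lborel u'" using lebesgue_integral_cong_borel(2)[OF um u' ae] u by simp
  have eq: "(\<integral>x. u x * frac_div \<alpha> \<phi> x \<partial>lebesgue) = (\<integral>x. u' x * frac_div \<alpha> \<phi> x \<partial>lborel)"
    if \<phi>: "\<phi> \<in> Cc_infinity UNIV" for \<phi> :: "real^'n \<Rightarrow> real^'n"
  proof (rule lebesgue_integral_cong_borel(1))
    have m: "frac_div \<alpha> \<phi> \<in> borel_measurable borel" by (rule frac_div_bounded(2)[OF \<alpha> \<phi>])
    then have "frac_div \<alpha> \<phi> \<in> borel_measurable lebesgue" by (intro measurable_completion) simp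
    then show "(\<lambda>x. u x * frac_div \<alpha> \<phi> x) \<in> borel_measurable lebesgue" using um by (intro borel_measurable_times)
    show "(\<lambda>x. u' x * frac_div \<alpha> \<phi> x) \<in> borel_measurable borel" using u' m by (intro borel_measurable_times)
    show "AE x in lebesgue. u x * frac_div \<alpha> \<phi> x = u' x * frac_div \<alpha> \<phi> x" using ae by eventually_elim simp
  qed
  show ?thesis unfolding has_frac_variation_def frac_pairing_def using D iu eq by simp
qed

lemma radon_vec:
  fixes D :: "'m::finite \<Rightarrow> 'a::euclidean_space set \<Rightarrow> 'b::euclidean_space"
  assumes "\<And>k. radon_vmeasure (D k)"
  shows "radon_vmeasure (\<lambda>A. \<chi> k. D k A)"
  unfolding radon_vmeasure_def
proof (intro conjI allI impI)
  fix A :: "'a set" assume "A \<notin> sets borel"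
  then show "(\<chi> k. D k A) = 0" using assms by (simp add: radon_vmeasure_def vec_eq_iff)
next
  fix A :: "nat \<Rightarrow> 'a set" assume A: "range A \<subseteq> sets borel \<and> disjoint_family A"
  show "(\<lambda>i. \<chi> k. D k (A i)) sums (\<chi> k. D k (\<Union>i. A i))"
    unfolding sums_def
  proof (rule vec_tendstoI)
    fix k
    have "(\<lambda>i. D k (A i)) sums D k (\<Union>i. A i)" using A assms[of k] unfolding radon_vmeasure_def by blast
    then show "(\<lambda>n. (\<Sum>i<n. \<chi> k. D k (A i)) $ k) \<longlonglongrightarrow> (\<chi> k. D k (\<Union>i. A i)) $ k"
      by (simp add: sums_def)
  qed
qed

section \<open>Localisation of the fractional variation\<close>

lemma Cc_infinity_sum:
  fixes f :: "'i \<Rightarrow> 'a::euclidean_space \<Rightarrow> 'b::real_normed_vector"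
  assumes "finite I" "\<And>i. i \<in> I \<Longrightarrow> f i \<in> Cc_infinity \<Omega>"
  shows "(\<lambda>x. \<Sum>i\<in>I. f i x) \<in> Cc_infinity \<Omega>"
proof (rule Cc_infinityI[where K = "\<Union>i\<in>I. closure {x. f i x \<noteq> 0}"])
  show "Ck k (\<lambda>x. \<Sum>i\<in>I. f i x)" for k
    using assms(2) unfolding Cc_infinity_def by (intro Ck_sum) blast
  show "compact (\<Union>i\<in>I. closure {x. f i x \<noteq> 0})"
    using assms unfolding Cc_infinity_def by (intro compact_UN) blast+
  show "(\<Union>i\<in>I. closure {x. f i x \<noteq> 0}) \<subseteq> \<Omega>"
    using assms(2) unfolding Cc_infinity_def by blast
  fix x assume x: "x \<notin> (\<Union>i\<in>I. closure {x. f i x \<noteq> 0})"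
  have "f i x = 0" if "i \<in> I" for i
  proof (rule ccontr)
    assume "f i x \<noteq> 0"
    then have "x \<in> {x. f i x \<noteq> 0}" by simp
    then have "x \<in> closure {x. f i x \<noteq> 0}" by (rule closure_subset[THEN subsetD])
    then show False using x that by blast
  qed
  then show "(\<Sum>i\<in>I. f i x) = 0" by simp
qed

lemma integrable_vec:
  fixes f :: "'a \<Rightarrow> 'b::euclidean_space ^ 'm"
  assumes "\<And>k. integrable M (\<lambda>x. f x $ k)"
  shows "integrable M f"
proof -
  have "integrable M (\<lambda>x. \<Sum>k\<in>UNIV. axis k (f x $ k))"
  proof (rule Bochner_Integration.integrable_sum)
    fix k :: 'm
    have "bounded_linear (axis k :: 'b \<Rightarrow> 'b ^ 'm)"
      by (rule linear_conv_bounded_linear[THEN iffD1], rule linearI) (simp_all add: axis_def vec_eq_iff)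
    then show "integrable M (\<lambda>x. axis k (f x $ k))" by (rule integrable_bounded_linear) (rule assms)
  qed
  moreover have "(\<Sum>k\<in>UNIV. axis k (v $ k)) = v" for v :: "'b ^ 'm"
    by (simp add: vec_eq_iff axis_def if_distrib[where f = "\<lambda>g. g $ _"] cong: if_cong)
  ultimately show ?thesis by simp
qed

lemma frac_pairing_cong:
  "frac_pairing \<alpha> u \<Lambda> \<Longrightarrow> (\<And>\<phi>. \<phi> \<in> Cc_infinity UNIV \<Longrightarrow> \<Lambda> \<phi> = \<Lambda>' \<phi>) \<Longrightarrow> frac_pairing \<alpha> u \<Lambda>'"
  by (simp add: frac_pairing_def)

lemma Cc_integrable_inner:
  fixes \<phi> f :: "'a::euclidean_space \<Rightarrow> 'b::euclidean_space"
  assumes \<phi>: "\<phi> \<in> Cc_infinity UNIV" and M: "sets M = sets borel" and f: "integrable M f"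
  shows "integrable M (\<lambda>x. \<phi> x \<bullet> f x)"
proof -
  obtain C where C: "\<And>x. norm (\<phi> x) \<le> C" using Cc_infinity_bounded[OF \<phi>] by metis
  show ?thesis
    by (rule integrable_inner_bounded[OF f borel_measurable_continuous_UNIV[OF M Cc_continuous[OF \<phi>]] C])
qed

lemma conv_adjoint_mollifier:
  fixes s \<phi> :: "'a::euclidean_space \<Rightarrow> 'b::euclidean_space"
  assumes "sigma_finite_measure Q" "sets Q = sets borel" and m: "mollifier \<eta> a r" and s: "integrable Q s"
    and \<phi>: "\<phi> \<in> Cc_infinity UNIV"
  shows "(\<integral>x. \<phi> x \<bullet> conv Q \<eta> s x \<partial>lborel) = (\<integral>y. conv lborel (\<lambda>z. \<eta> (- z)) \<phi> y \<bullet> s y \<partial>Q)"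
proof -
  obtain C where C: "\<And>x. norm (\<phi> x) \<le> C" using Cc_infinity_bounded[OF \<phi>] by metis
  obtain B where B: "\<And>z. \<bar>\<eta> z\<bar> \<le> B" using mollifierD(7)[OF m] by blast
  show ?thesis
    by (rule conv_adjoint[OF assms(1,2) mollifierD(5)[OF m] B s borel_measurable_continuous_onI[OF Cc_continuous[OF \<phi>]] C])
qed

text \<open>If the variation of \<open>v\<close> has density \<open>f\<close> and singular part \<open>s T\<close>, then multiplication by \<open>\<theta>\<close> multiplies both
  by \<open>\<theta>\<close> and adds an \<open>L\<^sup>1\<close> function. Subsequent mollification turns everything into a density: a
  part that converges in \<open>L\<^sup>1\<close> and the mollified singular part.\<close>

lemma frac_pairing_localised:
  fixes v \<theta> :: "real^'n \<Rightarrow> real" and f s :: "real^'n \<Rightarrow> real^'n"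
  assumes \<alpha>: "0 < \<alpha>" "\<alpha> < 1" and T: "finite_measure T" "sets T = sets borel"
    and f: "integrable lborel f" and s: "integrable T s"
    and v: "frac_pairing \<alpha> v (\<lambda>\<phi>. (\<integral>x. \<phi> x \<bullet> f x \<partial>lborel) + (\<integral>x. \<phi> x \<bullet> s x \<partial>T))"
    and \<theta>: "\<And>k. Ck k \<theta>" and L: "\<And>x y. norm (\<theta> x - \<theta> y) \<le> L * norm (x - y)" and B: "\<And>x. norm (\<theta> x) \<le> 1"
  shows "frac_pairing \<alpha> (\<lambda>x. \<theta> x * v x) (\<lambda>\<phi>. (\<integral>x. \<phi> x \<bullet> (\<theta> x *\<^sub>R f x + nonlocal_gradient \<alpha> \<theta> v x) \<partial>lborel)
      + (\<integral>x. \<phi> x \<bullet> (\<theta> x *\<^sub>R s x) \<partial>T))"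
    and "integrable lborel (\<lambda>x. \<theta> x *\<^sub>R f x + nonlocal_gradient \<alpha> \<theta> v x)"
    and "integrable T (\<lambda>x. \<theta> x *\<^sub>R s x)"
    and "mollifier \<eta> a r \<Longrightarrow> frac_pairing \<alpha> (conv lborel \<eta> (\<lambda>x. \<theta> x * v x))
      (\<lambda>\<phi>. \<integral>x. \<phi> x \<bullet> (conv lborel \<eta> (\<lambda>x. \<theta> x *\<^sub>R f x + nonlocal_gradient \<alpha> \<theta> v x) x + conv T \<eta> (\<lambda>x. \<theta> x *\<^sub>R s x) x) \<partial>lborel)"
proof -
  interpret T: finite_measure T by fact
  have vi: "integrable lborel v" using v by (simp add: frac_pairing_def)
  have \<theta>c: "continuous_on UNIV \<theta>" using \<theta>[of 0] by simp
  have \<theta>m: "\<theta> \<in> borel_measurable borel" by (rule borel_measurable_continuous_onI[OF \<theta>c])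
  have \<theta>T: "\<theta> \<in> borel_measurable T" by (rule borel_measurable_continuous_UNIV[OF T(2) \<theta>c])
  have B': "\<bar>\<theta> x\<bar> \<le> 1" for x using B[of x] by simp
  have i1: "integrable lborel (\<lambda>x. \<theta> x *\<^sub>R f x)" by (rule integrable_scaleR_bounded[OF f _ B']) (use \<theta>m in simp)
  have i2: "integrable lborel (nonlocal_gradient \<alpha> \<theta> v)" by (rule nonlocal_gradient_integrable[OF \<alpha> vi L B \<theta>m])
  show i3: "integrable lborel (\<lambda>x. \<theta> x *\<^sub>R f x + nonlocal_gradient \<alpha> \<theta> v x)" using i1 i2 by simp
  show i4: "integrable T (\<lambda>x. \<theta> x *\<^sub>R s x)" by (rule integrable_scaleR_bounded[OF s \<theta>T B'])
  show loc: "frac_pairing \<alpha> (\<lambda>x. \<theta> x * v x) (\<lambda>\<phi>. (\<integral>x. \<phi> x \<bullet> (\<theta> x *\<^sub>R f x + nonlocal_gradient \<alpha> \<theta> v x) \<partial>lborel)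
      + (\<integral>x. \<phi> x \<bullet> (\<theta> x *\<^sub>R s x) \<partial>T))"
  proof (rule frac_pairing_cong[OF frac_pairing_mult[OF \<alpha> v \<theta> L B]])
    fix \<phi> :: "real^'n \<Rightarrow> real^'n" assume \<phi>: "\<phi> \<in> Cc_infinity UNIV"
    have "(\<integral>x. \<phi> x \<bullet> (\<theta> x *\<^sub>R f x + nonlocal_gradient \<alpha> \<theta> v x) \<partial>lborel)
        = (\<integral>x. \<phi> x \<bullet> (\<theta> x *\<^sub>R f x) \<partial>lborel) + (\<integral>x. \<phi> x \<bullet> nonlocal_gradient \<alpha> \<theta> v x \<partial>lborel)"
      unfolding inner_add_right
      by (rule Bochner_Integration.integral_add[OF Cc_integrable_inner[OF \<phi> sets_lborel i1] Cc_integrable_inner[OF \<phi> sets_lborel i2]])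
    then show "(\<integral>x. (\<theta> x *\<^sub>R \<phi> x) \<bullet> f x \<partial>lborel) + (\<integral>x. (\<theta> x *\<^sub>R \<phi> x) \<bullet> s x \<partial>T) + (\<integral>x. \<phi> x \<bullet> nonlocal_gradient \<alpha> \<theta> v x \<partial>lborel)
      = (\<integral>x. \<phi> x \<bullet> (\<theta> x *\<^sub>R f x + nonlocal_gradient \<alpha> \<theta> v x) \<partial>lborel) + (\<integral>x. \<phi> x \<bullet> (\<theta> x *\<^sub>R s x) \<partial>T)"
      by simp
  qed
  assume m: "mollifier \<eta> a r"
  show "frac_pairing \<alpha> (conv lborel \<eta> (\<lambda>x. \<theta> x * v x))
      (\<lambda>\<phi>. \<integral>x. \<phi> x \<bullet> (conv lborel \<eta> (\<lambda>x. \<theta> x *\<^sub>R f x + nonlocal_gradient \<alpha> \<theta> v x) x + conv T \<eta> (\<lambda>x. \<theta> x *\<^sub>R s x) x) \<partial>lborel)"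
  proof (rule frac_pairing_cong[OF frac_pairing_conv[OF \<alpha> loc m]])
    fix \<phi> :: "real^'n \<Rightarrow> real^'n" assume \<phi>: "\<phi> \<in> Cc_infinity UNIV"
    have c1: "integrable lborel (conv lborel \<eta> (\<lambda>x. \<theta> x *\<^sub>R f x + nonlocal_gradient \<alpha> \<theta> v x))"
      by (rule conv_integrable[OF lborel.sigma_finite_measure_axioms sets_lborel mollifierD(5)[OF m] i3])
    have c2: "integrable lborel (conv T \<eta> (\<lambda>x. \<theta> x *\<^sub>R s x))"
      by (rule conv_integrable[OF T.sigma_finite_measure_axioms T(2) mollifierD(5)[OF m] i4])
    show "(\<integral>x. conv lborel (\<lambda>z. \<eta> (- z)) \<phi> x \<bullet> (\<theta> x *\<^sub>R f x + nonlocal_gradient \<alpha> \<theta> v x) \<partial>lborel)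
        + (\<integral>x. conv lborel (\<lambda>z. \<eta> (- z)) \<phi> x \<bullet> (\<theta> x *\<^sub>R s x) \<partial>T)
      = (\<integral>x. \<phi> x \<bullet> (conv lborel \<eta> (\<lambda>x. \<theta> x *\<^sub>R f x + nonlocal_gradient \<alpha> \<theta> v x) x + conv T \<eta> (\<lambda>x. \<theta> x *\<^sub>R s x) x) \<partial>lborel)"
      unfolding inner_add_right[of "\<phi> _" "conv _ _ _ _"]
        Bochner_Integration.integral_add[OF Cc_integrable_inner[OF \<phi> sets_lborel c1] Cc_integrable_inner[OF \<phi> sets_lborel c2]]
        conv_adjoint_mollifier[OF lborel.sigma_finite_measure_axioms sets_lborel m i3 \<phi>]
        conv_adjoint_mollifier[OF T.sigma_finite_measure_axioms T(2) m i4 \<phi>] ..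
  qed
qed

lemma frac_pairing_sum:
  fixes v :: "'i \<Rightarrow> real^'n \<Rightarrow> real" and p :: "'i \<Rightarrow> real^'n \<Rightarrow> real^'n"
  assumes \<alpha>: "0 < \<alpha>" "\<alpha> < 1" and I: "finite I"
    and v: "\<And>i. i \<in> I \<Longrightarrow> frac_pairing \<alpha> (v i) (\<lambda>\<phi>. \<integral>x. \<phi> x \<bullet> p i x \<partial>lborel)" and p: "\<And>i. i \<in> I \<Longrightarrow> integrable lborel (p i)"
  shows "frac_pairing \<alpha> (\<lambda>x. \<Sum>i\<in>I. v i x) (\<lambda>\<phi>. \<integral>x. \<phi> x \<bullet> (\<Sum>i\<in>I. p i x) \<partial>lborel)"
  using I v p
proof (induction I rule: finite_induct)
  case empty
  then show ?case by (simp add: frac_pairing_def)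
next
  case (insert i I)
  have pI: "integrable lborel (\<lambda>x. \<Sum>i\<in>I. p i x)" using insert by (intro Bochner_Integration.integrable_sum) blast
  have "frac_pairing \<alpha> (\<lambda>x. v i x + (\<Sum>i\<in>I. v i x)) (\<lambda>\<phi>. \<integral>x. \<phi> x \<bullet> (p i x + (\<Sum>i\<in>I. p i x)) \<partial>lborel)"
  proof (rule frac_pairing_cong[OF frac_pairing_add[OF \<alpha>]])
    show "frac_pairing \<alpha> (v i) (\<lambda>\<phi>. \<integral>x. \<phi> x \<bullet> p i x \<partial>lborel)" using insert by blast
    show "frac_pairing \<alpha> (\<lambda>x. \<Sum>i\<in>I. v i x) (\<lambda>\<phi>. \<integral>x. \<phi> x \<bullet> (\<Sum>i\<in>I. p i x) \<partial>lborel)" using insert by blast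
    fix \<phi> :: "real^'n \<Rightarrow> real^'n" assume \<phi>: "\<phi> \<in> Cc_infinity UNIV"
    have "integrable lborel (p i)" using insert by blast
    from Bochner_Integration.integral_add[OF Cc_integrable_inner[OF \<phi> sets_lborel this] Cc_integrable_inner[OF \<phi> sets_lborel pI]]
    show "(\<integral>x. \<phi> x \<bullet> p i x \<partial>lborel) + (\<integral>x. \<phi> x \<bullet> (\<Sum>i\<in>I. p i x) \<partial>lborel) = (\<integral>x. \<phi> x \<bullet> (p i x + (\<Sum>i\<in>I. p i x)) \<partial>lborel)"
      by (simp only: inner_add_right)
  qed
  then show ?case using insert by simp
qed

text \<open>Multiply \<open>v\<close> by a test function \<open>\<zeta>\<close> supported off \<open>X\<close>. The product is zero, so \<open>\<zeta> D v\<close> is minus the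
  nonlocal gradient and thus absolutely continuous. Hence \<open>\<zeta> s\<close> vanishes almost everywhere for \<open>T\<close>.\<close>

lemma singular_part_supported:
  fixes v :: "real^'n \<Rightarrow> real" and f s :: "real^'n \<Rightarrow> real^'n"
  assumes \<alpha>: "0 < \<alpha>" "\<alpha> < 1" and T: "finite_measure T" "sets T = sets borel"
    and f: "integrable lborel f" and s: "integrable T s"
    and N: "N \<in> null_sets lborel" "N \<in> sets borel" "\<And>x. x \<notin> N \<Longrightarrow> s x = 0"
    and v: "frac_pairing \<alpha> v (\<lambda>\<phi>. (\<integral>x. \<phi> x \<bullet> f x \<partial>lborel) + (\<integral>x. \<phi> x \<bullet> s x \<partial>T))"
    and X: "closed X" "\<And>x. x \<notin> X \<Longrightarrow> v x = 0"
  shows "AE x in T. x \<notin> X \<longrightarrow> s x = 0"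
proof -
  interpret T: finite_measure T by fact
  obtain \<zeta> :: "nat \<Rightarrow> real^'n \<Rightarrow> real" where \<zeta>: "\<And>n. \<zeta> n \<in> Cc_infinity (- X)" "\<And>n x. 0 \<le> \<zeta> n x" "\<And>n x. \<zeta> n x \<le> 1"
    "\<And>x. (\<lambda>n. \<zeta> n x) \<longlonglongrightarrow> indicator (- X) x"
    using smooth_approx_open[of "- X"] X(1) by (metis open_Compl)
  have "AE x in T. \<zeta> n x *\<^sub>R s x = 0" for n
  proof -
    note \<zeta>U = Cc_infinity_imp_UNIV[OF \<zeta>(1)[of n]]
    have Ckn: "\<And>k. Ck k (\<zeta> n)" using \<zeta>U by (simp add: Cc_infinity_UNIV)
    obtain L where L: "\<And>x y. norm (\<zeta> n x - \<zeta> n y) \<le> L * norm (x - y)" using Cc_infinity_lipschitz[OF \<zeta>U] by metis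
    have B: "norm (\<zeta> n x) \<le> 1" for x using \<zeta>(2,3)[of n x] by simp
    have z: "\<zeta> n x * v x = 0" for x
    proof (cases "x \<in> X")
      case True
      have "closure {x. \<zeta> n x \<noteq> 0} \<subseteq> - X" using \<zeta>(1)[of n] unfolding Cc_infinity_def by blast
      then have "\<zeta> n x = 0" using True closure_subset[of "{x. \<zeta> n x \<noteq> 0}"] by blast
      then show ?thesis by simp
    qed (simp add: X(2))
    note loc = frac_pairing_localised[OF \<alpha> T f s v Ckn L B]
    have test: "(\<integral>x. \<phi> x \<bullet> (\<zeta> n x *\<^sub>R f x + nonlocal_gradient \<alpha> (\<zeta> n) v x) \<partial>lborel) + (\<integral>x. \<phi> x \<bullet> (\<zeta> n x *\<^sub>R s x) \<partial>T) = 0"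
      if "\<phi> \<in> Cc_infinity UNIV" for \<phi>
    proof -
      have "(\<integral>x. \<zeta> n x * v x * frac_div \<alpha> \<phi> x \<partial>lborel) = - ((\<integral>x. \<phi> x \<bullet> (\<zeta> n x *\<^sub>R f x + nonlocal_gradient \<alpha> (\<zeta> n) v x) \<partial>lborel) + (\<integral>x. \<phi> x \<bullet> (\<zeta> n x *\<^sub>R s x) \<partial>T))"
        using loc(1) that unfolding frac_pairing_def by blast
      moreover have "(\<integral>x. \<zeta> n x * v x * frac_div \<alpha> \<phi> x \<partial>lborel) = 0" by (simp add: z)
      ultimately show ?thesis by linarith
    qed
    have D: "(LINT x:A|lborel. \<zeta> n x *\<^sub>R f x + nonlocal_gradient \<alpha> (\<zeta> n) v x) + (LINT x:A|T. \<zeta> n x *\<^sub>R s x) = 0"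
      if "A \<in> sets borel" for A
      by (rule test_fields_determine[OF T(2) loc(2,3) test that])
    show "AE x in T. \<zeta> n x *\<^sub>R s x = 0"
    proof (rule T.density_unique_banach[OF loc(3) integrable_zero])
      fix A assume "A \<in> sets T"
      then have A: "A \<in> sets borel" "A \<inter> N \<in> sets borel" using T(2) N(2) by auto
      have "AE x in lborel. x \<notin> N" by (rule AE_not_in[OF N(1)])
      then have "AE x in lborel. indicator (A \<inter> N) x *\<^sub>R (\<zeta> n x *\<^sub>R f x + nonlocal_gradient \<alpha> (\<zeta> n) v x) = 0"
        by eventually_elim simp
      then have "(LINT x:A \<inter> N|lborel. \<zeta> n x *\<^sub>R f x + nonlocal_gradient \<alpha> (\<zeta> n) v x) = 0"
        unfolding set_lebesgue_integral_def by (rule integral_eq_zero_AE)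
      then have "(LINT x:A \<inter> N|T. \<zeta> n x *\<^sub>R s x) = 0" using D[OF A(2)] by simp
      moreover have "(LINT x:A \<inter> N|T. \<zeta> n x *\<^sub>R s x) = (LINT x:A|T. \<zeta> n x *\<^sub>R s x)"
        unfolding set_lebesgue_integral_def
        by (intro Bochner_Integration.integral_cong refl) (use N(3) in \<open>auto simp: indicator_def\<close>)
      ultimately show "(LINT x:A|T. \<zeta> n x *\<^sub>R s x) = (LINT x:A|T. 0)" by (simp add: set_lebesgue_integral_def[of _ _ "\<lambda>x. 0"])
    qed
  qed
  then have "AE x in T. \<forall>n. \<zeta> n x *\<^sub>R s x = 0" unfolding AE_all_countable by blast
  then show ?thesis
  proof eventually_elim
    fix x assume z: "\<forall>n. \<zeta> n x *\<^sub>R s x = 0"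
    show "x \<notin> X \<longrightarrow> s x = 0"
    proof
      assume "x \<notin> X"
      have "(\<lambda>n. \<zeta> n x *\<^sub>R s x) \<longlonglongrightarrow> indicator (- X) x *\<^sub>R s x" by (intro tendsto_scaleR \<zeta>(4) tendsto_const)
      then have "(\<lambda>n::nat. 0) \<longlonglongrightarrow> indicator (- X) x *\<^sub>R s x" using z by simp
      then have "indicator (- X) x *\<^sub>R s x = 0" by (simp add: LIMSEQ_const_iff)
      then show "s x = 0" using \<open>x \<notin> X\<close> by simp
    qed
  qed
qed

text \<open>The increments of a partition of unity add up to zero. The statement holds almost everywhere only,
  because the individual integrals exist almost everywhere.\<close>

lemma nonlocal_gradient_partition:
  fixes v :: "real^'n \<Rightarrow> real" and \<theta> :: "'i \<Rightarrow> real^'n \<Rightarrow> real"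
  assumes \<alpha>: "0 < \<alpha>" "\<alpha> < 1" and v: "integrable lborel v" and I: "finite I"
    and \<theta>: "\<And>i. continuous_on UNIV (\<theta> i)" "\<And>i x y. norm (\<theta> i x - \<theta> i y) \<le> L i * norm (x - y)" "\<And>i x. norm (\<theta> i x) \<le> 1"
    and one: "\<And>x. (\<Sum>i\<in>I. \<theta> i x) = 1"
  shows "AE y in lborel. (\<Sum>i\<in>I. nonlocal_gradient \<alpha> (\<theta> i) v y) = 0"
proof -
  have "AE y in lborel. \<forall>i\<in>I. integrable lborel (\<lambda>x. (v x * (\<theta> i y - \<theta> i x)) *\<^sub>R riesz_kernel \<alpha> (y - x))"
  proof (rule AE_finite_allI[OF I])
    fix i
    show "AE y in lborel. integrable lborel (\<lambda>x. (v x * (\<theta> i y - \<theta> i x)) *\<^sub>R riesz_kernel \<alpha> (y - x))"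
      by (rule lborel_pair.AE_integrable_snd[OF nonlocal_pair_integrable[OF \<alpha> v \<theta>(2,3) borel_measurable_continuous_onI[OF \<theta>(1)]]])
  qed
  then show ?thesis
  proof eventually_elim
    fix y assume i: "\<forall>i\<in>I. integrable lborel (\<lambda>x. (v x * (\<theta> i y - \<theta> i x)) *\<^sub>R riesz_kernel \<alpha> (y - x))"
    have "(\<Sum>i\<in>I. nonlocal_gradient \<alpha> (\<theta> i) v y) = frac_const CARD('n) \<alpha> *\<^sub>R
      (\<Sum>i\<in>I. \<integral>x. (v x * (\<theta> i y - \<theta> i x)) *\<^sub>R riesz_kernel \<alpha> (y - x) \<partial>lborel)"
      by (simp add: nonlocal_gradient_def scaleR_sum_right)
    also have "(\<Sum>i\<in>I. \<integral>x. (v x * (\<theta> i y - \<theta> i x)) *\<^sub>R riesz_kernel \<alpha> (y - x) \<partial>lborel)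
      = (\<integral>x. (\<Sum>i\<in>I. (v x * (\<theta> i y - \<theta> i x)) *\<^sub>R riesz_kernel \<alpha> (y - x)) \<partial>lborel)"
      by (rule Bochner_Integration.integral_sum[symmetric]) (use i in blast)
    also have "(\<lambda>x. \<Sum>i\<in>I. (v x * (\<theta> i y - \<theta> i x)) *\<^sub>R riesz_kernel \<alpha> (y - x)) = (\<lambda>x. 0)"
    proof
      fix x
      have "(\<Sum>i\<in>I. (v x * (\<theta> i y - \<theta> i x)) *\<^sub>R riesz_kernel \<alpha> (y - x)) = (v x * ((\<Sum>i\<in>I. \<theta> i y) - (\<Sum>i\<in>I. \<theta> i x))) *\<^sub>R riesz_kernel \<alpha> (y - x)"
        by (simp add: scaleR_sum_left[symmetric] sum_distrib_left[symmetric] sum_subtractf)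
      then show "(\<Sum>i\<in>I. (v x * (\<theta> i y - \<theta> i x)) *\<^sub>R riesz_kernel \<alpha> (y - x)) = 0" by (simp add: one)
    qed
    finally show "(\<Sum>i\<in>I. nonlocal_gradient \<alpha> (\<theta> i) v y) = 0" by simp
  qed
qed

text \<open>A fractional variation is recognised by its densities: by uniqueness it suffices to verify the
  pairing in each component.\<close>

lemma frac_variation_density:
  fixes w :: "real^'n \<Rightarrow> real^'m" and f s :: "real^'n \<Rightarrow> real^'n^'m"
  assumes \<alpha>: "0 < \<alpha>" "\<alpha> < 1" and T: "finite_measure T" "sets T = sets borel"
    and f: "integrable lborel f" and s: "integrable T s"
    and w: "\<And>k. integrable lebesgue (\<lambda>x. w x $ k)" and w': "\<And>k. w' k \<in> borel_measurable borel"
    and ae: "\<And>k. AE x in lebesgue. w x $ k = w' k x"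
    and pair: "\<And>k. frac_pairing \<alpha> (w' k) (\<lambda>\<phi>. (\<integral>x. \<phi> x \<bullet> f x $ k \<partial>lborel) + (\<integral>x. \<phi> x \<bullet> s x $ k \<partial>T))"
  shows "w \<in> BV_frac \<alpha>"
    and "frac_variation \<alpha> w = (\<lambda>A. if A \<in> sets borel then (LINT x:A|lborel. f x) + (LINT x:A|T. s x) else 0)"
proof -
  define D where "D k A = (if A \<in> sets borel then (LINT x:A|lborel. f x $ k) else 0) + (if A \<in> sets borel then (LINT x:A|T. s x $ k) else 0)" for k A
  have bl: "bounded_linear (\<lambda>v::real^'n^'m. v $ k)" for k by (rule bounded_linear_vec_nth)
  have fk: "integrable lborel (\<lambda>x. f x $ k)" and sk: "integrable T (\<lambda>x. s x $ k)" for k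
    by (rule integrable_bounded_linear[OF bl f], rule integrable_bounded_linear[OF bl s])
  have D: "radon_vmeasure (D k)" for k
    unfolding D_def by (intro radon_add radon_density sets_lborel T(2) fk sk)
  have hv: "has_frac_variation \<alpha> (\<lambda>x. w x $ k) (D k)" for k
    unfolding has_frac_variation_pairing[OF \<alpha> w w' ae D]
  proof (rule frac_pairing_cong[OF pair])
    fix \<phi> :: "real^'n \<Rightarrow> real^'n" assume \<phi>: "\<phi> \<in> Cc_infinity UNIV"
    obtain C where C: "\<And>x. norm (\<phi> x) \<le> C" using Cc_infinity_bounded[OF \<phi>] by metis
    show "(\<integral>x. \<phi> x \<bullet> f x $ k \<partial>lborel) + (\<integral>x. \<phi> x \<bullet> s x $ k \<partial>T) = dot_integral (D k) \<phi>"
      by (rule dot_integral_density[OF T(2) fk sk D _ borel_measurable_continuous_onI[OF Cc_continuous[OF \<phi>]] C, symmetric])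
        (simp add: D_def)
  qed
  then show "w \<in> BV_frac \<alpha>" using w by (auto simp: BV_frac_def BV_frac_scalar_def)
  show "frac_variation \<alpha> w = (\<lambda>A. if A \<in> sets borel then (LINT x:A|lborel. f x) + (LINT x:A|T. s x) else 0)"
  proof
    fix A :: "(real^'n) set"
    show "frac_variation \<alpha> w A = (if A \<in> sets borel then (LINT x:A|lborel. f x) + (LINT x:A|T. s x) else 0)"
      unfolding frac_variation_def frac_variation_scalar_eq[OF hv]
      using set_integral_bounded_linear[OF bl sets_lborel f] set_integral_bounded_linear[OF bl T(2) s]
      by (simp add: vec_eq_iff D_def)
  qed
qed

text \<open>Uniqueness of the decomposition makes the chosen density and the singular part computable.\<close>

lemma
  fixes f s :: "'a::euclidean_space \<Rightarrow> 'b::euclidean_space"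
  assumes T: "finite_measure T" "sets T = sets borel" and f: "integrable lborel f" and s: "integrable T s"
    and N: "N \<in> null_sets lborel" "N \<in> sets borel" "\<And>x. x \<notin> N \<Longrightarrow> s x = 0"
  defines "\<mu> \<equiv> (\<lambda>A. if A \<in> sets borel then (LINT x:A|lborel. f x) + (LINT x:A|T. s x) else 0)"
  shows ac_density_of_densities: "AE x in lebesgue. ac_density \<mu> x = f x"
    and singular_part_of_densities: "singular_part \<mu> = (\<lambda>A. if A \<in> sets borel then (LINT x:A|T. s x) else 0)"
    and area_functional_of_densities: "X \<in> sets borel \<Longrightarrow> emeasure lborel X < \<infinity> \<Longrightarrow> (\<And>x. x \<notin> X \<Longrightarrow> s x = 0) \<Longrightarrow>
      area_functional \<mu> X = ennreal ((\<integral>x. indicator X x * norm (1::real, f x) \<partial>lborel) + (\<integral>x. norm (s x) \<partial>T))"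
proof -
  have dec: "lebesgue_decomposition \<mu> f (\<lambda>A. if A \<in> sets borel then (LINT x:A|T. s x) else 0)"
    by (rule lebesgue_decomposition_density[OF T s f N(1,2)]) (auto simp: N(3) \<mu>_def)
  show ae: "AE x in lebesgue. ac_density \<mu> x = f x" by (rule ac_density_eq[OF dec])
  show sp: "singular_part \<mu> = (\<lambda>A. if A \<in> sets borel then (LINT x:A|T. s x) else 0)" by (rule singular_part_eq[OF dec])
  assume X: "X \<in> sets borel" "emeasure lborel X < \<infinity>" and sX: "\<And>x. x \<notin> X \<Longrightarrow> s x = 0"
  note i = integrable_indicator_one_Pair(2)[OF X f]
  have "(\<integral>\<^sup>+x\<in>X. ennreal (sqrt (1 + (norm (ac_density \<mu> x))\<^sup>2)) \<partial>lebesgue) = (\<integral>\<^sup>+x. ennreal (indicator X x * norm (1::real, f x)) \<partial>lebesgue)"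
  proof (rule nn_integral_cong_AE)
    show "AE x in lebesgue. ennreal (sqrt (1 + (norm (ac_density \<mu> x))\<^sup>2)) * indicator X x = ennreal (indicator X x * norm (1::real, f x))"
      using ae by eventually_elim (simp add: indicator_def sqrt_one_plus_norm del: norm_Pair)
  qed
  also have "\<dots> = (\<integral>\<^sup>+x. ennreal (indicator X x * norm (1::real, f x)) \<partial>lborel)"
    by (rule nn_integral_completion)
  also have "\<dots> = ennreal (\<integral>x. indicator X x * norm (1::real, f x) \<partial>lborel)"
    by (rule nn_integral_eq_integral[OF i]) simp
  finally have 1: "(\<integral>\<^sup>+x\<in>X. ennreal (sqrt (1 + (norm (ac_density \<mu> x))\<^sup>2)) \<partial>lebesgue) = ennreal (\<integral>x. indicator X x * norm (1::real, f x) \<partial>lborel)" .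
  have "total_variation (singular_part \<mu>) X = (\<integral>\<^sup>+x\<in>X. ennreal (norm (s x)) \<partial>T)"
    by (rule total_variation_density[OF T s _ X(1)]) (simp add: sp)
  also have "\<dots> = (\<integral>\<^sup>+x. ennreal (norm (s x)) \<partial>T)"
    using sX by (intro nn_integral_cong) (auto simp: indicator_def)
  also have "\<dots> = ennreal (\<integral>x. norm (s x) \<partial>T)" by (rule nn_integral_eq_integral[OF integrable_norm[OF s]]) simp
  finally have 2: "total_variation (singular_part \<mu>) X = ennreal (\<integral>x. norm (s x) \<partial>T)" .
  have nn: "0 \<le> (\<integral>x. indicator X x * norm (1::real, f x) \<partial>lborel)" by (rule integral_nonneg_AE) simp
  show "area_functional \<mu> X = ennreal ((\<integral>x. indicator X x * norm (1::real, f x) \<partial>lborel) + (\<integral>x. norm (s x) \<partial>T))"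
    unfolding area_functional_def 1 2 using nn by (intro ennreal_plus[symmetric]) auto
qed

text \<open>Borel representatives and densities for all components at once: the singular parts share one
  dominating measure and one null set.\<close>

lemma BV_frac_data:
  fixes u :: "real^'n \<Rightarrow> real^'m"
  assumes \<alpha>: "0 < \<alpha>" "\<alpha> < 1" and u: "u \<in> BV_frac \<alpha>"
  obtains T :: "(real^'n) measure" and s f N u' where
    "finite_measure T" "sets T = sets borel" "integrable lborel f" "integrable T s"
    "N \<in> null_sets lborel" "N \<in> sets borel" "\<And>x. x \<notin> N \<Longrightarrow> s x = 0"
    "\<And>k. u' k \<in> borel_measurable borel" "\<And>k. integrable lebesgue (\<lambda>x. u x $ k)" "\<And>k. AE x in lebesgue. u x $ k = u' k x"
    "\<And>k. frac_pairing \<alpha> (u' k) (\<lambda>\<phi>. (\<integral>x. \<phi> x \<bullet> f x $ k \<partial>lborel) + (\<integral>x. \<phi> x \<bullet> s x $ k \<partial>T))"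
proof -
  have i: "integrable lebesgue (\<lambda>x. u x $ k)" for k using u by (simp add: BV_frac_def BV_frac_scalar_def)
  have "\<exists>D. has_frac_variation \<alpha> (\<lambda>x. u x $ k) D" for k using u by (simp add: BV_frac_def BV_frac_scalar_def)
  then obtain D where D: "\<And>k. has_frac_variation \<alpha> (\<lambda>x. u x $ k) (D k)" by metis
  have Dr: "radon_vmeasure (D k)" for k using D by (simp add: has_frac_variation_def)
  have "\<exists>u'\<in>borel_measurable borel. AE x in lebesgue. u x $ k = u' x" for k
  proof -
    have "(\<lambda>x. u x $ k) \<in> borel_measurable lebesgue" using i by auto
    from completion_ex_borel_measurable_real[OF this] obtain u' where u': "u' \<in> borel_measurable lborel" "AE x in lborel. u x $ k = u' x"
      by blast
    show ?thesis using AE_completion[OF u'(2)] u'(1) by (intro bexI[of _ u']) simp_all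
  qed
  then obtain u' where u': "\<And>k. u' k \<in> borel_measurable borel" "\<And>k. AE x in lebesgue. u x $ k = u' k x" by metis
  obtain T s f N where T: "finite_measure T" "sets T = sets borel" and s: "integrable T s" and f: "integrable lborel f"
    and N: "N \<in> null_sets lborel" "N \<in> sets borel" "\<And>x. x \<notin> N \<Longrightarrow> s x = 0"
    and rep: "\<And>A. A \<in> sets borel \<Longrightarrow> (\<chi> k. D k A) = (LINT x:A|lborel. f x) + (LINT x:A|T. s x)"
    by (rule radon_structure[OF radon_vec[OF Dr]]) (rule that)
  have bl: "bounded_linear (\<lambda>v::real^'n^'m. v $ k)" for k by (rule bounded_linear_vec_nth)
  have fk: "integrable lborel (\<lambda>x. f x $ k)" and sk: "integrable T (\<lambda>x. s x $ k)" for k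
    by (rule integrable_bounded_linear[OF bl f], rule integrable_bounded_linear[OF bl s])
  have Dk: "D k A = (LINT x:A|lborel. f x $ k) + (LINT x:A|T. s x $ k)" if A: "A \<in> sets borel" for k A
  proof -
    have "D k A = (\<chi> k. D k A) $ k" by simp
    also have "\<dots> = (LINT x:A|lborel. f x $ k) + (LINT x:A|T. s x $ k)"
      unfolding rep[OF A] using set_integral_bounded_linear[OF bl sets_lborel f A] set_integral_bounded_linear[OF bl T(2) s A] by simp
    finally show ?thesis .
  qed
  have pr: "frac_pairing \<alpha> (u' k) (\<lambda>\<phi>. (\<integral>x. \<phi> x \<bullet> f x $ k \<partial>lborel) + (\<integral>x. \<phi> x \<bullet> s x $ k \<partial>T))" for k
  proof (rule frac_pairing_cong)
    show "frac_pairing \<alpha> (u' k) (dot_integral (D k))"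
      using D has_frac_variation_pairing[OF \<alpha> i u' Dr] by blast
    fix \<phi> :: "real^'n \<Rightarrow> real^'n" assume \<phi>: "\<phi> \<in> Cc_infinity UNIV"
    obtain C where C: "\<And>x. norm (\<phi> x) \<le> C" using Cc_infinity_bounded[OF \<phi>] by metis
    show "dot_integral (D k) \<phi> = (\<integral>x. \<phi> x \<bullet> f x $ k \<partial>lborel) + (\<integral>x. \<phi> x \<bullet> s x $ k \<partial>T)"
      by (rule dot_integral_density[OF T(2) fk sk Dr Dk borel_measurable_continuous_onI[OF Cc_continuous[OF \<phi>]] C])
  qed
  show ?thesis by (rule that[OF T f s N u'(1) i u'(2) pr])
qed

section \<open>Sums of localised mollifications\<close>

lemma conv_component:
  fixes s :: "'a::euclidean_space \<Rightarrow> 'b::euclidean_space ^ 'm"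
  assumes m: "mollifier \<eta> a r" and Q: "sets Q = sets borel" and s: "integrable Q s"
  shows "conv Q \<eta> s x $ k = conv Q \<eta> (\<lambda>y. s y $ k) x"
proof -
  obtain B where B: "\<And>z. \<bar>\<eta> z\<bar> \<le> B" using mollifierD(7)[OF m] by blast
  have "integrable Q (\<lambda>y. \<eta> (x - y) *\<^sub>R s y)" by (rule conv_integrand[OF Q mollifierD(6)[OF m] B s])
  from integral_bounded_linear[OF bounded_linear_vec_nth[of k] this] show ?thesis by (simp add: conv_def)
qed

lemma sum_conv_L1_limit:
  fixes f :: "'i \<Rightarrow> 'a::euclidean_space \<Rightarrow> 'b::euclidean_space"
  assumes I: "finite I" and f: "\<And>i. i \<in> I \<Longrightarrow> integrable lborel (f i)"
    and m: "\<And>i j. mollifier (\<eta> i j) (a i j) (r j)" and a: "\<And>i. a i \<longlonglongrightarrow> 0" and r: "r \<longlonglongrightarrow> 0"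
  shows "(\<lambda>j. \<integral>x. norm ((\<Sum>i\<in>I. conv lborel (\<eta> i j) (f i) x) - (\<Sum>i\<in>I. f i x)) \<partial>lborel) \<longlonglongrightarrow> 0"
    and "integrable lborel (\<lambda>x. \<Sum>i\<in>I. conv lborel (\<eta> i j) (f i) x)"
proof -
  have ci: "integrable lborel (conv lborel (\<eta> i j) (f i))" if "i \<in> I" for i j
    by (rule conv_integrable[OF lborel.sigma_finite_measure_axioms sets_lborel mollifierD(5)[OF m] f[OF that]])
  then show "integrable lborel (\<lambda>x. \<Sum>i\<in>I. conv lborel (\<eta> i j) (f i) x)"
    by (intro Bochner_Integration.integrable_sum) blast
  have di: "integrable lborel (\<lambda>x. norm (conv lborel (\<eta> i j) (f i) x - f i x))" if "i \<in> I" for i j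
    by (intro integrable_norm Bochner_Integration.integrable_diff ci f that)
  have "(\<lambda>j. \<Sum>i\<in>I. \<integral>x. norm (conv lborel (\<eta> i j) (f i) x - f i x) \<partial>lborel) \<longlonglongrightarrow> (\<Sum>i\<in>I. 0)"
    by (intro tendsto_sum conv_L1_limit[OF f m a r])
  then have lim: "(\<lambda>j. \<Sum>i\<in>I. \<integral>x. norm (conv lborel (\<eta> i j) (f i) x - f i x) \<partial>lborel) \<longlonglongrightarrow> 0" by simp
  show "(\<lambda>j. \<integral>x. norm ((\<Sum>i\<in>I. conv lborel (\<eta> i j) (f i) x) - (\<Sum>i\<in>I. f i x)) \<partial>lborel) \<longlonglongrightarrow> 0"
  proof (rule tendsto_sandwich[OF _ _ tendsto_const lim])
    show "\<forall>\<^sub>F j in sequentially. 0 \<le> (\<integral>x. norm ((\<Sum>i\<in>I. conv lborel (\<eta> i j) (f i) x) - (\<Sum>i\<in>I. f i x)) \<partial>lborel)" by simp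
    have "(\<integral>x. norm ((\<Sum>i\<in>I. conv lborel (\<eta> i j) (f i) x) - (\<Sum>i\<in>I. f i x)) \<partial>lborel)
        \<le> (\<Sum>i\<in>I. \<integral>x. norm (conv lborel (\<eta> i j) (f i) x - f i x) \<partial>lborel)" for j
    proof -
      have "(\<integral>x. norm ((\<Sum>i\<in>I. conv lborel (\<eta> i j) (f i) x) - (\<Sum>i\<in>I. f i x)) \<partial>lborel)
          \<le> (\<integral>x. (\<Sum>i\<in>I. norm (conv lborel (\<eta> i j) (f i) x - f i x)) \<partial>lborel)"
      proof (rule Bochner_Integration.integral_mono')
        show "integrable lborel (\<lambda>x. \<Sum>i\<in>I. norm (conv lborel (\<eta> i j) (f i) x - f i x))"
          by (intro Bochner_Integration.integrable_sum di)
        show "norm ((\<Sum>i\<in>I. conv lborel (\<eta> i j) (f i) x) - (\<Sum>i\<in>I. f i x)) \<le> (\<Sum>i\<in>I. norm (conv lborel (\<eta> i j) (f i) x - f i x))" for x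
          unfolding sum_subtractf[symmetric] by (rule norm_sum)
      qed (simp add: sum_nonneg)
      also have "\<dots> = (\<Sum>i\<in>I. \<integral>x. norm (conv lborel (\<eta> i j) (f i) x - f i x) \<partial>lborel)"
        by (rule Bochner_Integration.integral_sum) (rule di)
      finally show ?thesis .
    qed
    then show "\<forall>\<^sub>F j in sequentially. (\<integral>x. norm ((\<Sum>i\<in>I. conv lborel (\<eta> i j) (f i) x) - (\<Sum>i\<in>I. f i x)) \<partial>lborel)
        \<le> (\<Sum>i\<in>I. \<integral>x. norm (conv lborel (\<eta> i j) (f i) x - f i x) \<partial>lborel)" by simp
  qed
qed

text \<open>Mollifying the pieces \<open>\<theta>\<^sub>i S\<close> with different kernels neither increases the total mass nor changes the
  weak limit, since the \<open>\<theta>\<^sub>i\<close> are nonnegative and add up to one.\<close>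

lemma partition_conv_measure:
  fixes S :: "'a::euclidean_space \<Rightarrow> 'b::euclidean_space" and \<theta> :: "'i \<Rightarrow> 'a \<Rightarrow> real"
  assumes T: "finite_measure T" "sets T = sets borel" and S: "integrable T S" and I: "finite I"
    and \<theta>: "\<And>i. continuous_on UNIV (\<theta> i)" "\<And>i x. 0 \<le> \<theta> i x" "\<And>i x. \<theta> i x \<le> 1" and one: "\<And>x. (\<Sum>i\<in>I. \<theta> i x) = 1"
    and m: "\<And>i j. mollifier (\<eta> i j) (a i j) (r j)" and a: "\<And>i. a i \<longlonglongrightarrow> 0" and r: "r \<longlonglongrightarrow> 0"
  defines "h \<equiv> \<lambda>j x. \<Sum>i\<in>I. conv T (\<eta> i j) (\<lambda>y. \<theta> i y *\<^sub>R S y) x"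
  shows "integrable lborel (h j)"
    and "(\<integral>x. norm (h j x) \<partial>lborel) \<le> (\<integral>x. norm (S x) \<partial>T)"
    and "continuous_on UNIV \<Phi> \<Longrightarrow> (\<And>x. norm (\<Phi> x) \<le> C) \<Longrightarrow>
      (\<lambda>j. \<integral>x. \<Phi> x \<bullet> h j x \<partial>lborel) \<longlonglongrightarrow> (\<integral>x. \<Phi> x \<bullet> S x \<partial>T)"
proof -
  interpret T: finite_measure T by fact
  have \<theta>S: "integrable T (\<lambda>y. \<theta> i y *\<^sub>R S y)" for i
    by (rule integrable_scaleR_bounded[OF S borel_measurable_continuous_UNIV[OF T(2) \<theta>(1)], of i 1])
      (use \<theta>(2,3) in simp)
  have ci: "integrable lborel (conv T (\<eta> i j) (\<lambda>y. \<theta> i y *\<^sub>R S y))" for i j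
    by (rule conv_integrable[OF T.sigma_finite_measure_axioms T(2) mollifierD(5)[OF m] \<theta>S])
  show "integrable lborel (h j)" for j unfolding h_def by (intro Bochner_Integration.integrable_sum ci)
  have cn: "(\<integral>x. norm (conv T (\<eta> i j) (\<lambda>y. \<theta> i y *\<^sub>R S y) x) \<partial>lborel) \<le> (\<integral>x. \<theta> i x * norm (S x) \<partial>T)" for i j
    using conv_norm_le[OF T.sigma_finite_measure_axioms T(2) mollifierD(5)[OF m] \<theta>S, of i j i]
      mollifierD(2,4)[OF m] \<theta>(2) by simp
  have \<theta>n: "integrable T (\<lambda>x. \<theta> i x * norm (S x))" for i using integrable_norm[OF \<theta>S[of i]] \<theta>(2) by simp
  have "(\<integral>x. norm (h j x) \<partial>lborel) \<le> (\<integral>x. (\<Sum>i\<in>I. norm (conv T (\<eta> i j) (\<lambda>y. \<theta> i y *\<^sub>R S y) x)) \<partial>lborel)"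
    unfolding h_def
    by (rule Bochner_Integration.integral_mono'[OF Bochner_Integration.integrable_sum[OF integrable_norm[OF ci]] norm_sum]) (simp add: sum_nonneg)
  also have "\<dots> = (\<Sum>i\<in>I. \<integral>x. norm (conv T (\<eta> i j) (\<lambda>y. \<theta> i y *\<^sub>R S y) x) \<partial>lborel)"
    by (rule Bochner_Integration.integral_sum[OF integrable_norm[OF ci]])
  also have "\<dots> \<le> (\<Sum>i\<in>I. \<integral>x. \<theta> i x * norm (S x) \<partial>T)" by (rule sum_mono[OF cn])
  also have "\<dots> = (\<integral>x. (\<Sum>i\<in>I. \<theta> i x * norm (S x)) \<partial>T)" by (rule Bochner_Integration.integral_sum[OF \<theta>n, symmetric])
  also have "\<dots> = (\<integral>x. norm (S x) \<partial>T)" by (simp add: sum_distrib_right[symmetric] one)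
  finally show "(\<integral>x. norm (h j x) \<partial>lborel) \<le> (\<integral>x. norm (S x) \<partial>T)" .
  assume \<Phi>: "continuous_on UNIV \<Phi>" "\<And>x. norm (\<Phi> x) \<le> C"
  have \<Phi>m: "\<Phi> \<in> borel_measurable lborel" using borel_measurable_continuous_onI[OF \<Phi>(1)] by simp
  have \<Phi>T: "\<Phi> \<in> borel_measurable T" by (rule borel_measurable_continuous_UNIV[OF T(2) \<Phi>(1)])
  have "(\<lambda>j. \<Sum>i\<in>I. \<integral>x. \<Phi> x \<bullet> conv T (\<eta> i j) (\<lambda>y. \<theta> i y *\<^sub>R S y) x \<partial>lborel) \<longlonglongrightarrow> (\<Sum>i\<in>I. \<integral>x. \<Phi> x \<bullet> (\<theta> i x *\<^sub>R S x) \<partial>T)"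
    by (intro tendsto_sum conv_weak_limit[OF T.sigma_finite_measure_axioms T(2) \<theta>S \<Phi> m a r])
  moreover have "(\<Sum>i\<in>I. \<integral>x. \<Phi> x \<bullet> conv T (\<eta> i j) (\<lambda>y. \<theta> i y *\<^sub>R S y) x \<partial>lborel) = (\<integral>x. \<Phi> x \<bullet> h j x \<partial>lborel)" for j
    unfolding h_def inner_sum_right
    by (rule Bochner_Integration.integral_sum[OF integrable_inner_bounded[OF ci \<Phi>m \<Phi>(2)], symmetric])
  moreover have "(\<Sum>i\<in>I. \<integral>x. \<Phi> x \<bullet> (\<theta> i x *\<^sub>R S x) \<partial>T) = (\<integral>x. \<Phi> x \<bullet> S x \<partial>T)"
  proof -
    have "(\<Sum>i\<in>I. \<integral>x. \<Phi> x \<bullet> (\<theta> i x *\<^sub>R S x) \<partial>T) = (\<integral>x. (\<Sum>i\<in>I. \<Phi> x \<bullet> (\<theta> i x *\<^sub>R S x)) \<partial>T)"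
      by (rule Bochner_Integration.integral_sum[OF integrable_inner_bounded[OF \<theta>S \<Phi>T \<Phi>(2)], symmetric])
    then show ?thesis by (simp add: sum_distrib_right[symmetric] one)
  qed
  ultimately show "(\<lambda>j. \<integral>x. \<Phi> x \<bullet> h j x \<partial>lborel) \<longlonglongrightarrow> (\<integral>x. \<Phi> x \<bullet> S x \<partial>T)" by simp
qed

lemma frac_pairing_AE_cong:
  fixes u v :: "real^'n \<Rightarrow> real"
  assumes \<alpha>: "0 < \<alpha>" "\<alpha> < 1" and u: "frac_pairing \<alpha> u \<Lambda>" and v: "v \<in> borel_measurable borel" and ae: "AE x in lebesgue. u x = v x"
  shows "frac_pairing \<alpha> v \<Lambda>"
proof -
  have ui: "integrable lborel u" using u by (simp add: frac_pairing_def)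
  then have um: "u \<in> borel_measurable borel" by auto
  have eq: "(\<integral>x. f x \<partial>lborel) = (\<integral>x. f' x \<partial>lborel)" "integrable lborel f \<longleftrightarrow> integrable lborel f'"
    if f: "f \<in> borel_measurable borel" and f': "f' \<in> borel_measurable borel" and "AE x in lebesgue. f x = f' x" for f f' :: "real^'n \<Rightarrow> real"
  proof -
    have fl: "f \<in> borel_measurable lebesgue" using f by (intro measurable_completion) simp
    show "(\<integral>x. f x \<partial>lborel) = (\<integral>x. f' x \<partial>lborel)" "integrable lborel f \<longleftrightarrow> integrable lborel f'"
      using lebesgue_integral_cong_borel[OF fl f' that(3)] lebesgue_integral_cong_borel[OF fl f] by simp_all
  qed
  show ?thesis
    unfolding frac_pairing_def
  proof (intro conjI ballI)
    show "integrable lborel v" using eq(2)[OF um v ae] ui by simp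
    fix \<phi> :: "real^'n \<Rightarrow> real^'n" assume \<phi>: "\<phi> \<in> Cc_infinity UNIV"
    have m: "frac_div \<alpha> \<phi> \<in> borel_measurable borel" by (rule frac_div_bounded(2)[OF \<alpha> \<phi>])
    have "(\<integral>x. u x * frac_div \<alpha> \<phi> x \<partial>lborel) = (\<integral>x. v x * frac_div \<alpha> \<phi> x \<partial>lborel)"
    proof (rule eq(1))
      show "AE x in lebesgue. u x * frac_div \<alpha> \<phi> x = v x * frac_div \<alpha> \<phi> x" using ae by eventually_elim simp
    qed (intro borel_measurable_times um v m)+
    then show "(\<integral>x. v x * frac_div \<alpha> \<phi> x \<partial>lborel) = - \<Lambda> \<phi>" using u \<phi> by (simp add: frac_pairing_def)
  qed
qed

lemma frac_pairing_uminus: "frac_pairing \<alpha> u \<Lambda> \<Longrightarrow> frac_pairing \<alpha> (\<lambda>x. - u x) (\<lambda>\<phi>. - \<Lambda> \<phi>)"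
  by (simp add: frac_pairing_def)

text \<open>A vanishing singular part means that its density vanishes almost everywhere for its measure, so
  the pairing involves the absolutely continuous part alone.\<close>

lemma S_frac_data:
  fixes g :: "real^'n \<Rightarrow> real^'m"
  assumes \<alpha>: "0 < \<alpha>" "\<alpha> < 1" and g: "g \<in> S_frac \<alpha>"
  obtains G g' where "integrable lborel G" "\<And>k. g' k \<in> borel_measurable borel" "\<And>k. integrable lebesgue (\<lambda>x. g x $ k)"
    "\<And>k. AE x in lebesgue. g x $ k = g' k x" "\<And>k. frac_pairing \<alpha> (g' k) (\<lambda>\<phi>. \<integral>x. \<phi> x \<bullet> G x $ k \<partial>lborel)"
proof -
  have gB: "g \<in> BV_frac \<alpha>" and sing: "singular_part (frac_variation \<alpha> g) = (\<lambda>A. 0)" using g by (simp_all add: S_frac_def)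
  obtain T :: "(real^'n) measure" and s G N g' where
    T: "finite_measure T" "sets T = sets borel" and G: "integrable lborel G" and s: "integrable T s"
    and N: "N \<in> null_sets lborel" "N \<in> sets borel" "\<And>x. x \<notin> N \<Longrightarrow> s x = 0"
    and g': "\<And>k. g' k \<in> borel_measurable borel" and gi: "\<And>k. integrable lebesgue (\<lambda>x. g x $ k)"
    and ae: "\<And>k. AE x in lebesgue. g x $ k = g' k x"
    and pr: "\<And>k. frac_pairing \<alpha> (g' k) (\<lambda>\<phi>. (\<integral>x. \<phi> x \<bullet> G x $ k \<partial>lborel) + (\<integral>x. \<phi> x \<bullet> s x $ k \<partial>T))"
    by (rule BV_frac_data[OF \<alpha> gB]) (rule that)
  interpret T: finite_measure T by fact
  have fv: "frac_variation \<alpha> g = (\<lambda>A. if A \<in> sets borel then (LINT x:A|lborel. G x) + (LINT x:A|T. s x) else 0)"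
    by (rule frac_variation_density(2)[OF \<alpha> T G s gi g' ae pr])
  have "(\<lambda>A. if A \<in> sets borel then (LINT x:A|T. s x) else 0) = (\<lambda>A. 0)"
    using singular_part_of_densities[OF T G s N] sing unfolding fv by simp
  then have z: "(LINT x:A|T. s x) = 0" if "A \<in> sets borel" for A using that by (auto dest: fun_cong[of _ _ A])
  have s0: "AE x in T. s x = 0"
    by (rule T.density_unique_banach[OF s integrable_zero]) (simp add: z T(2) set_lebesgue_integral_def[of _ _ "\<lambda>x. 0"])
  have sz: "(\<integral>x. \<phi> x \<bullet> s x $ k \<partial>T) = 0" for \<phi> k
  proof (rule integral_eq_zero_AE)
    show "AE x in T. \<phi> x \<bullet> s x $ k = 0" using s0 by eventually_elim simp
  qed
  have "frac_pairing \<alpha> (g' k) (\<lambda>\<phi>. \<integral>x. \<phi> x \<bullet> G x $ k \<partial>lborel)" for k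
    using pr[of k] unfolding sz by simp
  then show ?thesis by (rule that[OF G g' gi ae])
qed

section \<open>Approximation in the area-strict sense\<close>

theorem theorem3p9:
  fixes \<alpha> :: real and \<Omega> :: "(real^'n) set" and g u :: "real^'n \<Rightarrow> real^'m"
  assumes "0 < \<alpha>" and "\<alpha> < 1"
    and "bounded_lipschitz_domain \<Omega>"
    and "g \<in> S_frac \<alpha>"
    and "u \<in> BV_frac_bdry \<alpha> \<Omega> g"
  shows "\<exists>w :: nat \<Rightarrow> real^'n \<Rightarrow> real^'m.
           (\<forall>j. \<exists>\<psi>\<in>Cc_infinity \<Omega>. w j = (\<lambda>x. g x + \<psi> x)) \<and>
           area_strict_convergence \<alpha> \<Omega> g w u"
proof -
  note \<alpha> = assms(1,2)
  have uB: "u \<in> BV_frac \<alpha>" and ubd: "AE x in lebesgue. x \<notin> \<Omega> \<longrightarrow> u x = g x"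
    using assms(5) by (simp_all add: BV_frac_bdry_def)
  have \<Omega>o: "open \<Omega>" and \<Omega>b: "bounded \<Omega>" using assms(3) by (simp_all add: bounded_lipschitz_domain_def)
  have \<Omega>s[measurable]: "\<Omega> \<in> sets borel" using \<Omega>o by simp
  define X where "X = closure \<Omega>"
  have Xc: "compact X" using \<Omega>b by (simp add: X_def compact_closure)
  have Xcl: "closed X" by (simp add: X_def)
  have XX: "X \<in> sets borel" "emeasure lborel X < \<infinity>" using Xcl emeasure_compact_finite[OF Xc] by simp_all
  have \<Omega>X: "\<Omega> \<subseteq> X" by (simp add: X_def closure_subset)

  obtain G g' where G: "integrable lborel G" and g': "\<And>k. g' k \<in> borel_measurable borel"
    and gi: "\<And>k. integrable lebesgue (\<lambda>x. g x $ k)" and gae: "\<And>k. AE x in lebesgue. g x $ k = g' k x"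
    and gpr: "\<And>k. frac_pairing \<alpha> (g' k) (\<lambda>\<phi>. \<integral>x. \<phi> x \<bullet> G x $ k \<partial>lborel)"
    by (rule S_frac_data[OF \<alpha> assms(4)]) (rule that)
  obtain T :: "(real^'n) measure" and S0 F N u' where
    T: "finite_measure T" "sets T = sets borel" and F: "integrable lborel F" and S0: "integrable T S0"
    and N: "N \<in> null_sets lborel" "N \<in> sets borel" "\<And>x. x \<notin> N \<Longrightarrow> S0 x = 0"
    and u': "\<And>k. u' k \<in> borel_measurable borel" and ui: "\<And>k. integrable lebesgue (\<lambda>x. u x $ k)"
    and uae: "\<And>k. AE x in lebesgue. u x $ k = u' k x"
    and upr0: "\<And>k. frac_pairing \<alpha> (u' k) (\<lambda>\<phi>. (\<integral>x. \<phi> x \<bullet> F x $ k \<partial>lborel) + (\<integral>x. \<phi> x \<bullet> S0 x $ k \<partial>T))"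
    by (rule BV_frac_data[OF \<alpha> uB]) (rule that)
  interpret T: finite_measure T by fact
  have bl: "bounded_linear (\<lambda>v::real^'n^'m. v $ k)" for k by (rule bounded_linear_vec_nth)
  have Gk: "integrable lborel (\<lambda>x. G x $ k)" and Fk: "integrable lborel (\<lambda>x. F x $ k)" for k
    by (rule integrable_bounded_linear[OF bl G], rule integrable_bounded_linear[OF bl F])

  \<comment> \<open>the density of the variation of \<open>u - g\<close>; its singular part is that of \<open>u\<close>\<close>
  define f where "f x = F x - G x" for x
  have f: "integrable lborel f" unfolding f_def[abs_def] using F G by simp
  have fk: "integrable lborel (\<lambda>x. f x $ k)" for k by (rule integrable_bounded_linear[OF bl f])
  \<comment> \<open>a Borel representative of \<open>u - g\<close> that vanishes everywhere outside \<open>\<Omega>\<close>\<close>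
  define v where "v x = (\<chi> k. indicator \<Omega> x * (u' k x - g' k x))" for x
  have vk: "(\<lambda>x. v x $ k) = (\<lambda>x. indicator \<Omega> x * (u' k x - g' k x))" for k by (simp add: v_def)
  have vm: "(\<lambda>x. v x $ k) \<in> borel_measurable borel" for k
    unfolding vk using u' g' by (intro borel_measurable_times borel_measurable_diff borel_measurable_indicator \<Omega>s)
  have v0: "v x = 0" if "x \<notin> \<Omega>" for x using that by (simp add: v_def vec_eq_iff)
  have vae: "AE x in lebesgue. u x $ k = g x $ k + v x $ k \<and> u' k x - g' k x = v x $ k" for k
    using ubd uae[of k] gae[of k] by eventually_elim (auto simp: v_def indicator_def)
  have vpr0: "frac_pairing \<alpha> (\<lambda>x. v x $ k) (\<lambda>\<phi>. (\<integral>x. \<phi> x \<bullet> f x $ k \<partial>lborel) + (\<integral>x. \<phi> x \<bullet> S0 x $ k \<partial>T))" for k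
  proof (rule frac_pairing_AE_cong[OF \<alpha> frac_pairing_cong[OF frac_pairing_add[OF \<alpha> upr0 frac_pairing_uminus[OF gpr]]] vm])
    fix \<phi> :: "real^'n \<Rightarrow> real^'n" assume \<phi>: "\<phi> \<in> Cc_infinity UNIV"
    have "(\<integral>x. \<phi> x \<bullet> f x $ k \<partial>lborel) = (\<integral>x. \<phi> x \<bullet> F x $ k \<partial>lborel) - (\<integral>x. \<phi> x \<bullet> G x $ k \<partial>lborel)"
      unfolding f_def vector_minus_component inner_diff_right
      by (rule Bochner_Integration.integral_diff[OF Cc_integrable_inner[OF \<phi> sets_lborel Fk] Cc_integrable_inner[OF \<phi> sets_lborel Gk]])
    then show "(\<integral>x. \<phi> x \<bullet> F x $ k \<partial>lborel) + (\<integral>x. \<phi> x \<bullet> S0 x $ k \<partial>T) + - (\<integral>x. \<phi> x \<bullet> G x $ k \<partial>lborel)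
      = (\<integral>x. \<phi> x \<bullet> f x $ k \<partial>lborel) + (\<integral>x. \<phi> x \<bullet> S0 x $ k \<partial>T)" by simp
  next
    show "AE x in lebesgue. u' k x + - g' k x = v x $ k" using vae[of k] by eventually_elim simp
  qed

  have S0X: "AE x in T. x \<notin> X \<longrightarrow> S0 x = 0"
  proof -
    have "AE x in T. x \<notin> X \<longrightarrow> S0 x $ k = 0" for k
    proof (rule singular_part_supported[OF \<alpha> T fk integrable_bounded_linear[OF bl S0] N(1,2) _ vpr0 Xcl])
      show "S0 x $ k = 0" if "x \<notin> N" for x using N(3)[OF that] by simp
      show "v x $ k = 0" if "x \<notin> X" for x
      proof -
        have "x \<notin> \<Omega>" using that \<Omega>X by blast
        then show ?thesis by (simp add: v0)
      qed
    qed
    then have "AE x in T. \<forall>k. x \<notin> X \<longrightarrow> S0 x $ k = 0" by (subst AE_all_countable) blast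
    then show ?thesis by eventually_elim (simp add: vec_eq_iff)
  qed
  \<comment> \<open>changed on a null set so that it vanishes everywhere outside \<open>X\<close>\<close>
  define S where "S x = indicator X x *\<^sub>R S0 x" for x
  have XT: "X \<in> sets T" using XX T(2) by simp
  have S: "integrable T S" unfolding S_def[abs_def] by (rule integrable_mult_indicator[OF XT S0])
  have SS0: "AE x in T. S0 x = S x" using S0X by eventually_elim (auto simp: S_def indicator_def)
  have SN: "S x = 0" if "x \<notin> N" for x using N(3)[OF that] by (simp add: S_def)
  have SX: "S x = 0" if "x \<notin> X" for x using that by (simp add: S_def)
  have S0S: "(\<integral>x. \<phi> x \<bullet> S0 x $ k \<partial>T) = (\<integral>x. \<phi> x \<bullet> S x $ k \<partial>T)" if \<phi>: "\<phi> \<in> Cc_infinity UNIV" for \<phi> k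
  proof (rule integral_cong_AE)
    show "(\<lambda>x. \<phi> x \<bullet> S0 x $ k) \<in> borel_measurable T"
      using Cc_integrable_inner[OF \<phi> T(2) integrable_bounded_linear[OF bl S0]] by auto
    show "(\<lambda>x. \<phi> x \<bullet> S x $ k) \<in> borel_measurable T"
      using Cc_integrable_inner[OF \<phi> T(2) integrable_bounded_linear[OF bl S]] by auto
    show "AE x in T. \<phi> x \<bullet> S0 x $ k = \<phi> x \<bullet> S x $ k" using SS0 by eventually_elim simp
  qed
  have upr: "frac_pairing \<alpha> (u' k) (\<lambda>\<phi>. (\<integral>x. \<phi> x \<bullet> F x $ k \<partial>lborel) + (\<integral>x. \<phi> x \<bullet> S x $ k \<partial>T))" for k
    by (rule frac_pairing_cong[OF upr0]) (simp add: S0S)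
  have vpr: "frac_pairing \<alpha> (\<lambda>x. v x $ k) (\<lambda>\<phi>. (\<integral>x. \<phi> x \<bullet> f x $ k \<partial>lborel) + (\<integral>x. \<phi> x \<bullet> S x $ k \<partial>T))" for k
    by (rule frac_pairing_cong[OF vpr0]) (simp add: S0S)
  have Sk: "integrable T (\<lambda>x. S x $ k)" for k by (rule integrable_bounded_linear[OF bl S])
  have vki: "integrable lborel (\<lambda>x. v x $ k)" for k using vpr by (simp add: frac_pairing_def)
  have vi: "integrable lborel v" by (rule integrable_vec[OF vki])

  obtain M :: nat and \<theta> :: "nat \<Rightarrow> real^'n \<Rightarrow> real" and W \<nu> t0 c L where
    t0: "0 < t0" and c: "0 < c" and \<theta>k: "\<And>i k. Ck k (\<theta> i)" and \<theta>0: "\<And>i x. 0 \<le> \<theta> i x" and \<theta>1: "\<And>i x. \<theta> i x \<le> 1"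
    and \<theta>L: "\<And>i x y. norm (\<theta> i x - \<theta> i y) \<le> L i * norm (x - y)"
    and Wc: "\<And>i. closed (W i)" and W: "\<And>i x. \<theta> i x \<noteq> 0 \<Longrightarrow> x \<in> W i" and \<nu>: "\<And>i. norm (\<nu> i) \<le> 1"
    and inw: "\<And>i x t w. i \<le> M \<Longrightarrow> x \<in> closure \<Omega> \<Longrightarrow> x \<in> W i \<Longrightarrow> 0 < t \<Longrightarrow> t < t0 \<Longrightarrow> norm w \<le> c * t \<Longrightarrow> x + t *\<^sub>R \<nu> i + w \<in> \<Omega>"
    and one: "\<And>x. (\<Sum>i\<le>M. \<theta> i x) = 1"
    by (rule lipschitz_domain_partition[OF assms(3)]) (rule that)
  have \<theta>c: "continuous_on UNIV (\<theta> i)" for i using \<theta>k[of 0 i] by simp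
  have \<theta>n: "norm (\<theta> i x) \<le> 1" for i x using \<theta>0[of i x] \<theta>1[of i x] by simp
  \<comment> \<open>the translation lengths; the mollification radii \<open>c * t j\<close> are proportional to them\<close>
  define t where "t j = t0 / (real j + 2)" for j :: nat
  have t: "0 < t j" "t j < t0" for j using t0 by (simp_all add: t_def divide_simps)
  have tl: "t \<longlonglongrightarrow> 0"
  proof -
    have "(\<lambda>j. t0 * inverse (real (j + 2))) \<longlonglongrightarrow> t0 * 0"
      by (intro tendsto_mult tendsto_const LIMSEQ_ignore_initial_segment[OF lim_inverse_n])
    then show ?thesis by (simp add: t_def[abs_def] divide_inverse add.commute)
  qed
  have "\<forall>i j. \<exists>\<eta>. mollifier \<eta> (t j *\<^sub>R \<nu> i) (c * t j)" by (intro allI mollifier_exists mult_pos_pos c t)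
  then obtain \<eta> where m: "\<And>i j. mollifier (\<eta> i j) (t j *\<^sub>R \<nu> i) (c * t j)" by metis
  have al: "(\<lambda>j. t j *\<^sub>R \<nu> i) \<longlonglongrightarrow> 0" for i using tendsto_scaleR[OF tl tendsto_const[of "\<nu> i"]] by simp
  have rl: "(\<lambda>j. c * t j) \<longlonglongrightarrow> 0" using tendsto_mult[OF tendsto_const[of c] tl] by simp
  \<comment> \<open>mollification after translation stays in \<open>\<Omega>\<close>, even when started on its boundary\<close>
  have shift: "x \<in> \<Omega>" if "i \<le> M" "\<eta> i j (x - y) \<noteq> 0" "y \<in> X" "\<theta> i y \<noteq> 0" for i j x y
  proof -
    have "norm (x - y - t j *\<^sub>R \<nu> i) \<le> c * t j" using mollifierD(3)[OF m that(2)] by simp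
    then have "y + t j *\<^sub>R \<nu> i + (x - y - t j *\<^sub>R \<nu> i) \<in> \<Omega>"
      using that t by (intro inw) (auto simp: X_def W)
    then show ?thesis by (simp add: algebra_simps)
  qed

  note loc = frac_pairing_localised[OF \<alpha> T fk Sk vpr \<theta>k \<theta>L \<theta>n]
  \<comment> \<open>the absolutely continuous part of the variation of \<open>\<theta> i * v\<close>\<close>
  define A where "A i x = (\<chi> k. \<theta> i x *\<^sub>R f x $ k + nonlocal_gradient \<alpha> (\<theta> i) (\<lambda>y. v y $ k) x)" for i x
  have Ak: "A i x $ k = \<theta> i x *\<^sub>R f x $ k + nonlocal_gradient \<alpha> (\<theta> i) (\<lambda>y. v y $ k) x" for i x k by (simp add: A_def)
  have Ai: "integrable lborel (A i)" for i
    by (rule integrable_vec) (unfold Ak, rule loc(2))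
  have Asum: "AE x in lborel. (\<Sum>i\<le>M. A i x) = f x"
  proof -
    have "AE x in lborel. \<forall>k. (\<Sum>i\<le>M. nonlocal_gradient \<alpha> (\<theta> i) (\<lambda>y. v y $ k) x) = 0"
      by (subst AE_all_countable) (intro allI nonlocal_gradient_partition[OF \<alpha> vki finite_atMost \<theta>c \<theta>L \<theta>n one])
    then show ?thesis
    proof eventually_elim
      fix x assume z: "\<forall>k. (\<Sum>i\<le>M. nonlocal_gradient \<alpha> (\<theta> i) (\<lambda>y. v y $ k) x) = 0"
      have "(\<Sum>i\<le>M. A i x) $ k = f x $ k" for k
        using z by (simp add: Ak sum.distrib scaleR_sum_left[symmetric] one)
      then show "(\<Sum>i\<le>M. A i x) = f x" by (simp add: vec_eq_iff)
    qed
  qed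
  have \<theta>vi: "integrable lborel (\<lambda>y. \<theta> i y *\<^sub>R v y)" for i
    by (rule integrable_scaleR_bounded[OF vi, of _ 1]) (use borel_measurable_continuous_onI[OF \<theta>c] \<theta>n in auto)
  have \<theta>Si: "integrable T (\<lambda>y. \<theta> i y *\<^sub>R S y)" for i
    by (rule integrable_scaleR_bounded[OF S borel_measurable_continuous_UNIV[OF T(2) \<theta>c], of i 1]) (use \<theta>n[of i] in simp)
  define \<psi> where "\<psi> j x = (\<Sum>i\<le>M. conv lborel (\<eta> i j) (\<lambda>y. \<theta> i y *\<^sub>R v y) x)" for j x
  \<comment> \<open>the part of the new density that converges in \<open>L\<^sup>1\<close>, and the mollified singular part \<open>h\<close>\<close>
  define a where "a j x = G x + (\<Sum>i\<le>M. conv lborel (\<eta> i j) (A i) x)" for j x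
  define h where "h j x = (\<Sum>i\<le>M. conv T (\<eta> i j) (\<lambda>y. \<theta> i y *\<^sub>R S y) x)" for j x
  define w where "w j x = g x + \<psi> j x" for j x

  have \<psi>C: "\<psi> j \<in> Cc_infinity \<Omega>" for j
    unfolding \<psi>_def[abs_def]
  proof (rule Cc_infinity_sum[OF finite_atMost])
    fix i assume "i \<in> {..M}"
    then have i: "i \<le> M" by simp
    \<comment> \<open>the points of the support pushed inwards and thickened\<close>
    define K where "K = (\<lambda>p. fst p + t j *\<^sub>R \<nu> i + snd p) ` ((X \<inter> W i) \<times> cball 0 (c * t j))"
    show "conv lborel (\<eta> i j) (\<lambda>y. \<theta> i y *\<^sub>R v y) \<in> Cc_infinity \<Omega>"
    proof (rule conv_Cc_infinity[OF sets_lborel \<theta>vi mollifierD(1)[OF m]])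
      show "compact K" unfolding K_def
        by (intro compact_continuous_image compact_Times compact_Int_closed Xc Wc compact_cball continuous_intros)
      show "K \<subseteq> \<Omega>"
      proof
        fix z assume "z \<in> K"
        then obtain y b where "z = y + t j *\<^sub>R \<nu> i + b" "y \<in> X" "y \<in> W i" "norm b \<le> c * t j"
          unfolding K_def by auto
        then show "z \<in> \<Omega>" using inw[OF i _ _ t] by (simp add: X_def)
      qed
      fix x y assume xy: "\<eta> i j (x - y) \<noteq> 0" "\<theta> i y *\<^sub>R v y \<noteq> 0"
      then have y: "y \<in> X \<inter> W i" using v0[of y] \<Omega>X W[of i y] by auto
      have "norm (x - y - t j *\<^sub>R \<nu> i) \<le> c * t j" using mollifierD(3)[OF m xy(1)] by simp
      then have "(y, x - y - t j *\<^sub>R \<nu> i) \<in> (X \<inter> W i) \<times> cball 0 (c * t j)" using y by simp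
      moreover have "x = fst (y, x - y - t j *\<^sub>R \<nu> i) + t j *\<^sub>R \<nu> i + snd (y, x - y - t j *\<^sub>R \<nu> i)" by simp
      ultimately show "x \<in> K" unfolding K_def by (rule rev_image_eqI)
    qed
  qed
  \<comment> \<open>no mass of the singular part is moved across the boundary\<close>
  have hz: "h j x = 0" if x: "x \<notin> \<Omega>" for j x
    unfolding h_def
  proof (rule sum.neutral, rule ballI)
    fix i assume "i \<in> {..M}"
    then have i: "i \<le> M" by simp
    have "\<eta> i j (x - y) *\<^sub>R \<theta> i y *\<^sub>R S y = 0" for y
      using shift[OF i, of j x y] x SX[of y] by auto
    then show "conv T (\<eta> i j) (\<lambda>y. \<theta> i y *\<^sub>R S y) x = 0" unfolding conv_def by (simp only: integral_zero)
  qed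

  note hfacts = partition_conv_measure[where \<eta> = \<eta> and \<theta> = \<theta> and I = "{..M}" and a = "\<lambda>i j. t j *\<^sub>R \<nu> i",
      OF T S finite_atMost \<theta>c \<theta>0 \<theta>1 one m al rl]
  have hi: "integrable lborel (h j)" for j unfolding h_def[abs_def] by (rule hfacts(1))
  have hn: "(\<integral>x. norm (h j x) \<partial>lborel) \<le> (\<integral>x. norm (S x) \<partial>T)" for j unfolding h_def by (rule hfacts(2))
  have hw: "(\<lambda>j. \<integral>x. \<Phi> x \<bullet> h j x \<partial>lborel) \<longlonglongrightarrow> (\<integral>x. \<Phi> x \<bullet> S x \<partial>T)"
    if "continuous_on UNIV \<Phi>" "\<And>x. norm (\<Phi> x) \<le> C" for \<Phi> C
    unfolding h_def by (rule hfacts(3)[OF that])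
  have Alim: "(\<lambda>j. \<integral>x. norm ((\<Sum>i\<le>M. conv lborel (\<eta> i j) (A i) x) - (\<Sum>i\<le>M. A i x)) \<partial>lborel) \<longlonglongrightarrow> 0"
    by (rule sum_conv_L1_limit(1)[OF finite_atMost Ai m al rl])
  have cAi: "integrable lborel (\<lambda>x. \<Sum>i\<le>M. conv lborel (\<eta> i j) (A i) x)" for j
    by (rule sum_conv_L1_limit(2)[OF finite_atMost Ai m al rl])
  have ai: "integrable lborel (a j)" for j unfolding a_def[abs_def] using G cAi by simp
  have aF: "(\<integral>x. norm (a j x - F x) \<partial>lborel) = (\<integral>x. norm ((\<Sum>i\<le>M. conv lborel (\<eta> i j) (A i) x) - (\<Sum>i\<le>M. A i x)) \<partial>lborel)" for j
  proof (rule integral_cong_AE)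
    show "(\<lambda>x. norm (a j x - F x)) \<in> borel_measurable lborel"
      by (intro borel_measurable_integrable integrable_norm Bochner_Integration.integrable_diff ai F)
    show "(\<lambda>x. norm ((\<Sum>i\<le>M. conv lborel (\<eta> i j) (A i) x) - (\<Sum>i\<le>M. A i x))) \<in> borel_measurable lborel"
      by (intro borel_measurable_integrable integrable_norm Bochner_Integration.integrable_diff cAi Bochner_Integration.integrable_sum Ai)
    show "AE x in lborel. norm (a j x - F x) = norm ((\<Sum>i\<le>M. conv lborel (\<eta> i j) (A i) x) - (\<Sum>i\<le>M. A i x))"
      using Asum
    proof eventually_elim
      fix x assume A: "(\<Sum>i\<le>M. A i x) = f x"
      have "a j x - F x = (\<Sum>i\<le>M. conv lborel (\<eta> i j) (A i) x) - f x" by (simp add: a_def f_def)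
      then show "norm (a j x - F x) = norm ((\<Sum>i\<le>M. conv lborel (\<eta> i j) (A i) x) - (\<Sum>i\<le>M. A i x))"
        unfolding A by (rule arg_cong)
    qed
  qed
  have alim: "(\<lambda>j. \<integral>x. norm (a j x - F x) \<partial>lborel) \<longlonglongrightarrow> 0" unfolding aF by (rule Alim)

  have \<psi>k: "\<psi> j x $ k = (\<Sum>i\<le>M. conv lborel (\<eta> i j) (\<lambda>y. \<theta> i y * v y $ k) x)" for j x k
    unfolding \<psi>_def sum_component conv_component[OF m sets_lborel \<theta>vi] by simp
  have ahk: "(a j x + h j x) $ k = G x $ k + (\<Sum>i\<le>M. conv lborel (\<eta> i j) (\<lambda>x. \<theta> i x *\<^sub>R f x $ k + nonlocal_gradient \<alpha> (\<theta> i) (\<lambda>y. v y $ k) x) x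
      + conv T (\<eta> i j) (\<lambda>x. \<theta> i x *\<^sub>R S x $ k) x)" for j x k
    unfolding a_def h_def vector_add_component sum_component conv_component[OF m sets_lborel Ai] conv_component[OF m T(2) \<theta>Si]
    by (simp add: Ak sum.distrib)
  have ah: "integrable lborel (\<lambda>x. a j x + h j x)" for j using ai hi by simp
  have z0: "integrable T (\<lambda>x. 0 :: real^'n^'m)" by simp
  define w' where "w' j k x = g' k x + \<psi> j x $ k" for j k x
  have \<psi>m: "(\<lambda>x. \<psi> j x $ k) \<in> borel_measurable borel" for j k
    by (rule borel_measurable_component[OF borel_measurable_continuous_onI[OF Cc_continuous[OF \<psi>C]]])
  have w'm: "w' j k \<in> borel_measurable borel" for j k
    unfolding w'_def[abs_def] by (intro borel_measurable_add g' \<psi>m)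
  have wpr: "frac_pairing \<alpha> (w' j k) (\<lambda>\<phi>. (\<integral>x. \<phi> x \<bullet> (a j x + h j x) $ k \<partial>lborel) + (\<integral>x. \<phi> x \<bullet> (0::real^'n^'m) $ k \<partial>T))" for j k
  proof -
    let ?p = "\<lambda>i x. conv lborel (\<eta> i j) (\<lambda>x. \<theta> i x *\<^sub>R f x $ k + nonlocal_gradient \<alpha> (\<theta> i) (\<lambda>y. v y $ k) x) x
      + conv T (\<eta> i j) (\<lambda>x. \<theta> i x *\<^sub>R S x $ k) x"
    have p: "integrable lborel (?p i)" for i
      by (intro Bochner_Integration.integrable_add conv_integrable[OF lborel.sigma_finite_measure_axioms sets_lborel mollifierD(5)[OF m] loc(2)]
          conv_integrable[OF T.sigma_finite_measure_axioms T(2) mollifierD(5)[OF m] loc(3)])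
    have ps: "integrable lborel (\<lambda>x. \<Sum>i\<le>M. ?p i x)" by (intro Bochner_Integration.integrable_sum p)
    have "frac_pairing \<alpha> (\<lambda>x. \<psi> j x $ k) (\<lambda>\<phi>. \<integral>x. \<phi> x \<bullet> (\<Sum>i\<le>M. ?p i x) \<partial>lborel)"
      unfolding \<psi>k by (rule frac_pairing_sum[OF \<alpha> finite_atMost loc(4)[OF m] p])
    from frac_pairing_add[OF \<alpha> gpr this]
    have "frac_pairing \<alpha> (w' j k) (\<lambda>\<phi>. (\<integral>x. \<phi> x \<bullet> G x $ k \<partial>lborel) + (\<integral>x. \<phi> x \<bullet> (\<Sum>i\<le>M. ?p i x) \<partial>lborel))"
      unfolding w'_def[abs_def] .
    then show ?thesis
    proof (rule frac_pairing_cong)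
      fix \<phi> :: "real^'n \<Rightarrow> real^'n" assume \<phi>: "\<phi> \<in> Cc_infinity UNIV"
      have "(\<integral>x. \<phi> x \<bullet> G x $ k \<partial>lborel) + (\<integral>x. \<phi> x \<bullet> (\<Sum>i\<le>M. ?p i x) \<partial>lborel) = (\<integral>x. \<phi> x \<bullet> (a j x + h j x) $ k \<partial>lborel)"
        unfolding ahk inner_add_right[of "\<phi> _" "G _ $ k"]
        by (rule Bochner_Integration.integral_add[OF Cc_integrable_inner[OF \<phi> sets_lborel Gk] Cc_integrable_inner[OF \<phi> sets_lborel ps], symmetric])
      then show "(\<integral>x. \<phi> x \<bullet> G x $ k \<partial>lborel) + (\<integral>x. \<phi> x \<bullet> (\<Sum>i\<le>M. ?p i x) \<partial>lborel)
        = (\<integral>x. \<phi> x \<bullet> (a j x + h j x) $ k \<partial>lborel) + (\<integral>x. \<phi> x \<bullet> (0::real^'n^'m) $ k \<partial>T)" by simp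
    qed
  qed
  have wi: "integrable lebesgue (\<lambda>x. w j x $ k)" for j k
  proof -
    have "integrable lborel (\<lambda>x. \<psi> j x $ k)"
      by (rule integrable_bounded_linear[OF bounded_linear_vec_nth Cc_integrable[OF Cc_infinity_imp_UNIV[OF \<psi>C]]])
    then have "integrable lebesgue (\<lambda>x. \<psi> j x $ k)" by (subst integrable_completion) (use \<psi>m in auto)
    then show ?thesis using gi[of k] by (simp add: w_def)
  qed
  have wae: "AE x in lebesgue. w j x $ k = w' j k x" for j k
    using gae[of k] by eventually_elim (simp add: w_def w'_def)

  have wB: "w j \<in> BV_frac \<alpha>" and wv: "frac_variation \<alpha> (w j) = (\<lambda>B. if B \<in> sets borel then (LINT x:B|lborel. a j x + h j x) + (LINT x:B|T. 0) else 0)" for j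
    by (rule frac_variation_density[OF \<alpha> T ah z0 wi w'm wae wpr])+
  have uv: "frac_variation \<alpha> u = (\<lambda>B. if B \<in> sets borel then (LINT x:B|lborel. F x) + (LINT x:B|T. S x) else 0)"
    by (rule frac_variation_density(2)[OF \<alpha> T F S ui u' uae upr])
  have wgrad: "AE x in lebesgue. frac_gradient \<alpha> (w j) x = a j x + h j x" for j
    unfolding frac_gradient_def wv by (rule ac_density_of_densities[OF T ah z0 N(1,2)]) simp
  have ugrad: "AE x in lebesgue. frac_gradient \<alpha> u x = F x"
    unfolding frac_gradient_def uv by (rule ac_density_of_densities[OF T F S N(1,2)]) (rule SN)
  have warea: "area_functional (frac_variation \<alpha> (w j)) X = ennreal (\<integral>x. indicator X x * norm (1::real, a j x + h j x) \<partial>lborel)" for j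
    unfolding wv using area_functional_of_densities[OF T ah z0 N(1,2) _ XX] by simp
  have uarea: "area_functional (frac_variation \<alpha> u) X = ennreal ((\<integral>x. indicator X x * norm (1::real, F x) \<partial>lborel) + (\<integral>x. norm (S x) \<partial>T))"
    unfolding uv by (rule area_functional_of_densities[OF T F S N(1,2) _ XX]) (auto simp: SN SX)

  have hX: "h j x = 0" if "x \<notin> X" for j x using hz[of x j] that \<Omega>X by blast
  have area: "(\<lambda>j. area_functional (frac_variation \<alpha> (w j)) (closure \<Omega>)) \<longlonglongrightarrow> area_functional (frac_variation \<alpha> u) (closure \<Omega>)"
    unfolding X_def[symmetric] warea uarea
    by (intro tendsto_ennrealI area_limit[OF T F S N(1,2) SN XX ai alim hi hX hn hw])

  have bdry: "w j \<in> BV_frac_bdry \<alpha> \<Omega> g" for j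
  proof -
    have "w j x = g x" if "x \<notin> \<Omega>" for x
    proof -
      have "closure {x. \<psi> j x \<noteq> 0} \<subseteq> \<Omega>" using \<psi>C[of j] unfolding Cc_infinity_def by blast
      then have "\<psi> j x = 0" using that closure_subset[of "{x. \<psi> j x \<noteq> 0}"] by blast
      then show ?thesis by (simp add: w_def)
    qed
    then show ?thesis using wB by (simp add: BV_frac_bdry_def)
  qed

  have L1: "(\<lambda>j. \<integral>\<^sup>+x. ennreal (norm (w j x - u x)) \<partial>lebesgue) \<longlonglongrightarrow> 0"
  proof -
    have "(\<lambda>j. \<integral>x. norm (\<psi> j x - (\<Sum>i\<le>M. \<theta> i x *\<^sub>R v x)) \<partial>lborel) \<longlonglongrightarrow> 0"
      unfolding \<psi>_def by (rule sum_conv_L1_limit(1)[OF finite_atMost \<theta>vi m al rl])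
    then have lim: "(\<lambda>j. \<integral>x. norm (\<psi> j x - v x) \<partial>lborel) \<longlonglongrightarrow> 0"
      by (simp add: scaleR_sum_left[symmetric] one)
    have "(\<integral>\<^sup>+x. ennreal (norm (w j x - u x)) \<partial>lebesgue) = ennreal (\<integral>x. norm (\<psi> j x - v x) \<partial>lborel)" for j
    proof -
      have "AE x in lebesgue. \<forall>k. u x $ k = g x $ k + v x $ k"
        by (subst AE_all_countable, rule allI) (use vae in \<open>fast elim: AE_mp intro: AE_I2\<close>)
      then have "(\<integral>\<^sup>+x. ennreal (norm (w j x - u x)) \<partial>lebesgue) = (\<integral>\<^sup>+x. ennreal (norm (\<psi> j x - v x)) \<partial>lebesgue)"
      proof (intro nn_integral_cong_AE, eventually_elim)
        fix x assume "\<forall>k. u x $ k = g x $ k + v x $ k"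
        then have "u x = g x + v x" by (simp add: vec_eq_iff)
        then show "ennreal (norm (w j x - u x)) = ennreal (norm (\<psi> j x - v x))" by (simp add: w_def)
      qed
      also have "\<dots> = (\<integral>\<^sup>+x. ennreal (norm (\<psi> j x - v x)) \<partial>lborel)" by (rule nn_integral_completion)
      also have "\<dots> = ennreal (\<integral>x. norm (\<psi> j x - v x) \<partial>lborel)"
        by (rule nn_integral_eq_integral)
          (intro integrable_norm Bochner_Integration.integrable_diff vi Cc_integrable[OF Cc_infinity_imp_UNIV[OF \<psi>C]], simp)
      finally show ?thesis .
    qed
    then show ?thesis using tendsto_ennrealI[OF lim] by simp
  qed

  have out: "(\<lambda>j. \<integral>\<^sup>+x\<in>-\<Omega>. ennreal (norm (frac_gradient \<alpha> (w j) x - frac_gradient \<alpha> u x)) \<partial>lebesgue) \<longlonglongrightarrow> 0"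
  proof (rule tendsto_sandwich[OF _ _ tendsto_const])
    show "\<forall>\<^sub>F j in sequentially. 0 \<le> (\<integral>\<^sup>+x\<in>-\<Omega>. ennreal (norm (frac_gradient \<alpha> (w j) x - frac_gradient \<alpha> u x)) \<partial>lebesgue)" by simp
    have "(\<integral>\<^sup>+x\<in>-\<Omega>. ennreal (norm (frac_gradient \<alpha> (w j) x - frac_gradient \<alpha> u x)) \<partial>lebesgue) \<le> ennreal (\<integral>x. norm (a j x - F x) \<partial>lborel)" for j
    proof -
      have "(\<integral>\<^sup>+x\<in>-\<Omega>. ennreal (norm (frac_gradient \<alpha> (w j) x - frac_gradient \<alpha> u x)) \<partial>lebesgue) \<le> (\<integral>\<^sup>+x. ennreal (norm (a j x - F x)) \<partial>lebesgue)"
      proof (rule nn_integral_mono_AE)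
        show "AE x in lebesgue. ennreal (norm (frac_gradient \<alpha> (w j) x - frac_gradient \<alpha> u x)) * indicator (- \<Omega>) x \<le> ennreal (norm (a j x - F x))"
          using wgrad[of j] ugrad by eventually_elim (simp add: indicator_def hz)
      qed
      also have "\<dots> = (\<integral>\<^sup>+x. ennreal (norm (a j x - F x)) \<partial>lborel)" by (rule nn_integral_completion)
      also have "\<dots> = ennreal (\<integral>x. norm (a j x - F x) \<partial>lborel)"
        by (rule nn_integral_eq_integral) (intro integrable_norm Bochner_Integration.integrable_diff ai F, simp)
      finally show ?thesis .
    qed
    then show "\<forall>\<^sub>F j in sequentially. (\<integral>\<^sup>+x\<in>-\<Omega>. ennreal (norm (frac_gradient \<alpha> (w j) x - frac_gradient \<alpha> u x)) \<partial>lebesgue)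
        \<le> ennreal (\<integral>x. norm (a j x - F x) \<partial>lborel)" by simp
    show "(\<lambda>j. ennreal (\<integral>x. norm (a j x - F x) \<partial>lborel)) \<longlonglongrightarrow> 0" using tendsto_ennrealI[OF alim] by simp
  qed
  have "area_strict_convergence \<alpha> \<Omega> g w u"
    unfolding area_strict_convergence_def using bdry assms(5) L1 area out by blast
  moreover have "\<forall>j. \<exists>\<psi>\<in>Cc_infinity \<Omega>. w j = (\<lambda>x. g x + \<psi> x)"
    using \<psi>C unfolding w_def[abs_def] by blast
  ultimately show ?thesis by blast
qed

end
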